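(* Let $1<\alpha<2$, $\gamma=1/\alpha$, and let $X,m,A$ be as in the context. Suppose either Case (i) holds with $\alpha\in[\alpha_0,2)$ (provided that the interval is non-empty), or Case (ii) holds, and suppose that $f$ satisfies (Hf1), with exponent $r>1$. Let $u$ be a (maximally-defined) weak solution on $[0,T]$, for some $T\in(0,T_{\max})$, of $$\mathbb D_t^\alpha u(x,t)+Au(x,t)=f(u(x,t))\ \text{ in } X\times(0,T),\qquad u(\cdot,0)=u_0,\quad\partial_tu(\cdot,0)=u_1\ \text{ in }X, \quad (\ast)$$ such that $$\|u\|_{L^{q(r-1)}((0,T);L^\infty(X))}<\infty,$$ where $q$ is the exponent in the definition of weak solution. Then $u$ is a strong solution on $[0,T]$, namely $$\mathbb D_t^\alpha u\in L^1((0,T);L^2(X))\qquad\text{and}\qquad u\in L^1((0,T);D(A)).$$ (Cases (i), (ii), $\alpha_0$, (Hf1), weak solution and $T_{\max}$ are defined in the context.)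
   Context: Setting. $X$ is a relatively compact metric space and $m$ is a Radon measure on $X$ with $\mathrm{supp}(m)=X$ and $m(X)<\infty$; $L^p(X)=L^p(X,m)$ (real-valued), and $(\cdot,\cdot)$ is the inner product of $L^2(X)$; "a.e. in $X$" means $m$-a.e. A Dirichlet form on $L^2(X)$ is a symmetric, non-negative, bilinear form $\mathcal E_A:V_{1/2}\times V_{1/2}\to\mathbb R$ whose domain $V_{1/2}=D(\mathcal E_A)$ is a dense linear subspace of $L^2(X)$, which is closed ($V_{1/2}$ is complete for the inner product $\mathcal E_A(u,v)+\lambda(u,v)$, $\lambda>0$) and Markovian: for each $\epsilon>0$ there is $\phi_\epsilon\in C^\infty(\mathbb R)$ with $\phi_\epsilon(t)=t$ on $[0,1]$, $-\epsilon\le\phi_\epsilon\le1+\epsilon$, $0\le\phi_\epsilon(t)-\phi_\epsilon(\tau)\le t-\tau$ for $\tau<t$, such that $u\in V_{1/2}$ implies $\phi_\epsilon(u)\in V_{1/2}$ and $\mathcal E_A(\phi_\epsilon(u),\phi_\epsilon(u))\le\mathcal E_A(u,u)$. Assumptions on $A$. $A$ is the non-negative self-adjoint operator on $L^2(X)$ associated with a Dirichlet form $\mathcal E_A$, i.e. $V_{1/2}=D(A^{1/2})$ and $\mathcal E_A(u,v)=(Au,v)$ for $u\in D(A)$, $v\in V_{1/2}$. It is assumed that $V_{1/2}$ embeds compactly in $L^2(X)$ and that $V_{1/2}\hookrightarrow L^{2q_A}(X)$ continuously for some $q_A>1$. Then $A$ has discrete spectrum $\lambda_1\le\lambda_2\le\dots\to+\infty$;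 throughout, $\lambda_1>0$. $(\varphi_n)_{n\in\mathbb N}$ is an orthonormal basis of $L^2(X)$ of eigenfunctions, $A\varphi_n=\lambda_n\varphi_n$. Set $\theta_A:=\frac{q_A}{2(q_A-1)}$. Spaces. For $s\ge0$, $V_s:=D(A^s)=\{h\in L^2(X):\sum_n|(h,\varphi_n)|^2\lambda_n^{2s}<\infty\}$, with norm $\|h\|_{V_s}=(\sum_n|(h,\varphi_n)|^2\lambda_n^{2s})^{1/2}$. Identifying $L^2(X)$ with its dual, $V_{-s}:=(V_s)^*$, with norm $(\sum_n|\langle h,\varphi_n\rangle|^2\lambda_n^{-2s})^{1/2}$; $\langle\cdot,\cdot\rangle_{V_{-s},V_s}$ is the duality bracket. Caputo derivative: $\mathbb D_t^\alpha u(x,t)=\frac1{\Gamma(2-\alpha)}\int_0^t(t-s)^{1-\alpha}\partial_s^2u(x,s)\,ds$, which for sufficiently smooth $u$ is equivalent to the weaker form $\frac{1}{\Gamma(2-\alpha)}\partial_t^2\int_0^t(t-s)^{1-\alpha}\big(u(x,s)-u(x,0)-s\,\partial_su(x,0)\big)ds$ (which requires less smoothness of $u$). Cases. Case (i): $q_A>2$; then $\alpha_0:=\frac1{\theta_A}=\frac{2(q_A-1)}{q_A}\in(1,2)$. Case (ii): $1<q_A\le2$ (and $\alpha\in(1,2)$ arbitrary). Known embeddings: $V_{1/\alpha_0}\hookrightarrow L^{2r_*}(X)$ for any $r_*\in(1,\infty)$ in Case (i); in Case (i) with $\alpha>\alpha_0$, and in Case (ii) for all $\alpha\in(1,2)$,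 $V_{1/\alpha}\hookrightarrow L^{2r_*}(X)$ with $r_*=\frac{\alpha\theta_A}{\alpha\theta_A-1}>1$. (Hf1): $f\in C^1(\mathbb R)$, $f(0)=0$ and there are $C>0$ and $r>1$ with $|f'(s)|\le C|s|^{r-1}$ for all $s\in\mathbb R$, where: in Case (i) with $\alpha=\alpha_0$, $r$ is any number in $(1,\infty)$; in Case (i) with $\alpha>\alpha_0$, and in Case (ii) for all $\alpha\in(1,2)$, $r=\frac{\theta_A\alpha}{\theta_A\alpha-1}>1$. Weak solution of $(\ast)$ on $(0,T)$ (for Case (i) with $\alpha\in[\alpha_0,2)$ and for Case (ii)): let $1\le p<\frac1{2-\alpha}$ and $q=\frac p{p-1}\in(\frac1{\alpha-1},\infty]$; $u$ satisfies (1) for some $\rho>1$, $u\in C([0,T];V_\gamma)\cap C^1([0,T];L^2(X))\cap L^{\rho q}((0,T);L^{2\rho}(X))$ and $\mathbb D_t^\alpha u\in C([0,T];V_{-\gamma})\oplus L^q((0,T);L^2(X))$; (2) $u(\cdot,0)=u_0$, $\partial_tu(\cdot,0)=u_1$ a.e. in $X$, and $\lim_{t\to0^+}\|u(\cdot,t)-u_0\|_{V_\sigma}=0$, $\lim_{t\to0^+}\|\partial_tu(\cdot,t)-u_1\|_{V_{-\beta}}=0$ for some $\frac1\alpha>\sigma\ge0$ and $1-\frac1\alpha\ge\beta>0$; (3) for every $\varphi\in V_\gamma$ and a.e. $t\in(0,T)$, $\langle\mathbb D_t^\alpha u(\cdot,t),\varphi\rangle_{V_{-\gamma},V_\gamma}+\mathcal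 E_A(u(\cdot,t),\varphi)=(f(u(\cdot,t)),\varphi)$. $T_{\max}\in(0,\infty]$ is the supremum of all $T$ such that $(\ast)$ has a unique weak solution on $(0,T)$. *)

theory Defs
  imports "HOL-Analysis.Analysis" "HOL-Probability.Essential_Supremum"
begin

text \<open>
  Elements of \<open>L\<^sup>p(X,m)\<close> are represented by measurable functions, and all notions below are
  insensitive to changing a function on an \<open>m\<close>-null set. Norms take values in the extended
  non-negative reals, so that they are meaningful (possibly infinite) for every measurable function.
\<close>

subsection \<open>Lebesgue spaces\<close>

definition epow :: "ennreal \<Rightarrow> real \<Rightarrow> ennreal" where
  "epow y a = (if y = top then top else ennreal (enn2real y powr a))"

definition Lp_norm :: "ennreal \<Rightarrow> 'b measure \<Rightarrow> ('b \<Rightarrow> ennreal) \<Rightarrow> ennreal" where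
  "Lp_norm p M g =
     (if p = top then esssup M g
      else epow (\<integral>\<^sup>+ x. epow (g x) (enn2real p) \<partial>M) (1 / enn2real p))"

definition lnorm :: "'a measure \<Rightarrow> ennreal \<Rightarrow> ('a \<Rightarrow> real) \<Rightarrow> ennreal" where
  "lnorm m p h = Lp_norm p m (\<lambda>x. ennreal \<bar>h x\<bar>)"

definition Lp :: "'a measure \<Rightarrow> ennreal \<Rightarrow> ('a \<Rightarrow> real) set" where
  "Lp m p = {h \<in> borel_measurable m. lnorm m p h < \<infinity>}"

abbreviation L2 :: "'a measure \<Rightarrow> ('a \<Rightarrow> real) set" where
  "L2 m \<equiv> Lp m 2"

definition ip :: "'a measure \<Rightarrow> ('a \<Rightarrow> real) \<Rightarrow> ('a \<Rightarrow> real) \<Rightarrow> real" where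
  "ip m h k = (LINT x|m. h x * k x)"

definition ae_eq :: "'a measure \<Rightarrow> ('a \<Rightarrow> real) \<Rightarrow> ('a \<Rightarrow> real) \<Rightarrow> bool" where
  "ae_eq m h k \<longleftrightarrow> (AE x in m. h x = k x)"

subsection \<open>The underlying space\<close>

text \<open>\<open>X\<close> is a relatively compact subset of an ambient metric space, with the induced metric; for a
  finite Borel measure the Radon property is inner regularity with respect to compact sets.\<close>

definition radon_space :: "'a::metric_space set \<Rightarrow> 'a measure \<Rightarrow> bool" where
  "radon_space X m \<longleftrightarrow>
     compact (closure X) \<and>
     sets m = sets (restrict_space borel X) \<and>
     finite_measure m \<and>
     (\<forall>B \<in> sets m. emeasure m B = (SUP K \<in> {K. compact K \<and> K \<subseteq> B}. emeasure m K)) \<and>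
     (\<forall>x \<in> X. \<forall>U. open U \<and> x \<in> U \<longrightarrow> emeasure m (X \<inter> U) > 0)"

subsection \<open>Dirichlet forms\<close>

definition smooth :: "(real \<Rightarrow> real) \<Rightarrow> bool" where
  "smooth \<psi> \<longleftrightarrow> (\<forall>k t. ((deriv ^^ k) \<psi>) differentiable (at t))"

text \<open>A dense linear subspace of \<open>L\<^sup>2\<close>, as a set of representatives.\<close>

definition dense_subspace :: "'a measure \<Rightarrow> ('a \<Rightarrow> real) set \<Rightarrow> bool" where
  "dense_subspace m D \<longleftrightarrow>
     D \<subseteq> L2 m \<and>
     (\<forall>u \<in> D. \<forall>v \<in> L2 m. ae_eq m u v \<longrightarrow> v \<in> D) \<and>
     (\<lambda>x. 0) \<in> D \<and>
     (\<forall>u \<in> D. \<forall>v \<in> D. \<forall>a b. (\<lambda>x. a * u x + b * v x) \<in> D) \<and>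
     (\<forall>h \<in> L2 m. \<forall>\<epsilon>>0. \<exists>u \<in> D. lnorm m 2 (h - u) < ennreal \<epsilon>)"

definition form_norm ::
  "'a measure \<Rightarrow> (('a \<Rightarrow> real) \<Rightarrow> ('a \<Rightarrow> real) \<Rightarrow> real) \<Rightarrow> real \<Rightarrow> ('a \<Rightarrow> real) \<Rightarrow> real" where
  "form_norm m E lam u = sqrt (E u u + lam * ip m u u)"

definition symmetric_form ::
  "'a measure \<Rightarrow> ('a \<Rightarrow> real) set \<Rightarrow> (('a \<Rightarrow> real) \<Rightarrow> ('a \<Rightarrow> real) \<Rightarrow> real) \<Rightarrow> bool" where
  "symmetric_form m D E \<longleftrightarrow>
     (\<forall>u \<in> D. \<forall>u' \<in> D. \<forall>v \<in> D. ae_eq m u u' \<longrightarrow> E u v = E u' v) \<and>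
     (\<forall>u \<in> D. \<forall>v \<in> D. E u v = E v u) \<and>
     (\<forall>u \<in> D. 0 \<le> E u u) \<and>
     (\<forall>u \<in> D. \<forall>v \<in> D. \<forall>w \<in> D. \<forall>a b. E (\<lambda>x. a * u x + b * v x) w = a * E u w + b * E v w)"

definition closed_form ::
  "'a measure \<Rightarrow> ('a \<Rightarrow> real) set \<Rightarrow> (('a \<Rightarrow> real) \<Rightarrow> ('a \<Rightarrow> real) \<Rightarrow> real) \<Rightarrow> bool" where
  "closed_form m D E \<longleftrightarrow>
     (\<forall>lam>0. \<forall>u :: nat \<Rightarrow> 'a \<Rightarrow> real.
        (\<forall>n. u n \<in> D) \<and>
        (\<forall>\<epsilon>>0. \<exists>N. \<forall>i\<ge>N. \<forall>j\<ge>N. form_norm m E lam (u i - u j) < \<epsilon>) \<longrightarrow>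
        (\<exists>v \<in> D. (\<lambda>n. form_norm m E lam (u n - v)) \<longlonglongrightarrow> 0))"

definition markovian_form ::
  "('a \<Rightarrow> real) set \<Rightarrow> (('a \<Rightarrow> real) \<Rightarrow> ('a \<Rightarrow> real) \<Rightarrow> real) \<Rightarrow> bool" where
  "markovian_form D E \<longleftrightarrow>
     (\<forall>\<epsilon>>0. \<exists>\<phi> :: real \<Rightarrow> real. smooth \<phi> \<and>
        (\<forall>t \<in> {0..1}. \<phi> t = t) \<and>
        (\<forall>t. - \<epsilon> \<le> \<phi> t \<and> \<phi> t \<le> 1 + \<epsilon>) \<and>
        (\<forall>t \<tau>. \<tau> < t \<longrightarrow> 0 \<le> \<phi> t - \<phi> \<tau> \<and> \<phi> t - \<phi> \<tau> \<le> t - \<tau>) \<and>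
        (\<forall>u \<in> D. \<phi> \<circ> u \<in> D \<and> E (\<phi> \<circ> u) (\<phi> \<circ> u) \<le> E u u))"

definition dirichlet_form ::
  "'a measure \<Rightarrow> ('a \<Rightarrow> real) set \<Rightarrow> (('a \<Rightarrow> real) \<Rightarrow> ('a \<Rightarrow> real) \<Rightarrow> real) \<Rightarrow> bool" where
  "dirichlet_form m D E \<longleftrightarrow>
     dense_subspace m D \<and> symmetric_form m D E \<and> closed_form m D E \<and> markovian_form D E"

definition compactly_embedded ::
  "'a measure \<Rightarrow> ('a \<Rightarrow> real) set \<Rightarrow> (('a \<Rightarrow> real) \<Rightarrow> ('a \<Rightarrow> real) \<Rightarrow> real) \<Rightarrow> bool" where
  "compactly_embedded m D E \<longleftrightarrow>
     (\<forall>u :: nat \<Rightarrow> 'a \<Rightarrow> real. (\<forall>n. u n \<in> D) \<and> (\<exists>C. \<forall>n. form_norm m E 1 (u n) \<le> C) \<longrightarrow>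
        (\<exists>k h. strict_mono (k :: nat \<Rightarrow> nat) \<and> h \<in> L2 m \<and>
           (\<lambda>n. lnorm m 2 (u (k n) - h)) \<longlonglongrightarrow> 0))"

definition continuously_embedded ::
  "'a measure \<Rightarrow> ('a \<Rightarrow> real) set \<Rightarrow> (('a \<Rightarrow> real) \<Rightarrow> ('a \<Rightarrow> real) \<Rightarrow> real) \<Rightarrow> ennreal \<Rightarrow> bool" where
  "continuously_embedded m D E p \<longleftrightarrow>
     (\<exists>C::real. \<forall>u \<in> D. u \<in> Lp m p \<and> lnorm m p u \<le> ennreal (C * form_norm m E 1 u))"

subsection \<open>The operator and its spectral scale\<close>

text \<open>The last clause says that the adjoint of the (densely defined, symmetric) operator \<open>A\<close>
  is not a proper extension of \<open>A\<close>.\<close>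

definition nonneg_selfadjoint ::
  "'a measure \<Rightarrow> ('a \<Rightarrow> real) set \<Rightarrow> (('a \<Rightarrow> real) \<Rightarrow> ('a \<Rightarrow> real)) \<Rightarrow> bool" where
  "nonneg_selfadjoint m DA A \<longleftrightarrow>
     dense_subspace m DA \<and>
     (\<forall>u \<in> DA. A u \<in> L2 m) \<and>
     (\<forall>u \<in> DA. \<forall>v \<in> DA. ae_eq m u v \<longrightarrow> ae_eq m (A u) (A v)) \<and>
     (\<forall>u \<in> DA. \<forall>v \<in> DA. \<forall>a b.
        ae_eq m (A (\<lambda>x. a * u x + b * v x)) (\<lambda>x. a * A u x + b * A v x)) \<and>
     (\<forall>u \<in> DA. \<forall>v \<in> DA. ip m (A u) v = ip m u (A v)) \<and>
     (\<forall>u \<in> DA. 0 \<le> ip m (A u) u) \<and>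
     (\<forall>v \<in> L2 m. \<forall>g \<in> L2 m. (\<forall>u \<in> DA. ip m (A u) v = ip m u g) \<longrightarrow>
        v \<in> DA \<and> ae_eq m (A v) g)"

text \<open>Eigenvalues and eigenfunctions are numbered from \<open>0\<close>.\<close>

definition eigenbasis ::
  "'a measure \<Rightarrow> ('a \<Rightarrow> real) set \<Rightarrow> (('a \<Rightarrow> real) \<Rightarrow> ('a \<Rightarrow> real)) \<Rightarrow>
   (nat \<Rightarrow> 'a \<Rightarrow> real) \<Rightarrow> (nat \<Rightarrow> real) \<Rightarrow> bool" where
  "eigenbasis m DA A e ev \<longleftrightarrow>
     (\<forall>n. e n \<in> DA \<and> ae_eq m (A (e n)) (\<lambda>x. ev n * e n x)) \<and>
     (\<forall>i j. ip m (e i) (e j) = (if i = j then 1 else 0)) \<and>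
     (\<forall>h \<in> L2 m. (\<lambda>n. lnorm m 2 (\<lambda>x. h x - (\<Sum>k<n. ip m h (e k) * e k x))) \<longlonglongrightarrow> 0) \<and>
     incseq ev \<and> filterlim ev at_top sequentially \<and> 0 < ev 0"

text \<open>The norm of \<open>V\<^sub>s\<close>; for negative \<open>s\<close> it is the norm of \<open>V\<^sub>s\<close> on elements of \<open>L\<^sup>2\<close>.\<close>

definition Vnorm ::
  "'a measure \<Rightarrow> (nat \<Rightarrow> 'a \<Rightarrow> real) \<Rightarrow> (nat \<Rightarrow> real) \<Rightarrow> real \<Rightarrow> ('a \<Rightarrow> real) \<Rightarrow> ennreal" where
  "Vnorm m e ev s h = epow (\<Sum>n. ennreal ((ip m h (e n))\<^sup>2 * ev n powr (2 * s))) (1/2)"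

definition V ::
  "'a measure \<Rightarrow> (nat \<Rightarrow> 'a \<Rightarrow> real) \<Rightarrow> (nat \<Rightarrow> real) \<Rightarrow> real \<Rightarrow> ('a \<Rightarrow> real) set" where
  "V m e ev s = {h \<in> L2 m. Vnorm m e ev s h < \<infinity>}"

text \<open>\<open>V\<^sub>-\<^sub>s = (V\<^sub>s)\<^sup>*\<close> as bounded linear functionals, so that the duality bracket is function
  application; the values outside \<open>V\<^sub>s\<close> are irrelevant. An element \<open>h\<close> of \<open>L\<^sup>2\<close> is identified
  with the functional \<open>ip m h\<close>.\<close>

definition Vdual ::
  "'a measure \<Rightarrow> (nat \<Rightarrow> 'a \<Rightarrow> real) \<Rightarrow> (nat \<Rightarrow> real) \<Rightarrow> real \<Rightarrow> (('a \<Rightarrow> real) \<Rightarrow> real) set" where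
  "Vdual m e ev s =
     {l. (\<forall>h \<in> V m e ev s. \<forall>k \<in> V m e ev s. \<forall>a b.
            l (\<lambda>x. a * h x + b * k x) = a * l h + b * l k) \<and>
         (\<exists>C::real. \<forall>h \<in> V m e ev s. ennreal \<bar>l h\<bar> \<le> ennreal C * Vnorm m e ev s h)}"

definition Vdual_norm ::
  "(nat \<Rightarrow> 'a \<Rightarrow> real) \<Rightarrow> (nat \<Rightarrow> real) \<Rightarrow> real \<Rightarrow> (('a \<Rightarrow> real) \<Rightarrow> real) \<Rightarrow> ennreal" where
  "Vdual_norm e ev s l = epow (\<Sum>n. ennreal ((l (e n))\<^sup>2 * ev n powr (- 2 * s))) (1/2)"

text \<open>\<open>A\<close> is the operator associated with the form \<open>E\<close>; \<open>V m e ev (1/2)\<close> is the domain of the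
  square root of \<open>A\<close>.\<close>

definition associated_operator ::
  "'a measure \<Rightarrow> ('a \<Rightarrow> real) set \<Rightarrow> (('a \<Rightarrow> real) \<Rightarrow> ('a \<Rightarrow> real) \<Rightarrow> real) \<Rightarrow>
   ('a \<Rightarrow> real) set \<Rightarrow> (('a \<Rightarrow> real) \<Rightarrow> ('a \<Rightarrow> real)) \<Rightarrow>
   (nat \<Rightarrow> 'a \<Rightarrow> real) \<Rightarrow> (nat \<Rightarrow> real) \<Rightarrow> bool" where
  "associated_operator m D E DA A e ev \<longleftrightarrow>
     D = V m e ev (1/2) \<and> DA \<subseteq> D \<and> (\<forall>u \<in> DA. \<forall>v \<in> D. E u v = ip m (A u) v)"

subsection \<open>Vector-valued functions of time\<close>

text \<open>Throughout, \<open>S\<close> is a space of functions (or functionals) with norm \<open>N\<close>.\<close>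

definition cont_into ::
  "real \<Rightarrow> 'b::minus set \<Rightarrow> ('b \<Rightarrow> ennreal) \<Rightarrow> (real \<Rightarrow> 'b) \<Rightarrow> bool" where
  "cont_into T S N g \<longleftrightarrow>
     (\<forall>t \<in> {0..T}. g t \<in> S \<and> ((\<lambda>s. N (g s - g t)) \<longlongrightarrow> 0) (at t within {0..T}))"

text \<open>The Bochner space \<open>L\<^sup>p((0,T);S)\<close>: strong (Bochner) measurability and finite norm.\<close>

definition strongly_measurable ::
  "real \<Rightarrow> 'b::minus set \<Rightarrow> ('b \<Rightarrow> ennreal) \<Rightarrow> (real \<Rightarrow> 'b) \<Rightarrow> bool" where
  "strongly_measurable T S N g \<longleftrightarrow>
     (AE t in lebesgue_on {0<..<T}. g t \<in> S) \<and>
     (\<exists>\<sigma> :: nat \<Rightarrow> real \<Rightarrow> 'b.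
        (\<forall>n. simple_function (lebesgue_on {0<..<T}) (\<sigma> n) \<and> \<sigma> n ` {0<..<T} \<subseteq> S) \<and>
        (AE t in lebesgue_on {0<..<T}. (\<lambda>n. N (\<sigma> n t - g t)) \<longlonglongrightarrow> 0))"

definition bochner_norm ::
  "ennreal \<Rightarrow> real \<Rightarrow> ('b \<Rightarrow> ennreal) \<Rightarrow> (real \<Rightarrow> 'b) \<Rightarrow> ennreal" where
  "bochner_norm p T N g = Lp_norm p (lebesgue_on {0<..<T}) (\<lambda>t. N (g t))"

definition bochner_Lp ::
  "ennreal \<Rightarrow> real \<Rightarrow> 'b::minus set \<Rightarrow> ('b \<Rightarrow> ennreal) \<Rightarrow> (real \<Rightarrow> 'b) set" where
  "bochner_Lp p T S N = {g. strongly_measurable T S N g \<and> bochner_norm p T N g < \<infinity>}"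

text \<open>The strong \<open>L\<^sup>2\<close>-derivative in time (one-sided at the end points of \<open>[0,T]\<close>).\<close>

definition has_dt :: "'a measure \<Rightarrow> real \<Rightarrow> (real \<Rightarrow> 'a \<Rightarrow> real) \<Rightarrow> real \<Rightarrow> ('a \<Rightarrow> real) \<Rightarrow> bool" where
  "has_dt m T u t v \<longleftrightarrow>
     v \<in> L2 m \<and>
     ((\<lambda>s. lnorm m 2 (\<lambda>x. (u s x - u t x) / (s - t) - v x)) \<longlongrightarrow> 0) (at t within {0..T})"

definition dt :: "'a measure \<Rightarrow> real \<Rightarrow> (real \<Rightarrow> 'a \<Rightarrow> real) \<Rightarrow> real \<Rightarrow> 'a \<Rightarrow> real" where
  "dt m T u t = (SOME v. has_dt m T u t v)"

definition C1_L2 :: "'a measure \<Rightarrow> real \<Rightarrow> (real \<Rightarrow> 'a \<Rightarrow> real) \<Rightarrow> bool" where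
  "C1_L2 m T u \<longleftrightarrow>
     cont_into T (L2 m) (lnorm m 2) u \<and>
     (\<forall>t \<in> {0..T}. has_dt m T u t (dt m T u t)) \<and>
     cont_into T (L2 m) (lnorm m 2) (dt m T u)"

subsection \<open>The Caputo derivative\<close>

text \<open>
  For \<open>u\<close> in \<open>C\<^sup>1([0,T];L\<^sup>2)\<close> the Caputo derivative is understood in the weaker form, as the second
  time derivative of
  \<open>caputo_primitive t = 1/\<Gamma>(2-\<alpha>) \<integral>\<^sub>0\<^sup>t (t-s)\<^bsup>1-\<alpha>\<^esup> (u(s) - u(0) - s \<partial>\<^sub>tu(0)) ds\<close>,
  where the (Bochner) integral is an element of \<open>L\<^sup>2\<close>, identified with a functional, and the second
  derivative is the distributional one on \<open>(0,T)\<close> for functions with values in the dual of \<open>S\<close>: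
  equality of functionals is equality after evaluation at every \<open>\<phi>\<close> in \<open>S\<close>, and evaluation at \<open>\<phi>\<close>
  commutes with Bochner integrals.
\<close>

definition caputo_primitive ::
  "'a measure \<Rightarrow> real \<Rightarrow> real \<Rightarrow> (real \<Rightarrow> 'a \<Rightarrow> real) \<Rightarrow> real \<Rightarrow> ('a \<Rightarrow> real) \<Rightarrow> real" where
  "caputo_primitive m \<alpha> T u t \<phi> =
     1 / Gamma (2 - \<alpha>) *
     (LINT s:{0<..<t}|lebesgue.
        (t - s) powr (1 - \<alpha>) * ip m (\<lambda>x. u s x - u 0 x - s * dt m T u 0 x) \<phi>)"

definition test_function :: "real \<Rightarrow> (real \<Rightarrow> real) \<Rightarrow> bool" where
  "test_function T \<psi> \<longleftrightarrow>
     smooth \<psi> \<and> (\<exists>a b. 0 < a \<and> b < T \<and> (\<forall>t. t \<notin> {a..b} \<longrightarrow> \<psi> t = 0))"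

definition has_caputo_derivative ::
  "'a measure \<Rightarrow> ('a \<Rightarrow> real) set \<Rightarrow> real \<Rightarrow> real \<Rightarrow> (real \<Rightarrow> 'a \<Rightarrow> real) \<Rightarrow>
   (real \<Rightarrow> ('a \<Rightarrow> real) \<Rightarrow> real) \<Rightarrow> bool" where
  "has_caputo_derivative m S \<alpha> T u w \<longleftrightarrow>
     (\<forall>\<phi> \<in> S. set_integrable lebesgue {0<..<T} (\<lambda>t. w t \<phi>) \<and>
        (\<forall>\<psi>. test_function T \<psi> \<longrightarrow>
           (LINT t:{0<..<T}|lebesgue. caputo_primitive m \<alpha> T u t \<phi> * (deriv ^^ 2) \<psi> t) =
           (LINT t:{0<..<T}|lebesgue. w t \<phi> * \<psi> t)))"

subsection \<open>The semilinear problem\<close>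

definition theta_A :: "real \<Rightarrow> real" where
  "theta_A qA = qA / (2 * (qA - 1))"

definition alpha0 :: "real \<Rightarrow> real" where
  "alpha0 qA = 1 / theta_A qA"

definition case_i :: "real \<Rightarrow> bool" where
  "case_i qA \<longleftrightarrow> qA > 2"

definition case_ii :: "real \<Rightarrow> bool" where
  "case_ii qA \<longleftrightarrow> 1 < qA \<and> qA \<le> 2"

definition Hf1 :: "real \<Rightarrow> real \<Rightarrow> real \<Rightarrow> (real \<Rightarrow> real) \<Rightarrow> bool" where
  "Hf1 qA \<alpha> r f \<longleftrightarrow>
     f differentiable_on UNIV \<and> continuous_on UNIV (deriv f) \<and> f 0 = 0 \<and>
     r > 1 \<and> (\<exists>C>0. \<forall>s. \<bar>deriv f s\<bar> \<le> C * \<bar>s\<bar> powr (r - 1)) \<and>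
     ((case_i qA \<and> \<alpha> > alpha0 qA) \<or> case_ii qA \<longrightarrow>
        r = theta_A qA * \<alpha> / (theta_A qA * \<alpha> - 1))"

definition conj_exponent :: "real \<Rightarrow> ennreal" where
  "conj_exponent p = (if p = 1 then top else ennreal (p / (p - 1)))"

definition weak_solution ::
  "'a measure \<Rightarrow> (('a \<Rightarrow> real) \<Rightarrow> ('a \<Rightarrow> real) \<Rightarrow> real) \<Rightarrow> (nat \<Rightarrow> 'a \<Rightarrow> real) \<Rightarrow> (nat \<Rightarrow> real) \<Rightarrow>
   real \<Rightarrow> ennreal \<Rightarrow> (real \<Rightarrow> real) \<Rightarrow> ('a \<Rightarrow> real) \<Rightarrow> ('a \<Rightarrow> real) \<Rightarrow> real \<Rightarrow>
   (real \<Rightarrow> 'a \<Rightarrow> real) \<Rightarrow> bool" where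
  "weak_solution m E e ev \<alpha> q f u0 u1 T u \<longleftrightarrow>
     (let \<gamma> = 1 / \<alpha> in
      cont_into T (V m e ev \<gamma>) (Vnorm m e ev \<gamma>) u \<and>
      C1_L2 m T u \<and>
      (\<exists>\<rho>>1. u \<in> bochner_Lp (ennreal \<rho> * q) T (Lp m (ennreal (2 * \<rho>))) (lnorm m (ennreal (2 * \<rho>)))) \<and>
      \<comment> \<open>\<open>w\<close> is the Caputo derivative of \<open>u\<close>, determined for a.e. time\<close>
      (\<exists>w. has_caputo_derivative m (V m e ev \<gamma>) \<alpha> T u w \<and>
         (\<exists>w1 w2. cont_into T (Vdual m e ev \<gamma>) (Vdual_norm e ev \<gamma>) w1 \<and>
            w2 \<in> bochner_Lp q T (L2 m) (lnorm m 2) \<and>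
            (\<forall>t \<in> {0<..<T}. \<forall>\<phi> \<in> V m e ev \<gamma>. w t \<phi> = w1 t \<phi> + ip m (w2 t) \<phi>)) \<and>
         (\<forall>\<phi> \<in> V m e ev \<gamma>. AE t in lebesgue_on {0<..<T}.
            w t \<phi> + E (u t) \<phi> = ip m (\<lambda>x. f (u t x)) \<phi>)) \<and>
      ae_eq m (u 0) u0 \<and> ae_eq m (dt m T u 0) u1 \<and>
      (\<exists>\<sigma>. 0 \<le> \<sigma> \<and> \<sigma> < 1 / \<alpha> \<and>
         ((\<lambda>t. Vnorm m e ev \<sigma> (u t - u0)) \<longlongrightarrow> 0) (at_right 0)) \<and>
      (\<exists>\<beta>. 0 < \<beta> \<and> \<beta> \<le> 1 - 1 / \<alpha> \<and>
         ((\<lambda>t. Vnorm m e ev (- \<beta>) (dt m T u t - u1)) \<longlongrightarrow> 0) (at_right 0)))"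

definition unique_weak_solution ::
  "'a measure \<Rightarrow> (('a \<Rightarrow> real) \<Rightarrow> ('a \<Rightarrow> real) \<Rightarrow> real) \<Rightarrow> (nat \<Rightarrow> 'a \<Rightarrow> real) \<Rightarrow> (nat \<Rightarrow> real) \<Rightarrow>
   real \<Rightarrow> ennreal \<Rightarrow> (real \<Rightarrow> real) \<Rightarrow> ('a \<Rightarrow> real) \<Rightarrow> ('a \<Rightarrow> real) \<Rightarrow> real \<Rightarrow> bool" where
  "unique_weak_solution m E e ev \<alpha> q f u0 u1 T \<longleftrightarrow>
     (\<exists>u. weak_solution m E e ev \<alpha> q f u0 u1 T u \<and>
        (\<forall>v. weak_solution m E e ev \<alpha> q f u0 u1 T v \<longrightarrow> (\<forall>t \<in> {0..T}. ae_eq m (v t) (u t))))"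

definition T_max ::
  "'a measure \<Rightarrow> (('a \<Rightarrow> real) \<Rightarrow> ('a \<Rightarrow> real) \<Rightarrow> real) \<Rightarrow> (nat \<Rightarrow> 'a \<Rightarrow> real) \<Rightarrow> (nat \<Rightarrow> real) \<Rightarrow>
   real \<Rightarrow> ennreal \<Rightarrow> (real \<Rightarrow> real) \<Rightarrow> ('a \<Rightarrow> real) \<Rightarrow> ('a \<Rightarrow> real) \<Rightarrow> ereal" where
  "T_max m E e ev \<alpha> q f u0 u1 =
     Sup {ereal T | T. 0 < T \<and> unique_weak_solution m E e ev \<alpha> q f u0 u1 T}"

text \<open>Strong solution: the Caputo derivative belongs to \<open>L\<^sup>1((0,T);L\<^sup>2)\<close> and \<open>u\<close> belongs to
  \<open>L\<^sup>1((0,T);D(A))\<close>, where \<open>D(A) = V\<^sub>1\<close> carries the norm of \<open>V\<^sub>1\<close>.\<close>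

definition strong_solution ::
  "'a measure \<Rightarrow> ('a \<Rightarrow> real) set \<Rightarrow> (nat \<Rightarrow> 'a \<Rightarrow> real) \<Rightarrow> (nat \<Rightarrow> real) \<Rightarrow>
   real \<Rightarrow> real \<Rightarrow> (real \<Rightarrow> 'a \<Rightarrow> real) \<Rightarrow> bool" where
  "strong_solution m DA e ev \<alpha> T u \<longleftrightarrow>
     (\<exists>w \<in> bochner_Lp 1 T (L2 m) (lnorm m 2).
        has_caputo_derivative m (V m e ev (1 / \<alpha>)) \<alpha> T u (\<lambda>t \<phi>. ip m (w t) \<phi>)) \<and>
     u \<in> bochner_Lp 1 T DA (Vnorm m e ev 1)"

end

theory Submission
  imports Defs "HOL-Computational_Algebra.Polynomial"
begin

text \<open>
  Write \<open>y\<^sub>n(t) = (u(t), e\<^sub>n)\<close> for the coefficients of the solution in the eigenbasis, \<open>F = f(u)\<close>,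
  \<open>F\<^sub>n = (F, e\<^sub>n)\<close>, and \<open>RL a\<close> for the Riemann-Liouville integral of order \<open>a\<close>. The proof rests on
  four observations.

  First, the hypothesis on the sup norm makes \<open>F\<close> essentially bounded in \<open>L\<^sup>2\<close>, not merely
  integrable. As \<open>u\<close> is Lipschitz continuous into \<open>L\<^sup>2\<close>, the growth of the derivative of \<open>f\<close> gives
  \<open>\<bar>F(t) - F(s)\<bar> \<le> (g(t) + g(s)) \<bar>t - s\<bar>\<close> with \<open>g\<close> a multiple of the power \<open>r - 1\<close> of the sup norm of
  \<open>u\<close>, a function in \<open>L\<^sup>1(0,T)\<close>. Joining \<open>t\<close> to a point at distance comparable to \<open>T\<close> by a chain of
  points at dyadic distances from \<open>t\<close>, each chosen where \<open>g\<close> is below its average, the increments add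
  up to a multiple of the integral of \<open>g\<close> (\<open>chain_bound\<close>, \<open>nonlinearity_bounded\<close>).

  Second, testing the equation with \<open>e\<^sub>n\<close> gives a scalar distributional equation of second order, which
  is equivalent to \<open>y\<^sub>n = y\<^sub>n(0) + t y\<^sub>n'(0) + RL \<alpha> w\<^sub>n\<close> with \<open>w\<^sub>n = F\<^sub>n - \<lambda>\<^sub>n y\<^sub>n\<close>: the two sides differ, after a
  fractional integration, by an affine function, which vanishes because both are small at \<open>t = 0\<close>
  (\<open>caputo_equation_integrated\<close>).

  Third, the Volterra equation \<open>W + \<lambda> RL \<alpha> W = Q\<close> has maximal regularity in \<open>L\<^sup>2(0,R)\<close> with a constant
  that depends neither on \<open>\<lambda>\<close> nor on \<open>R\<close> (\<open>maximal_regularity\<close>). This follows from the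
  sectoriality of \<open>RL (\<alpha>/2)\<close>: its kernel is a superposition of the kernels
  \<open>max 0 (1 - r\<bar>t - s\<bar>)\<close> times \<open>exp(-i r (t - s))\<close>, which are of positive type
  (\<open>triangle_kernel_nonneg\<close>, \<open>sectorial_positivity\<close>).

  Fourth, the initial values are too rough for \<open>A u\<close> to be controlled up to \<open>t = 0\<close> directly, so maximal
  regularity is applied to \<open>t\<^sup>2 y\<^sub>n\<close>, which satisfies an equation of the same kind (\<open>weighted_equation\<close>)
  with a right-hand side bounded by \<open>F\<close>, by \<open>u\<close> in \<open>V\<^bsub>1/\<alpha>\<^esub>\<close> and by its time derivative in \<open>L\<^sup>2\<close>. Summation
  over the modes shows that the square of the norm of \<open>A u\<close> has integral at most a multiple of
  \<open>R\<^bsup>3-2\<alpha>\<^esup>\<close> over \<open>[R/2, R)\<close> (\<open>block_A2\<close>); hence its norm has integral at most a multiple of \<open>R\<^bsup>2-\<alpha>\<^esup>\<close>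
  there, and the sum over \<open>R = T/2\<^sup>k\<close> is finite as \<open>\<alpha> < 2\<close> (\<open>A_integrable\<close>).

  Finally, completeness of \<open>L\<^sup>2\<close> and self-adjointness show that \<open>u(t)\<close> is in the domain of \<open>A\<close> for almost
  every \<open>t\<close> (\<open>Riesz_Fischer\<close>, \<open>domain_of_A\<close>). The function \<open>F - A u\<close> is then integrable with values in
  \<open>L\<^sup>2\<close>, and it is the Caputo derivative because it has the right pairing with every test element
  (\<open>weak_solution_imp_strong\<close>).
\<close>

section \<open>Riemann-Liouville integrals\<close>

text \<open>Euler's Beta integral, moved from \<open>(0,1)\<close> to \<open>(x,t)\<close> by an affine substitution. It is the source of
  the semigroup law of fractional integration.\<close>

lemma beta_kernel:
  fixes a b x t :: real
  assumes a: "a > 0" and b: "b > 0" and xt: "x < t"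
  shows "has_bochner_integral lborel
     (\<lambda>s. indicator {x<..<t} s * ((t - s) powr (a - 1) * (s - x) powr (b - 1)))
     (Beta a b * (t - x) powr (a + b - 1))"
proof -
  define d where "d = t - x"
  have d: "d > 0" using xt by (simp add: d_def)
  let ?f = "\<lambda>v::real. v powr (b - 1) * (1 - v) powr (a - 1)"
  have si: "set_integrable lborel {0..1} ?f"
    using integrable_Beta[of b a] a b by auto
  have "set_lebesgue_integral lborel {0..1} ?f = integral {0..1} ?f"
    by (rule set_borel_integral_eq_integral[OF si])
  also have "\<dots> = Beta b a"
    using has_integral_Beta_real[OF b a] by (rule integral_unique)
  finally have v: "set_lebesgue_integral lborel {0..1} ?f = Beta a b"
    by (simp add: Beta_commute)
  have hb: "has_bochner_integral lborel (\<lambda>v. indicator {0..1} v * ?f v) (Beta a b)"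
    using si v by (simp add: set_integrable_def set_lebesgue_integral_def has_bochner_integral_iff)
  have hb2: "has_bochner_integral lborel (\<lambda>v. d powr (a + b - 2) * (indicator {0<..<1} v * ?f v))
     (d powr (a + b - 2) * Beta a b)"
  proof (rule has_bochner_integral_mult_right, rule has_bochner_integral_cong_AE[THEN iffD1, OF _ _ _ hb])
    show "AE v in lborel. indicator {0..1} v * ?f v = indicator {0<..<1} v * ?f v"
      using AE_lborel_singleton[of 0] AE_lborel_singleton[of 1]
      by eventually_elim (auto simp: indicator_def)
  qed auto
  have "has_bochner_integral lborel
     (\<lambda>s. indicator {x<..<t} s * ((t - s) powr (a - 1) * (s - x) powr (b - 1)))
     (d *\<^sub>R (d powr (a + b - 2) * Beta a b))"
  proof (subst lborel_has_bochner_integral_real_affine_iff[of d _ _ x])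
    show "d \<noteq> 0" using d by simp
    have "(\<lambda>v. indicator {x<..<t} (x + d * v) * ((t - (x + d * v)) powr (a - 1) * (x + d * v - x) powr (b - 1)))
        = (\<lambda>v. d powr (a + b - 2) * (indicator {0<..<1} v * ?f v))"
    proof
      fix v :: real
      have i: "indicator {x<..<t} (x + d * v) = (indicator {0<..<1} v :: real)"
        using d by (auto simp: indicator_def d_def zero_less_mult_iff)
                   (smt (verit) mult_less_cancel_left2 mult_le_cancel_left1)+
      show "indicator {x<..<t} (x + d * v) * ((t - (x + d * v)) powr (a - 1) * (x + d * v - x) powr (b - 1))
        = d powr (a + b - 2) * (indicator {0<..<1} v * ?f v)"
      proof (cases "v \<in> {0<..<1}")
        case True
        have "t - (x + d * v) = d * (1 - v)" by (simp add: d_def algebra_simps)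
        then have "(t - (x + d * v)) powr (a - 1) * (x + d * v - x) powr (b - 1)
          = (d powr (a - 1) * d powr (b - 1)) * ?f v"
          using True d by (simp add: powr_mult)
        also have "d powr (a - 1) * d powr (b - 1) = d powr (a + b - 2)"
          by (simp add: powr_add[symmetric] algebra_simps)
        finally show ?thesis using i True by simp
      next
        case False then show ?thesis using i by simp
      qed
    qed
    moreover have "d *\<^sub>R (d powr (a + b - 2) * Beta a b) /\<^sub>R \<bar>d\<bar> = d powr (a + b - 2) * Beta a b"
      using d by simp
    ultimately show "has_bochner_integral lborel
     (\<lambda>v. indicator {x<..<t} (x + d * v) * ((t - (x + d * v)) powr (a - 1) * (x + d * v - x) powr (b - 1)))
     (d *\<^sub>R (d powr (a + b - 2) * Beta a b) /\<^sub>R \<bar>d\<bar>)"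
      using hb2 by (simp only:)
  qed
  moreover have "d * d powr (a + b - 2) = d powr (a + b - 1)"
    using powr_add[of d 1 "a + b - 2"] d by (simp add: algebra_simps)
  ultimately show ?thesis by (simp add: d_def mult.commute mult.left_commute)
qed

lemma pos_notin_nonpos: "(a::real) > 0 \<Longrightarrow> a \<notin> \<int>\<^sub>\<le>\<^sub>0"
  by (auto elim!: nonpos_Ints_cases)

lemma pos_Gamma_ne: "(a::real) > 0 \<Longrightarrow> Gamma a \<noteq> 0"
  by (metis Gamma_real_pos less_irrefl)

lemma power_kernel:
  fixes a x t :: real
  assumes a: "a > 0" and xt: "x \<le> t"
  shows "has_bochner_integral lborel (\<lambda>s. indicator {x<..<t} s * (t - s) powr (a - 1)) ((t - x) powr a / a)"
proof (cases "x = t")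
  case True
  then show ?thesis using has_bochner_integral_zero[of lborel] by simp
next
  case False
  then have "x < t" using xt by simp
  have B: "Beta a 1 = 1 / a"
    using a by (simp add: Beta_def Gamma_plus1[OF pos_notin_nonpos] pos_Gamma_ne)
  have eq: "(\<lambda>s. indicator {x<..<t} s * ((t - s) powr (a - 1) * (s - x) powr (1 - 1)))
     = (\<lambda>s. indicator {x<..<t} s * (t - s) powr (a - 1))"
    by (auto simp: fun_eq_iff indicator_def)
  show ?thesis using beta_kernel[of a 1 x t, unfolded eq] \<open>x < t\<close> a B by simp
qed

text \<open>The Riemann-Liouville integral of order \<open>a\<close>, based at the origin; it vanishes for \<open>t \<le> 0\<close>.\<close>

definition RL :: "real \<Rightarrow> (real \<Rightarrow> real) \<Rightarrow> real \<Rightarrow> real" where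
  "RL a g t = (LINT s|lborel. indicator {0<..<t} s * ((t - s) powr (a - 1) * g s)) / Gamma a"

text \<open>Only the values on \<open>[0,R]\<close> are bounded, but measurability is required on the whole line. In this way the
  class is closed under products, under fractional integration and under passing to a smaller
  interval, without any restriction of domains.\<close>

definition bdd_borel :: "real \<Rightarrow> (real \<Rightarrow> real) \<Rightarrow> bool" where
  "bdd_borel R g \<longleftrightarrow> g \<in> borel_measurable borel \<and> (\<exists>M. \<forall>t\<in>{0..R}. \<bar>g t\<bar> \<le> M)"

lemma bdd_borelE:
  assumes "bdd_borel R g"
  obtains M where "M > 0" "\<And>t. t \<in> {0..R} \<Longrightarrow> \<bar>g t\<bar> \<le> M" "g \<in> borel_measurable borel"
proof -
  obtain M where "\<forall>t\<in>{0..R}. \<bar>g t\<bar> \<le> M" "g \<in> borel_measurable borel"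
    using assms by (auto simp: bdd_borel_def)
  then show ?thesis by (intro that[of "\<bar>M\<bar> + 1"]) force+
qed

lemma bdd_borelI:
  "g \<in> borel_measurable borel \<Longrightarrow> (\<And>t. t \<in> {0..R} \<Longrightarrow> \<bar>g t\<bar> \<le> M) \<Longrightarrow> bdd_borel R g"
  unfolding bdd_borel_def by blast

lemma bdd_borel_const: "bdd_borel R (\<lambda>t. c)"
  by (rule bdd_borelI[where M="\<bar>c\<bar>"]) auto

lemma bdd_borel_id: "bdd_borel R (\<lambda>t. t)"
  by (rule bdd_borelI[where M="\<bar>R\<bar>"]) auto

lemma bdd_borel_mult:
  assumes "bdd_borel R g" "bdd_borel R h"
  shows "bdd_borel R (\<lambda>t. g t * h t)"
proof -
  obtain M where M: "M > 0" "\<And>t. t \<in> {0..R} \<Longrightarrow> \<bar>g t\<bar> \<le> M" "g \<in> borel_measurable borel"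
    using assms(1) by (rule bdd_borelE) blast
  obtain K where K: "K > 0" "\<And>t. t \<in> {0..R} \<Longrightarrow> \<bar>h t\<bar> \<le> K" "h \<in> borel_measurable borel"
    using assms(2) by (rule bdd_borelE) blast
  show ?thesis using M K
    by (intro bdd_borelI[where M="M * K"]) (auto simp: abs_mult intro!: mult_mono)
qed

lemma bdd_borel_add:
  assumes "bdd_borel R g" "bdd_borel R h"
  shows "bdd_borel R (\<lambda>t. g t + h t)"
proof -
  obtain M where M: "M > 0" "\<And>t. t \<in> {0..R} \<Longrightarrow> \<bar>g t\<bar> \<le> M" "g \<in> borel_measurable borel"
    using assms(1) by (rule bdd_borelE) blast
  obtain K where K: "K > 0" "\<And>t. t \<in> {0..R} \<Longrightarrow> \<bar>h t\<bar> \<le> K" "h \<in> borel_measurable borel"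
    using assms(2) by (rule bdd_borelE) blast
  show ?thesis using M(3) K(3)
    by (intro bdd_borelI[where M="M + K"])
       (auto intro!: order_trans[OF abs_triangle_ineq] add_mono M(2) K(2))
qed

lemma bdd_borel_cmult: "bdd_borel R g \<Longrightarrow> bdd_borel R (\<lambda>t. c * g t)"
  by (intro bdd_borel_mult bdd_borel_const)

lemma bdd_borel_diff:
  assumes "bdd_borel R g" "bdd_borel R h"
  shows "bdd_borel R (\<lambda>t. g t - h t)"
  using bdd_borel_add[OF assms(1) bdd_borel_cmult[OF assms(2), of "-1"]] by simp

lemma bdd_borel_power2: "bdd_borel R g \<Longrightarrow> bdd_borel R (\<lambda>t. (g t)\<^sup>2)"
  unfolding power2_eq_square by (rule bdd_borel_mult)

lemma bdd_borel_mono: "bdd_borel R g \<Longrightarrow> R' \<le> R \<Longrightarrow> bdd_borel R' g"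
  unfolding bdd_borel_def by fastforce

lemmas bdd_borel_intros = bdd_borel_const bdd_borel_id bdd_borel_mult bdd_borel_add
  bdd_borel_diff bdd_borel_power2

lemma bdd_borel_measurable: "bdd_borel R g \<Longrightarrow> g \<in> borel_measurable borel"
  by (simp add: bdd_borel_def)

lemma integrable_bdd_borel:
  assumes "bdd_borel R g"
  shows "integrable lborel (\<lambda>t. indicator {0<..<R} t * g t)"
proof -
  obtain M where M: "M > 0" "\<And>t. t \<in> {0..R} \<Longrightarrow> \<bar>g t\<bar> \<le> M" and [measurable]: "g \<in> borel_measurable borel"
    using assms by (rule bdd_borelE) blast
  show ?thesis
  proof (rule Bochner_Integration.integrable_bound)
    show "integrable lborel (\<lambda>t. M * indicator {0<..<R} t :: real)" 
      using emeasure_bounded_finite[of "{0<..<R}"] by (intro integrable_mult_right integrable_real_indicator) auto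
    show "AE t in lborel. norm (indicator {0<..<R} t * g t) \<le> norm (M * indicator {0<..<R} t)"
      using M by (auto simp: indicator_def)
  qed auto
qed

lemma RL_integrable:
  assumes g: "bdd_borel R g" and a: "a > 0" and t: "t \<le> R"
  shows "integrable lborel (\<lambda>s. indicator {0<..<t} s * ((t - s) powr (a - 1) * g s))"
proof (cases "t \<le> 0")
  case True
  then show ?thesis by simp
next
  case False
  obtain M where M: "M > 0" "\<And>t. t \<in> {0..R} \<Longrightarrow> \<bar>g t\<bar> \<le> M" and [measurable]: "g \<in> borel_measurable borel"
    using g by (rule bdd_borelE) blast
  show ?thesis
  proof (rule Bochner_Integration.integrable_bound)
    show "integrable lborel (\<lambda>s. M * (indicator {0<..<t} s * (t - s) powr (a - 1)))"
      using power_kernel[OF a, of 0 t] False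
      by (intro integrable_mult_right) (auto simp: has_bochner_integral_iff)
    show "AE s in lborel. norm (indicator {0<..<t} s * ((t - s) powr (a - 1) * g s))
        \<le> norm (M * (indicator {0<..<t} s * (t - s) powr (a - 1)))"
      using M t by (auto simp: indicator_def abs_mult mult.commute intro!: mult_right_mono)
  qed auto
qed

lemma RL_measurable:
  assumes [measurable]: "g \<in> borel_measurable borel"
  shows "RL a g \<in> borel_measurable borel"
proof -
  have "(\<lambda>t. LINT s|lborel. indicator {0<..<t} s * ((t - s) powr (a - 1) * g s)) \<in> borel_measurable borel"
  proof -
    have eq: "(\<lambda>t s. indicator {0<..<t} s * ((t - s) powr (a - 1) * g s))
      = (\<lambda>t s. if 0 < s \<and> s < t then ((t - s) powr (a - 1) * g s) else (0::real))"
      by (auto simp: fun_eq_iff)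
    show ?thesis
      by (rule lborel.borel_measurable_lebesgue_integral) (auto simp: eq case_prod_beta')
  qed
  then show ?thesis unfolding RL_def by auto
qed

lemma RL_nonpos: "t \<le> 0 \<Longrightarrow> RL a g t = 0"
  by (simp add: RL_def)

lemma RL_one: "a > 0 \<Longrightarrow> 0 \<le> t \<Longrightarrow> RL a (\<lambda>s. 1) t = t powr a / Gamma (a + 1)"
  using power_kernel[of a 0 t]
  by (simp add: RL_def has_bochner_integral_iff Gamma_plus1[OF pos_notin_nonpos] mult.commute)

lemma RL_abs_le:
  assumes g: "bdd_borel R g" and a: "a > 0" and t: "t \<le> R" and "0 \<le> t"
    and M: "\<And>s. s \<in> {0<..<t} \<Longrightarrow> \<bar>g s\<bar> \<le> M"
  shows "\<bar>RL a g t\<bar> \<le> M * (t powr a / Gamma (a + 1))"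
proof -
  note [measurable] = bdd_borel_measurable[OF g]
  have "norm (LINT s|lborel. indicator {0<..<t} s * ((t - s) powr (a - 1) * g s))
     \<le> (LINT s|lborel. M * (indicator {0<..<t} s * ((t - s) powr (a - 1))))"
  proof (rule Bochner_Integration.integral_norm_bound_integral)
    show "integrable lborel (\<lambda>s. M * (indicator {0<..<t} s * (t - s) powr (a - 1)))"
      using power_kernel[OF a, of 0 t] \<open>0 \<le> t\<close>
      by (intro integrable_mult_right) (auto simp: has_bochner_integral_iff)
    show "integrable lborel (\<lambda>s. indicator {0<..<t} s * ((t - s) powr (a - 1) * g s))"
      by (rule RL_integrable[OF g a t])
    show "norm (indicator {0<..<t} s * ((t - s) powr (a - 1) * g s))
       \<le> M * (indicator {0<..<t} s * (t - s) powr (a - 1))" for s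
      using M[of s] by (auto simp: indicator_def abs_mult mult.commute intro!: mult_right_mono)
  qed
  also have "\<dots> = M * (t powr a / a)"
    using power_kernel[OF a, of 0 t] \<open>0 \<le> t\<close> by (simp add: has_bochner_integral_iff)
  finally have "\<bar>RL a g t\<bar> \<le> M * (t powr a / a) / Gamma a"
    using Gamma_real_pos[OF a] unfolding RL_def abs_divide
    by (simp only: abs_of_pos real_norm_def) (intro divide_right_mono, auto)
  then show ?thesis using a by (simp add: Gamma_plus1[OF pos_notin_nonpos] mult.commute)
qed

lemma RL_bdd:
  assumes g: "bdd_borel R g" and a: "a > 0"
  shows "bdd_borel R (RL a g)"
proof -
  obtain M where M: "M > 0" "\<And>t. t \<in> {0..R} \<Longrightarrow> \<bar>g t\<bar> \<le> M" and m: "g \<in> borel_measurable borel"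
    using g by (rule bdd_borelE) blast
  show ?thesis
  proof (rule bdd_borelI[where M = "M * (R powr a / Gamma (a + 1))"])
    show "RL a g \<in> borel_measurable borel" by (rule RL_measurable[OF m])
    fix t assume t: "t \<in> {0..R}"
    have "\<bar>RL a g t\<bar> \<le> M * (t powr a / Gamma (a + 1))"
      using t M by (intro RL_abs_le[OF g a]) auto
    also have "\<dots> \<le> M * (R powr a / Gamma (a + 1))"
      using t M(1) a by (intro mult_left_mono divide_right_mono powr_mono2) (auto intro: less_imp_le)
    finally show "\<bar>RL a g t\<bar> \<le> M * (R powr a / Gamma (a + 1))" .
  qed
qed

lemma RL_add:
  assumes "bdd_borel R g" "bdd_borel R h" "a > 0" "t \<le> R"
  shows "RL a (\<lambda>s. g s + h s) t = RL a g t + RL a h t"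
  unfolding RL_def distrib_left
  by (subst Bochner_Integration.integral_add[OF RL_integrable[OF assms(1,3,4)] RL_integrable[OF assms(2,3,4)]])
     (rule add_divide_distrib)

lemma RL_cmult: "RL a (\<lambda>s. c * g s) t = c * RL a g t"
  unfolding RL_def by (simp add: mult.left_commute[of _ c])

lemma RL_diff:
  assumes "bdd_borel R g" "bdd_borel R h" "a > 0" "t \<le> R"
  shows "RL a (\<lambda>s. g s - h s) t = RL a g t - RL a h t"
  using RL_add[OF assms(1) bdd_borel_cmult[OF assms(2), of "-1"] assms(3,4)] RL_cmult[of a "-1" h t] by simp

lemma RL_cong:
  assumes "\<And>s. s \<in> {0<..<t} \<Longrightarrow> g s = h s"
  shows "RL a g t = RL a h t"
  unfolding RL_def
  by (intro arg_cong2[where f="(/)"] refl Bochner_Integration.integral_cong)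
     (use assms in \<open>auto simp: indicator_def\<close>)

text \<open>Interchanging the two integrations leaves the Beta integral of \<open>beta_kernel\<close> as the inner one.\<close>

lemma RL_semigroup:
  assumes g: "bdd_borel R g" and a: "a > 0" and b: "b > 0" and t: "t \<le> R"
  shows "RL a (RL b g) t = RL (a + b) g t"
proof (cases "t \<le> 0")
  case True
  then show ?thesis by (simp add: RL_nonpos)
next
  case False
  obtain M where M: "M > 0" "\<And>t. t \<in> {0..R} \<Longrightarrow> \<bar>g t\<bar> \<le> M" and m[measurable]: "g \<in> borel_measurable borel"
    using g by (rule bdd_borelE) blast
  define f where "f x s = (if 0 < x \<and> x < s \<and> s < t then (t - s) powr (a - 1) * (s - x) powr (b - 1) * g x else 0)"
    for x s :: real
  have f1: "f x s = (if 0 < x then g x * (indicator {x<..<t} s * ((t - s) powr (a - 1) * (s - x) powr (b - 1))) else 0)" for x s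
    by (auto simp: f_def)
  have hb: "has_bochner_integral lborel (f x) (indicator {0<..<t} x * (g x * (Beta a b * (t - x) powr (a + b - 1))))" for x
  proof (cases "0 < x \<and> x < t")
    case True
    then have "f x = (\<lambda>s. g x * (indicator {x<..<t} s * ((t - s) powr (a - 1) * (s - x) powr (b - 1))))"
      by (auto simp: f1 fun_eq_iff)
    with True show ?thesis using beta_kernel[OF a b, of x t]
      by (auto intro!: has_bochner_integral_mult_right)
  next
    case False
    then have "f x = (\<lambda>s. 0)" by (auto simp: f_def fun_eq_iff)
    then show ?thesis using False has_bochner_integral_zero[of lborel] by auto
  qed
  have hbn: "has_bochner_integral lborel (\<lambda>s. norm (f x s)) (indicator {0<..<t} x * (\<bar>g x\<bar> * (Beta a b * (t - x) powr (a + b - 1))))" for x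
  proof (cases "0 < x \<and> x < t")
    case True
    then have "(\<lambda>s. norm (f x s)) = (\<lambda>s. \<bar>g x\<bar> * (indicator {x<..<t} s * ((t - s) powr (a - 1) * (s - x) powr (b - 1))))"
      by (auto simp: f1 fun_eq_iff abs_mult)
    with True show ?thesis using beta_kernel[OF a b, of x t]
      by (auto intro!: has_bochner_integral_mult_right)
  next
    case False
    then have "f x = (\<lambda>s. 0)" by (auto simp: f_def fun_eq_iff)
    then show ?thesis using False has_bochner_integral_zero[of lborel] by auto
  qed
  have ab: "a + b > 0" using a b by simp
  have bg: "bdd_borel R (\<lambda>s. \<bar>g s\<bar>)" using M m by (intro bdd_borelI[where M=M]) auto
  have int: "integrable (lborel \<Otimes>\<^sub>M lborel) (\<lambda>(x, s). f x s)"
  proof (rule lborel_pair.Fubini_integrable)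
    show "(\<lambda>(x, s). f x s) \<in> borel_measurable (lborel \<Otimes>\<^sub>M lborel)"
      unfolding f_def by (simp add: case_prod_beta')
    show "AE x in lborel. integrable lborel (\<lambda>y. case (x, y) of (x, s) \<Rightarrow> f x s)"
      using hb by (auto simp: has_bochner_integral_iff)
    have "(\<lambda>x. LBINT y. norm (case (x, y) of (x, s) \<Rightarrow> f x s))
      = (\<lambda>x. Beta a b * (indicator {0<..<t} x * ((t - x) powr (a + b - 1) * \<bar>g x\<bar>)))"
      using hbn by (auto simp: has_bochner_integral_iff fun_eq_iff mult_ac)
    then show "integrable lborel (\<lambda>x. LBINT y. norm (case (x, y) of (x, s) \<Rightarrow> f x s))"
      using RL_integrable[OF bg ab t] by simp
  qed
  have "RL a (RL b g) t = (LBINT s. LBINT x. f x s) / (Gamma a * Gamma b)"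
  proof -
    have "indicator {0<..<t} s * ((t - s) powr (a - 1) * RL b g s) = (LBINT x. f x s) / Gamma b" for s
    proof (cases "0 < s \<and> s < t")
      case True
      have "(\<lambda>x. f x s) = (\<lambda>x. (t - s) powr (a - 1) * (indicator {0<..<s} x * ((s - x) powr (b - 1) * g x)))"
        using True by (auto simp: f_def fun_eq_iff)
      then show ?thesis using True by (simp add: RL_def)
    next
      case False
      then have "(\<lambda>x. f x s) = (\<lambda>x. 0)" by (auto simp: f_def fun_eq_iff)
      then show ?thesis using False by simp
    qed
    then show ?thesis unfolding RL_def[of a] by simp
  qed
  also have "(LBINT s. LBINT x. f x s) = (LBINT x. LBINT s. f x s)"
    by (rule lborel_pair.Fubini_integral[OF int])
  also have "\<dots> = (LBINT x. Beta a b * (indicator {0<..<t} x * ((t - x) powr (a + b - 1) * g x)))"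
    using hb by (intro Bochner_Integration.integral_cong) (auto simp: has_bochner_integral_iff mult_ac)
  also have "\<dots> = Beta a b * (RL (a + b) g t * Gamma (a + b))"
    using Gamma_real_pos[OF ab] by (simp add: RL_def)
  also have "Beta a b * (RL (a + b) g t * Gamma (a + b)) / (Gamma a * Gamma b) = RL (a + b) g t"
    using Gamma_real_pos[OF ab] Gamma_real_pos[OF a] Gamma_real_pos[OF b] by (simp add: Beta_def)
  finally show ?thesis .
qed

section \<open>Fractional integration is sectorial\<close>

lemma integrable_box:
  fixes f :: "real \<times> real \<Rightarrow> real"
  assumes [measurable]: "f \<in> borel_measurable borel"
    and M: "\<And>x y. \<bar>f (x, y)\<bar> \<le> M * (indicator {a<..<b} x * indicator {c<..<d} y)"
  shows "integrable lborel f"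
proof (rule Bochner_Integration.integrable_bound)
  let ?B = "box (a, c) (b, d)"
  have "emeasure lborel ?B < \<infinity>" by (rule emeasure_bounded_finite) (rule bounded_box)
  then show "integrable lborel (\<lambda>z. M * indicator ?B z :: real)"
    by (intro integrable_mult_right integrable_real_indicator) auto
  have B: "indicator ?B (x, y) = (indicator {a<..<b} x * indicator {c<..<d} y :: real)" for x y
    by (auto simp: indicator_def box_def Basis_prod_def)
  show "AE z in lborel. norm (f z) \<le> norm (M * indicator ?B z)"
  proof (rule AE_I2)
    fix z :: "real \<times> real"
    obtain x y where z: "z = (x, y)" by (cases z)
    show "norm (f z) \<le> norm (M * indicator ?B z)"
      unfolding z B using M[of x y] by simp
  qed
qed auto

lemma integral_pair:
  fixes f :: "real \<times> real \<Rightarrow> real"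
  assumes "integrable lborel f"
  shows "(LBINT x. LBINT y. f (x, y)) = integral\<^sup>L lborel f"
    and "(LBINT y. LBINT x. f (x, y)) = integral\<^sup>L lborel f"
  using lborel_pair.integral_fst'[of f] lborel_pair.integral_snd[of "\<lambda>x y. f (x, y)"] assms
  by (simp_all add: lborel_prod)

lemma measure_Ioo: "measure lborel {l<..<u} = max 0 (u - l :: real)"
  by (cases "l \<le> u") auto

text \<open>The triangle is the autocorrelation of the indicator function of an interval of length \<open>1/r\<close>; such functions are of
  positive type.\<close>

lemma triangle_kernel_integral:
  assumes r: "(r::real) > 0"
  shows "(LBINT y. indicator {t - 1/r<..<t} y * indicator {s - 1/r<..<s} y) = max 0 (1 - r * \<bar>t - s\<bar>) / r"
proof -
  have "(\<lambda>y. indicator {t - 1/r<..<t} y * indicator {s - 1/r<..<s} y :: real)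
     = indicator {max t s - 1/r<..<min t s}"
    by (auto simp: fun_eq_iff indicator_def)
  then have "(LBINT y. indicator {t - 1/r<..<t} y * indicator {s - 1/r<..<s} y :: real)
     = measure lborel {max t s - 1/r<..<min t s}" by simp
  also have "\<dots> = max 0 (min t s - (max t s - 1/r))"
    using measure_Ioo by blast
  also have "min t s - (max t s - 1/r) = (1 - r * \<bar>t - s\<bar>) / r"
    using r by (auto simp: field_simps min_def max_def)
  also have "max 0 \<dots> = max 0 (1 - r * \<bar>t - s\<bar>) / r"
    using r by (auto simp: max_def field_simps)
  finally show ?thesis .
qed

text \<open>Integrated over the whole square, the quadratic form of the triangle is the integral of the square of a
  convolution by \<open>triangle_kernel_integral\<close>. The symmetry of the kernel then yields the part \<open>s < t\<close>, on which
  Volterra operators live.\<close>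

lemma triangle_kernel_nonneg:
  fixes a :: "real \<Rightarrow> real"
  assumes r: "r > 0" and [measurable]: "a \<in> borel_measurable borel"
    and M: "\<And>t. \<bar>a t\<bar> \<le> M * indicator {0<..<R} t"
  shows "0 \<le> (\<integral>(t, s). indicator {0<..<t} s * max 0 (1 - r * \<bar>t - s\<bar>) * (a t * a s) \<partial>lborel)"
proof -
  define k where "k = (\<lambda>(t, s). max 0 (1 - r * \<bar>t - s\<bar>) * (a t * a s))"
  have [measurable]: "k \<in> borel_measurable borel"
    unfolding k_def by (simp add: case_prod_beta' borel_prod[symmetric])
  have M0: "M \<ge> 0 \<or> (\<forall>t. a t = 0)"
    using M by (smt (verit, best) indicator_simps mult_cancel_left1 mult_cancel_right1)
  have a2: "\<bar>a t * a s\<bar> \<le> M * M * (indicator {0<..<R} t * indicator {0<..<R} s)" for t s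
    using mult_mono[OF M[of t] M[of s]] M[of t] by (simp add: abs_mult mult_ac)
  have kb: "\<bar>k (t, s)\<bar> \<le> M * M * (indicator {0<..<R} t * indicator {0<..<R} s)" for t s
  proof -
    have "\<bar>k (t, s)\<bar> = max 0 (1 - r * \<bar>t - s\<bar>) * \<bar>a t * a s\<bar>"
      by (simp add: k_def abs_mult)
    also have "\<dots> \<le> 1 * \<bar>a t * a s\<bar>" using r by (intro mult_right_mono) auto
    finally show ?thesis using a2[of t s] by simp
  qed
  have ki: "integrable lborel k" by (rule integrable_box[OF _ kb]) auto
  define B where "B y = (LBINT s. indicator {s - 1/r<..<s} y * a s)" for y
  have [measurable]: "B \<in> borel_measurable borel"
  proof -
    have "(\<lambda>(y, s). indicator {s - 1/r<..<s} y * a s) = (\<lambda>(y, s). if s - 1/r < y \<and> y < s then a s else 0)"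
      by (auto simp: fun_eq_iff)
    then show ?thesis unfolding B_def
      by (intro lborel.borel_measurable_lebesgue_integral) (simp add: case_prod_beta')
  qed
  \<comment> \<open>Integration over \<open>s\<close> first exhibits the kernel as a superposition over \<open>y\<close> of rank-one kernels.\<close>
  have inner: "(LBINT s. k (t, s)) = r * (LBINT y. a t * (indicator {t - 1/r<..<t} y * B y))" for t
  proof -
    define h where "h = (\<lambda>(s, y). indicator {t - 1/r<..<t} y * (indicator {s - 1/r<..<s} y * a s))"
    have [measurable]: "h \<in> borel_measurable borel"
    proof -
      have "h = (\<lambda>(s, y). if t - 1/r < y \<and> y < t \<and> s - 1/r < y \<and> y < s then a s else 0)"
        by (auto simp: fun_eq_iff h_def)
      then show ?thesis by (simp add: case_prod_beta' borel_prod[symmetric])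
    qed
    have hi: "integrable lborel h"
    proof (rule integrable_box)
      show "\<bar>h (s, y)\<bar> \<le> M * (indicator {0<..<R} s * indicator {t - 1/r<..<t} y)" for s y
        using M[of s] by (auto simp: h_def indicator_def)
    qed auto
    have "(LBINT s. k (t, s)) = (LBINT s. a t * (r * (LBINT y. h (s, y))))"
    proof (rule Bochner_Integration.integral_cong[OF refl])
      fix s
      have "(LBINT y. h (s, y)) = a s * (LBINT y. indicator {t - 1/r<..<t} y * indicator {s - 1/r<..<s} y)"
        unfolding h_def by (simp add: mult_ac flip: integral_mult_right_zero)
      then show "k (t, s) = a t * (r * (LBINT y. h (s, y)))"
        using r by (simp add: triangle_kernel_integral k_def)
    qed
    also have "\<dots> = a t * (r * (LBINT s. LBINT y. h (s, y)))" by simp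
    also have "(LBINT s. LBINT y. h (s, y)) = (LBINT y. LBINT s. h (s, y))"
      using integral_pair[OF hi] by simp
    also have "\<dots> = (LBINT y. indicator {t - 1/r<..<t} y * B y)"
      by (simp add: h_def B_def)
    finally show ?thesis
      by (subst integral_mult_right_zero) (simp only: mult.left_commute[of "a t"])
  qed
  define h where "h = (\<lambda>(t, y). a t * (indicator {t - 1/r<..<t} y * B y))"
  have Bb: "\<bar>B y\<bar> \<le> M * R" if "R \<ge> 0" for y
  proof -
    have "norm (B y) \<le> (LBINT s. M * indicator {0<..<R} s)"
      unfolding B_def
    proof (rule Bochner_Integration.integral_norm_bound_integral)
      show *: "integrable lborel (\<lambda>s. M * indicator {0<..<R} s :: real)"
        using emeasure_bounded_finite[of "{0<..<R}"] by (intro integrable_mult_right integrable_real_indicator) auto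
      have **: "norm (indicator {s - 1/r<..<s} y * a s) \<le> M * indicator {0<..<R} s" for s
        using M[of s] by (auto simp: indicator_def)
      then show "norm (indicator {s - 1/r<..<s} y * a s) \<le> M * indicator {0<..<R} s" for s .
      have m: "(\<lambda>s. indicator {s - 1/r<..<s} y * a s) \<in> borel_measurable lborel"
      proof -
        have "(\<lambda>s. indicator {s - 1/r<..<s} y * a s) = (\<lambda>s. if s - 1/r < y \<and> y < s then a s else 0)"
          by (auto simp: fun_eq_iff)
        then show ?thesis by simp
      qed
      show "integrable lborel (\<lambda>s. indicator {s - 1/r<..<s} y * a s)"
        using * m by (rule Bochner_Integration.integrable_bound) (intro AE_I2 order_trans[OF **], simp)
    qed
    also have "\<dots> = M * R" using that by simp
    finally show ?thesis by simp
  qed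
  have [measurable]: "h \<in> borel_measurable borel"
  proof -
    have "h = (\<lambda>(t, y). if t - 1/r < y \<and> y < t then a t * B y else 0)"
      by (auto simp: fun_eq_iff h_def)
    then show ?thesis by (simp add: case_prod_beta' borel_prod[symmetric])
  qed
  have hi: "integrable lborel h"
  proof (rule integrable_box)
    show "\<bar>h (t, y)\<bar> \<le> M * (M * R) * (indicator {0<..<R} t * indicator {- 1/r<..<R} y)" for t y
    proof (cases "0 < t \<and> t < R")
      case True
      then have "\<bar>a t * B y\<bar> \<le> M * (M * R)"
        using M[of t] Bb[of y] by (auto simp: abs_mult intro!: mult_mono)
      moreover have "0 \<le> M * (M * R)" using True M0 M[of t] by auto
      ultimately show ?thesis using True by (auto simp: h_def indicator_def)
    next
      case False
      then show ?thesis using M[of t] by (auto simp: h_def indicator_def)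
    qed
  qed auto
  have "integral\<^sup>L lborel k = r * (LBINT t. LBINT y. h (t, y))"
    unfolding integral_pair(1)[OF ki, symmetric] inner by (simp add: h_def)
  also have "(LBINT t. LBINT y. h (t, y)) = (LBINT y. LBINT t. h (t, y))"
    using integral_pair[OF hi] by simp
  also have "\<dots> = (LBINT y. B y * B y)"
    by (intro Bochner_Integration.integral_cong[OF refl])
       (simp add: h_def B_def mult_ac flip: integral_mult_right_zero)
  finally have full: "integral\<^sup>L lborel k \<ge> 0" using r by simp
  \<comment> \<open>By symmetry of the kernel half of the integral comes from \<open>s < t\<close>.\<close>
  define lo where "lo = (\<lambda>(t, s). indicator {0<..<t} s * k (t, s))"
  have [measurable]: "lo \<in> borel_measurable borel"
  proof -
    have "lo = (\<lambda>(t, s). if 0 < s \<and> s < t then k (t, s) else 0)" by (auto simp: fun_eq_iff lo_def)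
    then show ?thesis by (simp add: case_prod_beta' borel_prod[symmetric])
  qed
  have loi: "integrable lborel lo"
  proof (rule integrable_box)
    show "\<bar>lo (t, s)\<bar> \<le> M * M * (indicator {0<..<R} t * indicator {0<..<R} s)" for t s
      using kb[of t s] by (auto simp: lo_def indicator_def)
  qed auto
  have dec: "(LBINT s. k (t, s)) = (LBINT s. lo (t, s)) + (LBINT s. lo (s, t))" for t
  proof -
    have m: "(\<lambda>s. lo (t, s)) \<in> borel_measurable borel" "(\<lambda>s. lo (s, t)) \<in> borel_measurable borel"
      by (auto intro: measurable_compose[OF _ \<open>lo \<in> borel_measurable borel\<close>])
    have "integrable lborel (\<lambda>s. lo (t, s))" "integrable lborel (\<lambda>s. lo (s, t))"
    proof -
      have i: "integrable lborel (\<lambda>s. M * M * indicator {0<..<R} s :: real)"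
        using emeasure_bounded_finite[of "{0<..<R}"] by (intro integrable_mult_right integrable_real_indicator) auto
      have "norm (lo (t, s)) \<le> norm (M * M * indicator {0<..<R} s)"
        "norm (lo (s, t)) \<le> norm (M * M * indicator {0<..<R} s)" for s
      proof -
        have 1: "M * M * (indicator {0<..<R} t * indicator {0<..<R} s) \<le> M * M * indicator {0<..<R} s"
          by (intro mult_left_mono zero_le_square) (auto simp: indicator_def)
        have 2: "\<bar>lo x\<bar> \<le> \<bar>k x\<bar>" for x by (cases x) (auto simp: lo_def indicator_def)
        have 3: "norm (M * M * indicator {0<..<R} s) = M * M * indicator {0<..<R} s" by (simp add: abs_mult)
        show "norm (lo (t, s)) \<le> norm (M * M * indicator {0<..<R} s)"
          unfolding 3 real_norm_def using 1 2[of "(t, s)"] kb[of t s] by linarith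
        show "norm (lo (s, t)) \<le> norm (M * M * indicator {0<..<R} s)"
          unfolding 3 real_norm_def using 1 2[of "(s, t)"] kb[of s t] by (simp add: mult.commute mult.left_commute)
      qed
      then show "integrable lborel (\<lambda>s. lo (t, s))" "integrable lborel (\<lambda>s. lo (s, t))"
        using m by (auto intro!: Bochner_Integration.integrable_bound[OF i] AE_I2)
    qed
    then have "(LBINT s. lo (t, s)) + (LBINT s. lo (s, t)) = (LBINT s. lo (t, s) + lo (s, t))"
      by (rule Bochner_Integration.integral_add[symmetric])
    also have "\<dots> = (LBINT s. k (t, s))"
    proof (rule integral_cong_AE)
      show "AE s in lborel. lo (t, s) + lo (s, t) = k (t, s)"
        using AE_lborel_singleton[of t]
      proof eventually_elim
        case (elim s)
        show ?case
        proof (cases "s \<in> {0<..<R} \<and> t \<in> {0<..<R}")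
          case True
          then show ?thesis using elim
            by (cases "s < t") (auto simp: lo_def k_def abs_minus_commute mult.commute)
        next
          case False
          then have "a s = 0 \<or> a t = 0" using M[of s] M[of t] by auto
          then show ?thesis by (auto simp: lo_def k_def)
        qed
      qed
    qed (use m in auto)
    finally show ?thesis by simp
  qed
  have "integral\<^sup>L lborel k = (LBINT t. (LBINT s. lo (t, s)) + (LBINT s. lo (s, t)))"
    unfolding integral_pair(1)[OF ki, symmetric] dec ..
  also have "\<dots> = (LBINT t. LBINT s. lo (t, s)) + (LBINT t. LBINT s. lo (s, t))"
    using lborel_pair.integrable_fst'[of lo] lborel_pair.integrable_snd[of "\<lambda>x y. lo (x, y)"] loi
    by (intro Bochner_Integration.integral_add) (auto simp: lborel_prod)
  also have "\<dots> = 2 * integral\<^sup>L lborel lo"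
    using integral_pair[OF loi] by simp
  finally have "0 \<le> integral\<^sup>L lborel lo" using full by simp
  then show ?thesis by (simp add: lo_def k_def case_prod_beta' mult_ac)
qed

text \<open>For \<open>h = cos\<close> and \<open>h = sin\<close> these numbers are the real and the imaginary part of the factor by which a
  superposition of truncated oscillations differs from the kernel of fractional integration; see
  \<open>scaled_kernel\<close>.\<close>

definition tri_moment :: "real \<Rightarrow> (real \<Rightarrow> real) \<Rightarrow> real" where
  "tri_moment \<kappa> h = (LBINT x. indicator {0<..<1} x * (x powr (- \<kappa>) * (1 - x) * h x))"

lemma tri_moment_integrable:
  assumes \<kappa>: "\<kappa> < 1" and [measurable]: "h \<in> borel_measurable borel" and h: "\<And>x. \<bar>h x\<bar> \<le> 1"
  shows "integrable lborel (\<lambda>x. indicator {0<..<1} x * (x powr (- \<kappa>) * (1 - x) * h x) :: real)"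
proof (rule Bochner_Integration.integrable_bound)
  show "integrable lborel (\<lambda>x. indicator {0<..<1} x * ((1 - x) powr (2 - 1) * (x - 0) powr ((1 - \<kappa>) - 1)) :: real)"
    using beta_kernel[of 2 "1 - \<kappa>" 0 1] \<kappa> by (auto simp: has_bochner_integral_iff)
  show "AE x in lborel. norm (indicator {0<..<1} x * (x powr (- \<kappa>) * (1 - x) * h x))
     \<le> norm (indicator {0<..<1} x * ((1 - x) powr (2 - 1) * (x - 0) powr ((1 - \<kappa>) - 1)) :: real)"
  proof (rule AE_I2)
    fix x :: real
    show "norm (indicator {0<..<1} x * (x powr (- \<kappa>) * (1 - x) * h x))
     \<le> norm (indicator {0<..<1} x * ((1 - x) powr (2 - 1) * (x - 0) powr ((1 - \<kappa>) - 1)) :: real)"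
      using h[of x] mult_left_mono[OF h[of x], of "x powr (- \<kappa>) * (1 - x)"]
      by (auto simp: indicator_def abs_mult mult_ac)
  qed
qed auto

text \<open>The interval \<open>(0,1)\<close> lies within the first half period of the sine, so the integrand is positive. For \<open>\<kappa> = \<alpha>/2\<close> the
  condition \<open>\<kappa> < 1\<close> is \<open>\<alpha> < 2\<close>.\<close>

lemma tri_moment_sin_pos:
  assumes \<kappa>: "\<kappa> < 1"
  shows "tri_moment \<kappa> sin > 0"
proof -
  let ?f = "\<lambda>x::real. indicator {0<..<1} x * (x powr (- \<kappa>) * (1 - x) * sin x)"
  have int: "integrable lborel ?f" by (rule tri_moment_integrable[OF \<kappa>]) auto
  have pos: "?f x > 0" if "x \<in> {0<..<1}" for x
    using that sin_gt_zero[of x] pi_gt3 by (simp add: indicator_def)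
  have nn: "?f x \<ge> 0" for x using pos[of x] by (cases "x \<in> {0<..<1}") auto
  have "tri_moment \<kappa> sin \<noteq> 0"
  proof
    assume "tri_moment \<kappa> sin = 0"
    then have "AE x in lborel. ?f x = 0"
      using integral_nonneg_eq_0_iff_AE[OF int] nn by (simp add: tri_moment_def)
    then have "AE x in lborel. x \<notin> {0<..<1::real}"
    proof eventually_elim
      case (elim x)
      then show ?case using pos[of x] by force
    qed
    then have "emeasure lborel {0<..<1::real} = 0"
      by (subst (asm) AE_iff_measurable[of "{0<..<1}"]) auto
    then show False by simp
  qed
  moreover have "tri_moment \<kappa> sin \<ge> 0" unfolding tri_moment_def using nn by (intro Bochner_Integration.integral_nonneg) auto
  ultimately show ?thesis by simp
qed

text \<open>The substitution \<open>x = r \<tau>\<close> turns the scale invariant weight \<open>r\<^bsup>-\<kappa>\<^esup> dr\<close> into the homogeneous kernel \<open>\<tau>\<^bsup>\<kappa>-1\<^esup>\<close>.\<close>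

lemma scaled_kernel:
  assumes \<kappa>: "\<kappa> < 1" and m: "h \<in> borel_measurable borel" and h: "\<And>x. \<bar>h x\<bar> \<le> 1"
    and \<tau>: "\<tau> > 0"
  shows "has_bochner_integral lborel
    (\<lambda>r. indicator {0<..} r * (r powr (- \<kappa>) * max 0 (1 - r * \<tau>) * h (r * \<tau>))) (\<tau> powr (\<kappa> - 1) * tri_moment \<kappa> h)"
proof -
  let ?f = "\<lambda>x::real. indicator {0<..<1} x * (x powr (- \<kappa>) * (1 - x) * h x)"
  have "has_bochner_integral lborel ?f (tri_moment \<kappa> h)"
    using tri_moment_integrable[OF \<kappa> m h] by (simp add: tri_moment_def has_bochner_integral_iff)
  then have "has_bochner_integral lborel (\<lambda>r. ?f (0 + \<tau> * r)) (tri_moment \<kappa> h /\<^sub>R \<bar>\<tau>\<bar>)"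
    by (subst (asm) lborel_has_bochner_integral_real_affine_iff[of \<tau> _ _ 0]) (use \<tau> in auto)
  then have "has_bochner_integral lborel (\<lambda>r. \<tau> powr \<kappa> * ?f (0 + \<tau> * r)) (\<tau> powr \<kappa> * (tri_moment \<kappa> h /\<^sub>R \<bar>\<tau>\<bar>))"
    by (rule has_bochner_integral_mult_right)
  moreover have "\<tau> powr \<kappa> * (tri_moment \<kappa> h /\<^sub>R \<bar>\<tau>\<bar>) = \<tau> powr (\<kappa> - 1) * tri_moment \<kappa> h"
    using \<tau> by (simp add: powr_diff divide_inverse)
  moreover have "(\<lambda>r. \<tau> powr \<kappa> * ?f (0 + \<tau> * r))
     = (\<lambda>r. indicator {0<..} r * (r powr (- \<kappa>) * max 0 (1 - r * \<tau>) * h (r * \<tau>)))"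
  proof
    fix r
    show "\<tau> powr \<kappa> * ?f (0 + \<tau> * r)
     = indicator {0<..} r * (r powr (- \<kappa>) * max 0 (1 - r * \<tau>) * h (r * \<tau>))"
    proof (cases "0 < r \<and> r * \<tau> < 1")
      case True
      then have "\<tau> powr \<kappa> * (\<tau> * r) powr (- \<kappa>) = r powr (- \<kappa>)"
        using \<tau> by (simp add: powr_mult powr_minus field_simps)
      then show ?thesis using True \<tau> by (simp add: mult_ac)
    next
      case False
      then show ?thesis using \<tau> by (auto simp: indicator_def mult_ac zero_less_mult_iff max_def)
    qed
  qed
  ultimately show ?thesis by (simp only:)
qed

text \<open>Integrability of the weakly singular kernel over the triangle \<open>0 < s < t < R\<close>, needed for Fubini's
  theorem below.\<close>

lemma weak_kernel_integrable:
  fixes R :: real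
  assumes \<kappa>: "0 < \<kappa>" and [measurable]: "g \<in> borel_measurable borel"
    and g: "\<And>t s. \<bar>g (t, s)\<bar> \<le> C * indicator {0<..<R} t"
  shows "integrable lborel (\<lambda>(t, s). indicator {0<..<t} s * (t - s) powr (\<kappa> - 1) * g (t, s))"
proof (rule Bochner_Integration.integrable_bound)
  define H where "H = (\<lambda>(t, s). indicator {0<..<R} t * (indicator {0<..<t} s * (t - s) powr (\<kappa> - 1)))"
  have [measurable]: "H \<in> borel_measurable borel"
  proof -
    have "H = (\<lambda>(t, s). if 0 < t \<and> t < R \<and> 0 < s \<and> s < t then (t - s) powr (\<kappa> - 1) else 0)"
      by (auto simp: H_def fun_eq_iff)
    then show ?thesis by (simp add: case_prod_beta' borel_prod[symmetric])
  qed
  have pk: "has_bochner_integral lborel (\<lambda>s. norm (H (t, s))) (indicator {0<..<R} t * (t powr \<kappa> / \<kappa>))" for t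
  proof (cases "t > 0")
    case True
    then have "has_bochner_integral lborel (\<lambda>s. indicator {0<..<R} t * (indicator {0<..<t} s * (t - s) powr (\<kappa> - 1)))
       (indicator {0<..<R} t * ((t - 0) powr \<kappa> / \<kappa>))"
      by (intro has_bochner_integral_mult_right power_kernel \<kappa>) simp
    then show ?thesis by (simp add: H_def abs_mult)
  next
    case False
    then show ?thesis using has_bochner_integral_zero[of lborel] by (auto simp: H_def)
  qed
  have "integrable (lborel \<Otimes>\<^sub>M lborel) H"
  proof (rule lborel_pair.Fubini_integrable)
    have "(\<lambda>t. LBINT s. norm (H (t, s))) = (\<lambda>t. indicator {0<..<R} t * (t powr \<kappa> / \<kappa>))"
      using pk by (auto simp: has_bochner_integral_iff)
    moreover have "integrable lborel (\<lambda>t. indicator {0<..<R} t * (t powr \<kappa> / \<kappa>))"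
      using \<kappa> by (intro integrable_bdd_borel bdd_borelI[where M="R powr \<kappa> / \<kappa>"])
         (auto intro!: divide_right_mono powr_mono2)
    ultimately show "integrable lborel (\<lambda>t. LBINT s. norm (H (t, s)))" by simp
    show "AE t in lborel. integrable lborel (\<lambda>s. H (t, s))"
    proof (rule AE_I2)
      fix t
      have "(\<lambda>s. norm (H (t, s))) = (\<lambda>s. H (t, s))" by (auto simp: H_def abs_mult)
      then show "integrable lborel (\<lambda>s. H (t, s))" using pk[of t] by (simp add: has_bochner_integral_iff)
    qed
  qed (simp add: lborel_prod)
  then show "integrable lborel (\<lambda>z. C * H z)" by (simp add: lborel_prod)
  show "AE z in lborel. norm (case z of (t, s) \<Rightarrow> indicator {0<..<t} s * (t - s) powr (\<kappa> - 1) * g (t, s)) \<le> norm (C * H z)"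
  proof (rule AE_I2)
    fix z :: "real \<times> real"
    obtain t s where z: "z = (t, s)" by (cases z)
    have "\<bar>g (t, s)\<bar> \<le> \<bar>C\<bar> * indicator {0<..<R} t"
      using g[of t s] by (auto simp: indicator_def split: if_splits)
    then show "norm (case z of (t, s) \<Rightarrow> indicator {0<..<t} s * (t - s) powr (\<kappa> - 1) * g (t, s)) \<le> norm (C * H z)"
      unfolding z by (auto simp: H_def abs_mult indicator_def mult_ac intro!: mult_left_mono)
  qed
  have "(\<lambda>(t, s). indicator {0<..<t} s * (t - s) powr (\<kappa> - 1) * g (t, s))
      = (\<lambda>z. if 0 < snd z \<and> snd z < fst z then (fst z - snd z) powr (\<kappa> - 1) * g z else 0)"
    by (auto simp: fun_eq_iff)
  moreover have "(\<lambda>z. if 0 < snd z \<and> snd z < fst z then (fst z - snd z) powr (\<kappa> - 1) * g z else 0) \<in> borel_measurable (borel \<Otimes>\<^sub>M borel)"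
    using assms(2) by (simp add: borel_prod[symmetric])
  ultimately show "(\<lambda>(t, s). indicator {0<..<t} s * (t - s) powr (\<kappa> - 1) * g (t, s)) \<in> borel_measurable lborel"
    by (simp add: borel_prod)
qed

lemma abs_prod_bound:
  fixes x y :: "real \<Rightarrow> real"
  assumes "\<And>t. \<bar>x t\<bar> \<le> M * indicator {0<..<R} t" "\<And>t. \<bar>y t\<bar> \<le> M * indicator {0<..<R} t"
  shows "\<bar>x t * y s\<bar> \<le> M * M * indicator {0<..<R} t"
proof -
  have "\<bar>x t * y s\<bar> \<le> (M * indicator {0<..<R} t) * (M * indicator {0<..<R} s)"
    unfolding abs_mult using assms(1)[of t] assms(2)[of s] by (intro mult_mono) auto
  also have "\<dots> \<le> M * M * indicator {0<..<R} t"
    by (auto simp: indicator_def)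
  finally show ?thesis .
qed

text \<open>For each \<open>r > 0\<close> the kernel \<open>max 0 (1 - r\<bar>t - s\<bar>) exp(-i r (t - s))\<close> is of positive type, as the product of the
  triangle with a character. Integration against \<open>r\<^bsup>-\<kappa>\<^esup> dr\<close> gives, by \<open>scaled_kernel\<close>, the kernel \<open>(t - s)\<^bsup>\<kappa>-1\<^esup>\<close> with a
  complex factor. The claim is the positivity of its quadratic form on the complex function
  \<open>W + i U\<close>, written out in real terms.\<close>

lemma sectorial_positivity_double:
  assumes \<kappa>0: "0 < \<kappa>" and \<kappa>: "\<kappa> < 1"
    and [measurable]: "W \<in> borel_measurable borel" "U \<in> borel_measurable borel"
    and W: "\<And>t. \<bar>W t\<bar> \<le> M * indicator {0<..<R} t" and U: "\<And>t. \<bar>U t\<bar> \<le> M * indicator {0<..<R} t"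
  shows "0 \<le> (\<integral>(t, s). indicator {0<..<t} s * (t - s) powr (\<kappa> - 1) *
     (tri_moment \<kappa> cos * (W t * W s + U t * U s) - tri_moment \<kappa> sin * (W t * U s - U t * W s)) \<partial>lborel)"
proof -
  define p where "p = (\<lambda>(t, s). W t * W s + U t * U s)"
  define p' where "p' = (\<lambda>(t, s). W t * U s - U t * W s)"
  have [measurable]: "p \<in> borel_measurable (borel \<Otimes>\<^sub>M borel)" "p' \<in> borel_measurable (borel \<Otimes>\<^sub>M borel)"
    by (simp_all add: p_def p'_def case_prod_beta')
  define G where "G = (\<lambda>((t, s), r). indicator {0<..<t} s * (indicator {0<..} r *
     (r powr (- \<kappa>) * max 0 (1 - r * (t - s)) * (cos (r * (t - s)) * p (t, s) - sin (r * (t - s)) * p' (t, s)))))"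
  define G' where "G' = (\<lambda>((t, s), r). indicator {0<..<R} t * (indicator {0<..<t} s * (indicator {0<..} r *
     (r powr (- \<kappa>) * max 0 (1 - r * (t - s)) * 1))))"
  have mG [measurable]: "G \<in> borel_measurable ((borel \<Otimes>\<^sub>M borel) \<Otimes>\<^sub>M borel)"
  proof -
    have "G = (\<lambda>((t, s), r). if 0 < s \<and> s < t \<and> 0 < r then r powr (- \<kappa>) * max 0 (1 - r * (t - s)) * (cos (r * (t - s)) * p (t, s) - sin (r * (t - s)) * p' (t, s)) else 0)"
      by (auto simp: G_def fun_eq_iff)
    then show ?thesis by (simp add: case_prod_beta')
  qed
  have mG' [measurable]: "G' \<in> borel_measurable ((borel \<Otimes>\<^sub>M borel) \<Otimes>\<^sub>M borel)"
  proof -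
    have "G' = (\<lambda>((t, s), r). if 0 < t \<and> t < R \<and> 0 < s \<and> s < t \<and> 0 < r then r powr (- \<kappa>) * max 0 (1 - r * (t - s)) else 0)"
      by (auto simp: G'_def fun_eq_iff)
    then show ?thesis by (simp add: case_prod_beta')
  qed
  have pb: "\<bar>p (t, s)\<bar> \<le> 2 * (M * M) * indicator {0<..<R} t" "\<bar>p' (t, s)\<bar> \<le> 2 * (M * M) * indicator {0<..<R} t" for t s
    using abs_prod_bound[OF W W, of t s] abs_prod_bound[OF U U, of t s] abs_prod_bound[OF W U, of t s] abs_prod_bound[OF U W, of t s]
    by (auto simp: p_def p'_def abs_le_iff algebra_simps)
  have hbG': "has_bochner_integral lborel (\<lambda>r. norm (G' ((t, s), r)))
     (indicator {0<..<R} t * (indicator {0<..<t} s * ((t - s) powr (\<kappa> - 1) * tri_moment \<kappa> (\<lambda>x. 1))))" for t s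
  proof (cases "0 < s \<and> s < t")
    case True
    then have "(\<lambda>r. norm (G' ((t, s), r))) = (\<lambda>r. indicator {0<..<R} t * (indicator {0<..} r * (r powr (- \<kappa>) * max 0 (1 - r * (t - s)) * 1)))"
      by (auto simp: G'_def fun_eq_iff abs_mult)
    then show ?thesis using True scaled_kernel[OF \<kappa>, of "\<lambda>_. 1" "t - s"]
      by (auto intro!: has_bochner_integral_mult_right)
  next
    case False
    then show ?thesis using has_bochner_integral_zero[of lborel] by (auto simp: G'_def)
  qed
  have Gi': "integrable (lborel \<Otimes>\<^sub>M lborel) G'"
  proof (rule lborel_pair.Fubini_integrable)
    show "G' \<in> borel_measurable (lborel \<Otimes>\<^sub>M lborel)"
      using mG' by (simp add: borel_prod lborel_prod)
    have "(\<lambda>x. LBINT y. norm (G' (x, y)))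
      = (\<lambda>(t, s). indicator {0<..<t} s * (t - s) powr (\<kappa> - 1) * (\<lambda>(t, s). indicator {0<..<R} t * tri_moment \<kappa> (\<lambda>x. 1)) (t, s))"
      using hbG' by (auto simp: has_bochner_integral_iff fun_eq_iff mult_ac)
    moreover have "integrable lborel (\<lambda>(t, s). indicator {0<..<t} s * (t - s) powr (\<kappa> - 1) * (\<lambda>(t, s). indicator {0<..<R} t * tri_moment \<kappa> (\<lambda>x. 1)) (t, s))"
      by (rule weak_kernel_integrable[OF \<kappa>0, where C="\<bar>tri_moment \<kappa> (\<lambda>x. 1)\<bar>" and R=R])
         (auto simp: case_prod_beta' abs_mult borel_prod[symmetric] indicator_def)
    ultimately show "integrable lborel (\<lambda>x. LBINT y. norm (G' (x, y)))" by simp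
    show "AE x in lborel. integrable lborel (\<lambda>y. G' (x, y))"
    proof (rule AE_I2)
      fix x :: "real \<times> real"
      obtain t s where x: "x = (t, s)" by (cases x)
      have "(\<lambda>r. norm (G' ((t, s), r))) = (\<lambda>r. G' ((t, s), r))" by (auto simp: G'_def abs_mult fun_eq_iff)
      then show "integrable lborel (\<lambda>y. G' (x, y))" using hbG'[of t s] by (simp add: x has_bochner_integral_iff)
    qed
  qed
  have Gi: "integrable (lborel \<Otimes>\<^sub>M lborel) G"
  proof (rule Bochner_Integration.integrable_bound)
    show "integrable (lborel \<Otimes>\<^sub>M lborel) (\<lambda>z. (4 * (M * M)) * G' z)" using Gi' by simp
    show "G \<in> borel_measurable (lborel \<Otimes>\<^sub>M lborel)"
      using mG by (simp add: borel_prod lborel_prod)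
    show "AE z in lborel \<Otimes>\<^sub>M lborel. norm (G z) \<le> norm ((4 * (M * M)) * G' z)"
    proof (rule AE_I2)
      fix z :: "(real \<times> real) \<times> real"
      obtain t s r where z: "z = ((t, s), r)" by (metis prod.exhaust)
      have "\<bar>cos (r * (t - s)) * p (t, s) - sin (r * (t - s)) * p' (t, s)\<bar>
         \<le> \<bar>cos (r * (t - s))\<bar> * \<bar>p (t, s)\<bar> + \<bar>sin (r * (t - s))\<bar> * \<bar>p' (t, s)\<bar>"
        by (metis abs_mult abs_triangle_ineq4)
      also have "\<dots> \<le> 1 * (2 * (M * M) * indicator {0<..<R} t) + 1 * (2 * (M * M) * indicator {0<..<R} t)"
        by (intro add_mono mult_mono pb) auto
      finally have q: "\<bar>cos (r * (t - s)) * p (t, s) - sin (r * (t - s)) * p' (t, s)\<bar> \<le> 4 * (M * M) * indicator {0<..<R} t"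
        by simp
      define w where "w = indicator {0<..<t} s * (indicator {0<..} r * (r powr (- \<kappa>) * max 0 (1 - r * (t - s))))"
      have w: "w \<ge> 0" by (simp add: w_def)
      have "norm (G z) = w * \<bar>cos (r * (t - s)) * p (t, s) - sin (r * (t - s)) * p' (t, s)\<bar>"
        by (simp add: z G_def w_def abs_mult)
      also have "\<dots> \<le> w * (4 * (M * M) * indicator {0<..<R} t)" by (rule mult_left_mono[OF q w])
      also have "\<dots> = 4 * (M * M) * G' z" by (simp add: z G'_def w_def)
      finally show "norm (G z) \<le> norm ((4 * (M * M)) * G' z)" by simp
    qed
  qed
  \<comment> \<open>For fixed \<open>r\<close> the addition theorems split the form into the triangle form of the real part \<open>a\<close> and of the
    imaginary part \<open>b\<close> of \<open>exp(-i r t) (W + i U)\<close>.\<close>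
  have pos: "0 \<le> (LBINT x. G (x, r))" for r
  proof (cases "r > 0")
    case False
    then show ?thesis by (simp add: G_def case_prod_beta')
  next
    case r: True
    define a where "a t = W t * cos (r * t) + U t * sin (r * t)" for t
    define b where "b t = U t * cos (r * t) - W t * sin (r * t)" for t
    have [measurable]: "a \<in> borel_measurable borel" "b \<in> borel_measurable borel"
      unfolding a_def b_def by auto
    have bnd: "\<bar>x * cos y + x' * sin y\<bar> \<le> 2 * M * indicator {0<..<R} t" "\<bar>x * cos y - x' * sin y\<bar> \<le> 2 * M * indicator {0<..<R} t"
      if "\<bar>x\<bar> \<le> M * indicator {0<..<R} t" "\<bar>x'\<bar> \<le> M * indicator {0<..<R} t" for x x' y t
    proof -
      have "\<bar>x * cos y\<bar> \<le> (M * indicator {0<..<R} t) * 1" "\<bar>x' * sin y\<bar> \<le> (M * indicator {0<..<R} t) * 1"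
        unfolding abs_mult using that by (intro mult_mono; auto)+
      then show "\<bar>x * cos y + x' * sin y\<bar> \<le> 2 * M * indicator {0<..<R} t" "\<bar>x * cos y - x' * sin y\<bar> \<le> 2 * M * indicator {0<..<R} t"
        by linarith+
    qed
    have ab: "\<bar>a t\<bar> \<le> 2 * M * indicator {0<..<R} t" "\<bar>b t\<bar> \<le> 2 * M * indicator {0<..<R} t" for t
      unfolding a_def b_def by (intro bnd W U)+
    let ?k = "\<lambda>c. (\<lambda>(t, s). indicator {0<..<t} s * max 0 (1 - r * \<bar>t - s\<bar>) * (c t * c s))"
    have ki: "integrable lborel (?k c)" if [measurable]: "c \<in> borel_measurable borel" and c: "\<And>t. \<bar>c t\<bar> \<le> 2 * M * indicator {0<..<R} t" for c
    proof (rule integrable_box)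
      have "?k c = (\<lambda>(t, s). if 0 < s \<and> s < t then max 0 (1 - r * \<bar>t - s\<bar>) * (c t * c s) else 0)"
        by (auto simp: fun_eq_iff)
      then show "?k c \<in> borel_measurable borel" by (simp add: case_prod_beta' borel_prod[symmetric])
      show "\<bar>?k c (t, s)\<bar> \<le> (2 * M) * (2 * M) * (indicator {0<..<R} t * indicator {0<..<R} s)" for t s
      proof -
        have cc: "\<bar>c t * c s\<bar> \<le> (2 * M) * (2 * M) * (indicator {0<..<R} t * indicator {0<..<R} s)"
          using mult_mono[OF c[of t] c[of s]] c[of t] by (simp add: abs_mult mult_ac)
        have "\<bar>?k c (t, s)\<bar> \<le> 1 * \<bar>c t * c s\<bar>"
          using r by (simp only: prod.case abs_mult[of "_ * _" "c t * c s"]) (intro mult_right_mono, auto simp: indicator_def)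
        then show ?thesis using cc by simp
      qed
    qed
    have "(LBINT x. G (x, r)) = (LBINT x. r powr (- \<kappa>) * (?k a x + ?k b x))"
    proof (rule Bochner_Integration.integral_cong[OF refl])
      fix x :: "real \<times> real"
      obtain t s where x: "x = (t, s)" by (cases x)
      have "cos (r * (t - s)) * p (t, s) - sin (r * (t - s)) * p' (t, s) = a t * a s + b t * b s"
        by (simp add: a_def b_def p_def p'_def right_diff_distrib cos_diff sin_diff algebra_simps)
      then have "G (x, r) = indicator {0<..<t} s * (r powr (- \<kappa>) * (max 0 (1 - r * (t - s)) * (a t * a s + b t * b s)))"
        using r by (simp add: x G_def)
      also have "\<dots> = r powr (- \<kappa>) * (?k a x + ?k b x)"
        unfolding x prod.case by (cases "0 < s \<and> s < t") (simp_all add: distrib_left distrib_right)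
      finally show "G (x, r) = r powr (- \<kappa>) * (?k a x + ?k b x)" .
    qed
    also have "\<dots> = r powr (- \<kappa>) * (integral\<^sup>L lborel (?k a) + integral\<^sup>L lborel (?k b))"
      using ki[of a] ki[of b] ab by (subst integral_mult_right_zero) (subst Bochner_Integration.integral_add, auto)
    also have "\<dots> \<ge> 0"
      using triangle_kernel_nonneg[OF r _ ab(1)] triangle_kernel_nonneg[OF r _ ab(2)]
      by (intro mult_nonneg_nonneg add_nonneg_nonneg) auto
    finally show ?thesis .
  qed
  have "0 \<le> (LBINT r. LBINT x. G (x, r))" by (rule Bochner_Integration.integral_nonneg[OF pos])
  also have "\<dots> = (LBINT x. LBINT r. G (x, r))"
    using lborel_pair.Fubini_integral[of "\<lambda>x r. G (x, r)"] Gi by simp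
  also have "\<dots> = (\<integral>(t, s). indicator {0<..<t} s * (t - s) powr (\<kappa> - 1) *
     (tri_moment \<kappa> cos * (W t * W s + U t * U s) - tri_moment \<kappa> sin * (W t * U s - U t * W s)) \<partial>lborel)"
  proof (rule Bochner_Integration.integral_cong[OF refl])
    fix x :: "real \<times> real"
    obtain t s where x: "x = (t, s)" by (cases x)
    show "(LBINT r. G (x, r)) = (case x of (t, s) \<Rightarrow> indicator {0<..<t} s * (t - s) powr (\<kappa> - 1) *
     (tri_moment \<kappa> cos * (W t * W s + U t * U s) - tri_moment \<kappa> sin * (W t * U s - U t * W s)))"
    proof (cases "0 < s \<and> s < t")
      case False
      then show ?thesis by (auto simp: x G_def)
    next
      case True
      have sc: "has_bochner_integral lborel
         (\<lambda>r. p (t, s) * (indicator {0<..} r * (r powr (- \<kappa>) * max 0 (1 - r * (t - s)) * cos (r * (t - s))))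
           - p' (t, s) * (indicator {0<..} r * (r powr (- \<kappa>) * max 0 (1 - r * (t - s)) * sin (r * (t - s)))))
         (p (t, s) * ((t - s) powr (\<kappa> - 1) * tri_moment \<kappa> cos) - p' (t, s) * ((t - s) powr (\<kappa> - 1) * tri_moment \<kappa> sin))"
        using True
        by (intro has_bochner_integral_diff has_bochner_integral_mult_right scaled_kernel[OF \<kappa>]) auto
      have "(\<lambda>r. G (x, r)) = (\<lambda>r. p (t, s) * (indicator {0<..} r * (r powr (- \<kappa>) * max 0 (1 - r * (t - s)) * cos (r * (t - s))))
           - p' (t, s) * (indicator {0<..} r * (r powr (- \<kappa>) * max 0 (1 - r * (t - s)) * sin (r * (t - s)))))"
        using True by (simp add: x G_def fun_eq_iff algebra_simps)
      then show ?thesis using sc True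
        by (simp add: has_bochner_integral_iff x p_def p'_def algebra_simps)
    qed
  qed
  finally show ?thesis .
qed

text \<open>Fubini's theorem identifies the double integrals of the preceding lemma with pairings in \<open>L\<^sup>2\<close>.\<close>

lemma RL_pairing:
  assumes \<kappa>: "0 < \<kappa>" and [measurable]: "W \<in> borel_measurable borel" "U \<in> borel_measurable borel"
    and W: "\<And>t. \<bar>W t\<bar> \<le> M * indicator {0<..<R} t" and U: "\<And>t. \<bar>U t\<bar> \<le> M * indicator {0<..<R} t"
  shows "integrable lborel (\<lambda>(t, s). indicator {0<..<t} s * (t - s) powr (\<kappa> - 1) * (W t * U s))"
    and "(\<integral>(t, s). indicator {0<..<t} s * (t - s) powr (\<kappa> - 1) * (W t * U s) \<partial>lborel)
       = Gamma \<kappa> * (LBINT t. W t * RL \<kappa> U t)"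
proof -
  have "integrable lborel (\<lambda>(t, s). indicator {0<..<t} s * (t - s) powr (\<kappa> - 1) * (\<lambda>(t, s). W t * U s) (t, s))"
  proof (rule weak_kernel_integrable[OF \<kappa>])
    show "(\<lambda>(t, s). W t * U s) \<in> borel_measurable borel" by (simp add: case_prod_beta' borel_prod[symmetric])
    show "\<bar>case (t, s) of (t, s) \<Rightarrow> W t * U s\<bar> \<le> M * M * indicator {0<..<R} t" for t s
      using abs_prod_bound[OF W U, of t s] by simp
  qed
  then show i: "integrable lborel (\<lambda>(t, s). indicator {0<..<t} s * (t - s) powr (\<kappa> - 1) * (W t * U s))"
    by simp
  show "(\<integral>(t, s). indicator {0<..<t} s * (t - s) powr (\<kappa> - 1) * (W t * U s) \<partial>lborel)
       = Gamma \<kappa> * (LBINT t. W t * RL \<kappa> U t)"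
    unfolding integral_pair(1)[OF i, symmetric] integral_mult_right_zero[symmetric]
  proof (intro Bochner_Integration.integral_cong[OF refl])
    fix t
    have "(LBINT s. case (t, s) of (t, s) \<Rightarrow> indicator {0<..<t} s * (t - s) powr (\<kappa> - 1) * (W t * U s))
       = (LBINT s. W t * (indicator {0<..<t} s * ((t - s) powr (\<kappa> - 1) * U s)))"
      by (intro Bochner_Integration.integral_cong[OF refl]) simp
    also have "\<dots> = W t * (Gamma \<kappa> * RL \<kappa> U t)"
      using pos_Gamma_ne[OF \<kappa>] by (simp add: RL_def)
    finally show "(LBINT s. case (t, s) of (t, s) \<Rightarrow> indicator {0<..<t} s * (t - s) powr (\<kappa> - 1) * (W t * U s))
        = Gamma \<kappa> * (W t * RL \<kappa> U t)" by simp
  qed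
qed

text \<open>The two sides are, up to the trigonometric factors, the imaginary and the real part of the pairing of the complex
  function \<open>W + i U\<close> with its fractional integral. Applied to \<open>U\<close> and to \<open>-U\<close>, the estimate confines the
  numerical range of \<open>RL \<kappa>\<close> to a sector strictly inside the right half plane.\<close>

lemma sectorial_positivity:
  assumes \<kappa>0: "0 < \<kappa>" and \<kappa>: "\<kappa> < 1"
    and m: "W \<in> borel_measurable borel" "U \<in> borel_measurable borel"
    and W: "\<And>t. \<bar>W t\<bar> \<le> M * indicator {0<..<R} t" and U: "\<And>t. \<bar>U t\<bar> \<le> M * indicator {0<..<R} t"
  shows "tri_moment \<kappa> sin * ((LBINT t. W t * RL \<kappa> U t) - (LBINT t. U t * RL \<kappa> W t))
     \<le> tri_moment \<kappa> cos * ((LBINT t. W t * RL \<kappa> W t) + (LBINT t. U t * RL \<kappa> U t))"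
proof -
  let ?k = "\<lambda>x y. (\<lambda>(t, s). indicator {0<..<t} s * (t - s) powr (\<kappa> - 1) * (x t * y s))"
  note P = RL_pairing[OF \<kappa>0 m(1) m(1) W W] RL_pairing[OF \<kappa>0 m(2) m(2) U U]
     RL_pairing[OF \<kappa>0 m(1) m(2) W U] RL_pairing[OF \<kappa>0 m(2) m(1) U W]
  have "(\<lambda>(t, s). indicator {0<..<t} s * (t - s) powr (\<kappa> - 1) *
     (tri_moment \<kappa> cos * (W t * W s + U t * U s) - tri_moment \<kappa> sin * (W t * U s - U t * W s)))
    = (\<lambda>z. tri_moment \<kappa> cos * (?k W W z + ?k U U z) - tri_moment \<kappa> sin * (?k W U z - ?k U W z))"
    by (auto simp: fun_eq_iff algebra_simps)
  then have "0 \<le> (\<integral>z. tri_moment \<kappa> cos * (?k W W z + ?k U U z) - tri_moment \<kappa> sin * (?k W U z - ?k U W z) \<partial>lborel)"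
    using sectorial_positivity_double[OF \<kappa>0 \<kappa> m W U] by (simp only:)
  also have "\<dots> = tri_moment \<kappa> cos * (integral\<^sup>L lborel (?k W W) + integral\<^sup>L lborel (?k U U))
      - tri_moment \<kappa> sin * (integral\<^sup>L lborel (?k W U) - integral\<^sup>L lborel (?k U W))"
    by (intro has_bochner_integral_integral_eq has_bochner_integral_diff has_bochner_integral_add
          has_bochner_integral_mult_right has_bochner_integral_integrable P(1,3,5,7))
  also have "\<dots> = Gamma \<kappa> * (tri_moment \<kappa> cos * ((LBINT t. W t * RL \<kappa> W t) + (LBINT t. U t * RL \<kappa> U t))
     - tri_moment \<kappa> sin * ((LBINT t. W t * RL \<kappa> U t) - (LBINT t. U t * RL \<kappa> W t)))"
    unfolding P(2,4,6,8) by (simp add: algebra_simps)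
  finally show ?thesis using Gamma_real_pos[OF \<kappa>0] by (simp add: zero_le_mult_iff)
qed

section \<open>Maximal regularity and the weighted equation\<close>

text \<open>The constant depends on \<open>\<alpha>\<close> only. Its independence of \<open>\<lambda>\<close> allows the estimates for the single modes to be summed.\<close>

definition mreg_const :: "real \<Rightarrow> real" where
  "mreg_const \<alpha> = 1 + (tri_moment (\<alpha>/2) cos)\<^sup>2 / (2 * (tri_moment (\<alpha>/2) sin)\<^sup>2)"

text \<open>Let \<open>N = RL (\<alpha>/2)\<close>, so that \<open>N N = RL \<alpha>\<close>, and put \<open>v = -\<surd>\<lambda> N W\<close>. Then \<open>\<surd>\<lambda> N v = W - Q\<close>. Inserting the pair
  \<open>W, v\<close> into \<open>sectorial_positivity\<close> makes the mixed terms in \<open>W v\<close> cancel. What remains bounds the sum of the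
  squares of \<open>W\<close> and \<open>v\<close> by pairings of \<open>W\<close> and \<open>v\<close> with \<open>Q\<close>, which are absorbed by completing squares.\<close>

lemma maximal_regularity:
  assumes \<alpha>: "0 < \<alpha>" "\<alpha> < 2" and W: "bdd_borel R W" and lam: "lam > 0"
  shows "(LBINT t. indicator {0<..<R} t * (W t)\<^sup>2)
     \<le> mreg_const \<alpha> * (LBINT t. indicator {0<..<R} t * (W t + lam * RL \<alpha> W t)\<^sup>2)"
proof -
  define \<kappa> where "\<kappa> = \<alpha> / 2"
  have \<kappa>: "0 < \<kappa>" "\<kappa> < 1" using \<alpha> by (auto simp: \<kappa>_def)
  define \<mu> where "\<mu> = sqrt lam"
  have \<mu>: "\<mu> > 0" "\<mu> * \<mu> = lam" using lam by (auto simp: \<mu>_def)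
  define v where "v t = - \<mu> * RL \<kappa> W t" for t
  define Q where "Q t = W t + lam * RL \<alpha> W t" for t
  have v: "bdd_borel R v" unfolding v_def using RL_bdd[OF W \<kappa>(1)] by (rule bdd_borel_cmult)
  have Q: "bdd_borel R Q" unfolding Q_def using RL_bdd[OF W \<alpha>(1)] W by (intro bdd_borel_intros)
  define W1 where "W1 t = indicator {0<..<R} t * W t" for t
  define v1 where "v1 t = indicator {0<..<R} t * v t" for t
  note [measurable] = bdd_borel_measurable[OF W] bdd_borel_measurable[OF v]
  have [measurable]: "W1 \<in> borel_measurable borel" "v1 \<in> borel_measurable borel"
    unfolding W1_def v1_def by auto
  obtain M where M: "M > 0" "\<And>t. t \<in> {0..R} \<Longrightarrow> \<bar>W t\<bar> \<le> M" using W by (rule bdd_borelE) blast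
  obtain K where K: "K > 0" "\<And>t. t \<in> {0..R} \<Longrightarrow> \<bar>v t\<bar> \<le> K" using v by (rule bdd_borelE) blast
  have b: "\<bar>W1 t\<bar> \<le> max M K * indicator {0<..<R} t" "\<bar>v1 t\<bar> \<le> max M K * indicator {0<..<R} t" for t
    using M K by (auto simp: W1_def v1_def indicator_def le_max_iff_disj)
  have JW: "RL \<kappa> W1 t = RL \<kappa> W t" "RL \<kappa> v1 t = - \<mu> * RL \<alpha> W t" if "t \<in> {0<..<R}" for t
  proof -
    show "RL \<kappa> W1 t = RL \<kappa> W t" by (rule RL_cong) (use that in \<open>auto simp: W1_def\<close>)
    have "RL \<kappa> v1 t = RL \<kappa> v t" by (rule RL_cong) (use that in \<open>auto simp: v1_def\<close>)
    also have "\<dots> = - \<mu> * RL \<kappa> (RL \<kappa> W) t" unfolding v_def by (rule RL_cmult)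
    also have "RL \<kappa> (RL \<kappa> W) t = RL \<alpha> W t"
      using RL_semigroup[OF W \<kappa>(1) \<kappa>(1), of t] that by (simp add: \<kappa>_def)
    finally show "RL \<kappa> v1 t = - \<mu> * RL \<alpha> W t" .
  qed
  define cc where "cc = tri_moment \<kappa> cos"
  define cs where "cs = tri_moment \<kappa> sin"
  have cs: "cs > 0" unfolding cs_def by (rule tri_moment_sin_pos[OF \<kappa>(2)])
  let ?I = "\<lambda>f. (LBINT t. indicator {0<..<R} t * f t)"
  have e1: "\<mu> * (LBINT t. W1 t * RL \<kappa> v1 t) = ?I (\<lambda>t. W t * (W t - Q t))"
    unfolding integral_mult_right_zero[symmetric]
    by (intro Bochner_Integration.integral_cong[OF refl])
       (auto simp: JW W1_def indicator_def Q_def \<mu>(2)[symmetric])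
  have e2: "\<mu> * (LBINT t. v1 t * RL \<kappa> W1 t) = ?I (\<lambda>t. - (v t)\<^sup>2)"
    unfolding integral_mult_right_zero[symmetric]
    by (intro Bochner_Integration.integral_cong[OF refl])
       (auto simp: JW v1_def v_def indicator_def power2_eq_square)
  have e3: "\<mu> * (LBINT t. W1 t * RL \<kappa> W1 t) = ?I (\<lambda>t. - (W t * v t))"
    unfolding integral_mult_right_zero[symmetric]
    by (intro Bochner_Integration.integral_cong[OF refl])
       (auto simp: JW W1_def v_def indicator_def)
  have e4: "\<mu> * (LBINT t. v1 t * RL \<kappa> v1 t) = ?I (\<lambda>t. v t * (W t - Q t))"
    unfolding integral_mult_right_zero[symmetric]
    by (intro Bochner_Integration.integral_cong[OF refl])
       (auto simp: JW v1_def indicator_def Q_def \<mu>(2)[symmetric])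
  \<comment> \<open>The four pairings of \<open>sectorial_positivity\<close>, with \<open>RL \<kappa> W1\<close> and \<open>RL \<kappa> v1\<close> replaced by means of \<open>v\<close> and \<open>Q\<close>.\<close>
  have main: "cs * (?I (\<lambda>t. W t * (W t - Q t)) - ?I (\<lambda>t. - (v t)\<^sup>2)) - cc * (?I (\<lambda>t. - (W t * v t)) + ?I (\<lambda>t. v t * (W t - Q t))) \<le> 0"
    using mult_left_mono[OF sectorial_positivity[OF \<kappa> _ _ b], of \<mu>] \<mu>(1)
    unfolding e1[symmetric] e2[symmetric] e3[symmetric] e4[symmetric] cc_def[symmetric] cs_def[symmetric]
    by (simp add: algebra_simps)
  have hb: "has_bochner_integral lborel (\<lambda>t. indicator {0<..<R} t * f t) (?I f)" if "bdd_borel R f" for f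
    by (rule has_bochner_integral_integrable[OF integrable_bdd_borel[OF that]])
  have bb: "bdd_borel R (\<lambda>t. W t * (W t - Q t))" "bdd_borel R (\<lambda>t. - (v t)\<^sup>2)"
      "bdd_borel R (\<lambda>t. - (W t * v t))" "bdd_borel R (\<lambda>t. v t * (W t - Q t))" "bdd_borel R (\<lambda>t. (W t)\<^sup>2)" "bdd_borel R (\<lambda>t. (Q t)\<^sup>2)"
    using bdd_borel_cmult[OF bdd_borel_power2[OF v], of "-1"] bdd_borel_cmult[OF bdd_borel_mult[OF W v], of "-1"]
    by (auto intro!: bdd_borel_intros W v Q)
  let ?E = "\<lambda>t. cs * (indicator {0<..<R} t * (W t * (W t - Q t)) - indicator {0<..<R} t * (- (v t)\<^sup>2))
     - cc * (indicator {0<..<R} t * (- (W t * v t)) + indicator {0<..<R} t * (v t * (W t - Q t)))"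
  let ?D = "\<lambda>t. cs/2 * (indicator {0<..<R} t * (W t)\<^sup>2) - (cs/2 + cc\<^sup>2/(4*cs)) * (indicator {0<..<R} t * (Q t)\<^sup>2)"
  have hE: "has_bochner_integral lborel ?E (cs * (?I (\<lambda>t. W t * (W t - Q t)) - ?I (\<lambda>t. - (v t)\<^sup>2))
      - cc * (?I (\<lambda>t. - (W t * v t)) + ?I (\<lambda>t. v t * (W t - Q t))))"
    by (intro has_bochner_integral_diff has_bochner_integral_add has_bochner_integral_mult_right hb bb)
  have hD: "has_bochner_integral lborel ?D (cs/2 * ?I (\<lambda>t. (W t)\<^sup>2) - (cs/2 + cc\<^sup>2/(4*cs)) * ?I (\<lambda>t. (Q t)\<^sup>2))"
    by (intro has_bochner_integral_diff has_bochner_integral_mult_right hb bb)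
  have "?D t \<le> ?E t" for t
  proof -
    have "cs * (w * (w - q) + x\<^sup>2) - cc * (- (w * x) + x * (w - q)) - (cs/2 * w\<^sup>2 - (cs/2 + cc\<^sup>2/(4*cs)) * q\<^sup>2)
       = cs/2 * (w - q)\<^sup>2 + cs * (x + cc/(2*cs) * q)\<^sup>2" for w q x
      using cs by (simp add: field_simps power2_eq_square)
    moreover have "0 \<le> cs/2 * (w - q)\<^sup>2 + cs * (x + cc/(2*cs) * q)\<^sup>2" for w q x :: real
      using cs by simp
    ultimately have "cs/2 * w\<^sup>2 - (cs/2 + cc\<^sup>2/(4*cs)) * q\<^sup>2 \<le> cs * (w * (w - q) + x\<^sup>2) - cc * (- (w * x) + x * (w - q))" for w q x
      by (metis diff_ge_0_iff_ge)
    from this[of "W t" "Q t" "v t"] show ?thesis by (auto simp: indicator_def)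
  qed
  then have "cs/2 * ?I (\<lambda>t. (W t)\<^sup>2) - (cs/2 + cc\<^sup>2/(4*cs)) * ?I (\<lambda>t. (Q t)\<^sup>2) \<le> 0"
  proof -
    assume "\<And>t. ?D t \<le> ?E t"
    then have "integral\<^sup>L lborel ?D \<le> integral\<^sup>L lborel ?E"
      using hD hE by (intro integral_mono) (simp_all only: has_bochner_integral_iff)
    then show ?thesis
      unfolding has_bochner_integral_integral_eq[OF hD] has_bochner_integral_integral_eq[OF hE] using main by linarith
  qed
  then have "cs/2 * ?I (\<lambda>t. (W t)\<^sup>2) \<le> (cs/2) * (mreg_const \<alpha> * ?I (\<lambda>t. (Q t)\<^sup>2))"
  proof -
    have "cs/2 * mreg_const \<alpha> = cs/2 + cc\<^sup>2/(4*cs)"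
      using cs by (simp add: mreg_const_def flip: cc_def cs_def \<kappa>_def) (simp add: field_simps power2_eq_square)
    moreover assume "cs/2 * ?I (\<lambda>t. (W t)\<^sup>2) - (cs/2 + cc\<^sup>2/(4*cs)) * ?I (\<lambda>t. (Q t)\<^sup>2) \<le> 0"
    ultimately show ?thesis by (simp add: mult.assoc[symmetric] del: times_divide_eq_left)
  qed
  then have "?I (\<lambda>t. (W t)\<^sup>2) \<le> mreg_const \<alpha> * ?I (\<lambda>t. (Q t)\<^sup>2)"
    using cs by (subst (asm) mult_le_cancel_left_pos) auto
  then show ?thesis by (simp add: Q_def)
qed

text \<open>Multiplication by \<open>t\<close> acts on convolutions as a derivation: \<open>t = s + (t - s)\<close>.\<close>

lemma RL_mult_id:
  assumes g: "bdd_borel R g" and a: "a > 0" and t: "t \<le> R"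
  shows "t * RL a g t = RL a (\<lambda>s. s * g s) t + a * RL (a + 1) g t"
proof -
  have 1: "integrable lborel (\<lambda>s. indicator {0<..<t} s * ((t - s) powr (a - 1) * (s * g s)))"
    by (rule RL_integrable[OF _ a t]) (intro bdd_borel_intros g)
  have 2: "integrable lborel (\<lambda>s. indicator {0<..<t} s * ((t - s) powr (a + 1 - 1) * g s))"
    by (rule RL_integrable[OF g _ t]) (use a in simp)
  have "t * (LINT s|lborel. indicator {0<..<t} s * ((t - s) powr (a - 1) * g s))
     = (LINT s|lborel. indicator {0<..<t} s * ((t - s) powr (a - 1) * (s * g s))
        + indicator {0<..<t} s * ((t - s) powr (a + 1 - 1) * g s))"
    unfolding integral_mult_right_zero[symmetric]
  proof (rule Bochner_Integration.integral_cong[OF refl])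
    fix s
    have pw: "(t - s) powr a = (t - s) * (t - s) powr (a - 1)" if "s < t"
      using that powr_add[of "t - s" 1 "a - 1"] by simp
    show "t * (indicator {0<..<t} s * ((t - s) powr (a - 1) * g s)) =
         indicator {0<..<t} s * ((t - s) powr (a - 1) * (s * g s)) +
         indicator {0<..<t} s * ((t - s) powr (a + 1 - 1) * g s)"
      by (cases "0 < s \<and> s < t") (auto simp: pw algebra_simps)
  qed
  also have "\<dots> = (LINT s|lborel. indicator {0<..<t} s * ((t - s) powr (a - 1) * (s * g s)))
     + (LINT s|lborel. indicator {0<..<t} s * ((t - s) powr (a + 1 - 1) * g s))"
    by (rule Bochner_Integration.integral_add[OF 1 2])
  moreover have G: "Gamma (a + 1) = a * Gamma a" "Gamma (1 + a) = a * Gamma a"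
    using Gamma_plus1[OF pos_notin_nonpos[OF a]] by (simp_all add: add.commute)
  ultimately show ?thesis
    using a pos_Gamma_ne[OF a]
    by (simp add: RL_def G field_simps)
qed

lemma RL_two_affine:
  assumes t: "0 \<le> t"
  shows "RL 2 (\<lambda>s. 2 * a + 6 * b * s) t = a * t\<^sup>2 + b * t ^ 3"
proof -
  have G: "Gamma (3::real) = 2" "Gamma (4::real) = 6"
    using Gamma_fact[of 2, where 'a=real] Gamma_fact[of 3, where 'a=real] by (simp_all add: fact_numeral)
  have p: "t powr 2 = t\<^sup>2" "t powr 3 = t ^ 3" using t by simp_all
  have 1: "RL 2 (\<lambda>s. 1) t = t\<^sup>2 / 2" "RL 3 (\<lambda>s. 1) t = t ^ 3 / 6"
    using RL_one[of 2 t] RL_one[of 3 t] t by (simp_all add: G p)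
  have 2: "RL 2 (\<lambda>s. s) t = t ^ 3 / 6"
    using RL_mult_id[of t "\<lambda>_. 1" 2 t] 1 by (simp add: bdd_borel_const power2_eq_square power3_eq_cube)
  have "RL 2 (\<lambda>s. 2 * a * 1 + 6 * b * s) t = RL 2 (\<lambda>s. 2 * a * 1) t + RL 2 (\<lambda>s. 6 * b * s) t"
    by (rule RL_add[of t]) (auto intro: bdd_borel_intros)
  also have "\<dots> = 2 * a * (t\<^sup>2 / 2) + 6 * b * (t ^ 3 / 6)"
    unfolding RL_cmult 1 2 ..
  finally show ?thesis by simp
qed

text \<open>The weight \<open>t\<^sup>2\<close> turns the initial data \<open>a + b t\<close>, which is not in the range of \<open>RL \<alpha>\<close> on bounded functions, into
  \<open>a t\<^sup>2 + b t\<^sup>3\<close>, which is \<open>RL 2\<close> and hence \<open>RL \<alpha>\<close> of something bounded. The commutators of \<open>t\<^sup>2\<close> with \<open>RL \<alpha>\<close> involve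
  only the regular functions \<open>RL 1 w\<close> and \<open>RL 2 w\<close>.\<close>

lemma weighted_equation:
  assumes \<alpha>: "1 < \<alpha>" "\<alpha> < 2" and w: "bdd_borel T w"
    and t: "0 \<le> t" "t \<le> T"
    and y: "y = a + b * t + RL \<alpha> w t"
  shows "t\<^sup>2 * y = RL \<alpha> (\<lambda>s. s\<^sup>2 * w s + RL (2 - \<alpha>) (\<lambda>s. 2 * a + 6 * b * s) s
      + 2 * \<alpha> * (s * RL 1 w s - RL 2 w s) + \<alpha> * (\<alpha> + 1) * RL 2 w s) t"
proof -
  have h: "bdd_borel T (\<lambda>s. 2 * a + 6 * b * s)" by (intro bdd_borel_intros)
  have sw: "bdd_borel T (\<lambda>s. s * w s)" "bdd_borel T (\<lambda>s. s\<^sup>2 * w s)" by (intro bdd_borel_intros w)+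
  have J1: "RL 1 (\<lambda>s. s * w s) s = s * RL 1 w s - RL 2 w s" if "s \<le> T" for s
    using RL_mult_id[OF w, of 1 s] that by simp
  have b1: "bdd_borel T (RL (2 - \<alpha>) (\<lambda>s. 2 * a + 6 * b * s))" by (rule RL_bdd[OF h]) (use \<alpha> in simp)
  have b2: "bdd_borel T (RL 1 (\<lambda>s. s * w s))" by (rule RL_bdd[OF sw(1)]) simp
  have b3: "bdd_borel T (RL 2 w)" by (rule RL_bdd[OF w]) simp
  have "RL \<alpha> (\<lambda>s. s\<^sup>2 * w s + RL (2 - \<alpha>) (\<lambda>s. 2 * a + 6 * b * s) s
      + 2 * \<alpha> * (s * RL 1 w s - RL 2 w s) + \<alpha> * (\<alpha> + 1) * RL 2 w s) t
    = RL \<alpha> (\<lambda>s. s\<^sup>2 * w s + RL (2 - \<alpha>) (\<lambda>s. 2 * a + 6 * b * s) s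
      + 2 * \<alpha> * RL 1 (\<lambda>s. s * w s) s + \<alpha> * (\<alpha> + 1) * RL 2 w s) t"
    using t by (intro RL_cong) (simp add: J1)
  also have "\<dots> = RL \<alpha> (\<lambda>s. s\<^sup>2 * w s) t + RL \<alpha> (RL (2 - \<alpha>) (\<lambda>s. 2 * a + 6 * b * s)) t
     + 2 * \<alpha> * RL \<alpha> (RL 1 (\<lambda>s. s * w s)) t + \<alpha> * (\<alpha> + 1) * RL \<alpha> (RL 2 w) t"
    using \<alpha> t b1 b2 b3 sw(2)
    by (simp add: RL_add[of T] RL_cmult bdd_borel_add bdd_borel_cmult)
  also have "RL \<alpha> (RL (2 - \<alpha>) (\<lambda>s. 2 * a + 6 * b * s)) t = a * t\<^sup>2 + b * t ^ 3"
    using RL_semigroup[OF h, of \<alpha> "2 - \<alpha>" t] \<alpha> t RL_two_affine[OF t(1)] by simp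
  also have "RL \<alpha> (RL 1 (\<lambda>s. s * w s)) t = RL (\<alpha> + 1) (\<lambda>s. s * w s) t"
    using \<alpha> t by (intro RL_semigroup[OF sw(1)]) auto
  also have "RL \<alpha> (RL 2 w) t = RL (\<alpha> + 2) w t"
    using \<alpha> t by (intro RL_semigroup[OF w]) auto
  finally have eq: "RL \<alpha> (\<lambda>s. s\<^sup>2 * w s + RL (2 - \<alpha>) (\<lambda>s. 2 * a + 6 * b * s) s
      + 2 * \<alpha> * (s * RL 1 w s - RL 2 w s) + \<alpha> * (\<alpha> + 1) * RL 2 w s) t
    = RL \<alpha> (\<lambda>s. s\<^sup>2 * w s) t + (a * t\<^sup>2 + b * t ^ 3)
     + 2 * \<alpha> * RL (\<alpha> + 1) (\<lambda>s. s * w s) t + \<alpha> * (\<alpha> + 1) * RL (\<alpha> + 2) w t" .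
  have m1: "t * RL \<alpha> w t = RL \<alpha> (\<lambda>s. s * w s) t + \<alpha> * RL (\<alpha> + 1) w t"
    using \<alpha> t by (intro RL_mult_id[OF w]) auto
  have m2: "t * RL \<alpha> (\<lambda>s. s * w s) t = RL \<alpha> (\<lambda>s. s\<^sup>2 * w s) t + \<alpha> * RL (\<alpha> + 1) (\<lambda>s. s * w s) t"
    using RL_mult_id[OF sw(1), of \<alpha> t] \<alpha> t by (simp add: power2_eq_square mult.assoc)
  have m3: "t * RL (\<alpha> + 1) w t = RL (\<alpha> + 1) (\<lambda>s. s * w s) t + (\<alpha> + 1) * RL (\<alpha> + 2) w t"
    using RL_mult_id[OF w, of "\<alpha> + 1" t] \<alpha> t by (simp add: add.assoc)
  have "t\<^sup>2 * RL \<alpha> w t = t * (t * RL \<alpha> w t)" by (simp add: power2_eq_square)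
  also have "\<dots> = t * RL \<alpha> (\<lambda>s. s * w s) t + \<alpha> * (t * RL (\<alpha> + 1) w t)" unfolding m1 by (simp add: algebra_simps)
  finally have m4: "t\<^sup>2 * RL \<alpha> w t = RL \<alpha> (\<lambda>s. s\<^sup>2 * w s) t + 2 * \<alpha> * RL (\<alpha> + 1) (\<lambda>s. s * w s) t
      + \<alpha> * (\<alpha> + 1) * RL (\<alpha> + 2) w t"
    unfolding m2 m3 by (simp add: algebra_simps)
  have "t\<^sup>2 * y = a * t\<^sup>2 + b * t ^ 3 + t\<^sup>2 * RL \<alpha> w t"
    unfolding y by (simp add: algebra_simps power2_eq_square power3_eq_cube)
  then show ?thesis unfolding eq m4 by simp
qed

lemma RL_nonneg:
  assumes "a > 0" "\<And>s. s \<in> {0<..<t} \<Longrightarrow> 0 \<le> g s"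
  shows "0 \<le> RL a g t"
  unfolding RL_def using assms Gamma_real_pos[OF assms(1)]
  by (intro divide_nonneg_pos Bochner_Integration.integral_nonneg) (auto simp: indicator_def)

text \<open>Jensen's inequality for the kernel of \<open>RL a\<close>, whose total mass is \<open>t powr a / Gamma (a + 1)\<close>: the variance of \<open>g\<close> is
  non-negative.\<close>

lemma RL_square_le:
  assumes g: "bdd_borel R g" and a: "a > 0" and t: "0 \<le> t" "t \<le> R"
  shows "(RL a g t)\<^sup>2 \<le> t powr a / Gamma (a + 1) * RL a (\<lambda>s. (g s)\<^sup>2) t"
proof (cases "t = 0")
  case True
  then show ?thesis by (simp add: RL_nonpos)
next
  case False
  define k where "k = t powr a / Gamma (a + 1)"
  have k: "k > 0" using False t a Gamma_real_pos[of "a + 1"] by (simp add: k_def)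
  define c where "c = RL a g t / k"
  have "0 \<le> RL a (\<lambda>s. (g s - c)\<^sup>2) t" by (rule RL_nonneg[OF a]) simp
  also have "(\<lambda>s. (g s - c)\<^sup>2) = (\<lambda>s. (g s)\<^sup>2 + ((- 2 * c) * g s + c\<^sup>2 * 1))"
    by (auto simp: power2_eq_square algebra_simps)
  also have "RL a \<dots> t = RL a (\<lambda>s. (g s)\<^sup>2) t + (- 2 * c * RL a g t + c\<^sup>2 * k)"
  proof -
    have "RL a (\<lambda>s. (g s)\<^sup>2 + ((- 2 * c) * g s + c\<^sup>2 * 1)) t = RL a (\<lambda>s. (g s)\<^sup>2) t + RL a (\<lambda>s. (- 2 * c) * g s + c\<^sup>2 * 1) t"
      by (rule RL_add[OF _ _ a t(2)]) (intro bdd_borel_intros g)+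
    also have "RL a (\<lambda>s. (- 2 * c) * g s + c\<^sup>2 * 1) t = RL a (\<lambda>s. (- 2 * c) * g s) t + RL a (\<lambda>s. c\<^sup>2 * 1) t"
      by (rule RL_add[OF _ _ a t(2)]) (intro bdd_borel_intros g)+
    also have "\<dots> = - 2 * c * RL a g t + c\<^sup>2 * k"
      unfolding RL_cmult using RL_one[OF a t(1)] by (simp add: k_def)
    finally show ?thesis .
  qed
  also have "\<dots> = RL a (\<lambda>s. (g s)\<^sup>2) t - (RL a g t)\<^sup>2 / k"
    using k by (simp add: c_def power2_eq_square field_simps)
  finally have "(RL a g t)\<^sup>2 \<le> k * RL a (\<lambda>s. (g s)\<^sup>2) t" using k by (simp add: field_simps)
  then show ?thesis unfolding k_def .
qed

lemma RL_sum:
  assumes "finite S" "\<And>n. n \<in> S \<Longrightarrow> bdd_borel R (g n)" "a > 0" "t \<le> R"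
  shows "bdd_borel R (\<lambda>s. \<Sum>n\<in>S. g n s) \<and> RL a (\<lambda>s. \<Sum>n\<in>S. g n s) t = (\<Sum>n\<in>S. RL a (g n) t)"
  using assms(1,2)
proof (induction S rule: finite_induct)
  case empty
  then show ?case using RL_cmult[of a 0 "\<lambda>_. 0" t] by (simp add: bdd_borel_const)
next
  case (insert x S)
  then show ?case using assms(3,4) by (auto simp: RL_add[of R] intro!: bdd_borel_add)
qed

text \<open>Fractional integration acts on sequences of coefficients as boundedly as on scalars, with a bound that
  does not depend on their number.\<close>

lemma RL_sum_square_le:
  assumes "finite S" "\<And>n. n \<in> S \<Longrightarrow> bdd_borel R (g n)" "a > 0" "0 \<le> t" "t \<le> R"
    and B: "\<And>s. s \<in> {0<..<t} \<Longrightarrow> (\<Sum>n\<in>S. (g n s)\<^sup>2) \<le> B"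
  shows "(\<Sum>n\<in>S. (RL a (g n) t)\<^sup>2) \<le> (t powr a / Gamma (a + 1))\<^sup>2 * B"
proof -
  have g2: "\<And>n. n \<in> S \<Longrightarrow> bdd_borel R (\<lambda>s. (g n s)\<^sup>2)" using assms(2) by (rule bdd_borel_power2)
  note JS = RL_sum[OF assms(1) g2 assms(3,5)]
  have k: "t powr a / Gamma (a + 1) \<ge> 0" using assms Gamma_real_pos[of "a + 1"] by simp
  have "(\<Sum>n\<in>S. (RL a (g n) t)\<^sup>2) \<le> (\<Sum>n\<in>S. t powr a / Gamma (a + 1) * RL a (\<lambda>s. (g n s)\<^sup>2) t)"
    using assms by (intro sum_mono RL_square_le) auto
  also have "\<dots> = t powr a / Gamma (a + 1) * RL a (\<lambda>s. \<Sum>n\<in>S. (g n s)\<^sup>2) t"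
    using JS by (simp add: sum_distrib_left)
  also have "\<dots> \<le> t powr a / Gamma (a + 1) * (B * (t powr a / Gamma (a + 1)))"
  proof (rule mult_left_mono[OF _ k], rule order_trans[OF abs_ge_self RL_abs_le])
    show "\<bar>\<Sum>n\<in>S. (g n s)\<^sup>2\<bar> \<le> B" if "s \<in> {0<..<t}" for s
      using B[OF that] by (simp add: sum_nonneg)
  qed (use JS assms in auto)
  finally show ?thesis by (simp add: power2_eq_square mult_ac)
qed

section \<open>Smooth bumps and test functions\<close>

text \<open>The standard flat function \<open>exp (-1/x)\<close> with a polynomial factor in \<open>1/x\<close>; this factor makes the family closed under
  differentiation.\<close>

definition flat :: "real poly \<Rightarrow> real \<Rightarrow> real" where
  "flat p x = (if x > 0 then poly p (1 / x) * exp (- (1 / x)) else 0)"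

lemma poly_exp_decay: "((\<lambda>X. poly p X * exp (- X)) \<longlongrightarrow> (0::real)) at_top"
proof -
  have "((\<lambda>X. \<Sum>i\<le>degree p. coeff p i * (X ^ i / exp X)) \<longlongrightarrow> (\<Sum>i\<le>degree p. coeff p i * 0)) at_top"
    by (intro tendsto_sum tendsto_mult tendsto_const tendsto_power_div_exp_0)
  moreover have "(\<lambda>X. \<Sum>i\<le>degree p. coeff p i * (X ^ i / exp X)) = (\<lambda>X. poly p X * exp (- X))"
    by (simp add: poly_altdef sum_distrib_right exp_minus divide_inverse mult.assoc)
  ultimately show ?thesis by simp
qed

text \<open>Away from the origin this is the chain rule. At the origin the difference quotients vanish in the limit since the exponential
  outweighs every polynomial in \<open>1/x\<close>.\<close>

lemma flat_derivative:
  "(flat p has_real_derivative flat ((p - pderiv p) * [:0, 0, 1:]) x) (at x)"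
proof -
  consider "x < 0" | "x = 0" | "x > 0" by linarith
  then show ?thesis
  proof cases
    case 1
    have "((\<lambda>_. 0) has_real_derivative 0) (at x)" by simp
    moreover have "\<forall>\<^sub>F y in nhds x. flat p y = 0"
      by (rule eventually_nhds_in_open[of "{..<0}" x, THEN eventually_mono]) (use 1 in \<open>auto simp: flat_def\<close>)
    ultimately have "(flat p has_real_derivative 0) (at x)"
      by (subst DERIV_cong_ev[OF refl _ refl]) auto
    then show ?thesis using 1 by (simp add: flat_def[of _ x])
  next
    case 3
    have "((\<lambda>x. poly p (1 / x) * exp (- (1 / x))) has_real_derivative
       (poly (pderiv p) (1 / x) * (- 1 / (x * x))) * exp (- (1 / x)) + (exp (- (1 / x)) * (1 / (x * x))) * poly p (1 / x)) (at x)"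
      using 3 by (auto intro!: derivative_eq_intros DERIV_chain'[OF _ poly_DERIV] simp: power2_eq_square)
    moreover have "\<forall>\<^sub>F y in nhds x. flat p y = poly p (1 / y) * exp (- (1 / y))"
      by (rule eventually_nhds_in_open[of "{0<..}" x, THEN eventually_mono]) (use 3 in \<open>auto simp: flat_def\<close>)
    ultimately have "(flat p has_real_derivative (poly (pderiv p) (1 / x) * (- 1 / (x * x))) * exp (- (1 / x)) + (exp (- (1 / x)) * (1 / (x * x))) * poly p (1 / x)) (at x)"
      by (subst DERIV_cong_ev[OF refl _ refl]) auto
    moreover have "(poly (pderiv p) (1 / x) * (- 1 / (x * x))) * exp (- (1 / x)) + (exp (- (1 / x)) * (1 / (x * x))) * poly p (1 / x)
       = flat ((p - pderiv p) * [:0, 0, 1:]) x"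
      using 3 by (simp add: flat_def field_simps)
    ultimately show ?thesis by simp
  next
    case 2
    have r: "((\<lambda>h. flat p h / h) \<longlongrightarrow> 0) (at_right 0)"
    proof -
      have "((\<lambda>h::real. poly ([:0, 1:] * p) (inverse h) * exp (- inverse h)) \<longlongrightarrow> 0) (at_right 0)"
        by (rule filterlim_compose[OF poly_exp_decay filterlim_inverse_at_top_right])
      moreover have "\<forall>\<^sub>F h in at_right 0. poly ([:0, 1:] * p) (inverse h) * exp (- inverse h) = flat p h / (h::real)"
        by (rule eventually_at_rightI[of 0 1]) (auto simp: flat_def field_simps)
      ultimately show ?thesis by (rule Lim_transform_eventually)
    qed
    have l: "((\<lambda>h. flat p h / h) \<longlongrightarrow> 0) (at_left 0)"
    proof (rule Lim_transform_eventually[OF tendsto_const])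
      show "\<forall>\<^sub>F h in at_left 0. 0 = flat p h / (h::real)"
        by (rule eventually_at_leftI[of "-1" 0]) (auto simp: flat_def)
    qed
    have "((\<lambda>h. flat p h / h) \<longlongrightarrow> 0) (at 0)" by (rule filterlim_split_at[OF l r])
    then show ?thesis using 2 by (simp add: has_field_derivative_iff flat_def[of _ 0])
  qed
qed

text \<open>The algebra generated by the constants and the rescaled flat functions is closed under differentiation.
  Its elements are therefore smooth, with no bookkeeping of higher derivatives.\<close>

inductive bump_algebra :: "(real \<Rightarrow> real) \<Rightarrow> bool" where
  bump_algebra_const: "bump_algebra (\<lambda>t. c)"
| bump_algebra_flat: "bump_algebra (\<lambda>t. flat p (c * t + d))"
| bump_algebra_add: "bump_algebra g \<Longrightarrow> bump_algebra h \<Longrightarrow> bump_algebra (\<lambda>t. g t + h t)"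
| bump_algebra_mult: "bump_algebra g \<Longrightarrow> bump_algebra h \<Longrightarrow> bump_algebra (\<lambda>t. g t * h t)"

lemma bump_algebra_derivative: "bump_algebra g \<Longrightarrow> \<exists>g'. bump_algebra g' \<and> (\<forall>t. (g has_real_derivative g' t) (at t))"
proof (induction rule: bump_algebra.induct)
  case (bump_algebra_const c)
  show ?case by (rule exI[of _ "\<lambda>_. 0"]) (auto intro: bump_algebra.intros)
next
  case (bump_algebra_flat p c d)
  have "((\<lambda>t. flat p (c * t + d)) has_real_derivative c * flat ((p - pderiv p) * [:0, 0, 1:]) (c * t + d)) (at t)" for t
    by (rule DERIV_chain'[OF _ flat_derivative, THEN DERIV_cong]) (auto intro!: derivative_eq_intros)
  then show ?case
    by (intro exI[of _ "\<lambda>t. c * flat ((p - pderiv p) * [:0, 0, 1:]) (c * t + d)"]) (auto intro: bump_algebra.intros)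
next
  case (bump_algebra_add g h)
  then obtain g' h' where "bump_algebra g'" "bump_algebra h'" "\<forall>t. (g has_real_derivative g' t) (at t)" "\<forall>t. (h has_real_derivative h' t) (at t)"
    by blast
  then show ?case
    by (intro exI[of _ "\<lambda>t. g' t + h' t"]) (auto intro: bump_algebra.intros DERIV_add)
next
  case (bump_algebra_mult g h)
  then obtain g' h' where "bump_algebra g'" "bump_algebra h'" "\<forall>t. (g has_real_derivative g' t) (at t)" "\<forall>t. (h has_real_derivative h' t) (at t)"
    by blast
  then show ?case using bump_algebra_mult
    by (intro exI[of _ "\<lambda>t. g' t * h t + h' t * g t"]) (auto intro!: bump_algebra.intros DERIV_mult)
qed

lemma bump_algebra_smooth:
  assumes "bump_algebra g"
  shows "smooth g"
proof -
  have "bump_algebra ((deriv ^^ k) g)" for k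
  proof (induction k)
    case (Suc k)
    then obtain g' where "bump_algebra g'" "\<forall>t. ((deriv ^^ k) g has_real_derivative g' t) (at t)"
      using bump_algebra_derivative by blast
    moreover from this have "deriv ((deriv ^^ k) g) = g'" by (auto intro: DERIV_imp_deriv)
    ultimately show ?case by simp
  qed (simp add: assms)
  then show ?thesis unfolding smooth_def
    using bump_algebra_derivative by (metis real_differentiable_def)
qed

lemma smooth_step:
  assumes "\<And>t. (g has_real_derivative g' t) (at t)" and "smooth g'"
  shows "smooth g"
proof -
  have d: "deriv g = g'" using assms(1) by (auto intro: DERIV_imp_deriv)
  have "((deriv ^^ k) g) differentiable (at t)" for k t
  proof (cases k)
    case 0
    then show ?thesis using assms(1) by (auto simp: real_differentiable_def)
  next
    case (Suc j)
    then have "(deriv ^^ k) g = (deriv ^^ j) g'" by (simp add: funpow_swap1 d)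
    then show ?thesis using assms(2) by (simp add: smooth_def)
  qed
  then show ?thesis by (simp add: smooth_def)
qed

definition bump :: "real \<Rightarrow> real \<Rightarrow> real" where
  "bump \<epsilon> s = flat 1 (s + \<epsilon>) * flat 1 (\<epsilon> - s)"

lemma bump_zero: "s \<notin> {- \<epsilon><..<\<epsilon>} \<Longrightarrow> bump \<epsilon> s = 0"
  by (auto simp: bump_def flat_def)

lemma bump_pos: "s \<in> {- \<epsilon><..<\<epsilon>} \<Longrightarrow> bump \<epsilon> s > 0"
  by (auto simp: bump_def flat_def)

lemma bump_nonneg: "bump \<epsilon> s \<ge> 0"
  by (auto simp: bump_def flat_def)

lemma bump_in_bump_algebra: "bump_algebra (\<lambda>t. bump \<epsilon> (t - c))"
proof -
  have "bump_algebra (\<lambda>t. flat 1 (1 * t + (\<epsilon> - c)) * flat 1 ((-1) * t + (\<epsilon> + c)))" by (intro bump_algebra.intros)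
  moreover have "(\<lambda>t. flat 1 (1 * t + (\<epsilon> - c)) * flat 1 ((-1) * t + (\<epsilon> + c))) = (\<lambda>t. bump \<epsilon> (t - c))"
    by (simp add: bump_def algebra_simps)
  ultimately show ?thesis by simp
qed

lemma bump_algebra_continuous: "bump_algebra g \<Longrightarrow> isCont g x"
  using bump_algebra_derivative DERIV_isCont by blast

lemma bump_isCont: "isCont (bump \<epsilon>) x"
  using bump_algebra_continuous[OF bump_in_bump_algebra[of \<epsilon> 0]] by simp

lemma bump_measurable [measurable]: "bump \<epsilon> \<in> borel_measurable borel"
  using bump_isCont by (intro borel_measurable_continuous_onI continuous_at_imp_continuous_on) auto

lemma DERIV_const_on:
  fixes f :: "real \<Rightarrow> real"
  assumes "\<And>x. x \<in> S \<Longrightarrow> (f has_real_derivative k) (at x)" "convex S" "a \<in> S" "b \<in> S"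
  shows "f b = f a + k * (b - a)"
proof -
  have "\<exists>c. \<forall>x\<in>S. f x - k * x = c"
    by (rule has_field_derivative_zero_constant[OF assms(2)])
       (auto intro!: derivative_eq_intros DERIV_subset[OF assms(1)])
  then obtain c where "\<forall>x\<in>S. f x - k * x = c" by blast
  then have "f a - k * a = f b - k * b" using assms(3,4) by simp
  then show ?thesis by (simp add: algebra_simps)
qed

lemma bump_primitives:
  assumes \<epsilon>: "\<epsilon> > 0"
  obtains R R1 :: "real \<Rightarrow> real" and k l where
    "\<And>t. (R has_real_derivative R1 t) (at t)" "\<And>t. (R1 has_real_derivative bump \<epsilon> t) (at t)"
    "\<And>t. t \<le> - \<epsilon> \<Longrightarrow> R t = 0" "\<And>t. t \<ge> \<epsilon> \<Longrightarrow> R t = k + l * t"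
proof -
  have ex: "\<exists>F. (\<forall>x. (F has_real_derivative f x) (at x)) \<and> F a = 0" if "\<And>x. isCont f x" for f :: "real \<Rightarrow> real" and a
  proof -
    have "\<exists>F. \<forall>x::real. -\<infinity> < ereal x \<longrightarrow> ereal x < \<infinity> \<longrightarrow> (F has_vector_derivative f x) (at x)"
      by (rule einterval_antiderivative) (auto intro: that)
    then obtain F where "\<forall>x. (F has_real_derivative f x) (at x)"
      by (auto simp: has_real_derivative_iff_has_vector_derivative)
    then show ?thesis
      by (intro exI[of _ "\<lambda>x. F x - F a"]) (auto intro!: derivative_eq_intros)
  qed
  obtain R1 where R1: "\<And>x. (R1 has_real_derivative bump \<epsilon> x) (at x)" "R1 (- \<epsilon>) = 0"
    using ex[of "bump \<epsilon>" "-\<epsilon>"] bump_isCont by blast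
  obtain R where R: "\<And>x. (R has_real_derivative R1 x) (at x)" "R (- \<epsilon>) = 0"
    using ex[of "R1" "-\<epsilon>"] DERIV_isCont[OF R1(1)] by blast
  have d0: "(R1 has_real_derivative 0) (at x)" if "x \<in> {..-\<epsilon>} \<or> x \<in> {\<epsilon>..}" for x
    using R1(1)[of x] bump_zero[of x \<epsilon>] that by auto
  have a: "R1 t = 0" if "t \<le> - \<epsilon>" for t
    using DERIV_const_on[of "{..-\<epsilon>}" R1 0 "-\<epsilon>" t] d0 R1(2) that by auto
  have b: "R1 t = R1 \<epsilon>" if "t \<ge> \<epsilon>" for t
    using DERIV_const_on[of "{\<epsilon>..}" R1 0 "\<epsilon>" t] d0 that by auto
  show ?thesis
  proof (rule that[of R R1 "R \<epsilon> - R1 \<epsilon> * \<epsilon>" "R1 \<epsilon>"])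
    show "R t = 0" if "t \<le> - \<epsilon>" for t
      using DERIV_const_on[of "{..-\<epsilon>}" R 0 "-\<epsilon>" t] R a that by (auto simp: dest: R(1)[THEN DERIV_cong])
    show "R t = R \<epsilon> - R1 \<epsilon> * \<epsilon> + R1 \<epsilon> * t" if "t \<ge> \<epsilon>" for t
    proof -
      have "(R has_real_derivative R1 \<epsilon>) (at y)" if "y \<in> {\<epsilon>..}" for y
        using R(1)[of y] b[of y] that by (metis atLeast_iff)
      then have "R t = R \<epsilon> + R1 \<epsilon> * (t - \<epsilon>)"
        by (rule DERIV_const_on[of "{\<epsilon>..}"]) (use that in auto)
      then show ?thesis by (simp add: right_diff_distrib)
    qed
  qed (use R R1 in auto)
qed

text \<open>A double primitive of a bump that vanishes to the left of its support is affine to the right of it. Second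
  differences annihilate affine functions, so the second difference of the double primitive has compact support.\<close>

lemma bump_test_function:
  assumes \<epsilon>: "\<epsilon> > 0" and h: "h > 0" and x: "h + \<epsilon> < x" "x + h + \<epsilon> < T"
  obtains \<psi> where "test_function T \<psi>"
    "(deriv ^^ 2) \<psi> = (\<lambda>t. bump \<epsilon> (t - (x + h)) - 2 * bump \<epsilon> (t - x) + bump \<epsilon> (t - (x - h)))"
proof -
  obtain R R1 k l where R: "\<And>t. (R has_real_derivative R1 t) (at t)" and R1: "\<And>t. (R1 has_real_derivative bump \<epsilon> t) (at t)"
    and l: "\<And>t. t \<le> - \<epsilon> \<Longrightarrow> R t = 0" and r: "\<And>t. t \<ge> \<epsilon> \<Longrightarrow> R t = k + l * t"
    using bump_primitives[OF \<epsilon>] by blast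
  define D where "D f t = f (t - (x + h)) - 2 * f (t - x) + f (t - (x - h))" for f :: "real \<Rightarrow> real" and t
  have D': "(D f has_real_derivative D f' t) (at t)" if f: "\<And>t. (f has_real_derivative f' t) (at t)" for f f' t
  proof -
    have sh: "((\<lambda>t. f (t - c)) has_real_derivative f' (t - c)) (at t)" for c
      using f[of "t - c"] DERIV_shift[of f "f' (t - c)" t "-c"] by simp
    show ?thesis unfolding D_def by (intro DERIV_add DERIV_diff DERIV_cmult sh)
  qed
  have 1: "\<And>t. (D R has_real_derivative D R1 t) (at t)" by (rule D'[OF R])
  have 2: "\<And>t. (D R1 has_real_derivative D (bump \<epsilon>) t) (at t)" by (rule D'[OF R1])
  have "bump_algebra (\<lambda>t. bump \<epsilon> (t - (x + h)) + (- 2) * bump \<epsilon> (t - x) + bump \<epsilon> (t - (x - h)))"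
    by (intro bump_algebra_add bump_algebra_mult bump_in_bump_algebra bump_algebra_const)
  then have "smooth (D (bump \<epsilon>))" using bump_algebra_smooth by (simp add: D_def[abs_def])
  then have s: "smooth (D R)" using smooth_step[OF 1] smooth_step[OF 2] by blast
  have "D R t = 0" if t: "t \<notin> {x - h - \<epsilon>..x + h + \<epsilon>}" for t
  proof -
    consider "t < x - h - \<epsilon>" | "t > x + h + \<epsilon>" using t unfolding atLeastAtMost_iff by linarith
    then show ?thesis
    proof cases
      case 1 then show ?thesis using l h by (simp add: D_def)
    next
      case 2 then show ?thesis using r h by (simp add: D_def algebra_simps)
    qed
  qed
  then have "test_function T (D R)" unfolding test_function_def using s x
    by (intro conjI exI[of _ "x - h - \<epsilon>"] exI[of _ "x + h + \<epsilon>"]) auto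
  moreover have "(deriv ^^ 2) (D R) = D (bump \<epsilon>)"
  proof -
    have "deriv (D R) = D R1" "deriv (D R1) = D (bump \<epsilon>)" using 1 2 by (auto intro: DERIV_imp_deriv)
    then show ?thesis by (simp add: numeral_2_eq_2)
  qed
  ultimately show ?thesis using that[of "D R"] by (simp add: D_def[abs_def])
qed

section \<open>From the distributional equation to the integral equation\<close>

lemma AE_not_in_Ioo:
  assumes "AE x in lborel. x \<notin> {a<..<b::real}"
  shows "b \<le> a"
proof (rule ccontr)
  assume "\<not> b \<le> a"
  moreover have "emeasure lborel {a<..<b} = 0"
    using assms by (subst (asm) AE_iff_measurable[of "{a<..<b}"]) auto
  ultimately show False by simp
qed

lemma integrable_support:
  fixes g :: "real \<Rightarrow> real"
  assumes "g \<in> borel_measurable borel" "\<And>x. \<bar>g x\<bar> \<le> M * indicator {a<..<b} x"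
  shows "integrable lborel g"
proof (rule Bochner_Integration.integrable_bound)
  show "integrable lborel (\<lambda>x. M * indicator {a<..<b} x :: real)"
    using emeasure_bounded_finite[of "{a<..<b}"] by (intro integrable_mult_right integrable_real_indicator) auto
  show "AE x in lborel. norm (g x) \<le> norm (M * indicator {a<..<b} x)"
    using assms(2) by (intro AE_I2) (metis abs_ge_self order_trans real_norm_def)
qed (use assms in auto)

lemma bump_le_1: "bump \<epsilon> s \<le> 1"
  unfolding bump_def flat_def by (auto intro!: mult_le_one)

lemma bump_abs: "\<bar>bump \<epsilon> s\<bar> \<le> 1 * indicator {- \<epsilon><..<\<epsilon>} s"
  using bump_le_1[of \<epsilon> s] bump_nonneg[of \<epsilon> s] bump_zero[of s \<epsilon>] by (auto simp: indicator_def)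

lemma bump_integral_pos:
  assumes "\<epsilon> > 0"
  shows "(LBINT s. bump \<epsilon> s) > 0"
proof -
  have int: "integrable lborel (bump \<epsilon>)" by (rule integrable_support[OF _ bump_abs]) auto
  have "(LBINT s. bump \<epsilon> s) \<noteq> 0"
  proof
    assume "(LBINT s. bump \<epsilon> s) = 0"
    then have "AE x in lborel. bump \<epsilon> x = 0"
      using integral_nonneg_eq_0_iff_AE[OF int] bump_nonneg by simp
    then have "AE x in lborel. x \<notin> {- \<epsilon><..<\<epsilon>}"
      by eventually_elim (use bump_pos in force)
    then show False using AE_not_in_Ioo assms by force
  qed
  moreover have "(LBINT s. bump \<epsilon> s) \<ge> 0" by (rule Bochner_Integration.integral_nonneg[OF bump_nonneg])
  ultimately show ?thesis by simp
qed

text \<open>Testing with the functions of \<open>bump_test_function\<close> shows that the second difference of \<open>D\<close>, averaged against a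
  bump, vanishes. The bump may be as narrow as desired, and \<open>D\<close> is continuous.\<close>

lemma second_difference_zero:
  fixes D :: "real \<Rightarrow> real"
  assumes D: "continuous_on {0..T} D"
    and DB: "\<And>\<psi>. test_function T \<psi> \<Longrightarrow> (LBINT t. indicator {0<..<T} t * (D t * (deriv ^^ 2) \<psi> t)) = 0"
    and h: "0 < h" "h < x" "x + h < T"
  shows "D (x + h) - 2 * D x + D (x - h) = 0"
proof -
  define D' where "D' t = indicator {0<..<T} t * D t" for t
  have Dc: "isCont D t" if "t \<in> {0<..<T}" for t
    using D that by (metis continuous_on_interior interior_atLeastAtMost_real)
  have D'm [measurable]: "D' \<in> borel_measurable borel"
  proof -
    have "(\<lambda>t. indicator {0<..<T} t *\<^sub>R D t) \<in> borel_measurable borel"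
      by (rule borel_measurable_continuous_on_indicator) (auto intro!: continuous_on_subset[OF D])
    then show ?thesis by (simp add: D'_def[abs_def])
  qed
  have "compact (D ` {0..T})" using D by (intro compact_continuous_image) auto
  then obtain M where M: "\<And>t. t \<in> {0..T} \<Longrightarrow> \<bar>D t\<bar> \<le> M"
    using compact_imp_bounded bounded_iff by (metis imageI real_norm_def)
  have M0: "M \<ge> 0" using M[of x] h by force
  have D'b: "\<bar>D' t\<bar> \<le> M" for t using M[of t] M0 by (auto simp: D'_def indicator_def)
  define E where "E s = D' (x + h + s) - 2 * D' (x + s) + D' (x - h + s)" for s
  have [measurable]: "E \<in> borel_measurable borel" unfolding E_def by measurable
  have E0: "E 0 = D (x + h) - 2 * D x + D (x - h)" using h by (simp add: E_def D'_def)
  have Ec: "isCont E 0"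
  proof -
    have *: "isCont D' t" if "t \<in> {0<..<T}" for t
    proof -
      have "\<forall>\<^sub>F y in nhds t. D' y = D y"
        by (rule eventually_nhds_in_open[of "{0<..<T}" t, THEN eventually_mono]) (use that in \<open>auto simp: D'_def\<close>)
      then show ?thesis using Dc[OF that] isCont_cong by blast
    qed
    have "isCont (\<lambda>s. D' (c + s)) 0" if "c \<in> {0<..<T}" for c
      by (rule isCont_o2[of _ "\<lambda>s. c + s"]) (use *[OF that] in auto)
    then show ?thesis unfolding E_def using h by (intro continuous_intros) auto
  qed
  have "\<bar>E 0\<bar> \<le> \<eta>" if \<eta>: "\<eta> > 0" for \<eta>
  proof -
    obtain d where d: "d > 0" "\<And>s. \<bar>s\<bar> < d \<Longrightarrow> \<bar>E s - E 0\<bar> < \<eta>"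
      using Ec \<eta> unfolding continuous_at_eps_delta by (auto simp: dist_real_def)
    define \<epsilon> where "\<epsilon> = min d (min (x - h) (T - x - h)) / 2"
    have e2: "min d (min (x - h) (T - x - h)) > 0" "min d (min (x - h) (T - x - h)) \<le> d"
      "min d (min (x - h) (T - x - h)) \<le> x - h" "min d (min (x - h) (T - x - h)) \<le> T - x - h"
      using d h by auto
    have \<epsilon>: "\<epsilon> > 0" "\<epsilon> < d" "h + \<epsilon> < x" "x + h + \<epsilon> < T"
      using e2 by (auto simp: \<epsilon>_def)
    obtain \<psi> where \<psi>: "test_function T \<psi>"
      "(deriv ^^ 2) \<psi> = (\<lambda>t. bump \<epsilon> (t - (x + h)) - 2 * bump \<epsilon> (t - x) + bump \<epsilon> (t - (x - h)))"
      using bump_test_function[OF \<epsilon>(1) h(1) \<epsilon>(3,4)] by blast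
    have hb: "has_bochner_integral lborel (\<lambda>t. D' t * bump \<epsilon> (t - c)) (LBINT s. D' (c + s) * bump \<epsilon> s)"
        and ib: "integrable lborel (\<lambda>s. D' (c + s) * bump \<epsilon> s)" for c
    proof -
      show i: "integrable lborel (\<lambda>s. D' (c + s) * bump \<epsilon> s)"
      proof (rule integrable_support)
        show "\<bar>D' (c + s) * bump \<epsilon> s\<bar> \<le> (M * 1) * indicator {- \<epsilon><..<\<epsilon>} s" for s
          unfolding abs_mult mult.assoc by (intro mult_mono D'b bump_abs M0) auto
      qed auto
      then have "has_bochner_integral lborel (\<lambda>s. D' (c + s) * bump \<epsilon> s) (LBINT s. D' (c + s) * bump \<epsilon> s)"
        by (rule has_bochner_integral_integrable)
      then show "has_bochner_integral lborel (\<lambda>t. D' t * bump \<epsilon> (t - c)) (LBINT s. D' (c + s) * bump \<epsilon> s)"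
        by (subst lborel_has_bochner_integral_real_affine_iff[of 1 _ _ c]) auto
    qed
    have "0 = (LBINT t. indicator {0<..<T} t * (D t * (deriv ^^ 2) \<psi> t))" using DB[OF \<psi>(1)] by simp
    also have "\<dots> = (LBINT t. D' t * bump \<epsilon> (t - (x + h)) - 2 * (D' t * bump \<epsilon> (t - x)) + D' t * bump \<epsilon> (t - (x - h)))"
      unfolding \<psi>(2) by (intro Bochner_Integration.integral_cong[OF refl]) (simp add: D'_def algebra_simps)
    also have "\<dots> = (LBINT s. D' (x + h + s) * bump \<epsilon> s) - 2 * (LBINT s. D' (x + s) * bump \<epsilon> s) + (LBINT s. D' (x - h + s) * bump \<epsilon> s)"
      by (intro has_bochner_integral_integral_eq has_bochner_integral_add has_bochner_integral_diff has_bochner_integral_mult_right hb)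
    also have "\<dots> = (LBINT s. D' (x + h + s) * bump \<epsilon> s - 2 * (D' (x + s) * bump \<epsilon> s) + D' (x - h + s) * bump \<epsilon> s)"
      by (intro has_bochner_integral_integral_eq[symmetric] has_bochner_integral_add has_bochner_integral_diff has_bochner_integral_mult_right
           has_bochner_integral_integrable ib)
    also have "\<dots> = (LBINT s. E s * bump \<epsilon> s)"
      by (intro Bochner_Integration.integral_cong[OF refl]) (simp add: E_def algebra_simps)
    finally have z: "(LBINT s. E s * bump \<epsilon> s) = 0" by simp
    have Eb: "\<bar>E s\<bar> \<le> 4 * M" for s
      unfolding E_def using D'b[of "x + h + s"] D'b[of "x + s"] D'b[of "x - h + s"] by linarith
    have i1: "integrable lborel (\<lambda>s. E s * bump \<epsilon> s)"
    proof (rule integrable_support)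
      show "\<bar>E s * bump \<epsilon> s\<bar> \<le> (4 * M * 1) * indicator {- \<epsilon><..<\<epsilon>} s" for s
        unfolding abs_mult mult.assoc[of "4 * M"] by (intro mult_mono Eb bump_abs) (use M0 in auto)
    qed auto
    have i2: "integrable lborel (bump \<epsilon>)" by (rule integrable_support[OF _ bump_abs]) auto
    have "(LBINT s. E 0 * bump \<epsilon> s - E s * bump \<epsilon> s) = E 0 * (LBINT s. bump \<epsilon> s)"
      using z i1 i2 by simp
    then have "\<bar>E 0\<bar> * (LBINT s. bump \<epsilon> s) = norm (LBINT s. E 0 * bump \<epsilon> s - E s * bump \<epsilon> s)"
      using bump_integral_pos[OF \<epsilon>(1)] by (simp add: abs_mult)
    also have "\<dots> \<le> (LBINT s. \<eta> * bump \<epsilon> s)"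
    proof (rule Bochner_Integration.integral_norm_bound_integral)
      show "norm (E 0 * bump \<epsilon> s - E s * bump \<epsilon> s) \<le> \<eta> * bump \<epsilon> s" for s
      proof (cases "s \<in> {- \<epsilon><..<\<epsilon>}")
        case True
        have "norm (E 0 * bump \<epsilon> s - E s * bump \<epsilon> s) = \<bar>E s - E 0\<bar> * bump \<epsilon> s"
          using bump_nonneg[of \<epsilon> s] by (simp add: abs_mult abs_minus_commute flip: left_diff_distrib)
        also have "\<dots> \<le> \<eta> * bump \<epsilon> s"
        proof (intro mult_right_mono bump_nonneg less_imp_le[OF d(2)])
          show "\<bar>s\<bar> < d" using True \<epsilon> by (simp add: abs_less_iff)
        qed
        finally show ?thesis .
      qed (simp add: bump_zero)
    qed (use i1 i2 in auto)
    also have "\<dots> = \<eta> * (LBINT s. bump \<epsilon> s)" by simp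
    finally show ?thesis
      by (subst (asm) mult_le_cancel_right_pos[OF bump_integral_pos[OF \<epsilon>(1)]])
  qed
  then have "\<bar>E 0\<bar> \<le> 0" by (rule field_le_epsilon) simp
  then show ?thesis using E0 by simp
qed

text \<open>A maximum principle. At a positive interior maximum \<open>c\<close> the midpoint identity, with step equal to the
  distance from \<open>c\<close> to the nearer end point, forces the maximum to be attained at that end point, where the function vanishes.\<close>

lemma midpoint_le_zero:
  fixes L :: "real \<Rightarrow> real"
  assumes T: "T > 0" and L: "continuous_on {0..T} L" "L 0 = 0" "L T = 0"
    and mid: "\<And>x h. 0 < h \<Longrightarrow> h < x \<Longrightarrow> x + h < T \<Longrightarrow> L (x + h) - 2 * L x + L (x - h) = 0"
    and t: "t \<in> {0..T}"
  shows "L t \<le> 0"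
proof (rule ccontr)
  assume "\<not> L t \<le> 0"
  obtain c where c: "c \<in> {0..T}" "\<And>s. s \<in> {0..T} \<Longrightarrow> L s \<le> L c"
    using continuous_attains_sup[OF _ _ L(1)] T by force
  have Lc: "L c > 0" using c(2)[OF t] \<open>\<not> L t \<le> 0\<close> by simp
  have c0: "0 < c" "c < T" using c(1) Lc L(2,3) by (auto simp: less_le)
  define d where "d = min c (T - c)"
  have d: "d > 0" "d \<le> c" "c + d \<le> T" "c - d = 0 \<or> c + d = T" using c0 by (auto simp: d_def)
  have cl: "closure {0<..<d} = {0..d}" using d by simp
  have "L (c + d) - 2 * L c + L (c - d) = 0"
  proof (rule continuous_constant_on_closure[of "{0<..<d}" "\<lambda>h. L (c + h) - 2 * L c + L (c - h)"])
    show "continuous_on (closure {0<..<d}) (\<lambda>h. L (c + h) - 2 * L c + L (c - h))"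
      unfolding cl using d by (intro continuous_intros continuous_on_compose2[OF L(1)]) auto
    show "L (c + h) - 2 * L c + L (c - h) = 0" if "h \<in> {0<..<d}" for h
      using that d by (intro mid) auto
    show "d \<in> closure {0<..<d}" unfolding cl using d by auto
  qed
  moreover have "L (c + d) \<le> L c" "L (c - d) \<le> L c" using d by (auto intro!: c(2))
  ultimately show False using d(4) L(2,3) Lc by auto
qed

text \<open>The lemma of du Bois-Reymond for second derivatives: after subtraction of the chord, the maximum principle
  applies to the difference and to its negative.\<close>

lemma distributionally_affine:
  fixes D :: "real \<Rightarrow> real"
  assumes T: "T > 0" and D: "continuous_on {0..T} D"
    and DB: "\<And>\<psi>. test_function T \<psi> \<Longrightarrow> (LBINT t. indicator {0<..<T} t * (D t * (deriv ^^ 2) \<psi> t)) = 0"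
    and t: "t \<in> {0..T}"
  shows "D t = D 0 + (D T - D 0) / T * t"
proof -
  define c where "c = (D T - D 0) / T"
  define L where "L t = D t - (D 0 + c * t)" for t
  have Lc: "continuous_on {0..T} L" unfolding L_def by (intro continuous_intros D)
  have L0: "L 0 = 0" "L T = 0" using T by (auto simp: L_def c_def)
  have mid: "L (x + h) - 2 * L x + L (x - h) = 0" if "0 < h" "h < x" "x + h < T" for x h
    using second_difference_zero[OF D DB that] by (simp add: L_def algebra_simps)
  have "L t \<le> 0" by (rule midpoint_le_zero[OF T Lc L0 mid t])
  moreover have "- L t \<le> 0"
  proof (rule midpoint_le_zero[OF T _ _ _ _ t, of "\<lambda>t. - L t"])
    show "- L (x + h) - 2 * - L x + - L (x - h) = 0" if "0 < h" "h < x" "x + h < T" for x h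
      using mid[OF that] by simp
  qed (use Lc L0 in \<open>auto intro: continuous_intros\<close>)
  ultimately show ?thesis by (simp add: L_def c_def)
qed

lemma RL_1: "RL 1 g t = (LBINT s. indicator {0<..<t} s * g s)"
proof -
  have "indicator {0<..<t} s * ((t - s) powr (1 - 1) * g s) = indicator {0<..<t} s * g s" for s
    by (cases "s < t") auto
  then show ?thesis unfolding RL_def by (simp only: Gamma_1 div_by_1)
qed

lemma RL_1_lipschitz:
  assumes g: "bdd_borel T g" and M: "\<And>t. t \<in> {0..T} \<Longrightarrow> \<bar>g t\<bar> \<le> M" and st: "0 \<le> s" "s \<le> t" "t \<le> T"
  shows "\<bar>RL 1 g t - RL 1 g s\<bar> \<le> M * (t - s)"
proof -
  note [measurable] = bdd_borel_measurable[OF g]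
  have "RL 1 g t - RL 1 g s = (LBINT x. indicator {0<..<t} x * g x - indicator {0<..<s} x * g x)"
    unfolding RL_1 using st by (intro Bochner_Integration.integral_diff[symmetric] integrable_bdd_borel bdd_borel_mono[OF g]) auto
  also have "norm \<dots> \<le> (LBINT x. M * indicator {s..t} x)"
  proof (rule Bochner_Integration.integral_norm_bound_integral)
    show "integrable lborel (\<lambda>x. indicator {0<..<t} x * g x - indicator {0<..<s} x * g x)"
      using st by (intro Bochner_Integration.integrable_diff integrable_bdd_borel bdd_borel_mono[OF g]) auto
    show "integrable lborel (\<lambda>x. M * indicator {s..t} x :: real)"
      using emeasure_bounded_finite[of "{s..t}"] by (intro integrable_mult_right integrable_real_indicator) auto
    show "norm (indicator {0<..<t} x * g x - indicator {0<..<s} x * g x) \<le> M * indicator {s..t} x" for x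
      using M[of x] st by (auto simp: indicator_def)
  qed
  also have "\<dots> = M * (t - s)" using st by simp
  finally show ?thesis by simp
qed

lemma RL_1_continuous:
  assumes g: "bdd_borel T g"
  shows "continuous_on {0..T} (RL 1 g)"
proof -
  obtain M where M: "M > 0" "\<And>t. t \<in> {0..T} \<Longrightarrow> \<bar>g t\<bar> \<le> M" using g by (rule bdd_borelE) blast
  have "\<bar>RL 1 g t - RL 1 g s\<bar> \<le> M * \<bar>t - s\<bar>" if "s \<in> {0..T}" "t \<in> {0..T}" for s t
    using RL_1_lipschitz[OF g M(2), of s t] RL_1_lipschitz[OF g M(2), of t s] that
    by (cases "s \<le> t") (auto simp: abs_minus_commute)
  then have "lipschitz_on M {0..T} (RL 1 g)"
    using M(1) by (intro lipschitz_onI) (auto simp: dist_real_def)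
  then show ?thesis by (rule lipschitz_on_continuous_on)
qed

text \<open>The positive and the negative part of \<open>g\<close> are densities of two measures that agree on all half lines, so
  they agree almost everywhere.\<close>

lemma RL_1_zero_imp_AE:
  assumes g: "bdd_borel T g" and 0: "\<And>t. t \<in> {0..T} \<Longrightarrow> RL 1 g t = 0" and T: "T > 0"
  shows "AE t in lborel. t \<in> {0<..<T} \<longrightarrow> g t = 0"
proof -
  note [measurable] = bdd_borel_measurable[OF g]
  let ?p = "\<lambda>t. indicator {0<..<T} t * max 0 (g t)"
  let ?n = "\<lambda>t. indicator {0<..<T} t * max 0 (- g t)"
  have bp: "bdd_borel T (\<lambda>t. indicator {x<..} t * max 0 (g t))" "bdd_borel T (\<lambda>t. indicator {x<..} t * max 0 (- g t))"
      "bdd_borel T (\<lambda>t. indicator {x<..} t * g t)" for x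
    using g unfolding bdd_borel_def by (auto simp: indicator_def max_def intro: exI split: if_splits) (smt (verit))+
  have e: "emeasure (density lborel f) {x<..} = ennreal (LBINT t. indicator {0<..<T} t * (indicator {x<..} t * k t))"
    if f: "f = (\<lambda>t. ennreal (indicator {0<..<T} t * k t))" and k: "\<And>t. k t \<ge> 0"
      and b: "bdd_borel T (\<lambda>t. indicator {x<..} t * k t)" and [measurable]: "k \<in> borel_measurable borel" for f k x
  proof -
    have "emeasure (density lborel f) {x<..} = (\<integral>\<^sup>+t. f t * indicator {x<..} t \<partial>lborel)"
      by (rule emeasure_density) (auto simp: f)
    also have "\<dots> = (\<integral>\<^sup>+t. ennreal (indicator {0<..<T} t * (indicator {x<..} t * k t)) \<partial>lborel)"
      by (intro nn_integral_cong) (auto simp: f indicator_def)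
    also have "\<dots> = ennreal (LBINT t. indicator {0<..<T} t * (indicator {x<..} t * k t))"
      by (rule nn_integral_eq_integral[OF integrable_bdd_borel[OF b]]) (use k in auto)
    finally show ?thesis .
  qed
  have z: "(LBINT t. indicator {0<..<T} t * (indicator {x<..} t * g t)) = 0" for x
  proof (cases "x \<in> {0..T}")
    case False
    then consider "x < 0" | "x > T" by force
    then show ?thesis
    proof cases
      case 1
      then have "(LBINT t. indicator {0<..<T} t * (indicator {x<..} t * g t)) = RL 1 g T"
        unfolding RL_1 by (intro Bochner_Integration.integral_cong[OF refl]) (auto simp: indicator_def)
      then show ?thesis using 0[of T] T by simp
    next
      case 2
      then have "(\<lambda>t. indicator {0<..<T} t * (indicator {x<..} t * g t)) = (\<lambda>t. 0)"
        by (auto simp: indicator_def)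
      then show ?thesis by simp
    qed
  next
    case True
    have "(LBINT t. indicator {0<..<T} t * (indicator {x<..} t * g t)) = (LBINT t. indicator {0<..<T} t * g t - indicator {0<..<x} t * g t)"
    proof (rule integral_cong_AE)
      show "AE t in lborel. indicator {0<..<T} t * (indicator {x<..} t * g t) = indicator {0<..<T} t * g t - indicator {0<..<x} t * g t"
        using AE_lborel_singleton[of x] by eventually_elim (use True in \<open>auto simp: indicator_def\<close>)
    qed auto
    also have "\<dots> = RL 1 g T - RL 1 g x" unfolding RL_1
      using True by (intro Bochner_Integration.integral_diff integrable_bdd_borel bdd_borel_mono[OF g]) auto
    finally show ?thesis using 0[of T] 0[OF True] T by simp
  qed
  have "density lborel (\<lambda>t. ennreal (?p t)) = density lborel (\<lambda>t. ennreal (?n t))"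
  proof (rule measure_eqI_lessThan)
    fix x
    have "(LBINT t. indicator {0<..<T} t * (indicator {x<..} t * max 0 (g t))) - (LBINT t. indicator {0<..<T} t * (indicator {x<..} t * max 0 (- g t)))
       = (LBINT t. indicator {0<..<T} t * (indicator {x<..} t * max 0 (g t)) - indicator {0<..<T} t * (indicator {x<..} t * max 0 (- g t)))"
      by (intro Bochner_Integration.integral_diff[symmetric] integrable_bdd_borel bp)
    also have "\<dots> = (LBINT t. indicator {0<..<T} t * (indicator {x<..} t * g t))"
      by (intro Bochner_Integration.integral_cong[OF refl]) (auto simp: indicator_def max_def)
    finally show "emeasure (density lborel (\<lambda>t. ennreal (?p t))) {x<..} = emeasure (density lborel (\<lambda>t. ennreal (?n t))) {x<..}"
      using z[of x] e[OF refl _ bp(1)[of x]] e[OF refl _ bp(2)[of x]] by simp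
    show "emeasure (density lborel (\<lambda>t. ennreal (?p t))) {x<..} < \<infinity>"
      using e[OF refl _ bp(1)[of x]] by simp
  qed auto
  then have "AE t in lborel. ennreal (?p t) = ennreal (?n t)"
    by (subst (asm) sigma_finite_measure.density_unique_iff[OF sigma_finite_lborel]) auto
  then show ?thesis
    by eventually_elim (auto simp: indicator_def max_def split: if_splits)
qed

text \<open>\<open>RL 2 w\<close> is a second primitive of \<open>w\<close>: after an application of Fubini's theorem this is an integration by parts against
  the compactly supported test function.\<close>

lemma RL_2_parts:
  assumes T: "T > 0" and w: "bdd_borel T w" and \<psi>: "test_function T \<psi>"
  shows "(LBINT t. indicator {0<..<T} t * (RL 2 w t * (deriv ^^ 2) \<psi> t)) = (LBINT t. indicator {0<..<T} t * (w t * \<psi> t))"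
proof -
  obtain M where M: "M > 0" "\<And>t. t \<in> {0..T} \<Longrightarrow> \<bar>w t\<bar> \<le> M" and [measurable]: "w \<in> borel_measurable borel"
    using w by (rule bdd_borelE) blast
  have sm: "\<And>k t. ((deriv ^^ k) \<psi>) differentiable (at t)" using \<psi> by (simp add: test_function_def smooth_def)
  define \<psi>1 where "\<psi>1 = deriv \<psi>"
  define \<psi>2 where "\<psi>2 = deriv \<psi>1"
  have d2: "(deriv ^^ 2) \<psi> = \<psi>2" by (simp add: \<psi>1_def \<psi>2_def numeral_2_eq_2)
  have D0: "(\<psi> has_real_derivative \<psi>1 t) (at t)" for t
    using sm[of 0 t] unfolding \<psi>1_def by (simp add: DERIV_deriv_iff_real_differentiable)
  have D1: "(\<psi>1 has_real_derivative \<psi>2 t) (at t)" for t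
    using sm[of 1 t] unfolding \<psi>2_def \<psi>1_def by (simp add: DERIV_deriv_iff_real_differentiable)
  have c2: "isCont \<psi>2 t" for t
    using sm[of 2 t] by (simp add: d2 differentiable_imp_continuous_within)
  have [measurable]: "\<psi>2 \<in> borel_measurable borel"
    using c2 by (intro borel_measurable_continuous_onI continuous_at_imp_continuous_on) auto
  have "compact (\<psi>2 ` {0..T})"
    using c2 by (intro compact_continuous_image continuous_at_imp_continuous_on) auto
  then obtain K where K: "\<And>t. t \<in> {0..T} \<Longrightarrow> \<bar>\<psi>2 t\<bar> \<le> K"
    using compact_imp_bounded bounded_iff by (metis imageI real_norm_def)
  have K0: "K \<ge> 0" using K[of 0] T by force
  obtain b where b: "b < T" "\<And>t. t > b \<Longrightarrow> \<psi> t = 0" using \<psi> by (force simp: test_function_def)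
  have \<psi>T: "\<psi> T = 0" using b by simp
  have \<psi>1T: "\<psi>1 T = 0"
  proof -
    have "\<forall>\<^sub>F y in nhds T. \<psi> y = 0"
      by (rule eventually_nhds_in_open[of "{b<..}" T, THEN eventually_mono]) (use b in auto)
    then have "(\<psi> has_real_derivative 0) (at T)"
      by (subst DERIV_cong_ev[OF refl _ refl, of _ "\<lambda>_. 0"]) auto
    then show ?thesis using D0 DERIV_unique by blast
  qed
  define F where "F = (\<lambda>(t, s). if 0 < s \<and> s < t \<and> t < T then (t - s) * w s * \<psi>2 t else 0)"
  have [measurable]: "F \<in> borel_measurable borel"
    unfolding F_def by (simp add: case_prod_beta' borel_prod[symmetric])
  have Fi: "integrable lborel F"
  proof (rule integrable_box)
    show "\<bar>F (t, s)\<bar> \<le> T * M * K * (indicator {0<..<T} t * indicator {0<..<T} s)" for t s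
    proof (cases "0 < s \<and> s < t \<and> t < T")
      case True
      then have "\<bar>(t - s) * w s * \<psi>2 t\<bar> \<le> T * M * K"
        unfolding abs_mult using M K K0 T by (intro mult_mono) auto
      then show ?thesis using True by (auto simp: F_def)
    next
      case False
      then show ?thesis using T M K0 by (auto simp: F_def)
    qed
  qed auto
  have "indicator {0<..<T} t * (RL 2 w t * \<psi>2 t) = (LBINT s. F (t, s))" for t
  proof (cases "0 < t \<and> t < T")
    case True
    have "(LBINT s. F (t, s)) = (LBINT s. \<psi>2 t * (indicator {0<..<t} s * ((t - s) powr (2 - 1) * w s)))"
      using True by (intro Bochner_Integration.integral_cong[OF refl]) (auto simp: F_def indicator_def)
    also have "\<dots> = \<psi>2 t * RL 2 w t" using Gamma_fact[of 1, where 'a=real] by (simp add: RL_def)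
    finally show ?thesis using True by simp
  next
    case False
    then have "(\<lambda>s. F (t, s)) = (\<lambda>s. 0)" by (auto simp: F_def)
    then show ?thesis using False by auto
  qed
  then have "(LBINT t. indicator {0<..<T} t * (RL 2 w t * \<psi>2 t)) = (LBINT t. LBINT s. F (t, s))" by simp
  also have "\<dots> = (LBINT s. LBINT t. F (t, s))" using integral_pair[OF Fi] by simp
  also have "\<dots> = (LBINT s. indicator {0<..<T} s * (w s * \<psi> s))"
  proof (rule Bochner_Integration.integral_cong[OF refl])
    fix s
    show "(LBINT t. F (t, s)) = indicator {0<..<T} s * (w s * \<psi> s)"
    proof (cases "0 < s \<and> s < T")
      case True
      have "(LBINT t. F (t, s)) = (LBINT t. w s * (((t - s) * \<psi>2 t) * indicator {s..T} t))"
      proof (rule integral_cong_AE)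
        show "AE t in lborel. F (t, s) = w s * (((t - s) * \<psi>2 t) * indicator {s..T} t)"
          using AE_lborel_singleton[of s] AE_lborel_singleton[of T]
          by eventually_elim (use True in \<open>auto simp: F_def indicator_def\<close>)
      qed auto
      also have "\<dots> = w s * (LBINT t. ((t - s) * \<psi>2 t) * indicator {s..T} t)" by simp
      also have "(LBINT t. ((t - s) * \<psi>2 t) * indicator {s..T} t) = ((T - s) * \<psi>1 T - \<psi> T) - ((s - s) * \<psi>1 s - \<psi> s)"
      proof (rule integral_FTC_Icc_real)
        show "((\<lambda>t. (t - s) * \<psi>1 t - \<psi> t) has_real_derivative (x - s) * \<psi>2 x) (at x)" for x
          by (rule derivative_eq_intros D0 D1 refl | simp add: algebra_simps)+
      qed (use True c2 in \<open>auto intro!: continuous_intros\<close>)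
      also have "\<dots> = \<psi> s" using \<psi>T \<psi>1T by simp
      finally show ?thesis using True by simp
    next
      case False
      then have "(\<lambda>t. F (t, s)) = (\<lambda>t. 0)" by (auto simp: F_def)
      then show ?thesis using False by auto
    qed
  qed
  finally show ?thesis unfolding d2 .
qed

text \<open>By \<open>RL_2_parts\<close> the difference \<open>D\<close> of \<open>RL (2 - \<alpha>) (RL 1 z')\<close> and \<open>RL 2 w\<close> has vanishing second distributional
  derivative, so it is affine. As \<open>z'\<close> is bounded, \<open>D\<close> is of order \<open>t\<^bsup>3-\<alpha>\<^esup> + t\<^sup>2\<close> at the origin, hence zero. By the semigroup law
  \<open>RL (2 - \<alpha>)\<close> also maps \<open>RL 1 z' - RL \<alpha> w\<close> to zero, and an application of \<open>RL (\<alpha> - 1)\<close> reduces its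
  injectivity to that of \<open>RL 1\<close>.\<close>

lemma caputo_equation_integrated:
  assumes \<alpha>: "1 < \<alpha>" "\<alpha> < 2" and T: "T > 0" and z': "bdd_borel T z'" and w: "bdd_borel T w"
    and eq: "\<And>\<psi>. test_function T \<psi> \<Longrightarrow>
       (LBINT t. indicator {0<..<T} t * (RL (2 - \<alpha>) (RL 1 z') t * (deriv ^^ 2) \<psi> t)) = (LBINT t. indicator {0<..<T} t * (w t * \<psi> t))"
  shows "\<forall>t\<in>{0..T}. RL 1 z' t = RL \<alpha> w t"
    and "\<forall>t\<in>{0..T}. RL (2 - \<alpha>) (RL 1 z') t = RL 2 w t"
    and "AE t in lborel. t \<in> {0<..<T} \<longrightarrow> RL (2 - \<alpha>) z' t = RL 1 w t"
proof -
  have a2: "2 - \<alpha> > 0" "\<alpha> - 1 > 0" using \<alpha> by auto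
  define p where "p = RL (2 - \<alpha>) z'"
  have p: "bdd_borel T p" unfolding p_def by (rule RL_bdd[OF z' a2(1)])
  have J1w: "bdd_borel T (RL 1 w)" by (rule RL_bdd[OF w]) simp
  have J1z: "bdd_borel T (RL 1 z')" by (rule RL_bdd[OF z']) simp
  have J2w: "bdd_borel T (RL 2 w)" by (rule RL_bdd[OF w]) simp
  define g where "g t = p t - RL 1 w t" for t
  have g: "bdd_borel T g" unfolding g_def by (intro bdd_borel_intros p J1w)
  define D where "D = RL 1 g"
  have P: "RL (2 - \<alpha>) (RL 1 z') t = RL 1 p t" if "t \<le> T" for t
    using RL_semigroup[OF z' a2(1), of 1 t] RL_semigroup[OF z' _ a2(1), of 1 t] that by (simp add: p_def add.commute)
  have Dt: "D t = RL (2 - \<alpha>) (RL 1 z') t - RL 2 w t" if "t \<le> T" for t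
    using RL_diff[OF p J1w, of 1 t] RL_semigroup[OF w, of 1 1 t] P that by (simp add: D_def g_def[abs_def])
  have Dc: "continuous_on {0..T} D" unfolding D_def by (rule RL_1_continuous[OF g])
  have DB: "(LBINT t. indicator {0<..<T} t * (D t * (deriv ^^ 2) \<psi> t)) = 0" if \<psi>: "test_function T \<psi>" for \<psi>
  proof -
    have sm: "\<And>t. ((deriv ^^ 2) \<psi>) differentiable (at t)" using \<psi> by (simp add: test_function_def smooth_def)
    have c2: "isCont ((deriv ^^ 2) \<psi>) t" for t using sm[of t] by (simp add: differentiable_imp_continuous_within)
    have "compact ((deriv ^^ 2) \<psi> ` {0..T})"
      using c2 by (intro compact_continuous_image continuous_at_imp_continuous_on) auto
    then obtain K where K: "\<And>t. t \<in> {0..T} \<Longrightarrow> \<bar>(deriv ^^ 2) \<psi> t\<bar> \<le> K"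
      using compact_imp_bounded bounded_iff by (metis imageI real_norm_def)
    have b: "bdd_borel T ((deriv ^^ 2) \<psi>)"
      using c2 by (intro bdd_borelI[OF _ K] borel_measurable_continuous_onI continuous_at_imp_continuous_on) auto
    have "(LBINT t. indicator {0<..<T} t * (D t * (deriv ^^ 2) \<psi> t))
       = (LBINT t. indicator {0<..<T} t * (RL (2 - \<alpha>) (RL 1 z') t * (deriv ^^ 2) \<psi> t) - indicator {0<..<T} t * (RL 2 w t * (deriv ^^ 2) \<psi> t))"
      by (intro Bochner_Integration.integral_cong[OF refl]) (auto simp: Dt indicator_def algebra_simps)
    also have "\<dots> = (LBINT t. indicator {0<..<T} t * (RL (2 - \<alpha>) (RL 1 z') t * (deriv ^^ 2) \<psi> t)) - (LBINT t. indicator {0<..<T} t * (RL 2 w t * (deriv ^^ 2) \<psi> t))"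
      by (intro Bochner_Integration.integral_diff integrable_bdd_borel bdd_borel_mult b J2w RL_bdd[OF J1z a2(1)])
    also have "\<dots> = 0" using eq[OF \<psi>] RL_2_parts[OF T w \<psi>] by simp
    finally show ?thesis .
  qed
  have D0: "D 0 = 0" by (simp add: D_def RL_nonpos)
  have aff: "D t = D T / T * t" if "t \<in> {0..T}" for t
    using distributionally_affine[OF T Dc DB that] D0 by simp
  obtain M where M: "M > 0" "\<And>t. t \<in> {0..T} \<Longrightarrow> \<bar>z' t\<bar> \<le> M" using z' by (rule bdd_borelE) blast
  obtain K where K: "K > 0" "\<And>t. t \<in> {0..T} \<Longrightarrow> \<bar>w t\<bar> \<le> K" using w by (rule bdd_borelE) blast
  \<comment> \<open>An affine function without constant term is zero if it vanishes to higher than first order at the origin; both terms of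
    \<open>D\<close> do.\<close>
  have small: "\<bar>D T / T\<bar> \<le> M / Gamma (3 - \<alpha>) * t powr (2 - \<alpha>) + K / 2 * t" if t: "t \<in> {0<..<T}" for t
  proof -
    have "\<bar>RL 1 z' s\<bar> \<le> M * t" if "s \<in> {0<..<t}" for s
    proof -
      have "\<bar>RL 1 z' s - RL 1 z' 0\<bar> \<le> M * (s - 0)"
        using that t by (intro RL_1_lipschitz[OF z' M(2)]) auto
      also have "\<dots> \<le> M * t" using that M by auto
      finally show ?thesis by (simp add: RL_nonpos)
    qed
    then have 1: "\<bar>RL (2 - \<alpha>) (RL 1 z') t\<bar> \<le> M * t * (t powr (2 - \<alpha>) / Gamma (2 - \<alpha> + 1))"
      using t by (intro RL_abs_le[OF J1z a2(1)]) auto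
    have 2: "\<bar>RL 2 w t\<bar> \<le> K * (t powr 2 / Gamma (2 + 1))"
      using t K by (intro RL_abs_le[OF w]) auto
    have G: "Gamma (2 + 1 :: real) = 2" using Gamma_fact[of 2, where 'a=real] by simp
    have "\<bar>D T / T\<bar> * t = \<bar>D t\<bar>" using aff[of t] t by (simp add: abs_mult)
    also have "\<dots> \<le> M * t * (t powr (2 - \<alpha>) / Gamma (2 - \<alpha> + 1)) + K * (t powr 2 / Gamma (2 + 1))"
      using 1 2 Dt[of t] t by auto
    also have "\<dots> = (M / Gamma (3 - \<alpha>) * t powr (2 - \<alpha>) + K / 2 * t) * t"
      unfolding G using t by (simp add: algebra_simps power2_eq_square)
    finally show ?thesis using t by (subst (asm) mult_le_cancel_right_pos) auto
  qed
  have "((\<lambda>t. M / Gamma (3 - \<alpha>) * t powr (2 - \<alpha>) + K / 2 * t) \<longlongrightarrow> M / Gamma (3 - \<alpha>) * 0 + K / 2 * 0) (at_right 0)"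
  proof (intro tendsto_add tendsto_mult tendsto_const)
    have "((\<lambda>t. t powr (2 - \<alpha>)) \<longlongrightarrow> 0 powr (2 - \<alpha>)) (at_right (0::real))"
      using a2 by (intro tendsto_powr2 tendsto_const tendsto_ident_at) (auto intro: eventually_at_rightI[of 0 1])
    then show "((\<lambda>t. t powr (2 - \<alpha>)) \<longlongrightarrow> 0) (at_right (0::real))" by simp
  qed auto
  moreover have "\<forall>\<^sub>F t in at_right 0. \<bar>D T / T\<bar> \<le> M / Gamma (3 - \<alpha>) * t powr (2 - \<alpha>) + K / 2 * t"
    using small T by (intro eventually_at_rightI[of 0 T]) auto
  ultimately have "\<bar>D T / T\<bar> \<le> M / Gamma (3 - \<alpha>) * 0 + K / 2 * 0"
    by (rule tendsto_lowerbound) simp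
  then have "D T = 0" using T by (simp add: divide_le_0_iff)
  then have Dz: "D t = 0" if "t \<in> {0..T}" for t using aff[OF that] by simp
  have 2: "RL (2 - \<alpha>) (RL 1 z') t = RL 2 w t" if "t \<in> {0..T}" for t
    using Dz[OF that] Dt[of t] that by simp
  have 3: "AE t in lborel. t \<in> {0<..<T} \<longrightarrow> RL (2 - \<alpha>) z' t = RL 1 w t"
  proof -
    have "AE t in lborel. t \<in> {0<..<T} \<longrightarrow> g t = 0"
      by (rule RL_1_zero_imp_AE[OF g _ T]) (use Dz in \<open>simp add: D_def\<close>)
    then show ?thesis by eventually_elim (simp add: g_def p_def)
  qed
  \<comment> \<open>\<open>RL (\<alpha> - 1)\<close> and \<open>RL (2 - \<alpha>)\<close> compose to \<open>RL 1\<close>, so injectivity of \<open>RL 1\<close> implies that of \<open>RL (2 - \<alpha>)\<close>.\<close>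
  define m where "m t = z' t - RL (\<alpha> - 1) w t" for t
  have Jw: "bdd_borel T (RL (\<alpha> - 1) w)" by (rule RL_bdd[OF w a2(2)])
  have m: "bdd_borel T m" unfolding m_def by (intro bdd_borel_intros z' Jw)
  have k: "RL 1 m t = RL 1 z' t - RL \<alpha> w t" if "t \<le> T" for t
    using RL_diff[OF z' Jw, of 1 t] RL_semigroup[OF w _ a2(2), of 1 t] that by (simp add: m_def[abs_def])
  have J1m: "bdd_borel T (RL 1 m)" by (rule RL_bdd[OF m]) simp
  have Jaw: "bdd_borel T (RL \<alpha> w)" by (rule RL_bdd[OF w]) (use \<alpha> in simp)
  have "RL (2 - \<alpha>) (RL 1 m) t = 0" if "t \<in> {0..T}" for t
  proof -
    have "RL (2 - \<alpha>) (RL 1 m) t = RL (2 - \<alpha>) (\<lambda>s. RL 1 z' s - RL \<alpha> w s) t"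
      using that k by (intro RL_cong) auto
    also have "\<dots> = RL (2 - \<alpha>) (RL 1 z') t - RL (2 - \<alpha>) (RL \<alpha> w) t"
      using that by (intro RL_diff[OF J1z Jaw a2(1)]) auto
    also have "\<dots> = 0" using 2[OF that] RL_semigroup[OF w a2(1), of \<alpha> t] that \<alpha> by simp
    finally show ?thesis .
  qed
  then have "RL (\<alpha> - 1) (RL (2 - \<alpha>) (RL 1 m)) t = RL (\<alpha> - 1) (\<lambda>s. 0) t" if "t \<in> {0..T}" for t
    using that by (intro RL_cong) simp
  then have "RL 1 (RL 1 m) t = 0" if "t \<in> {0..T}" for t
    using RL_semigroup[OF J1m a2(2,1), of t] that by (simp add: RL_def[of _ "\<lambda>s. 0"])
  then have ae: "AE t in lborel. t \<in> {0<..<T} \<longrightarrow> RL 1 m t = 0"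
    by (rule RL_1_zero_imp_AE[OF J1m _ T])
  have cm: "continuous_on {0..T} (RL 1 m)" by (rule RL_1_continuous[OF m])
  have zero: "RL 1 m t = 0" if t: "t \<in> {0<..<T}" for t
  proof (rule ccontr)
    assume n: "RL 1 m t \<noteq> 0"
    have "isCont (RL 1 m) t" using cm t by (metis continuous_on_interior interior_atLeastAtMost_real)
    then have "\<forall>\<^sub>F s in at t. RL 1 m s \<noteq> 0"
      using n by (intro tendsto_imp_eventually_ne[of _ "RL 1 m t"]) (simp_all add: isCont_def)
    then obtain d where d: "d > 0" "\<And>s. s \<noteq> t \<Longrightarrow> dist s t < d \<Longrightarrow> RL 1 m s \<noteq> 0"
      unfolding eventually_at by auto
    define d' where "d' = min d (T - t)"
    have "AE s in lborel. s \<notin> {t<..<t + d'}"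
      using ae by eventually_elim (use d t in \<open>auto simp: d'_def dist_real_def\<close>)
    from AE_not_in_Ioo[OF this] show False using d t by (auto simp: d'_def)
  qed
  have fin: "RL 1 m t = 0" if "t \<in> {0..T}" for t
  proof (rule continuous_constant_on_closure[of "{0<..<T}" "RL 1 m" 0 t])
    show "continuous_on (closure {0<..<T}) (RL 1 m)" using cm T by simp
    show "t \<in> closure {0<..<T}" using that T by simp
  qed (use zero in auto)
  have 1: "RL 1 z' t = RL \<alpha> w t" if t: "t \<in> {0..T}" for t
  proof -
    have "t \<le> T" using t by simp
    from k[OF this] fin[OF t] show ?thesis by linarith
  qed
  show "\<forall>t\<in>{0..T}. RL 1 z' t = RL \<alpha> w t" "\<forall>t\<in>{0..T}. RL (2 - \<alpha>) (RL 1 z') t = RL 2 w t"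
    "AE t in lborel. t \<in> {0<..<T} \<longrightarrow> RL (2 - \<alpha>) z' t = RL 1 w t"
    using 1 2 3 by blast+
qed

section \<open>Integrability of the norm of \<open>A u\<close>, mode by mode\<close>

text \<open>Young's inequality \<open>\<surd>x \<le> \<epsilon> x / 2 + 1 / (2 \<epsilon>)\<close> in the extended non-negative reals. With \<open>\<epsilon>\<close> adapted to a dyadic
  block it takes the place of the Cauchy-Schwarz inequality in time.\<close>

lemma epow_half_le:
  assumes "\<epsilon> > 0"
  shows "epow x (1/2) \<le> ennreal (\<epsilon> / 2) * x + ennreal (1 / (2 * \<epsilon>))"
proof (cases "x = top")
  case True
  then show ?thesis using assms by (simp add: ennreal_mult_top)
next
  case False
  define r where "r = enn2real x"
  have x: "x = ennreal r" "r \<ge> 0" using False by (auto simp: r_def less_top)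
  have "sqrt r \<le> \<epsilon> / 2 * r + 1 / (2 * \<epsilon>)"
  proof -
    have "0 \<le> (\<epsilon> * sqrt r - 1)\<^sup>2" by simp
    also have "\<dots> = \<epsilon>\<^sup>2 * r - 2 * \<epsilon> * sqrt r + 1" using x(2) by (simp add: power2_diff power_mult_distrib)
    finally have "2 * \<epsilon> * sqrt r \<le> \<epsilon>\<^sup>2 * r + 1" by simp
    then have "sqrt r \<le> (\<epsilon>\<^sup>2 * r + 1) / (2 * \<epsilon>)" using assms by (simp add: field_simps)
    also have "\<dots> = \<epsilon> / 2 * r + 1 / (2 * \<epsilon>)" using assms by (simp add: field_simps power2_eq_square)
    finally show ?thesis .
  qed
  then show ?thesis using assms x
    by (simp add: epow_def powr_half_sqrt flip: ennreal_mult ennreal_plus)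
qed

text \<open>The data of a weak solution that enter the estimates: the coefficients \<open>y n\<close> of the solution, \<open>y' n\<close> of its time
  derivative and \<open>F n\<close> of the nonlinearity, with the equation in distributional form. The constants \<open>M1\<close>, \<open>M2\<close>, \<open>M3\<close> bound the
  solution in \<open>V\<^bsub>1/\<alpha>\<^esub>\<close>, its time derivative in \<open>L\<^sup>2\<close> and the nonlinearity in \<open>L\<^sup>2\<close>.\<close>

locale modes =
  fixes \<alpha> T :: real and ev :: "nat \<Rightarrow> real" and y y' F :: "nat \<Rightarrow> real \<Rightarrow> real" and M1 M2 M3 :: real
  assumes \<alpha>: "1 < \<alpha>" "\<alpha> < 2" and T: "0 < T" and ev: "\<And>n. 0 < ev n"
    and y'_bdd: "\<And>n. bdd_borel T (y' n)" and F_bdd: "\<And>n. bdd_borel T (F n)" and y_bdd: "\<And>n. bdd_borel T (y n)"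
    and y_J: "\<And>n t. t \<in> {0..T} \<Longrightarrow> y n t = y n 0 + RL 1 (y' n) t"
    and eq: "\<And>n \<psi>. test_function T \<psi> \<Longrightarrow>
       (LBINT t. indicator {0<..<T} t * (RL (2 - \<alpha>) (\<lambda>t. y n t - y n 0 - t * y' n 0) t * (deriv ^^ 2) \<psi> t))
       = (LBINT t. indicator {0<..<T} t * ((F n t - ev n * y n t) * \<psi> t))"
    and M1: "\<And>N t. t \<in> {0..T} \<Longrightarrow> (\<Sum>n<N. ev n powr (2 / \<alpha>) * (y n t)\<^sup>2) \<le> M1"
    and M2: "\<And>N t. t \<in> {0..T} \<Longrightarrow> (\<Sum>n<N. (y' n t)\<^sup>2) \<le> M2"
    and M3: "\<And>N t. t \<in> {0..T} \<Longrightarrow> (\<Sum>n<N. (F n t)\<^sup>2) \<le> M3"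
begin

definition w :: "nat \<Rightarrow> real \<Rightarrow> real" where "w n t = F n t - ev n * y n t"
definition z' :: "nat \<Rightarrow> real \<Rightarrow> real" where "z' n t = y' n t - y' n 0"
definition Q :: "nat \<Rightarrow> real \<Rightarrow> real" where
  "Q n t = t\<^sup>2 * F n t + RL (2 - \<alpha>) (\<lambda>s. 2 * y n 0 + 6 * y' n 0 * s) t
     + 2 * \<alpha> * (t * RL 1 (w n) t - RL 2 (w n) t) + \<alpha> * (\<alpha> + 1) * RL 2 (w n) t"

lemma w_bdd: "bdd_borel T (w n)" unfolding w_def by (intro bdd_borel_intros F_bdd y_bdd)
lemma z'_bdd: "bdd_borel T (z' n)" unfolding z'_def by (intro bdd_borel_intros y'_bdd)

lemma Q_bdd: "bdd_borel T (Q n)"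
proof -
  have "bdd_borel T (RL (2 - \<alpha>) (\<lambda>s. 2 * y n 0 + 6 * y' n 0 * s))" "bdd_borel T (RL 1 (w n))" "bdd_borel T (RL 2 (w n))"
    using \<alpha> by (auto intro!: RL_bdd bdd_borel_intros w_bdd)
  then show ?thesis unfolding Q_def by (intro bdd_borel_intros F_bdd)
qed

lemma z_eq: "t \<in> {0..T} \<Longrightarrow> y n t - y n 0 - t * y' n 0 = RL 1 (z' n) t"
proof -
  assume t: "t \<in> {0..T}"
  have "RL 1 (z' n) t = RL 1 (y' n) t - RL 1 (\<lambda>s. y' n 0 * 1) t"
    unfolding z'_def using t by (subst RL_diff[of T, symmetric]) (auto intro!: y'_bdd bdd_borel_const)
  also have "RL 1 (\<lambda>s. y' n 0 * 1) t = y' n 0 * t" using t by (subst RL_cmult) (simp add: RL_1)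
  finally show ?thesis using y_J[OF t, of n] by simp
qed

lemma integrated:
  shows "t \<in> {0..T} \<Longrightarrow> RL 1 (z' n) t = RL \<alpha> (w n) t"
    and "t \<in> {0..T} \<Longrightarrow> RL (2 - \<alpha>) (RL 1 (z' n)) t = RL 2 (w n) t"
    and "AE t in lborel. t \<in> {0<..<T} \<longrightarrow> RL (2 - \<alpha>) (z' n) t = RL 1 (w n) t"
proof -
  have e: "(LBINT t. indicator {0<..<T} t * (RL (2 - \<alpha>) (RL 1 (z' n)) t * (deriv ^^ 2) \<psi> t)) = (LBINT t. indicator {0<..<T} t * (w n t * \<psi> t))"
    if "test_function T \<psi>" for \<psi>
  proof -
    have "RL (2 - \<alpha>) (RL 1 (z' n)) t = RL (2 - \<alpha>) (\<lambda>t. y n t - y n 0 - t * y' n 0) t" if "t \<in> {0<..<T}" for t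
      using that by (intro RL_cong) (simp add: z_eq)
    then have "(LBINT t. indicator {0<..<T} t * (RL (2 - \<alpha>) (RL 1 (z' n)) t * (deriv ^^ 2) \<psi> t))
      = (LBINT t. indicator {0<..<T} t * (RL (2 - \<alpha>) (\<lambda>t. y n t - y n 0 - t * y' n 0) t * (deriv ^^ 2) \<psi> t))"
      by (intro Bochner_Integration.integral_cong[OF refl]) (auto simp: indicator_def)
    then show ?thesis using eq[OF that, of n] by (simp add: w_def)
  qed
  note C = caputo_equation_integrated[OF \<alpha> T z'_bdd w_bdd e]
  show "t \<in> {0..T} \<Longrightarrow> RL 1 (z' n) t = RL \<alpha> (w n) t" using C(1) by blast
  show "t \<in> {0..T} \<Longrightarrow> RL (2 - \<alpha>) (RL 1 (z' n)) t = RL 2 (w n) t" using C(2) by blast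
  show "AE t in lborel. t \<in> {0<..<T} \<longrightarrow> RL (2 - \<alpha>) (z' n) t = RL 1 (w n) t" by (rule C(3))
qed

text \<open>By \<open>weighted_equation\<close> the function \<open>W = Q - \<lambda>\<^sub>n t\<^sup>2 y\<^sub>n\<close> satisfies \<open>t\<^sup>2 y\<^sub>n = RL \<alpha> W\<close>, that is
  \<open>W + \<lambda>\<^sub>n RL \<alpha> W = Q\<close>, and maximal regularity applies.\<close>

lemma mode_energy:
  assumes R: "0 < R" "R \<le> T"
  shows "(LBINT t. indicator {0<..<R} t * (ev n * (t\<^sup>2 * y n t))\<^sup>2)
     \<le> 2 * (1 + mreg_const \<alpha>) * (LBINT t. indicator {0<..<R} t * (Q n t)\<^sup>2)"
proof -
  define W where "W t = Q n t - ev n * (t\<^sup>2 * y n t)" for t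
  have bW: "bdd_borel R W" unfolding W_def
    by (intro bdd_borel_mono[OF _ R(2)] bdd_borel_intros Q_bdd y_bdd)
  have W1: "W s = s\<^sup>2 * w n s + RL (2 - \<alpha>) (\<lambda>s. 2 * y n 0 + 6 * y' n 0 * s) s
     + 2 * \<alpha> * (s * RL 1 (w n) s - RL 2 (w n) s) + \<alpha> * (\<alpha> + 1) * RL 2 (w n) s" for s
    by (simp add: W_def Q_def w_def algebra_simps)
  have "t\<^sup>2 * y n t = RL \<alpha> W t" if "t \<in> {0..T}" for t
  proof -
    have "y n t = y n 0 + y' n 0 * t + RL \<alpha> (w n) t"
      using z_eq[OF that, of n] integrated(1)[OF that, of n] by (simp add: mult.commute)
    from weighted_equation[OF \<alpha> w_bdd _ _ this] that show ?thesis
      unfolding W1[abs_def] by simp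
  qed
  then have WQ: "W t + ev n * RL \<alpha> W t = Q n t" if "t \<in> {0..T}" for t
    using that by (simp add: W_def)
  have "(LBINT t. indicator {0<..<R} t * (W t)\<^sup>2)
     \<le> mreg_const \<alpha> * (LBINT t. indicator {0<..<R} t * (W t + ev n * RL \<alpha> W t)\<^sup>2)"
    using \<alpha> by (intro maximal_regularity bW ev) auto
  also have "(LBINT t. indicator {0<..<R} t * (W t + ev n * RL \<alpha> W t)\<^sup>2) = (LBINT t. indicator {0<..<R} t * (Q n t)\<^sup>2)"
    using WQ R by (intro Bochner_Integration.integral_cong[OF refl]) (auto simp: indicator_def)
  finally have m: "(LBINT t. indicator {0<..<R} t * (W t)\<^sup>2) \<le> mreg_const \<alpha> * (LBINT t. indicator {0<..<R} t * (Q n t)\<^sup>2)" .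
  have bQ: "bdd_borel R (Q n)" by (rule bdd_borel_mono[OF Q_bdd R(2)])
  have yb: "bdd_borel R (y n)" by (rule bdd_borel_mono[OF y_bdd R(2)])
  have iW: "integrable lborel (\<lambda>t. indicator {0<..<R} t * (W t)\<^sup>2)" by (intro integrable_bdd_borel bdd_borel_intros bW)
  have iQ: "integrable lborel (\<lambda>t. indicator {0<..<R} t * (Q n t)\<^sup>2)" by (intro integrable_bdd_borel bdd_borel_intros bQ)
  have "(LBINT t. indicator {0<..<R} t * (ev n * (t\<^sup>2 * y n t))\<^sup>2)
    \<le> (LBINT t. 2 * (indicator {0<..<R} t * (Q n t)\<^sup>2) + 2 * (indicator {0<..<R} t * (W t)\<^sup>2))"
  proof (rule integral_mono)
    show "integrable lborel (\<lambda>t. indicator {0<..<R} t * (ev n * (t\<^sup>2 * y n t))\<^sup>2)"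
      by (intro integrable_bdd_borel bdd_borel_intros yb)
    show "integrable lborel (\<lambda>t. 2 * (indicator {0<..<R} t * (Q n t)\<^sup>2) + 2 * (indicator {0<..<R} t * (W t)\<^sup>2))"
      using iW iQ by auto
    show "indicator {0<..<R} t * (ev n * (t\<^sup>2 * y n t))\<^sup>2 \<le> 2 * (indicator {0<..<R} t * (Q n t)\<^sup>2) + 2 * (indicator {0<..<R} t * (W t)\<^sup>2)" for t
    proof -
      have "(ev n * (t\<^sup>2 * y n t))\<^sup>2 = (Q n t - W t)\<^sup>2" by (simp add: W_def)
      also have "\<dots> \<le> 2 * (Q n t)\<^sup>2 + 2 * (W t)\<^sup>2"
        using zero_le_power2[of "Q n t + W t"] by (simp add: power2_diff power2_sum)
      finally show ?thesis by (auto simp: indicator_def)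
    qed
  qed
  also have "\<dots> = 2 * (LBINT t. indicator {0<..<R} t * (Q n t)\<^sup>2) + 2 * (LBINT t. indicator {0<..<R} t * (W t)\<^sup>2)"
    using iW iQ by simp
  finally show ?thesis using m by (simp add: algebra_simps)
qed

text \<open>The numerical factors arise from \<open>(a + b + c + d)\<^sup>2 \<le> 4 (a\<^sup>2 + b\<^sup>2 + c\<^sup>2 + d\<^sup>2)\<close> and the bounds for the four terms of
  \<open>Q\<close> in \<open>Q_sum\<close>.\<close>

definition CQ :: real where
  "CQ = 4 * (T powr (2 * \<alpha> - 2) * M3 + (8 * M1 + 152 * M2) / (Gamma (3 - \<alpha>))\<^sup>2)"

lemma M_nonneg: "0 \<le> M1" "0 \<le> M2" "0 \<le> M3"
  using M1[of 0 0] M2[of 0 0] M3[of 0 0] T by auto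

lemma mreg_const_ge_1: "mreg_const \<alpha> \<ge> 1" by (simp add: mreg_const_def)

text \<open>The eigenvalues in \<open>w\<close> are unbounded, but \<open>RL 1 w\<close> and \<open>RL 2 w\<close> are also fractional integrals of order \<open>2 - \<alpha>\<close> of
  \<open>y' - y'(0)\<close> and of its primitive, by \<open>integrated\<close>. So they are bounded in \<open>L\<^sup>2\<close> uniformly in the number of
  modes. The initial value \<open>y(0)\<close> has to be of order \<open>R\<close>. This is where the restriction to modes with
  \<open>\<lambda> R\<^bsup>\<alpha>\<^esup> \<ge> 1\<close> enters: on these, \<open>1 \<le> R\<^sup>2 \<lambda>\<^bsup>2/\<alpha>\<^esup>\<close>.\<close>

lemma Q_sum:
  assumes R: "0 < R" "R \<le> T" and S: "finite S" "\<And>n. n \<in> S \<Longrightarrow> 1 \<le> ev n * R powr \<alpha>"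
  shows "AE t in lborel. t \<in> {0<..<R} \<longrightarrow> (\<Sum>n\<in>S. (Q n t)\<^sup>2) \<le> CQ * R powr (6 - 2 * \<alpha>)"
proof -
  have "AE t in lborel. \<forall>n\<in>S. t \<in> {0<..<T} \<longrightarrow> RL (2 - \<alpha>) (z' n) t = RL 1 (w n) t"
    using integrated(3) by (intro AE_finite_allI S(1)) auto
  then show ?thesis
  proof eventually_elim
    case (elim t)
    show ?case
    proof
      assume t: "t \<in> {0<..<R}"
      obtain N where N: "S \<subseteq> {..<N}" using S(1) finite_nat_iff_bounded by blast
      define k where "k = R powr (2 - \<alpha>) / Gamma (3 - \<alpha>)"
      have G: "Gamma (3 - \<alpha>) > 0" using \<alpha> by simp
      have k: "k \<ge> 0" using G by (simp add: k_def)
      have kt: "(s powr (2 - \<alpha>) / Gamma (2 - \<alpha> + 1))\<^sup>2 \<le> k\<^sup>2" if "0 \<le> s" "s \<le> R" for s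
      proof -
        have "2 - \<alpha> + 1 = 3 - \<alpha>" by simp
        then have "s powr (2 - \<alpha>) / Gamma (2 - \<alpha> + 1) \<le> k"
          using that \<alpha> G unfolding k_def by (auto intro!: divide_right_mono powr_mono2)
        then show ?thesis using G \<open>2 - \<alpha> + 1 = 3 - \<alpha>\<close> by (intro power_mono) auto
      qed
      have sub: "(\<Sum>n\<in>S. f n) \<le> (\<Sum>n<N. f n)" if "\<And>n. 0 \<le> f n" for f :: "nat \<Rightarrow> real"
        by (rule sum_mono2) (use N that in auto)
      have y'S: "(\<Sum>n\<in>S. (y' n s)\<^sup>2) \<le> M2" if "s \<in> {0..T}" for s
        using sub[of "\<lambda>n. (y' n s)\<^sup>2"] M2[OF that, of N] by simp
      have z'S: "(\<Sum>n\<in>S. (z' n s)\<^sup>2) \<le> 4 * M2" if s: "s \<in> {0..T}" for s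
      proof -
        have "(\<Sum>n\<in>S. (z' n s)\<^sup>2) \<le> (\<Sum>n\<in>S. 2 * (y' n s)\<^sup>2 + 2 * (y' n 0)\<^sup>2)"
        proof (rule sum_mono)
          fix n
          show "(z' n s)\<^sup>2 \<le> 2 * (y' n s)\<^sup>2 + 2 * (y' n 0)\<^sup>2"
            using zero_le_power2[of "y' n s + y' n 0"] by (simp add: z'_def power2_diff power2_sum)
        qed
        also have "\<dots> = 2 * (\<Sum>n\<in>S. (y' n s)\<^sup>2) + 2 * (\<Sum>n\<in>S. (y' n 0)\<^sup>2)"
          by (simp add: sum.distrib sum_distrib_left)
        finally show ?thesis using y'S[OF s] y'S[of 0] T by simp
      qed
      \<comment> \<open>The restriction to \<open>1 \<le> \<lambda> R\<^bsup>\<alpha>\<^esup>\<close> trades a factor \<open>R\<^sup>2\<close> for the weight of \<open>V\<^bsub>1/\<alpha>\<^esub>\<close>.\<close>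
      have a0: "(\<Sum>n\<in>S. (y n 0)\<^sup>2) \<le> R\<^sup>2 * M1"
      proof -
        have "(y n 0)\<^sup>2 \<le> R\<^sup>2 * (ev n powr (2 / \<alpha>) * (y n 0)\<^sup>2)" if n: "n \<in> S" for n
        proof -
          have "1 = 1 powr (2 / \<alpha>)" by simp
          also have "\<dots> \<le> (ev n * R powr \<alpha>) powr (2 / \<alpha>)"
            using S(2)[OF n] \<alpha> by (intro powr_mono2) auto
          also have "\<dots> = ev n powr (2 / \<alpha>) * R\<^sup>2"
            using ev[of n] R \<alpha> by (simp add: powr_mult powr_powr)
          finally have "1 * (y n 0)\<^sup>2 \<le> (ev n powr (2 / \<alpha>) * R\<^sup>2) * (y n 0)\<^sup>2" by (intro mult_right_mono) auto
          then show ?thesis by (simp add: mult_ac)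
        qed
        then have "(\<Sum>n\<in>S. (y n 0)\<^sup>2) \<le> R\<^sup>2 * (\<Sum>n\<in>S. ev n powr (2 / \<alpha>) * (y n 0)\<^sup>2)"
          unfolding sum_distrib_left by (rule sum_mono)
        also have "\<dots> \<le> R\<^sup>2 * M1"
          using sub[of "\<lambda>n. ev n powr (2 / \<alpha>) * (y n 0)\<^sup>2"] M1[of 0 N] T by (intro mult_left_mono) auto
        finally show ?thesis .
      qed
      have q1: "(\<Sum>n\<in>S. (t\<^sup>2 * F n t)\<^sup>2) \<le> R ^ 4 * M3"
      proof -
        have "(\<Sum>n\<in>S. (t\<^sup>2 * F n t)\<^sup>2) = t ^ 4 * (\<Sum>n\<in>S. (F n t)\<^sup>2)"
          by (simp add: power_mult_distrib sum_distrib_left flip: power_mult)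
        also have "\<dots> \<le> R ^ 4 * M3"
          using t R sub[of "\<lambda>n. (F n t)\<^sup>2"] M3[of t N] by (intro mult_mono power_mono sum_nonneg) auto
        finally show ?thesis .
      qed
      have q2: "(\<Sum>n\<in>S. (RL (2 - \<alpha>) (\<lambda>s. 2 * y n 0 + 6 * y' n 0 * s) t)\<^sup>2) \<le> k\<^sup>2 * (R\<^sup>2 * (8 * M1 + 72 * M2))"
      proof -
        have "(\<Sum>n\<in>S. (RL (2 - \<alpha>) (\<lambda>s. 2 * y n 0 + 6 * y' n 0 * s) t)\<^sup>2)
           \<le> (t powr (2 - \<alpha>) / Gamma (2 - \<alpha> + 1))\<^sup>2 * (R\<^sup>2 * (8 * M1 + 72 * M2))"
        proof (rule RL_sum_square_le[OF S(1), of T])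
          fix s assume s: "s \<in> {0<..<t}"
          have "(\<Sum>n\<in>S. (2 * y n 0 + 6 * y' n 0 * s)\<^sup>2) \<le> (\<Sum>n\<in>S. 8 * (y n 0)\<^sup>2 + 72 * R\<^sup>2 * (y' n 0)\<^sup>2)"
          proof (rule sum_mono)
            fix n
            have "(2 * y n 0 + 6 * y' n 0 * s)\<^sup>2 \<le> 2 * (2 * y n 0)\<^sup>2 + 2 * (6 * y' n 0 * s)\<^sup>2"
              using zero_le_power2[of "2 * y n 0 - 6 * y' n 0 * s"] by (simp add: power2_diff power2_sum)
            also have "2 * (6 * y' n 0 * s)\<^sup>2 = 72 * s\<^sup>2 * (y' n 0)\<^sup>2" by (simp add: power_mult_distrib)
            also have "\<dots> \<le> 72 * R\<^sup>2 * (y' n 0)\<^sup>2" using s t by (intro mult_right_mono mult_left_mono power_mono) auto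
            finally show "(2 * y n 0 + 6 * y' n 0 * s)\<^sup>2 \<le> 8 * (y n 0)\<^sup>2 + 72 * R\<^sup>2 * (y' n 0)\<^sup>2"
              by (simp add: power_mult_distrib)
          qed
          also have "\<dots> = 8 * (\<Sum>n\<in>S. (y n 0)\<^sup>2) + 72 * R\<^sup>2 * (\<Sum>n\<in>S. (y' n 0)\<^sup>2)"
            by (simp add: sum.distrib sum_distrib_left)
          also have "\<dots> \<le> 8 * (R\<^sup>2 * M1) + 72 * R\<^sup>2 * M2"
            using a0 y'S[of 0] T by (intro add_mono mult_left_mono) auto
          finally show "(\<Sum>n\<in>S. (2 * y n 0 + 6 * y' n 0 * s)\<^sup>2) \<le> R\<^sup>2 * (8 * M1 + 72 * M2)"
            by (simp add: algebra_simps)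
        qed (use t R \<alpha> in \<open>auto intro!: bdd_borel_intros\<close>)
        also have "\<dots> \<le> k\<^sup>2 * (R\<^sup>2 * (8 * M1 + 72 * M2))"
          using t kt[of t] M_nonneg by (intro mult_right_mono) auto
        finally show ?thesis .
      qed
      have q3: "(\<Sum>n\<in>S. (RL 1 (w n) t)\<^sup>2) \<le> k\<^sup>2 * (4 * M2)"
      proof -
        have "(\<Sum>n\<in>S. (RL 1 (w n) t)\<^sup>2) = (\<Sum>n\<in>S. (RL (2 - \<alpha>) (z' n) t)\<^sup>2)"
          using elim t R by (intro sum.cong) auto
        also have "\<dots> \<le> (t powr (2 - \<alpha>) / Gamma (2 - \<alpha> + 1))\<^sup>2 * (4 * M2)"
          using t R \<alpha> by (intro RL_sum_square_le[OF S(1), of T] z'_bdd z'S) auto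
        also have "\<dots> \<le> k\<^sup>2 * (4 * M2)"
          using t kt[of t] M_nonneg by (intro mult_right_mono) auto
        finally show ?thesis .
      qed
      have q4: "(\<Sum>n\<in>S. (RL 2 (w n) t)\<^sup>2) \<le> k\<^sup>2 * (R\<^sup>2 * (4 * M2))"
      proof -
        have "(\<Sum>n\<in>S. (RL 2 (w n) t)\<^sup>2) = (\<Sum>n\<in>S. (RL (2 - \<alpha>) (RL 1 (z' n)) t)\<^sup>2)"
          using integrated(2)[of t] t R by (intro sum.cong) auto
        also have "\<dots> \<le> (t powr (2 - \<alpha>) / Gamma (2 - \<alpha> + 1))\<^sup>2 * (R\<^sup>2 * (4 * M2))"
        proof (rule RL_sum_square_le[OF S(1), of T])
          fix s assume s: "s \<in> {0<..<t}"
          have "(\<Sum>n\<in>S. (RL 1 (z' n) s)\<^sup>2) \<le> (s powr 1 / Gamma (1 + 1))\<^sup>2 * (4 * M2)"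
            using s t R by (intro RL_sum_square_le[OF S(1), of T] z'_bdd z'S) auto
          also have "\<dots> = s\<^sup>2 * (4 * M2)" using s Gamma_fact[of 1, where 'a=real] by simp
          also have "\<dots> \<le> R\<^sup>2 * (4 * M2)" using s t M_nonneg by (intro mult_right_mono power_mono) auto
          finally show "(\<Sum>n\<in>S. (RL 1 (z' n) s)\<^sup>2) \<le> R\<^sup>2 * (4 * M2)" .
        qed (use t R \<alpha> in \<open>auto intro!: RL_bdd z'_bdd\<close>)
        also have "\<dots> \<le> k\<^sup>2 * (R\<^sup>2 * (4 * M2))"
          using t kt[of t] M_nonneg by (intro mult_right_mono) auto
        finally show ?thesis .
      qed
      have "(\<Sum>n\<in>S. (Q n t)\<^sup>2) \<le> (\<Sum>n\<in>S. 4 * (t\<^sup>2 * F n t)\<^sup>2 + 4 * (RL (2 - \<alpha>) (\<lambda>s. 2 * y n 0 + 6 * y' n 0 * s) t)\<^sup>2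
         + 64 * R\<^sup>2 * (RL 1 (w n) t)\<^sup>2 + 16 * (RL 2 (w n) t)\<^sup>2)"
      proof (rule sum_mono)
        fix n
        have sq4: "(a + b + c + d)\<^sup>2 \<le> 4 * a\<^sup>2 + 4 * b\<^sup>2 + 4 * c\<^sup>2 + 4 * d\<^sup>2" for a b c d :: real
        proof -
          have "4 * a\<^sup>2 + 4 * b\<^sup>2 + 4 * c\<^sup>2 + 4 * d\<^sup>2 - (a + b + c + d)\<^sup>2
             = (a - b)\<^sup>2 + (a - c)\<^sup>2 + (a - d)\<^sup>2 + (b - c)\<^sup>2 + (b - d)\<^sup>2 + (c - d)\<^sup>2"
            by (simp add: power2_eq_square algebra_simps)
          also have "\<dots> \<ge> 0" by simp
          finally show ?thesis by simp
        qed
        have Qe: "Q n t = t\<^sup>2 * F n t + RL (2 - \<alpha>) (\<lambda>s. 2 * y n 0 + 6 * y' n 0 * s) t + 2 * \<alpha> * t * RL 1 (w n) t + \<alpha> * (\<alpha> - 1) * RL 2 (w n) t"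
          by (simp add: Q_def algebra_simps)
        have "(2 * \<alpha> * t * RL 1 (w n) t)\<^sup>2 = (2 * \<alpha> * t)\<^sup>2 * (RL 1 (w n) t)\<^sup>2" by (rule power_mult_distrib)
        also have "\<dots> \<le> (4 * R)\<^sup>2 * (RL 1 (w n) t)\<^sup>2"
          using t \<alpha> by (intro mult_right_mono power_mono mult_mono) auto
        finally have 1: "(2 * \<alpha> * t * RL 1 (w n) t)\<^sup>2 \<le> 16 * R\<^sup>2 * (RL 1 (w n) t)\<^sup>2" by (simp add: power_mult_distrib)
        have "(\<alpha> * (\<alpha> - 1) * RL 2 (w n) t)\<^sup>2 = (\<alpha> * (\<alpha> - 1))\<^sup>2 * (RL 2 (w n) t)\<^sup>2" by (rule power_mult_distrib)
        also have "\<dots> \<le> (2 * 1)\<^sup>2 * (RL 2 (w n) t)\<^sup>2"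
          using \<alpha> by (intro mult_right_mono power_mono mult_mono) auto
        finally have 2: "(\<alpha> * (\<alpha> - 1) * RL 2 (w n) t)\<^sup>2 \<le> 4 * (RL 2 (w n) t)\<^sup>2" by simp
        show "(Q n t)\<^sup>2 \<le> 4 * (t\<^sup>2 * F n t)\<^sup>2 + 4 * (RL (2 - \<alpha>) (\<lambda>s. 2 * y n 0 + 6 * y' n 0 * s) t)\<^sup>2
         + 64 * R\<^sup>2 * (RL 1 (w n) t)\<^sup>2 + 16 * (RL 2 (w n) t)\<^sup>2"
          unfolding Qe by (rule order_trans[OF sq4]) (use 1 2 in linarith)
      qed
      also have "\<dots> = 4 * (\<Sum>n\<in>S. (t\<^sup>2 * F n t)\<^sup>2) + 4 * (\<Sum>n\<in>S. (RL (2 - \<alpha>) (\<lambda>s. 2 * y n 0 + 6 * y' n 0 * s) t)\<^sup>2)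
         + 64 * R\<^sup>2 * (\<Sum>n\<in>S. (RL 1 (w n) t)\<^sup>2) + 16 * (\<Sum>n\<in>S. (RL 2 (w n) t)\<^sup>2)"
        by (simp add: sum.distrib sum_distrib_left)
      also have "\<dots> \<le> 4 * (R ^ 4 * M3) + 4 * (k\<^sup>2 * (R\<^sup>2 * (8 * M1 + 72 * M2))) + 64 * R\<^sup>2 * (k\<^sup>2 * (4 * M2)) + 16 * (k\<^sup>2 * (R\<^sup>2 * (4 * M2)))"
        by (intro add_mono mult_left_mono q1 q2 q3 q4) auto
      also have "\<dots> = 4 * (R ^ 4 * M3) + 4 * (k\<^sup>2 * R\<^sup>2 * (8 * M1 + 152 * M2))"
        by (simp add: algebra_simps)
      also have "k\<^sup>2 * R\<^sup>2 = R powr (6 - 2 * \<alpha>) / (Gamma (3 - \<alpha>))\<^sup>2"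
      proof -
        have "(R powr (2 - \<alpha>))\<^sup>2 * R\<^sup>2 = R powr (2 - \<alpha>) * R powr (2 - \<alpha>) * R powr 2"
          using R by (simp add: power2_eq_square)
        also have "\<dots> = R powr (6 - 2 * \<alpha>)" by (simp flip: powr_add)
        finally show ?thesis by (simp add: k_def power_divide)
      qed
      also have "R ^ 4 * M3 \<le> R powr (6 - 2 * \<alpha>) * (T powr (2 * \<alpha> - 2) * M3)"
      proof -
        have "R ^ 4 = R powr 4" using R by simp
        also have "\<dots> = R powr (6 - 2 * \<alpha>) * R powr (2 * \<alpha> - 2)" by (simp flip: powr_add)
        also have "\<dots> \<le> R powr (6 - 2 * \<alpha>) * T powr (2 * \<alpha> - 2)"
          using R \<alpha> by (intro mult_left_mono powr_mono2) auto
        finally show ?thesis using M_nonneg(3) by (auto simp: mult.assoc[symmetric] intro!: mult_right_mono)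
      qed
      finally show "(\<Sum>n\<in>S. (Q n t)\<^sup>2) \<le> CQ * R powr (6 - 2 * \<alpha>)"
        by (simp add: CQ_def algebra_simps)
    qed
  qed
qed

definition CB :: real where "CB = 32 * (1 + mreg_const \<alpha>) * CQ + M1"

lemma CQ_nonneg: "0 \<le> CQ" using M_nonneg by (simp add: CQ_def)
lemma CB_nonneg: "0 \<le> CB" using M_nonneg CQ_nonneg mreg_const_ge_1 by (simp add: CB_def)

text \<open>The modes are split at \<open>\<lambda> = R\<^bsup>-\<alpha>\<^esup>\<close>, the natural scale of the equation. Above it \<open>mode_energy\<close> is used, where the
  weight \<open>t\<^sup>4\<close> is at least \<open>R\<^sup>4/16\<close> on \<open>[R/2, R)\<close>. Below it \<open>\<lambda>\<^sup>2\<close> is at most \<open>R\<^bsup>2-2\<alpha>\<^esup> \<lambda>\<^bsup>2/\<alpha>\<^esup>\<close>, and the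
  bound in \<open>V\<^bsub>1/\<alpha>\<^esub>\<close> suffices. Both parts are of order \<open>R\<^bsup>3-2\<alpha>\<^esup>\<close>.\<close>

lemma block_estimate:
  assumes R: "0 < R" "R \<le> T"
  shows "(\<Sum>n<N. LBINT t. indicator {R/2..<R} t * ((y n t)\<^sup>2 * (ev n)\<^sup>2)) \<le> CB * R powr (3 - 2 * \<alpha>)"
proof -
  define S where "S = {n. n < N \<and> 1 \<le> ev n * R powr \<alpha>}"
  define S' where "S' = {n. n < N \<and> \<not> 1 \<le> ev n * R powr \<alpha>}"
  have S: "finite S" "finite S'" "S \<inter> S' = {}" "{..<N} = S \<union> S'" by (auto simp: S_def S'_def)
  let ?f = "\<lambda>n t. indicator {R/2..<R} t * ((y n t)\<^sup>2 * (ev n)\<^sup>2)"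
  have yb: "bdd_borel R (y n)" for n by (rule bdd_borel_mono[OF y_bdd R(2)])
  have bQ: "bdd_borel R (Q n)" for n by (rule bdd_borel_mono[OF Q_bdd R(2)])
  have rw: "?f n t = indicator {0<..<R} t * (indicator {R/2..<R} t * ((y n t)\<^sup>2 * (ev n)\<^sup>2))" for n t
    using R by (auto simp: indicator_def)
  have bi: "bdd_borel R (\<lambda>t. indicator {R/2..<R} t)" by (rule bdd_borelI[where M=1]) (auto simp: indicator_def)
  have fi: "integrable lborel (?f n)" for n
  proof -
    have "integrable lborel (\<lambda>t. indicator {0<..<R} t * (indicator {R/2..<R} t * ((y n t)\<^sup>2 * (ev n)\<^sup>2)))"
      by (intro integrable_bdd_borel bdd_borel_intros yb bi)
    then show ?thesis by (simp only: rw[symmetric])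
  qed
  \<comment> \<open>Modes above the scale \<open>R\<^bsup>-\<alpha>\<^esup>\<close>: the weight \<open>t\<^sup>4\<close> can be divided out on the block.\<close>
  have high1: "(LBINT t. ?f n t) \<le> 16 / R ^ 4 * (2 * (1 + mreg_const \<alpha>) * (LBINT t. indicator {0<..<R} t * (Q n t)\<^sup>2))" for n
  proof -
    have "(LBINT t. ?f n t) \<le> (LBINT t. 16 / R ^ 4 * (indicator {0<..<R} t * (ev n * (t\<^sup>2 * y n t))\<^sup>2))"
    proof (rule integral_mono[OF fi])
      show "integrable lborel (\<lambda>t. 16 / R ^ 4 * (indicator {0<..<R} t * (ev n * (t\<^sup>2 * y n t))\<^sup>2))"
        by (intro integrable_mult_right integrable_bdd_borel bdd_borel_intros yb)
      show "?f n t \<le> 16 / R ^ 4 * (indicator {0<..<R} t * (ev n * (t\<^sup>2 * y n t))\<^sup>2)" for t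
      proof (cases "t \<in> {R/2..<R}")
        case True
        have "(R / 2) ^ 4 \<le> t ^ 4" using True R by (intro power_mono) auto
        then have "1 \<le> 16 / R ^ 4 * t ^ 4" using R by (simp add: field_simps)
        then have "1 * ((y n t)\<^sup>2 * (ev n)\<^sup>2) \<le> (16 / R ^ 4 * t ^ 4) * ((y n t)\<^sup>2 * (ev n)\<^sup>2)"
          by (intro mult_right_mono) auto
        also have "\<dots> = 16 / R ^ 4 * (ev n * (t\<^sup>2 * y n t))\<^sup>2"
          by (simp add: power_mult_distrib flip: power_mult)
        finally show ?thesis using True R by simp
      qed (use R in auto)
    qed
    also have "\<dots> = 16 / R ^ 4 * (LBINT t. indicator {0<..<R} t * (ev n * (t\<^sup>2 * y n t))\<^sup>2)" by simp
    also have "\<dots> \<le> 16 / R ^ 4 * (2 * (1 + mreg_const \<alpha>) * (LBINT t. indicator {0<..<R} t * (Q n t)\<^sup>2))"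
      using R by (intro mult_left_mono mode_energy) auto
    finally show ?thesis .
  qed
  have "(\<Sum>n\<in>S. LBINT t. indicator {0<..<R} t * (Q n t)\<^sup>2) = (LBINT t. \<Sum>n\<in>S. indicator {0<..<R} t * (Q n t)\<^sup>2)"
    by (intro Bochner_Integration.integral_sum[symmetric] integrable_bdd_borel bdd_borel_intros bQ)
  also have "\<dots> \<le> (LBINT t. CQ * R powr (6 - 2 * \<alpha>) * indicator {0<..<R} t)"
  proof (rule integral_mono_AE)
    show "integrable lborel (\<lambda>t. \<Sum>n\<in>S. indicator {0<..<R} t * (Q n t)\<^sup>2)"
      by (intro Bochner_Integration.integrable_sum integrable_bdd_borel bdd_borel_intros bQ)
    show "integrable lborel (\<lambda>t. CQ * R powr (6 - 2 * \<alpha>) * indicator {0<..<R} t)"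
      using R by (intro integrable_mult_right integrable_real_indicator) auto
    show "AE t in lborel. (\<Sum>n\<in>S. indicator {0<..<R} t * (Q n t)\<^sup>2) \<le> CQ * R powr (6 - 2 * \<alpha>) * indicator {0<..<R} t"
    proof -
      have "AE t in lborel. t \<in> {0<..<R} \<longrightarrow> (\<Sum>n\<in>S. (Q n t)\<^sup>2) \<le> CQ * R powr (6 - 2 * \<alpha>)"
        by (rule Q_sum[OF R S(1)]) (simp add: S_def)
      then show ?thesis by eventually_elim (auto simp: indicator_def)
    qed
  qed
  also have "\<dots> = CQ * R powr (6 - 2 * \<alpha>) * R" using R by simp
  finally have QS: "(\<Sum>n\<in>S. LBINT t. indicator {0<..<R} t * (Q n t)\<^sup>2) \<le> CQ * R powr (6 - 2 * \<alpha>) * R" .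
  have "(\<Sum>n\<in>S. LBINT t. ?f n t) \<le> 16 / R ^ 4 * (2 * (1 + mreg_const \<alpha>) * (\<Sum>n\<in>S. LBINT t. indicator {0<..<R} t * (Q n t)\<^sup>2))"
    unfolding sum_distrib_left by (rule sum_mono) (use high1 in simp)
  also have "\<dots> \<le> 16 / R ^ 4 * (2 * (1 + mreg_const \<alpha>) * (CQ * R powr (6 - 2 * \<alpha>) * R))"
    using QS R mreg_const_ge_1 by (intro mult_left_mono) auto
  also have "\<dots> = 32 * (1 + mreg_const \<alpha>) * CQ * (R powr (6 - 2 * \<alpha>) * R powr 1 / R powr 4)"
    using R by simp
  also have "R powr (6 - 2 * \<alpha>) * R powr 1 / R powr 4 = R powr (6 - 2 * \<alpha> + 1 - 4)"
    by (subst powr_diff, subst powr_add) (rule refl)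
  also have "6 - 2 * \<alpha> + 1 - 4 = 3 - 2 * \<alpha>" by simp
  finally have high: "(\<Sum>n\<in>S. LBINT t. ?f n t) \<le> 32 * (1 + mreg_const \<alpha>) * CQ * R powr (3 - 2 * \<alpha>)" .
  \<comment> \<open>Modes below this scale: \<open>\<lambda>\<^sup>2\<close> is split as \<open>\<lambda>\<^bsup>2/\<alpha>\<^esup>\<close> times a power that is bounded.\<close>
  have "(\<Sum>n\<in>S'. LBINT t. ?f n t) = (LBINT t. \<Sum>n\<in>S'. ?f n t)"
    by (intro Bochner_Integration.integral_sum[symmetric] fi)
  also have "\<dots> \<le> (LBINT t. R powr (2 - 2 * \<alpha>) * M1 * indicator {0<..<R} t)"
  proof (rule integral_mono)
    show "integrable lborel (\<lambda>t. \<Sum>n\<in>S'. ?f n t)" by (intro Bochner_Integration.integrable_sum fi)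
    show "integrable lborel (\<lambda>t. R powr (2 - 2 * \<alpha>) * M1 * indicator {0<..<R} t)"
      using R by (intro integrable_mult_right integrable_real_indicator) auto
    show "(\<Sum>n\<in>S'. ?f n t) \<le> R powr (2 - 2 * \<alpha>) * M1 * indicator {0<..<R} t" for t
    proof (cases "t \<in> {R/2..<R}")
      case True
      have "(y n t)\<^sup>2 * (ev n)\<^sup>2 \<le> R powr (2 - 2 * \<alpha>) * (ev n powr (2 / \<alpha>) * (y n t)\<^sup>2)" if n: "n \<in> S'" for n
      proof -
        have le: "ev n \<le> R powr (- \<alpha>)"
          using n R unfolding S'_def by (simp add: powr_minus field_simps)
        have "(ev n)\<^sup>2 = ev n powr (2 / \<alpha> + (2 - 2 / \<alpha>))" using ev[of n] by simp
        also have "\<dots> = ev n powr (2 / \<alpha>) * ev n powr (2 - 2 / \<alpha>)" by (rule powr_add)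
        also have "\<dots> \<le> ev n powr (2 / \<alpha>) * (R powr (- \<alpha>)) powr (2 - 2 / \<alpha>)"
          using le ev[of n] \<alpha> by (intro mult_left_mono powr_mono2) (auto simp: field_simps)
        also have "(R powr (- \<alpha>)) powr (2 - 2 / \<alpha>) = R powr (2 - 2 * \<alpha>)"
          using \<alpha> by (simp add: powr_powr algebra_simps)
        finally have "(y n t)\<^sup>2 * (ev n)\<^sup>2 \<le> (y n t)\<^sup>2 * (ev n powr (2 / \<alpha>) * R powr (2 - 2 * \<alpha>))"
          by (intro mult_left_mono) auto
        then show ?thesis by (simp add: mult_ac)
      qed
      then have "(\<Sum>n\<in>S'. (y n t)\<^sup>2 * (ev n)\<^sup>2) \<le> R powr (2 - 2 * \<alpha>) * (\<Sum>n\<in>S'. ev n powr (2 / \<alpha>) * (y n t)\<^sup>2)"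
        unfolding sum_distrib_left by (rule sum_mono)
      also have "(\<Sum>n\<in>S'. ev n powr (2 / \<alpha>) * (y n t)\<^sup>2) \<le> (\<Sum>n<N. ev n powr (2 / \<alpha>) * (y n t)\<^sup>2)"
        by (rule sum_mono2) (auto simp: S'_def)
      also have "\<dots> \<le> M1" using True R by (intro M1) auto
      finally show ?thesis using True R by (simp add: mult_left_mono)
    next
      case False
      then show ?thesis using M_nonneg by simp
    qed
  qed
  also have "\<dots> = M1 * (R powr (2 - 2 * \<alpha>) * R powr 1)" using R by simp
  also have "R powr (2 - 2 * \<alpha>) * R powr 1 = R powr (2 - 2 * \<alpha> + 1)" by (rule powr_add[symmetric])
  also have "2 - 2 * \<alpha> + 1 = 3 - 2 * \<alpha>" by simp
  finally have low: "(\<Sum>n\<in>S'. LBINT t. ?f n t) \<le> M1 * R powr (3 - 2 * \<alpha>)" .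
  have "(\<Sum>n<N. LBINT t. ?f n t) = (\<Sum>n\<in>S. LBINT t. ?f n t) + (\<Sum>n\<in>S'. LBINT t. ?f n t)"
    unfolding S(4) by (rule sum.union_disjoint[OF S(1-3)])
  then show ?thesis using high low by (simp add: CB_def algebra_simps)
qed

text \<open>The square of the norm of \<open>A u(t)\<close>. As an extended real it makes sense before \<open>u(t)\<close> is known to be in the
  domain of \<open>A\<close>.\<close>

definition A2 :: "real \<Rightarrow> ennreal" where
  "A2 t = (\<Sum>n. ennreal ((y n t)\<^sup>2 * ev n powr 2))"

lemma A2_measurable [measurable]: "A2 \<in> borel_measurable borel"
  unfolding A2_def using bdd_borel_measurable[OF y_bdd] by measurable

lemma block_A2:
  assumes R: "0 < R" "R \<le> T"
  shows "(\<integral>\<^sup>+t. indicator {R/2..<R} t * A2 t \<partial>lborel) \<le> ennreal (CB * R powr (3 - 2 * \<alpha>))"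
proof -
  note [measurable] = bdd_borel_measurable[OF y_bdd]
  let ?f = "\<lambda>n t. indicator {R/2..<R} t * ((y n t)\<^sup>2 * (ev n)\<^sup>2)"
  have yb: "bdd_borel R (y n)" for n by (rule bdd_borel_mono[OF y_bdd R(2)])
  have rw: "?f n t = indicator {0<..<R} t * (indicator {R/2..<R} t * ((y n t)\<^sup>2 * (ev n)\<^sup>2))" for n t
    using R by (auto simp: indicator_def)
  have bi: "bdd_borel R (\<lambda>t. indicator {R/2..<R} t)" by (rule bdd_borelI[where M=1]) (auto simp: indicator_def)
  have fi: "integrable lborel (?f n)" for n
  proof -
    have "integrable lborel (\<lambda>t. indicator {0<..<R} t * (indicator {R/2..<R} t * ((y n t)\<^sup>2 * (ev n)\<^sup>2)))"
      by (intro integrable_bdd_borel bdd_borel_intros yb bi)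
    then show ?thesis by (simp only: rw[symmetric])
  qed
  have "(\<integral>\<^sup>+t. indicator {R/2..<R} t * A2 t \<partial>lborel) = (\<integral>\<^sup>+t. (\<Sum>n. ennreal (?f n t)) \<partial>lborel)"
  proof (rule nn_integral_cong)
    fix t
    have "ev n powr 2 = (ev n)\<^sup>2" for n using ev[of n] by simp
    then show "indicator {R/2..<R} t * A2 t = (\<Sum>n. ennreal (?f n t))"
      by (cases "t \<in> {R/2..<R}") (simp_all add: A2_def)
  qed
  also have "\<dots> = (\<Sum>n. \<integral>\<^sup>+t. ennreal (?f n t) \<partial>lborel)"
    by (intro nn_integral_suminf) auto
  also have "\<dots> = (\<Sum>n. ennreal (LBINT t. ?f n t))"
    by (intro suminf_cong nn_integral_eq_integral[OF fi]) auto
  also have "\<dots> \<le> ennreal (CB * R powr (3 - 2 * \<alpha>))"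
  proof (rule suminf_le_const)
    fix N
    have "(\<Sum>n<N. ennreal (LBINT t. ?f n t)) = ennreal (\<Sum>n<N. LBINT t. ?f n t)"
      by (rule sum_ennreal) (intro Bochner_Integration.integral_nonneg, auto)
    also have "\<dots> \<le> ennreal (CB * R powr (3 - 2 * \<alpha>))" by (intro ennreal_leI block_estimate R)
    finally show "(\<Sum>n<N. ennreal (LBINT t. ?f n t)) \<le> ennreal (CB * R powr (3 - 2 * \<alpha>))" .
  qed auto
  finally show ?thesis .
qed

text \<open>On the block \<open>[R/2, R)\<close> Young's inequality with \<open>\<epsilon> = R\<^bsup>\<alpha>-1\<^esup>\<close> balances the bound \<open>R\<^bsup>3-2\<alpha>\<^esup>\<close> of \<open>block_A2\<close> against
  the length \<open>R\<close>; both contributions become \<open>R\<^bsup>2-\<alpha>\<^esup>\<close>. As \<open>2 - \<alpha> > 0\<close>, these form a convergent geometric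
  series for \<open>R = T/2\<^sup>k\<close>.\<close>

theorem A_integrable:
  "(\<integral>\<^sup>+t. indicator {0<..<T} t * epow (A2 t) (1/2) \<partial>lborel) < \<infinity>"
proof -
  define R where "R k = T / 2 ^ k" for k :: nat
  have R: "0 < R k" "R k \<le> T" for k
    using T by (auto simp: R_def field_simps)
  have Rs: "R (Suc k) = R k / 2" for k by (simp add: R_def)
  have m [measurable]: "(\<lambda>t. epow (A2 t) (1/2)) \<in> borel_measurable borel"
    unfolding epow_def by measurable
  have cover: "\<exists>k. t \<in> {R k / 2..<R k}" if t: "t \<in> {0<..<T}" for t
  proof -
    have "\<exists>k. R k \<le> t"
    proof -
      obtain k where "(1/2) ^ k < t / T" using real_arch_pow_inv[of "t / T" "1/2"] t T by auto
      then show ?thesis using T by (intro exI[of _ k]) (simp add: R_def field_simps power_divide)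
    qed
    then have L: "R (LEAST k. R k \<le> t) \<le> t" by (rule LeastI_ex)
    obtain j where j: "(LEAST k. R k \<le> t) = Suc j"
    proof (cases "LEAST k. R k \<le> t")
      case 0
      then show ?thesis using L t by (simp add: R_def)
    qed (use that in auto)
    have "\<not> R j \<le> t" using not_less_Least[of j "\<lambda>k. R k \<le> t"] j by simp
    then show ?thesis using L j Rs by (intro exI[of _ j]) auto
  qed
  have block: "(\<integral>\<^sup>+t. indicator {R k / 2..<R k} t * epow (A2 t) (1/2) \<partial>lborel) \<le> ennreal ((CB + 1) * R k powr (2 - \<alpha>))" for k
  proof -
    define \<epsilon> where "\<epsilon> = R k powr (\<alpha> - 1)"
    have \<epsilon>: "\<epsilon> > 0" using R[of k] by (simp add: \<epsilon>_def)
    have "(\<integral>\<^sup>+t. indicator {R k / 2..<R k} t * epow (A2 t) (1/2) \<partial>lborel)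
      \<le> (\<integral>\<^sup>+t. ennreal (\<epsilon> / 2) * (indicator {R k / 2..<R k} t * A2 t) + ennreal (1 / (2 * \<epsilon>)) * indicator {R k / 2..<R k} t \<partial>lborel)"
      by (intro nn_integral_mono) (use epow_half_le[OF \<epsilon>] in \<open>auto simp: indicator_def\<close>)
    also have "\<dots> = ennreal (\<epsilon> / 2) * (\<integral>\<^sup>+t. indicator {R k / 2..<R k} t * A2 t \<partial>lborel) + ennreal (1 / (2 * \<epsilon>)) * emeasure lborel {R k / 2..<R k}"
      by (subst nn_integral_add) (auto simp: nn_integral_cmult)
    also have "\<dots> \<le> ennreal (\<epsilon> / 2) * ennreal (CB * R k powr (3 - 2 * \<alpha>)) + ennreal (1 / (2 * \<epsilon>)) * ennreal (R k)"
      using R[of k] by (intro add_mono mult_left_mono block_A2) (auto intro: ennreal_leI)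
    also have "\<dots> = ennreal (\<epsilon> / 2 * (CB * R k powr (3 - 2 * \<alpha>)) + 1 / (2 * \<epsilon>) * R k)"
      using \<epsilon> R[of k] CB_nonneg by (simp flip: ennreal_mult ennreal_plus)
    also have "\<epsilon> / 2 * (CB * R k powr (3 - 2 * \<alpha>)) + 1 / (2 * \<epsilon>) * R k = (CB + 1) / 2 * R k powr (2 - \<alpha>)"
    proof -
      have "\<epsilon> * R k powr (3 - 2 * \<alpha>) = R k powr (2 - \<alpha>)" by (simp add: \<epsilon>_def flip: powr_add)
      moreover have "R k / \<epsilon> = R k powr (2 - \<alpha>)"
      proof -
        have "R k powr (2 - \<alpha>) = R k powr (1 - (\<alpha> - 1))" by simp
        also have "\<dots> = R k powr 1 / \<epsilon>" unfolding \<epsilon>_def by (rule powr_diff)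
        finally show ?thesis using R[of k] by simp
      qed
      ultimately show ?thesis by (simp add: field_simps)
    qed
    also have "\<dots> \<le> (CB + 1) * R k powr (2 - \<alpha>)"
      using CB_nonneg by (intro mult_right_mono) auto
    finally show ?thesis using ennreal_leI by auto
  qed
  have "(\<integral>\<^sup>+t. indicator {0<..<T} t * epow (A2 t) (1/2) \<partial>lborel)
    \<le> (\<integral>\<^sup>+t. (\<Sum>k. indicator {R k / 2..<R k} t * epow (A2 t) (1/2)) \<partial>lborel)"
  proof (rule nn_integral_mono)
    fix t
    show "indicator {0<..<T} t * epow (A2 t) (1/2) \<le> (\<Sum>k. indicator {R k / 2..<R k} t * epow (A2 t) (1/2))"
    proof (cases "t \<in> {0<..<T}")
      case True
      then obtain k where k: "t \<in> {R k / 2..<R k}" using cover by blast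
      define g where "g k = indicator {R k / 2..<R k} t * epow (A2 t) (1/2)" for k
      have "sum g {k} \<le> suminf g" by (rule sum_le_suminf) auto
      then have "g k \<le> suminf g" by simp
      moreover have "g k = indicator {0<..<T} t * epow (A2 t) (1/2)" using True k by (simp add: g_def)
      ultimately show ?thesis unfolding g_def by (simp only:)
    qed simp
  qed
  also have "\<dots> = (\<Sum>k. \<integral>\<^sup>+t. indicator {R k / 2..<R k} t * epow (A2 t) (1/2) \<partial>lborel)"
    by (intro nn_integral_suminf) auto
  also have "\<dots> \<le> (\<Sum>k. ennreal ((CB + 1) * R k powr (2 - \<alpha>)))"
    by (intro suminf_le block) auto
  also have "\<dots> < \<infinity>"
  proof -
    have "(\<lambda>k. (CB + 1) * R k powr (2 - \<alpha>)) = (\<lambda>k. (CB + 1) * T powr (2 - \<alpha>) * ((1/2) powr (2 - \<alpha>)) ^ k)"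
    proof
      fix k
      have "R k = T * (1/2) ^ k" by (simp add: R_def power_divide)
      then have "R k powr (2 - \<alpha>) = T powr (2 - \<alpha>) * ((1/2) ^ k) powr (2 - \<alpha>)"
        using T by (simp add: powr_mult)
      also have "((1/2::real) ^ k) powr (2 - \<alpha>) = ((1/2) powr (2 - \<alpha>)) ^ k"
        by (simp add: powr_powr mult.commute flip: powr_realpow)
      finally show "(CB + 1) * R k powr (2 - \<alpha>) = (CB + 1) * T powr (2 - \<alpha>) * ((1/2) powr (2 - \<alpha>)) ^ k" by simp
    qed
    moreover have "summable (\<lambda>k. (CB + 1) * T powr (2 - \<alpha>) * ((1/2::real) powr (2 - \<alpha>)) ^ k)"
      using \<alpha> powr_less_mono2[of "2 - \<alpha>" "1/2" "1::real"] by (intro summable_mult summable_geometric) auto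
    ultimately have "summable (\<lambda>k. (CB + 1) * R k powr (2 - \<alpha>))" by simp
    then show ?thesis using CB_nonneg by (subst suminf_ennreal2) auto
  qed
  finally show ?thesis .
qed

end

section \<open>Orthonormal expansions in \<open>L\<^sup>2\<close>\<close>

lemma epow_half: "r \<ge> 0 \<Longrightarrow> epow (ennreal r) (1/2) = ennreal (sqrt r)"
  by (simp add: epow_def powr_half_sqrt)

lemma epow_half_le_iff:
  assumes "c \<ge> 0"
  shows "epow x (1/2) \<le> ennreal c \<longleftrightarrow> x \<le> ennreal (c\<^sup>2)"
proof (cases "x = top")
  case True
  then show ?thesis by (simp add: epow_def top_unique)
next
  case False
  define r where "r = enn2real x"
  have x: "x = ennreal r" "r \<ge> 0" using False by (auto simp: r_def less_top)
  have "sqrt r \<le> c \<longleftrightarrow> r \<le> c\<^sup>2" using assms x(2) by (simp add: real_sqrt_le_iff' sqrt_le_D real_le_lsqrt)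
  then show ?thesis using assms x by (simp add: epow_half)
qed

lemma epow_half_finite: "epow x (1/2) < top \<longleftrightarrow> x < top"
  by (simp add: epow_def less_top[symmetric])

lemma lnorm_2: "lnorm m 2 h = epow (\<integral>\<^sup>+x. ennreal ((h x)\<^sup>2) \<partial>m) (1/2)"
proof -
  have "epow (ennreal \<bar>h x\<bar>) 2 = ennreal ((h x)\<^sup>2)" for x
    by (simp add: epow_def)
  then show ?thesis by (simp add: lnorm_def Lp_norm_def)
qed

lemma L2_iff: "h \<in> L2 m \<longleftrightarrow> h \<in> borel_measurable m \<and> integrable m (\<lambda>x. (h x)\<^sup>2)"
proof -
  have "integrable m (\<lambda>x. (h x)\<^sup>2) \<longleftrightarrow> (\<integral>\<^sup>+x. ennreal ((h x)\<^sup>2) \<partial>m) < \<infinity>" if "h \<in> borel_measurable m"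
    using that by (simp add: integrable_iff_bounded)
  then show ?thesis by (auto simp: Lp_def lnorm_2 epow_half_finite)
qed

lemma L2_measurable: "h \<in> L2 m \<Longrightarrow> h \<in> borel_measurable m" by (simp add: L2_iff)

lemma L2_square_integrable: "h \<in> L2 m \<Longrightarrow> integrable m (\<lambda>x. h x * h x)"
  by (simp add: L2_iff power2_eq_square)

lemma L2_prod_integrable:
  assumes "h \<in> L2 m" "k \<in> L2 m"
  shows "integrable m (\<lambda>x. h x * k x)"
proof (rule Bochner_Integration.integrable_bound)
  show "integrable m (\<lambda>x. h x * h x + k x * k x)"
    using assms by (intro Bochner_Integration.integrable_add L2_square_integrable)
  show "AE x in m. norm (h x * k x) \<le> norm (h x * h x + k x * k x)"
  proof (rule AE_I2)
    fix x
    have "2 * \<bar>h x * k x\<bar> \<le> h x * h x + k x * k x"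
      using zero_le_power2[of "\<bar>h x\<bar> - \<bar>k x\<bar>"]
      by (simp add: power2_diff abs_mult flip: power2_eq_square)
    then show "norm (h x * k x) \<le> norm (h x * h x + k x * k x)" by simp
  qed
qed (intro borel_measurable_times L2_measurable assms)

lemma L2_add:
  assumes "h \<in> L2 m" "k \<in> L2 m"
  shows "(\<lambda>x. h x + k x) \<in> L2 m"
proof -
  have "(\<lambda>x. (h x + k x)\<^sup>2) = (\<lambda>x. h x * h x + 2 * (h x * k x) + k x * k x)"
    by (auto simp: power2_eq_square algebra_simps)
  moreover have "integrable m (\<lambda>x. h x * h x + 2 * (h x * k x) + k x * k x)"
    by (intro Bochner_Integration.integrable_add integrable_mult_right L2_prod_integrable assms)
  ultimately show ?thesis
    unfolding L2_iff[of "\<lambda>x. h x + k x"] using assms[THEN L2_measurable] by simp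
qed

lemma L2_scale: "h \<in> L2 m \<Longrightarrow> (\<lambda>x. c * h x) \<in> L2 m"
  by (auto simp: L2_iff power_mult_distrib)

lemma L2_diff:
  assumes "h \<in> L2 m" "k \<in> L2 m"
  shows "(\<lambda>x. h x - k x) \<in> L2 m"
  using L2_add[OF assms(1) L2_scale[OF assms(2), of "-1"]] by simp

lemma L2_zero: "(\<lambda>x. 0) \<in> L2 m" by (simp add: L2_iff)

lemma L2_sum: "finite S \<Longrightarrow> (\<And>n. n \<in> S \<Longrightarrow> g n \<in> L2 m) \<Longrightarrow> (\<lambda>x. \<Sum>n\<in>S. g n x) \<in> L2 m"
  by (induction S rule: finite_induct) (auto intro: L2_zero L2_add)

lemma ip_commute: "ip m h k = ip m k h" by (simp add: ip_def mult.commute)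

lemma ip_add: "h \<in> L2 m \<Longrightarrow> k \<in> L2 m \<Longrightarrow> l \<in> L2 m \<Longrightarrow> ip m (\<lambda>x. h x + k x) l = ip m h l + ip m k l"
  by (simp add: ip_def distrib_right L2_prod_integrable)

lemma ip_scale: "ip m (\<lambda>x. c * h x) l = c * ip m h l"
  by (simp add: ip_def mult.assoc)

lemma ip_diff: "h \<in> L2 m \<Longrightarrow> k \<in> L2 m \<Longrightarrow> l \<in> L2 m \<Longrightarrow> ip m (\<lambda>x. h x - k x) l = ip m h l - ip m k l"
  by (simp add: ip_def left_diff_distrib L2_prod_integrable)

lemma ip_sum:
  assumes "finite S" "\<And>n. n \<in> S \<Longrightarrow> g n \<in> L2 m" "l \<in> L2 m"
  shows "ip m (\<lambda>x. \<Sum>n\<in>S. g n x) l = (\<Sum>n\<in>S. ip m (g n) l)"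
  using assms(1,2)
proof (induction S rule: finite_induct)
  case empty
  then show ?case by (simp add: ip_def)
next
  case (insert n S)
  then show ?case using assms(3) by (simp add: ip_add L2_sum)
qed

lemma ip_nonneg: "0 \<le> ip m h h" by (simp add: ip_def)

lemma ip_cong_AE:
  assumes "h \<in> borel_measurable m" "h' \<in> borel_measurable m" "k \<in> borel_measurable m" "ae_eq m h h'"
  shows "ip m h k = ip m h' k"
  unfolding ip_def using assms by (intro integral_cong_AE) (auto simp: ae_eq_def elim: eventually_mono)

lemma L2_norm: "h \<in> L2 m \<Longrightarrow> lnorm m 2 h = ennreal (sqrt (ip m h h))"
  unfolding lnorm_2
  by (subst nn_integral_eq_integral) (auto simp: L2_iff ip_def power2_eq_square epow_half)

lemma ip_Cauchy_Schwarz: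
  assumes h: "h \<in> L2 m" and k: "k \<in> L2 m"
  shows "(ip m h k)\<^sup>2 \<le> ip m h h * ip m k k"
proof -
  have q: "0 \<le> ip m h h - 2 * c * ip m h k + c\<^sup>2 * ip m k k" for c
  proof -
    have "0 \<le> ip m (\<lambda>x. h x - c * k x) (\<lambda>x. h x - c * k x)" by (rule ip_nonneg)
    also have "\<dots> = ip m h (\<lambda>x. h x - c * k x) - c * ip m k (\<lambda>x. h x - c * k x)"
      using h k by (simp add: ip_diff ip_scale L2_scale L2_diff)
    also have "\<dots> = ip m (\<lambda>x. h x - c * k x) h - c * ip m (\<lambda>x. h x - c * k x) k"
      by (simp add: ip_commute)
    also have "\<dots> = ip m h h - 2 * c * ip m h k + c\<^sup>2 * ip m k k"
      using h k by (simp add: ip_diff ip_scale L2_scale power2_eq_square algebra_simps ip_commute[of m k h])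
    finally show ?thesis .
  qed
  show ?thesis
  proof (cases "ip m k k = 0")
    case True
    have "ip m h k = 0"
    proof (rule ccontr)
      assume n: "ip m h k \<noteq> 0"
      show False using q[of "(ip m h h + 1) / (2 * ip m h k)"] True n by simp
    qed
    then show ?thesis using True by simp
  next
    case False
    then have p: "ip m k k > 0" using ip_nonneg[of m k] by simp
    have "0 \<le> ip m h h - (ip m h k)\<^sup>2 / ip m k k"
      using q[of "ip m h k / ip m k k"] p by (simp add: power2_eq_square field_simps)
    then show ?thesis using p by (simp add: field_simps)
  qed
qed

lemma ip_abs_le:
  assumes "h \<in> L2 m" "k \<in> L2 m"
  shows "\<bar>ip m h k\<bar> \<le> sqrt (ip m h h) * sqrt (ip m k k)"
  using ip_Cauchy_Schwarz[OF assms] by (metis real_sqrt_abs real_sqrt_le_mono real_sqrt_mult)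

lemma L2_triangle:
  assumes h: "h \<in> L2 m" and k: "k \<in> L2 m"
  shows "sqrt (ip m h h) \<le> sqrt (ip m k k) + sqrt (ip m (\<lambda>x. h x - k x) (\<lambda>x. h x - k x))"
proof (rule real_le_lsqrt)
  define d where "d x = h x - k x" for x
  have d: "d \<in> L2 m" unfolding d_def using h k by (rule L2_diff)
  have hd: "h = (\<lambda>x. k x + d x)" by (simp add: d_def)
  have 1: "ip m h l = ip m k l + ip m d l" if "l \<in> L2 m" for l
    by (subst hd) (rule ip_add[OF k d that])
  have "ip m h h = ip m h k + ip m h d"
    using 1[OF h] by (simp only: ip_commute[of m h k] ip_commute[of m h d])
  also have "\<dots> = ip m k k + 2 * ip m k d + ip m d d"
    using 1[OF k] 1[OF d] by (simp only: ip_commute[of m d k])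
  also have "\<dots> \<le> ip m k k + 2 * (sqrt (ip m k k) * sqrt (ip m d d)) + ip m d d"
    using ip_abs_le[OF k d] by simp
  also have "\<dots> = (sqrt (ip m k k) + sqrt (ip m d d))\<^sup>2"
    using ip_nonneg[of m] by (simp add: power2_sum)
  finally show "ip m h h \<le> (sqrt (ip m k k) + sqrt (ip m (\<lambda>x. h x - k x) (\<lambda>x. h x - k x)))\<^sup>2"
    unfolding d_def[abs_def] .
qed (auto simp: ip_nonneg)

lemma tendsto_lnorm_2_iff:
  assumes "\<And>s. g s \<in> L2 m"
  shows "((\<lambda>s. lnorm m 2 (g s)) \<longlongrightarrow> 0) G \<longleftrightarrow> ((\<lambda>s. sqrt (ip m (g s) (g s))) \<longlongrightarrow> 0) G"
  using assms by (simp add: L2_norm ip_nonneg flip: ennreal_0 del: ennreal_0)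

text \<open>A form of the Heine-Borel theorem: bounds that hold near every point of a compact interval hold
  uniformly.\<close>

lemma compact_locally_bounded:
  fixes P :: "real \<Rightarrow> real \<Rightarrow> bool"
  assumes loc: "\<And>t. t \<in> {0..T} \<Longrightarrow> \<exists>B. \<forall>\<^sub>F s in at t within {0..T}. P s B" and pt: "\<And>t. t \<in> {0..T} \<Longrightarrow> \<exists>B. P t B"
    and mono: "\<And>t B B'. P t B \<Longrightarrow> B \<le> B' \<Longrightarrow> P t B'"
  shows "\<exists>B. \<forall>t\<in>{0..T}. P t B"
proof -
  have "\<exists>d B. d > 0 \<and> (\<forall>s\<in>{0..T}. dist s t < d \<longrightarrow> P s B)" if t: "t \<in> {0..T}" for t
  proof -
    obtain B where "\<forall>\<^sub>F s in at t within {0..T}. P s B" using loc[OF t] by blast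
    then obtain d where d: "d > 0" "\<forall>s\<in>{0..T}. s \<noteq> t \<and> dist s t < d \<longrightarrow> P s B"
      by (auto simp: eventually_at)
    obtain B' where "P t B'" using pt[OF t] by blast
    then have "\<forall>s\<in>{0..T}. dist s t < d \<longrightarrow> P s (max B B')"
      using d(2) mono by (metis max.cobounded1 max.cobounded2)
    then show ?thesis using d(1) by blast
  qed
  then obtain d B where dB: "\<And>t. t \<in> {0..T} \<Longrightarrow> d t > 0" "\<And>t s. t \<in> {0..T} \<Longrightarrow> s \<in> {0..T} \<Longrightarrow> dist s t < d t \<Longrightarrow> P s (B t)"
    by metis
  have "{0..T} \<subseteq> (\<Union>t\<in>{0..T}. ball t (d t))" using dB(1) by force
  then obtain C where C: "C \<subseteq> {0..T}" "finite C" "{0..T} \<subseteq> (\<Union>t\<in>C. ball t (d t))"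
    using compactE_image[of "{0..T}" "{0..T}" "\<lambda>t. ball t (d t)"] by (metis compact_Icc open_ball)
  have "P s (Max (B ` C))" if s: "s \<in> {0..T}" for s
  proof -
    obtain t where t: "t \<in> C" "dist s t < d t" using C(3) s by (auto simp: dist_commute)
    have "P s (B t)" using dB(2) t C(1) s by blast
    then show ?thesis by (rule mono) (use t(1) C(2) in auto)
  qed
  then show ?thesis by blast
qed

locale onb =
  fixes m :: "'a measure" and e :: "nat \<Rightarrow> 'a \<Rightarrow> real" and ev :: "nat \<Rightarrow> real"
  assumes fin: "finite_measure m"
    and e_L2: "\<And>n. e n \<in> L2 m"
    and orth: "\<And>i j. ip m (e i) (e j) = (if i = j then 1 else 0)"
    and complete: "\<And>h. h \<in> L2 m \<Longrightarrow> (\<lambda>n. lnorm m 2 (\<lambda>x. h x - (\<Sum>k<n. ip m h (e k) * e k x))) \<longlonglongrightarrow> 0"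
    and ev_pos: "\<And>n. 0 < ev n" and ev_mono: "\<And>n. ev 0 \<le> ev n"
begin

lemma comb_L2: "(\<lambda>x. \<Sum>k<n. c k * e k x) \<in> L2 m"
  by (intro L2_sum L2_scale e_L2) auto

lemma ip_comb: "ip m (\<lambda>x. \<Sum>k<n. c k * e k x) (e j) = (if j < n then c j else 0)"
proof -
  have "ip m (\<lambda>x. \<Sum>k<n. c k * e k x) (e j) = (\<Sum>k<n. c k * ip m (e k) (e j))"
    by (subst ip_sum) (auto intro: L2_scale e_L2 simp: ip_scale)
  also have "\<dots> = (\<Sum>k<n. if k = j then c j else 0)" by (intro sum.cong) (auto simp: orth)
  finally show ?thesis by simp
qed

lemma ip_comb_right: "h \<in> L2 m \<Longrightarrow> ip m h (\<lambda>x. \<Sum>k<n. c k * e k x) = (\<Sum>k<n. c k * ip m h (e k))"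
  by (subst ip_commute, subst ip_sum) (auto intro: L2_scale e_L2 simp: ip_scale ip_commute[of m h])

lemma ip_comb_comb: "ip m (\<lambda>x. \<Sum>k<n. c k * e k x) (\<lambda>x. \<Sum>k<n. c k * e k x) = (\<Sum>k<n. (c k)\<^sup>2)"
  by (subst ip_comb_right[OF comb_L2]) (auto simp: ip_comb power2_eq_square intro!: sum.cong)

text \<open>The remainder is orthogonal to the partial sum, so Pythagoras' theorem computes its norm.\<close>

lemma remainder_norm:
  assumes h: "h \<in> L2 m"
  shows "ip m (\<lambda>x. h x - (\<Sum>k<n. ip m h (e k) * e k x)) (\<lambda>x. h x - (\<Sum>k<n. ip m h (e k) * e k x))
    = ip m h h - (\<Sum>k<n. (ip m h (e k))\<^sup>2)"
proof -
  let ?p = "\<lambda>x. \<Sum>k<n. ip m h (e k) * e k x"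
  have "ip m (\<lambda>x. h x - ?p x) (\<lambda>x. h x - ?p x) = ip m (\<lambda>x. h x - ?p x) h - ip m (\<lambda>x. h x - ?p x) ?p"
    using ip_diff[OF h comb_L2 L2_diff[OF h comb_L2]] by (simp add: ip_commute)
  also have "\<dots> = ip m h h - 2 * ip m h ?p + ip m ?p ?p"
    using ip_diff[OF h comb_L2 h] ip_diff[OF h comb_L2 comb_L2] by (simp add: ip_commute[of m ?p h])
  also have "\<dots> = ip m h h - (\<Sum>k<n. (ip m h (e k))\<^sup>2)"
    unfolding ip_comb_comb ip_comb_right[OF h] by (simp add: power2_eq_square)
  finally show ?thesis .
qed

lemma Bessel: "h \<in> L2 m \<Longrightarrow> (\<Sum>k<n. (ip m h (e k))\<^sup>2) \<le> ip m h h"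
  using remainder_norm[of h n] ip_nonneg[of m "\<lambda>x. h x - (\<Sum>k<n. ip m h (e k) * e k x)"] by simp

lemma remainder_tendsto:
  assumes h: "h \<in> L2 m"
  shows "(\<lambda>n. sqrt (ip m h h - (\<Sum>k<n. (ip m h (e k))\<^sup>2))) \<longlonglongrightarrow> 0"
proof -
  have *: "\<And>n. (\<lambda>x. h x - (\<Sum>k<n. ip m h (e k) * e k x)) \<in> L2 m" by (intro L2_diff h comb_L2)
  show ?thesis using complete[OF h] unfolding tendsto_lnorm_2_iff[OF *] remainder_norm[OF h] .
qed

lemma Parseval:
  assumes h: "h \<in> L2 m"
  shows "(\<lambda>n. (ip m h (e n))\<^sup>2) sums ip m h h"
proof -
  have "(\<lambda>n. (sqrt (ip m h h - (\<Sum>k<n. (ip m h (e k))\<^sup>2)))\<^sup>2) \<longlonglongrightarrow> 0\<^sup>2"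
    by (intro tendsto_power remainder_tendsto h)
  then have "(\<lambda>n. ip m h h - (\<Sum>k<n. (ip m h (e k))\<^sup>2)) \<longlonglongrightarrow> 0"
    using Bessel[OF h] by simp
  from tendsto_diff[OF tendsto_const[of "ip m h h"] this] show ?thesis by (simp add: sums_def)
qed

lemma Parseval2:
  assumes h: "h \<in> L2 m" and k: "k \<in> L2 m"
  shows "(\<lambda>n. ip m h (e n) * ip m k (e n)) sums ip m h k"
proof -
  have b: "\<bar>ip m h k - (\<Sum>j<n. ip m h (e j) * ip m k (e j))\<bar> \<le> sqrt (ip m h h - (\<Sum>k<n. (ip m h (e k))\<^sup>2)) * sqrt (ip m k k)" for n
  proof -
    let ?p = "\<lambda>x. \<Sum>j<n. ip m h (e j) * e j x"
    have "ip m h k - (\<Sum>j<n. ip m h (e j) * ip m k (e j)) = ip m (\<lambda>x. h x - ?p x) k"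
    proof -
      have "ip m ?p k = (\<Sum>j<n. ip m h (e j) * ip m k (e j))"
        by (subst ip_commute) (rule ip_comb_right[OF k])
      then show ?thesis by (subst ip_diff[OF h comb_L2 k]) simp
    qed
    moreover have "\<bar>ip m (\<lambda>x. h x - ?p x) k\<bar> \<le> sqrt (ip m h h - (\<Sum>k<n. (ip m h (e k))\<^sup>2)) * sqrt (ip m k k)"
      by (subst remainder_norm[OF h, symmetric]) (rule ip_abs_le[OF L2_diff[OF h comb_L2] k])
    ultimately show ?thesis by (simp only:)
  qed
  have lim: "(\<lambda>n. sqrt (ip m h h - (\<Sum>k<n. (ip m h (e k))\<^sup>2)) * sqrt (ip m k k)) \<longlonglongrightarrow> 0 * sqrt (ip m k k)"
    by (intro tendsto_mult tendsto_const remainder_tendsto h)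
  have "(\<lambda>n. ip m h k - (\<Sum>j<n. ip m h (e j) * ip m k (e j))) \<longlonglongrightarrow> 0"
  proof (rule Lim_null_comparison[rotated])
    show "(\<lambda>n. sqrt (ip m h h - (\<Sum>k<n. (ip m h (e k))\<^sup>2)) * sqrt (ip m k k)) \<longlonglongrightarrow> 0"
      using lim by (simp only: mult_zero_left)
    show "\<forall>\<^sub>F n in sequentially. norm (ip m h k - (\<Sum>j<n. ip m h (e j) * ip m k (e j)))
       \<le> sqrt (ip m h h - (\<Sum>k<n. (ip m h (e k))\<^sup>2)) * sqrt (ip m k k)"
      unfolding real_norm_def by (rule always_eventually) (rule allI, rule b)
  qed
  from tendsto_diff[OF tendsto_const[of "ip m h k"] this] show ?thesis by (simp add: sums_def)
qed

lemma Vnorm_zero: "h \<in> L2 m \<Longrightarrow> Vnorm m e ev 0 h = lnorm m 2 h"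
  using Parseval[of h] ev_pos
  by (simp add: Vnorm_def L2_norm ip_nonneg less_imp_neq[symmetric] suminf_ennreal2 sums_iff epow_half)

lemma Vnorm_partial_sum:
  assumes "Vnorm m e ev \<sigma> h \<le> ennreal c" "c \<ge> 0"
  shows "(\<Sum>n<N. ev n powr (2 * \<sigma>) * (ip m h (e n))\<^sup>2) \<le> c\<^sup>2"
proof -
  have "ennreal (\<Sum>n<N. (ip m h (e n))\<^sup>2 * ev n powr (2 * \<sigma>)) = (\<Sum>n<N. ennreal ((ip m h (e n))\<^sup>2 * ev n powr (2 * \<sigma>)))"
    by (rule sum_ennreal[symmetric]) simp
  also have "\<dots> \<le> (\<Sum>n. ennreal ((ip m h (e n))\<^sup>2 * ev n powr (2 * \<sigma>)))"
    by (rule sum_le_suminf) auto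
  also have "\<dots> \<le> ennreal (c\<^sup>2)"
    using assms by (simp add: Vnorm_def epow_half_le_iff)
  finally show ?thesis by (simp add: mult.commute)
qed

text \<open>A curve that is continuous into \<open>V\<^sub>\<sigma>\<close> is bounded on a compact interval. The bound is stated for the partial sums of the squared
  norm, the form in which the estimates for the modes use it.\<close>

lemma coefficient_bound:
  fixes g :: "real \<Rightarrow> 'a \<Rightarrow> real"
  assumes L2: "\<And>t. t \<in> {0..T} \<Longrightarrow> g t \<in> L2 m"
    and fin: "\<And>t. t \<in> {0..T} \<Longrightarrow> Vnorm m e ev \<sigma> (g t) < \<infinity>"
    and cont: "\<And>t. t \<in> {0..T} \<Longrightarrow> ((\<lambda>s. Vnorm m e ev \<sigma> (g s - g t)) \<longlongrightarrow> 0) (at t within {0..T})"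
  shows "\<exists>M. \<forall>t\<in>{0..T}. \<forall>N. (\<Sum>n<N. ev n powr (2 * \<sigma>) * (ip m (g t) (e n))\<^sup>2) \<le> M"
proof (rule compact_locally_bounded[where P="\<lambda>t M. \<forall>N. (\<Sum>n<N. ev n powr (2 * \<sigma>) * (ip m (g t) (e n))\<^sup>2) \<le> M"])
  fix t assume t: "t \<in> {0..T}"
  obtain c where c: "c \<ge> 0" "Vnorm m e ev \<sigma> (g t) = ennreal c"
    using fin[OF t] by (metis ennreal_cases infinity_ennreal_def less_irrefl)
  have ct: "(\<Sum>n<N. ev n powr (2 * \<sigma>) * (ip m (g t) (e n))\<^sup>2) \<le> c\<^sup>2" for N
    using c by (intro Vnorm_partial_sum) auto
  then show "\<exists>B. \<forall>N. (\<Sum>n<N. ev n powr (2 * \<sigma>) * (ip m (g t) (e n))\<^sup>2) \<le> B" by blast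
  have "\<forall>\<^sub>F s in at t within {0..T}. Vnorm m e ev \<sigma> (g s - g t) < 1"
    using order_tendstoD(2)[OF cont[OF t], of 1] by simp
  then have "\<forall>\<^sub>F s in at t within {0..T}. \<forall>N. (\<Sum>n<N. ev n powr (2 * \<sigma>) * (ip m (g s) (e n))\<^sup>2) \<le> 2 + 2 * c\<^sup>2"
    unfolding eventually_at_filter
  proof eventually_elim
    case (elim s)
    show ?case
    proof (intro impI allI)
      fix N assume s: "s \<noteq> t" "s \<in> {0..T}"
      then have "Vnorm m e ev \<sigma> (g s - g t) < 1" using elim by blast
      then have "(\<Sum>n<N. ev n powr (2 * \<sigma>) * (ip m (g s - g t) (e n))\<^sup>2) \<le> 1\<^sup>2"
        by (intro Vnorm_partial_sum) (auto intro: less_imp_le)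
      moreover have "ip m (g s - g t) (e n) = ip m (g s) (e n) - ip m (g t) (e n)" for n
        using ip_diff[OF L2[OF s(2)] L2[OF t] e_L2] by (simp add: fun_diff_def)
      ultimately have d: "(\<Sum>n<N. ev n powr (2 * \<sigma>) * (ip m (g s) (e n) - ip m (g t) (e n))\<^sup>2) \<le> 1" by simp
      have "(\<Sum>n<N. ev n powr (2 * \<sigma>) * (ip m (g s) (e n))\<^sup>2)
        \<le> (\<Sum>n<N. 2 * (ev n powr (2 * \<sigma>) * (ip m (g s) (e n) - ip m (g t) (e n))\<^sup>2) + 2 * (ev n powr (2 * \<sigma>) * (ip m (g t) (e n))\<^sup>2))"
      proof (rule sum_mono)
        fix n
        have "(a::real)\<^sup>2 \<le> 2 * (a - b)\<^sup>2 + 2 * b\<^sup>2" for a b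
          using zero_le_power2[of "a - 2 * b"] by (simp add: power2_diff power_mult_distrib)
        from mult_left_mono[OF this, of "ev n powr (2 * \<sigma>)"]
        show "ev n powr (2 * \<sigma>) * (ip m (g s) (e n))\<^sup>2
          \<le> 2 * (ev n powr (2 * \<sigma>) * (ip m (g s) (e n) - ip m (g t) (e n))\<^sup>2) + 2 * (ev n powr (2 * \<sigma>) * (ip m (g t) (e n))\<^sup>2)"
          by (simp add: distrib_left mult.left_commute)
      qed
      also have "\<dots> = 2 * (\<Sum>n<N. ev n powr (2 * \<sigma>) * (ip m (g s) (e n) - ip m (g t) (e n))\<^sup>2) + 2 * (\<Sum>n<N. ev n powr (2 * \<sigma>) * (ip m (g t) (e n))\<^sup>2)"
        by (simp add: sum.distrib sum_distrib_left)
      also have "\<dots> \<le> 2 + 2 * c\<^sup>2" using d ct[of N] by simp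
      finally show "(\<Sum>n<N. ev n powr (2 * \<sigma>) * (ip m (g s) (e n))\<^sup>2) \<le> 2 + 2 * c\<^sup>2" .
    qed
  qed
  then show "\<exists>B. \<forall>\<^sub>F s in at t within {0..T}. \<forall>N. (\<Sum>n<N. ev n powr (2 * \<sigma>) * (ip m (g s) (e n))\<^sup>2) \<le> B" by blast
qed (use order_trans in blast)

text \<open>The partial sums form a Cauchy sequence. Along a subsequence whose increments have \<open>L\<^sup>2\<close> norm at most \<open>2\<^bsup>-k\<^esup>\<close>,
  and hence summable \<open>L\<^sup>1\<close> norms because the measure is finite, they converge almost everywhere. Fatou's lemma
  shows that the pointwise limit is also the limit in \<open>L\<^sup>2\<close>.\<close>

theorem Riesz_Fischer:
  assumes c: "summable (\<lambda>n. (c n)\<^sup>2)"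
  shows "\<exists>g\<in>L2 m. \<forall>n. ip m g (e n) = c n"
proof -
  interpret finite_measure m by (rule fin)
  have [measurable]: "e n \<in> borel_measurable m" for n using e_L2 L2_measurable by blast
  define s where "s N x = (\<Sum>k<N. c k * e k x)" for N x
  have s_L2: "s N \<in> L2 m" for N unfolding s_def by (rule comb_L2)
  define b where "b N = (\<Sum>n. (c (n + N))\<^sup>2)" for N
  have b0: "b \<longlonglongrightarrow> 0" unfolding b_def using suminf_exist_split2[OF c] by simp
  have split: "(\<Sum>n. (c n)\<^sup>2) = b N + (\<Sum>n<N. (c n)\<^sup>2)" for N
    unfolding b_def using suminf_split_initial_segment[OF c, of N] by simp
  have bnn: "b N \<ge> 0" for N unfolding b_def using c summable_iff_shift[of "\<lambda>n. (c n)\<^sup>2" N] by (intro suminf_nonneg) auto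
  have dist: "ip m (\<lambda>x. s M x - s N x) (\<lambda>x. s M x - s N x) \<le> b N" if "N \<le> M" for M N
  proof -
    have eq: "(\<lambda>x. s M x - s N x) = (\<lambda>x. \<Sum>k<M. (if k < N then 0 else c k) * e k x)"
    proof
      fix x
      have "s M x - s N x = (\<Sum>k<M. c k * e k x) - (\<Sum>k\<in>{..<M} \<inter> {..<N}. c k * e k x)"
        using that by (simp add: s_def min.absorb2 Int_absorb1)
      also have "(\<Sum>k\<in>{..<M} \<inter> {..<N}. c k * e k x) = (\<Sum>k<M. if k \<in> {..<N} then c k * e k x else 0)"
        by (rule sum.inter_restrict) simp
      also have "(\<Sum>k<M. c k * e k x) - \<dots> = (\<Sum>k<M. (if k < N then 0 else c k) * e k x)"
        unfolding sum_subtractf[symmetric] by (intro sum.cong) auto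
      finally show "s M x - s N x = (\<Sum>k<M. (if k < N then 0 else c k) * e k x)" .
    qed
    have "ip m (\<lambda>x. s M x - s N x) (\<lambda>x. s M x - s N x) = (\<Sum>k<M. (if k < N then 0 else c k)\<^sup>2)"
      unfolding eq by (rule ip_comb_comb)
    also have "\<dots> = (\<Sum>k<M. (c k)\<^sup>2) - (\<Sum>k<N. (c k)\<^sup>2)"
    proof -
      have "(\<Sum>k<N. (c k)\<^sup>2) = (\<Sum>k\<in>{..<M} \<inter> {..<N}. (c k)\<^sup>2)" using that by (simp add: Int_absorb1)
      also have "\<dots> = (\<Sum>k<M. if k \<in> {..<N} then (c k)\<^sup>2 else 0)" by (rule sum.inter_restrict) simp
      finally show ?thesis unfolding sum_subtractf[symmetric]
        by (simp add: sum_subtractf[symmetric] del: sum_subtractf) (intro sum.cong, auto)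
    qed
    also have "\<dots> \<le> b N" using split[of M] split[of N] bnn[of M] by simp
    finally show ?thesis .
  qed
  have "\<exists>N. \<forall>M\<ge>N. b M < (1/4) ^ k" for k :: nat
    using order_tendstoD(2)[OF b0, of "(1/4) ^ k"] by (simp add: eventually_sequentially)
  then obtain r0 where r0: "\<And>k M. M \<ge> r0 k \<Longrightarrow> b M < (1/4) ^ k" by metis
  \<comment> \<open>Summing the indices makes \<open>r\<close> increasing and at least as large as each of the required ones.\<close>
  define r where "r k = k + (\<Sum>j\<le>k. r0 j)" for k
  have r_mono: "r j \<le> r k" if "j \<le> k" for j k unfolding r_def using that by (intro add_mono sum_mono2) auto
  have r_ge: "r0 k \<le> r k" for k unfolding r_def using member_le_sum[of k "{..k}" r0] by simp
  define d where "d k x = s (r (Suc k)) x - s (r k) x" for k x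
  have d_L2: "d k \<in> L2 m" for k unfolding d_def by (intro L2_diff s_L2)
  have [measurable]: "d k \<in> borel_measurable m" "s k \<in> borel_measurable m" for k using d_L2 s_L2 L2_measurable by blast+
  have dk: "ip m (d k) (d k) \<le> (1/4) ^ k" for k
    unfolding d_def using dist[of "r k" "r (Suc k)"] r_mono[of k "Suc k"] r0[OF r_ge[of k]] by force
  have one: "(\<lambda>x. 1) \<in> L2 m" by (simp add: L2_iff)
  define K where "K = sqrt (ip m (\<lambda>x. 1) (\<lambda>x. 1))"
  have d1: "(\<integral>\<^sup>+x. ennreal \<bar>d k x\<bar> \<partial>m) \<le> ennreal (K * (1/2) ^ k)" for k
  proof -
    have ad: "(\<lambda>x. \<bar>d k x\<bar>) \<in> L2 m" using d_L2[of k] by (auto simp: L2_iff)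
    have i: "integrable m (\<lambda>x. \<bar>d k x\<bar>)" using L2_prod_integrable[OF ad one] by simp
    have "(\<integral>\<^sup>+x. ennreal \<bar>d k x\<bar> \<partial>m) = ennreal (ip m (\<lambda>x. \<bar>d k x\<bar>) (\<lambda>x. 1))"
      using i by (simp add: nn_integral_eq_integral ip_def)
    moreover have "ip m (\<lambda>x. \<bar>d k x\<bar>) (\<lambda>x. 1) \<le> sqrt (ip m (d k) (d k)) * K"
      using ip_abs_le[OF ad one] by (simp add: K_def ip_def abs_mult[symmetric])
    moreover have "sqrt (ip m (d k) (d k)) \<le> (1/2) ^ k"
    proof (rule real_le_lsqrt)
      have "((1/2::real) ^ k)\<^sup>2 = ((1/2)\<^sup>2) ^ k" by (simp add: power_mult[symmetric] mult.commute)
      then show "ip m (d k) (d k) \<le> ((1/2) ^ k)\<^sup>2" using dk[of k] by (simp add: power2_eq_square)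
    qed (auto simp: ip_nonneg)
    then have "sqrt (ip m (d k) (d k)) * K \<le> (1/2) ^ k * K" by (intro mult_right_mono) (auto simp: K_def ip_nonneg)
    ultimately show ?thesis by (simp add: mult.commute ennreal_leI order_trans)
  qed
  have "(\<integral>\<^sup>+x. (\<Sum>k. ennreal \<bar>d k x\<bar>) \<partial>m) = (\<Sum>k. \<integral>\<^sup>+x. ennreal \<bar>d k x\<bar> \<partial>m)"
    by (rule nn_integral_suminf) simp
  also have "\<dots> \<le> (\<Sum>k. ennreal (K * (1/2) ^ k))" by (intro suminf_le d1) auto
  also have "\<dots> < \<infinity>"
    by (subst suminf_ennreal2) (auto simp: K_def ip_nonneg intro!: summable_mult summable_geometric)
  finally have "AE x in m. (\<Sum>k. ennreal \<bar>d k x\<bar>) \<noteq> \<infinity>"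
    by (intro nn_integral_PInf_AE) auto
  then have conv: "AE x in m. convergent (\<lambda>k. s (r k) x)"
  proof eventually_elim
    case (elim x)
    then have "summable (\<lambda>k. \<bar>d k x\<bar>)" by (intro summable_suminf_not_top) auto
    then have "summable (\<lambda>k. d k x)" by (rule summable_rabs_cancel)
    then have "(\<lambda>n. \<Sum>k<n. d k x) \<longlonglongrightarrow> (\<Sum>k. d k x)" by (rule summable_LIMSEQ)
    moreover have "(\<Sum>k<n. d k x) = s (r n) x - s (r 0) x" for n
      unfolding d_def by (rule sum_lessThan_telescope)
    ultimately have "(\<lambda>n. (s (r n) x - s (r 0) x) + s (r 0) x) \<longlonglongrightarrow> (\<Sum>k. d k x) + s (r 0) x"
      by (intro tendsto_add tendsto_const) simp
    then show ?case by (auto simp: convergent_def)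
  qed
  define g where "g x = lim (\<lambda>k. s (r k) x)" for x
  have [measurable]: "g \<in> borel_measurable m" unfolding g_def by (rule borel_measurable_lim_metric) simp
  have ae: "AE x in m. (\<lambda>k. s (r k) x) \<longlonglongrightarrow> g x"
    using conv by eventually_elim (simp add: g_def convergent_LIMSEQ_iff)
  have near: "(\<integral>\<^sup>+x. ennreal ((g x - s (r j) x)\<^sup>2) \<partial>m) \<le> ennreal ((1/4) ^ j)" for j
  proof -
    have "(\<integral>\<^sup>+x. ennreal ((g x - s (r j) x)\<^sup>2) \<partial>m) = (\<integral>\<^sup>+x. liminf (\<lambda>k. ennreal ((s (r k) x - s (r j) x)\<^sup>2)) \<partial>m)"
    proof (rule nn_integral_cong_AE)
      show "AE x in m. ennreal ((g x - s (r j) x)\<^sup>2) = liminf (\<lambda>k. ennreal ((s (r k) x - s (r j) x)\<^sup>2))"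
        using ae
      proof eventually_elim
        case (elim x)
        then have "(\<lambda>k. ennreal ((s (r k) x - s (r j) x)\<^sup>2)) \<longlonglongrightarrow> ennreal ((g x - s (r j) x)\<^sup>2)"
          by (intro tendsto_intros)
        then show ?case by (intro lim_imp_Liminf[symmetric]) auto
      qed
    qed
    also have "\<dots> \<le> liminf (\<lambda>k. \<integral>\<^sup>+x. ennreal ((s (r k) x - s (r j) x)\<^sup>2) \<partial>m)"
      by (rule nn_integral_liminf) simp
    also have "\<dots> \<le> ennreal ((1/4) ^ j)"
    proof (rule Liminf_le)
      show "\<forall>\<^sub>F k in sequentially. (\<integral>\<^sup>+x. ennreal ((s (r k) x - s (r j) x)\<^sup>2) \<partial>m) \<le> ennreal ((1/4) ^ j)"
      proof (rule eventually_sequentiallyI[of j])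
        fix k assume "j \<le> k"
        have "(\<integral>\<^sup>+x. ennreal ((s (r k) x - s (r j) x)\<^sup>2) \<partial>m) = ennreal (ip m (\<lambda>x. s (r k) x - s (r j) x) (\<lambda>x. s (r k) x - s (r j) x))"
          using L2_diff[OF s_L2 s_L2, of "r k" "r j"]
          by (subst nn_integral_eq_integral) (auto simp: L2_iff ip_def power2_eq_square)
        also have "\<dots> \<le> ennreal ((1/4) ^ j)"
          using dist[OF r_mono[OF \<open>j \<le> k\<close>]] r0[OF r_ge[of j]] by (intro ennreal_leI) force
        finally show "(\<integral>\<^sup>+x. ennreal ((s (r k) x - s (r j) x)\<^sup>2) \<partial>m) \<le> ennreal ((1/4) ^ j)" .
      qed
    qed simp
    finally show ?thesis .
  qed
  have gs: "(\<lambda>x. g x - s (r j) x) \<in> L2 m" for j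
    using near[of j] by (auto simp: L2_iff integrable_iff_bounded intro: le_less_trans)
  have g_L2: "g \<in> L2 m" using L2_add[OF gs[of 0] s_L2[of "r 0"]] by simp
  have "ip m g (e n) = c n" for n
  proof -
    have "\<bar>ip m g (e n) - c n\<bar> \<le> (1/2) ^ j" if j: "r j > n" for j
    proof -
      have "ip m (s (r j)) (e n) = c n" unfolding s_def[abs_def] using j by (simp add: ip_comb)
      then have "\<bar>ip m g (e n) - c n\<bar> = \<bar>ip m (\<lambda>x. g x - s (r j) x) (e n)\<bar>"
        using ip_diff[OF g_L2 s_L2 e_L2] by simp
      also have "\<dots> \<le> sqrt (ip m (\<lambda>x. g x - s (r j) x) (\<lambda>x. g x - s (r j) x)) * sqrt (ip m (e n) (e n))"
        by (rule ip_abs_le[OF gs e_L2])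
      also have "\<dots> \<le> (1/2) ^ j"
      proof -
        have "ennreal (ip m (\<lambda>x. g x - s (r j) x) (\<lambda>x. g x - s (r j) x)) \<le> ennreal ((1/4) ^ j)"
          using near[of j] gs[of j] by (subst (asm) nn_integral_eq_integral) (auto simp: L2_iff ip_def power2_eq_square)
        then have "ip m (\<lambda>x. g x - s (r j) x) (\<lambda>x. g x - s (r j) x) \<le> ((1/2) ^ j)\<^sup>2"
          by (simp add: power2_eq_square flip: power_mult_distrib)
        then show ?thesis by (simp add: orth real_le_lsqrt ip_nonneg)
      qed
      finally show ?thesis .
    qed
    moreover have "r j > n" if "j \<ge> Suc n" for j using that by (simp add: r_def)
    ultimately have "\<forall>\<^sub>F j in sequentially. \<bar>ip m g (e n) - c n\<bar> \<le> (1/2) ^ j"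
      by (intro eventually_sequentiallyI[of "Suc n"]) blast
    moreover have "(\<lambda>j. (1/2::real) ^ j) \<longlonglongrightarrow> 0" by (rule LIMSEQ_power_zero) simp
    ultimately have "\<bar>ip m g (e n) - c n\<bar> \<le> 0" by (intro tendsto_lowerbound[of "\<lambda>j. (1/2) ^ j"]) auto
    then show ?thesis by simp
  qed
  then show ?thesis using g_L2 by blast
qed

end

section \<open>Boundedness of the nonlinearity\<close>

text \<open>A function cannot exceed its mean almost everywhere.\<close>

lemma pick_below_average:
  fixes g :: "real \<Rightarrow> real"
  assumes ab: "a < b" and int: "integrable lborel (\<lambda>s. indicator {a<..<b} s * g s)"
    and good: "AE s in lborel. s \<in> {a<..<b} \<longrightarrow> s \<in> G"
  shows "\<exists>s\<in>{a<..<b} \<inter> G. g s * (b - a) \<le> (LBINT s. indicator {a<..<b} s * g s)"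
proof (rule ccontr)
  define I where "I = (LBINT s. indicator {a<..<b} s * g s)"
  assume "\<not> ?thesis"
  then have n: "I / (b - a) < g s" if "s \<in> {a<..<b}" "s \<in> G" for s
    using that ab by (force simp: I_def field_simps)
  define h where "h s = indicator {a<..<b} s * g s - I / (b - a) * indicator {a<..<b} s" for s
  have i1: "integrable lborel (\<lambda>s. I / (b - a) * indicator {a<..<b} s)"
    using ab by (intro integrable_mult_right integrable_real_indicator) auto
  have hi: "integrable lborel h" unfolding h_def using int i1 by (rule Bochner_Integration.integrable_diff)
  have "(LBINT s. h s) = I - (LBINT s. I / (b - a) * indicator {a<..<b} s)"
    unfolding h_def I_def by (rule Bochner_Integration.integral_diff[OF int i1[unfolded I_def]])
  also have "\<dots> = 0" using ab by simp
  finally have 0: "(LBINT s. h s) = 0" .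
  have nn: "AE s in lborel. 0 \<le> h s"
    using good by eventually_elim (use n in \<open>force simp: h_def indicator_def\<close>)
  have "AE s in lborel. h s = 0"
    using integral_nonneg_eq_0_iff_AE[OF hi nn] 0 by simp
  with good have "AE s in lborel. s \<notin> {a<..<b}"
    by eventually_elim (use n in \<open>force simp: h_def\<close>)
  from AE_not_in_Ioo[OF this] show False using ab by simp
qed

text \<open>The point \<open>t\<close> is approached from the side on which there is more room by points \<open>s\<^sub>k\<close> at distance
  between \<open>L/2\<^bsup>k+1\<^esup>\<close> and \<open>L/2\<^sup>k\<close>, where \<open>L = T/2\<close>. If \<open>g(s\<^sub>k)\<close> is at most its average over this interval of length \<open>L/2\<^bsup>k+1\<^esup>\<close>, then
  \<open>g(s\<^sub>k)\<close> times the step from \<open>s\<^sub>k\<close> to \<open>s\<^sub>k\<^sub>+\<^sub>1\<close> is at most a multiple of the integral of \<open>g\<close> over the interval. The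
  intervals are disjoint, so the increments of \<open>N\<close> along the chain add up to a multiple of the whole integral. The
  chain starts at distance comparable to \<open>T\<close>, where \<open>N(s\<^sub>0) \<le> K g(s\<^sub>0)\<close> is good enough.\<close>

lemma chain_bound:
  fixes N g :: "real \<Rightarrow> real"
  assumes T: "T > 0" and int: "integrable lborel (\<lambda>s. indicator {0<..<T} s * g s)"
    and g0: "\<And>s. g s \<ge> 0" and K: "K \<ge> 0"
    and good: "AE s in lborel. s \<in> {0<..<T} \<longrightarrow> s \<in> G"
    and lip: "\<And>s t. s \<in> G \<Longrightarrow> t \<in> G \<Longrightarrow> s \<in> {0<..<T} \<Longrightarrow> t \<in> {0<..<T} \<Longrightarrow> \<bar>N t - N s\<bar> \<le> (g t + g s) * \<bar>t - s\<bar>"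
    and start: "\<And>s. s \<in> G \<Longrightarrow> s \<in> {0<..<T} \<Longrightarrow> N s \<le> K * g s"
    and t: "t \<in> G" "t \<in> {0<..<T}"
  shows "N t \<le> (4 * K / T + 14) * (LBINT s. indicator {0<..<T} s * g s)"
proof -
  define L where "L = T / 2"
  have L: "L > 0" using T by (simp add: L_def)
  define \<Gamma> where "\<Gamma> = (LBINT s. indicator {0<..<T} s * g s)"
  define l where "l k = L / 2 ^ k" for k :: nat
  have l: "l k > 0" "l (Suc k) = l k / 2" "l k \<le> L" for k
    using L by (auto simp: l_def field_simps)
  have l_mono: "l j \<le> l i" if "i \<le> j" for i j
    using that L unfolding l_def by (intro divide_left_mono power_increasing) auto
  \<comment> \<open>The intervals lie to the right of \<open>t\<close> for \<open>t\<close> in the left half of \<open>(0,T)\<close>, and to its left otherwise.\<close>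
  define a where "a k = (if t \<le> L then t + l (Suc k) else t - l k)" for k
  define b where "b k = (if t \<le> L then t + l k else t - l (Suc k))" for k
  define I where "I k = {a k<..<b k}" for k
  have ba: "b k - a k = l k / 2" for k by (auto simp: a_def b_def l)
  have I_T: "I k \<subseteq> {0<..<T}" for k
    using t l(1)[of k] l(1)[of "Suc k"] l(3)[of k] by (auto simp: I_def a_def b_def L_def)
  have I_t: "l (Suc k) < \<bar>s - t\<bar> \<and> \<bar>s - t\<bar> < l k" if "s \<in> I k" for s k
    using that l(1)[of "Suc k"] by (auto simp: I_def a_def b_def split: if_splits)
  have disj: "disjoint_family I"
    unfolding disjoint_family_on_def
  proof (intro ballI impI)
    fix i j :: nat assume ij: "i \<noteq> j"
    have *: False if "i < j" "s \<in> I i" "s \<in> I j" for i j s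
      using I_t[OF that(2)] I_t[OF that(3)] l_mono[of "Suc i" j] that(1) by auto
    show "I i \<inter> I j = {}" using ij *[of i j] *[of j i] by (cases i j rule: linorder_cases) auto
  qed
  have int_I: "integrable lborel (\<lambda>s. indicator (I k) s * g s)" for k
  proof -
    have "(\<lambda>s. indicator (I k) s * g s) = (\<lambda>s. indicator (I k) s *\<^sub>R (indicator {0<..<T} s * g s))"
      using I_T[of k] by (auto simp: indicator_def fun_eq_iff)
    then show ?thesis using integrable_mult_indicator[OF _ int, of "I k"] by (simp add: I_def)
  qed
  define g' where "g' k = (LBINT s. indicator (I k) s * g s)" for k
  have g'0: "g' k \<ge> 0" for k unfolding g'_def using g0 by (intro Bochner_Integration.integral_nonneg) auto
  have sum_g': "(\<Sum>j<k. g' j) \<le> \<Gamma>" for k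
  proof -
    have "(\<Sum>j<k. g' j) = (LBINT s. \<Sum>j<k. indicator (I j) s * g s)"
      unfolding g'_def by (intro Bochner_Integration.integral_sum[symmetric] int_I)
    also have "\<dots> \<le> \<Gamma>" unfolding \<Gamma>_def
    proof (rule integral_mono[OF _ int])
      show "integrable lborel (\<lambda>s. \<Sum>j<k. indicator (I j) s * g s)" by (intro Bochner_Integration.integrable_sum int_I)
      fix s
      have "(\<Sum>j<k. indicator (I j) s :: real) = indicator (\<Union>j\<in>{..<k}. I j) s"
        by (rule indicator_UN_disjoint[symmetric]) (use disj in \<open>auto simp: disjoint_family_on_def\<close>)
      also have "\<dots> \<le> indicator {0<..<T} s" proof -
        have "(\<Union>j\<in>{..<k}. I j) \<subseteq> {0<..<T}" using I_T by blast
        then show ?thesis unfolding indicator_def by (auto simp del: greaterThanLessThan_iff)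
      qed
      finally show "(\<Sum>j<k. indicator (I j) s * g s) \<le> indicator {0<..<T} s * g s"
        unfolding sum_distrib_right[symmetric] by (rule mult_right_mono[OF _ g0])
    qed
    finally show ?thesis .
  qed
  have g'_le: "g' k \<le> \<Gamma>" for k
    using sum_g'[of "Suc k"] sum_nonneg[of "{..<k}" g'] g'0 by simp
  have "\<exists>s\<in>I k \<inter> G. g s * (l k / 2) \<le> g' k" for k
  proof -
    have "a k < b k" using ba[of k] l(1)[of k] by simp
    moreover have "AE s in lborel. s \<in> {a k<..<b k} \<longrightarrow> s \<in> G"
      using good by eventually_elim (use I_T[of k] in \<open>auto simp: I_def\<close>)
    ultimately show ?thesis
      using pick_below_average[of "a k" "b k" g G] int_I[of k] unfolding ba[symmetric] g'_def I_def by blast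
  qed
  then obtain s where s: "\<And>k. s k \<in> I k" "\<And>k. s k \<in> G" "\<And>k. g (s k) * (l k / 2) \<le> g' k" by (metis IntE)
  have sT: "s k \<in> {0<..<T}" for k using s(1) I_T by blast
  have gs: "g (s k) * l k \<le> 2 * g' k" for k using s(3)[of k] by simp
  have step: "N (s k) \<le> N (s (Suc k)) + (4 * g' k + 8 * g' (Suc k))"
      and step': "N (s (Suc k)) \<le> N (s k) + (4 * g' k + 8 * g' (Suc k))" for k
  proof -
    have "\<bar>N (s k) - N (s (Suc k))\<bar> \<le> (g (s k) + g (s (Suc k))) * \<bar>s k - s (Suc k)\<bar>"
      by (intro lip s sT)
    also have "\<dots> \<le> (g (s k) + g (s (Suc k))) * (2 * l k)"
    proof (intro mult_left_mono add_nonneg_nonneg g0)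
      show "\<bar>s k - s (Suc k)\<bar> \<le> 2 * l k"
        using I_t[OF s(1)[of k]] I_t[OF s(1)[of "Suc k"]] l(1,2)[of k]
          abs_triangle_ineq4[of "s k - t" "s (Suc k) - t"] by simp
    qed
    also have "\<dots> = 2 * (g (s k) * l k) + 4 * (g (s (Suc k)) * l (Suc k))" using l(2)[of k] by (simp add: algebra_simps)
    also have "\<dots> \<le> 4 * g' k + 8 * g' (Suc k)" using gs[of k] gs[of "Suc k"] by linarith
    finally have "\<bar>N (s k) - N (s (Suc k))\<bar> \<le> 4 * g' k + 8 * g' (Suc k)" .
    then show "N (s k) \<le> N (s (Suc k)) + (4 * g' k + 8 * g' (Suc k))" "N (s (Suc k)) \<le> N (s k) + (4 * g' k + 8 * g' (Suc k))"
      by linarith+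
  qed
  have tele: "N (s k) \<le> N (s 0) + (4 * (\<Sum>j<k. g' j) + 8 * (\<Sum>j<k. g' (Suc j)))" for k
  proof (induction k)
    case (Suc k)
    then show ?case using step'[of k] by simp
  qed simp
  have N0: "N (s 0) \<le> 4 * K / T * \<Gamma>"
  proof -
    have "g (s 0) * L \<le> 2 * \<Gamma>" using gs[of 0] g'_le[of 0] by (simp add: l_def)
    then have "g (s 0) \<le> 4 * \<Gamma> / T" using T by (simp add: L_def field_simps)
    then have "K * g (s 0) \<le> K * (4 * \<Gamma> / T)" using K by (rule mult_left_mono)
    then show ?thesis using start[OF s(2) sT, of 0] by (simp add: mult_ac)
  qed
  \<comment> \<open>\<open>14 = 4 + 8 + 2\<close>: the first two come from the sums along the chain, the last from the step to \<open>t\<close>. The term \<open>l k * g t\<close>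
    disappears in the limit.\<close>
  have main: "N t \<le> (4 * K / T + 14) * \<Gamma> + l k * g t" for k
  proof -
    have "\<bar>N t - N (s k)\<bar> \<le> (g t + g (s k)) * \<bar>t - s k\<bar>" by (intro lip s sT t)
    also have "\<dots> \<le> (g t + g (s k)) * l k"
      using I_t[OF s(1)[of k]] g0 by (intro mult_left_mono add_nonneg_nonneg) auto
    also have "\<dots> \<le> l k * g t + 2 * \<Gamma>" using gs[of k] g'_le[of k] by (simp add: algebra_simps)
    finally have "N t \<le> N (s k) + l k * g t + 2 * \<Gamma>" by linarith
    moreover have "(\<Sum>j<k. g' (Suc j)) \<le> \<Gamma>"
    proof -
      have "(\<Sum>j<Suc k. g' j) = g' 0 + (\<Sum>j<k. g' (Suc j))" by (rule sum.lessThan_Suc_shift)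
      then show ?thesis using sum_g'[of "Suc k"] g'0[of 0] by linarith
    qed
    ultimately show ?thesis using tele[of k] N0 sum_g'[of k] unfolding distrib_right by linarith
  qed
  have "(\<lambda>k. (4 * K / T + 14) * \<Gamma> + L * (1/2) ^ k * g t) \<longlonglongrightarrow> (4 * K / T + 14) * \<Gamma> + L * 0 * g t"
    by (intro tendsto_intros LIMSEQ_power_zero) simp
  moreover have "N t \<le> (4 * K / T + 14) * \<Gamma> + L * (1/2) ^ k * g t" for k
    using main[of k] by (simp add: l_def power_divide)
  ultimately have "N t \<le> (4 * K / T + 14) * \<Gamma> + L * 0 * g t" by (intro LIMSEQ_le_const) auto
  then show ?thesis by (simp add: \<Gamma>_def)
qed

lemma lnorm_top_le_iff:
  assumes "h \<in> borel_measurable m" "c \<ge> 0"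
  shows "lnorm m \<infinity> h \<le> ennreal c \<longleftrightarrow> (AE x in m. \<bar>h x\<bar> \<le> c)"
proof
  assume a: "lnorm m \<infinity> h \<le> ennreal c"
  have "AE x in m. ennreal \<bar>h x\<bar> \<le> lnorm m \<infinity> h"
    using esssup_AE[of "\<lambda>x. ennreal \<bar>h x\<bar>" m] by (simp add: lnorm_def Lp_norm_def)
  then show "AE x in m. \<bar>h x\<bar> \<le> c"
    by eventually_elim (use a assms in \<open>metis ennreal_le_iff order_trans\<close>)
next
  assume "AE x in m. \<bar>h x\<bar> \<le> c"
  then have "AE x in m. ennreal \<bar>h x\<bar> \<le> ennreal c" by eventually_elim (rule ennreal_leI)
  then show "lnorm m \<infinity> h \<le> ennreal c"
    using assms by (simp add: lnorm_def Lp_norm_def esssup_I)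
qed

text \<open>The sup norm is lower semicontinuous with respect to convergence in \<open>L\<^sup>2\<close>: the excess of \<open>\<bar>u(t)\<bar>\<close> over \<open>c\<close> is
  dominated by the distance to any function bounded by \<open>c\<close>. This makes the sup norm of \<open>u(t)\<close> a Borel
  function of \<open>t\<close>.\<close>

lemma sup_norm_semicontinuous:
  fixes u :: "real \<Rightarrow> 'a \<Rightarrow> real"
  assumes L2: "\<And>t. t \<in> {0..T} \<Longrightarrow> u t \<in> L2 m"
    and lip: "\<And>s t. s \<in> {0..T} \<Longrightarrow> t \<in> {0..T} \<Longrightarrow> sqrt (ip m (\<lambda>x. u t x - u s x) (\<lambda>x. u t x - u s x)) \<le> K * \<bar>t - s\<bar>"
  shows "closed {t \<in> {0..T}. AE x in m. \<bar>u t x\<bar> \<le> c}"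
  unfolding closed_sequential_limits
proof (intro allI impI)
  fix tt t assume "(\<forall>n. tt n \<in> {t \<in> {0..T}. AE x in m. \<bar>u t x\<bar> \<le> c}) \<and> tt \<longlonglongrightarrow> t"
  then have tt: "\<And>n. tt n \<in> {0..T}" "\<And>n. AE x in m. \<bar>u (tt n) x\<bar> \<le> c" "tt \<longlonglongrightarrow> t" by auto
  have t: "t \<in> {0..T}" using closed_sequentially[OF closed_atLeastAtMost, of tt 0 T t] tt by auto
  define \<phi> where "\<phi> x = max 0 (\<bar>u t x\<bar> - c)" for x
  have [measurable]: "u t \<in> borel_measurable m" using L2[OF t] by (rule L2_measurable)
  have [measurable]: "\<phi> \<in> borel_measurable m" unfolding \<phi>_def by measurable
  have le: "(\<integral>\<^sup>+x. ennreal ((\<phi> x)\<^sup>2) \<partial>m) \<le> ennreal ((K * \<bar>t - tt n\<bar>)\<^sup>2)" for n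
  proof -
    have d: "(\<lambda>x. u t x - u (tt n) x) \<in> L2 m" by (intro L2_diff L2 t tt)
    have "(\<integral>\<^sup>+x. ennreal ((\<phi> x)\<^sup>2) \<partial>m) \<le> (\<integral>\<^sup>+x. ennreal ((u t x - u (tt n) x)\<^sup>2) \<partial>m)"
    proof (rule nn_integral_mono_AE)
      show "AE x in m. ennreal ((\<phi> x)\<^sup>2) \<le> ennreal ((u t x - u (tt n) x)\<^sup>2)"
        using tt(2)[of n]
      proof eventually_elim
        case (elim x)
        then have "\<bar>\<phi> x\<bar> \<le> \<bar>u t x - u (tt n) x\<bar>" by (auto simp: \<phi>_def)
        then show ?case by (intro ennreal_leI) (simp add: abs_le_square_iff)
      qed
    qed
    also have "\<dots> = ennreal (ip m (\<lambda>x. u t x - u (tt n) x) (\<lambda>x. u t x - u (tt n) x))"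
      using d by (subst nn_integral_eq_integral) (auto simp: L2_iff ip_def power2_eq_square)
    also have "\<dots> \<le> ennreal ((K * \<bar>t - tt n\<bar>)\<^sup>2)"
    proof (rule ennreal_leI)
      have "ip m (\<lambda>x. u t x - u (tt n) x) (\<lambda>x. u t x - u (tt n) x) = (sqrt (ip m (\<lambda>x. u t x - u (tt n) x) (\<lambda>x. u t x - u (tt n) x)))\<^sup>2"
        by (simp add: ip_nonneg)
      also have "\<dots> \<le> (K * \<bar>t - tt n\<bar>)\<^sup>2" by (intro power_mono lip t tt) (simp add: ip_nonneg)
      finally show "ip m (\<lambda>x. u t x - u (tt n) x) (\<lambda>x. u t x - u (tt n) x) \<le> (K * \<bar>t - tt n\<bar>)\<^sup>2" .
    qed
    finally show ?thesis .
  qed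
  have "(\<lambda>n. ennreal ((K * \<bar>t - tt n\<bar>)\<^sup>2)) \<longlonglongrightarrow> ennreal ((K * \<bar>t - t\<bar>)\<^sup>2)"
    by (intro tendsto_intros tt)
  then have "(\<lambda>n. ennreal ((K * \<bar>t - tt n\<bar>)\<^sup>2)) \<longlonglongrightarrow> 0" by simp
  then have "(\<integral>\<^sup>+x. ennreal ((\<phi> x)\<^sup>2) \<partial>m) \<le> 0" using le by (intro LIMSEQ_le_const) auto
  then have "AE x in m. ennreal ((\<phi> x)\<^sup>2) = 0" by (simp add: nn_integral_0_iff_AE)
  then have "AE x in m. \<bar>u t x\<bar> \<le> c" by eventually_elim (auto simp: \<phi>_def max_def split: if_splits)
  then show "t \<in> {t \<in> {0..T}. AE x in m. \<bar>u t x\<bar> \<le> c}" using t by simp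
qed

text \<open>The mean value theorem on the interval between \<open>a\<close> and \<open>b\<close>, on which \<open>\<bar>s\<bar> \<le> A\<close>.\<close>

lemma power_growth_lipschitz:
  fixes f :: "real \<Rightarrow> real"
  assumes f: "f differentiable_on UNIV" and C: "C > 0" "\<And>s. \<bar>deriv f s\<bar> \<le> C * \<bar>s\<bar> powr (r - 1)" and r: "r > 1"
    and B: "\<bar>a\<bar> \<le> A" "\<bar>b\<bar> \<le> A"
  shows "\<bar>f a - f b\<bar> \<le> C * A powr (r - 1) * \<bar>a - b\<bar>"
proof -
  have d: "(f has_real_derivative deriv f x) (at x)" for x
    using f by (simp add: differentiable_on_def DERIV_deriv_iff_real_differentiable)
  have *: "\<bar>f b - f a\<bar> \<le> C * A powr (r - 1) * \<bar>b - a\<bar>" if ab: "a < b" "\<bar>a\<bar> \<le> A" "\<bar>b\<bar> \<le> A" for a b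
  proof -
    obtain z where z: "a < z" "z < b" "f b - f a = (b - a) * deriv f z"
      using MVT2[of a b f "deriv f"] ab(1) d by blast
    have "\<bar>deriv f z\<bar> \<le> C * \<bar>z\<bar> powr (r - 1)" by (rule C(2))
    also have "\<dots> \<le> C * A powr (r - 1)" using z ab C(1) r by (intro mult_left_mono powr_mono2) auto
    finally have "\<bar>b - a\<bar> * \<bar>deriv f z\<bar> \<le> \<bar>b - a\<bar> * (C * A powr (r - 1))" by (rule mult_left_mono) simp
    then show ?thesis unfolding z(3) abs_mult by (simp add: mult_ac)
  qed
  show ?thesis
    using *[of a b] *[of b a] B by (cases a b rule: linorder_cases) (auto simp: abs_minus_commute)
qed

text \<open>With \<open>g\<close> the power \<open>r - 1\<close> of the sup norm of \<open>u\<close>, the norm of \<open>f(u(t))\<close> in \<open>L\<^sup>2\<close> satisfies the hypotheses of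
  \<open>chain_bound\<close> for a multiple of \<open>g\<close>: the increments are controlled by the Lipschitz continuity of \<open>u\<close> in
  \<open>L\<^sup>2\<close>, and the values themselves by \<open>f(0) = 0\<close> and the boundedness of \<open>u\<close> in \<open>L\<^sup>2\<close>. As \<open>q \<ge> 1\<close>, the function \<open>g\<close> is
  integrable.\<close>

lemma nonlinearity_bounded:
  fixes u :: "real \<Rightarrow> 'a \<Rightarrow> real"
  assumes T: "T > 0"
    and L2: "\<And>t. t \<in> {0..T} \<Longrightarrow> u t \<in> L2 m"
    and lip: "\<And>s t. s \<in> {0..T} \<Longrightarrow> t \<in> {0..T} \<Longrightarrow> sqrt (ip m (\<lambda>x. u t x - u s x) (\<lambda>x. u t x - u s x)) \<le> K * \<bar>t - s\<bar>"
    and K: "K \<ge> 0" and K': "\<And>t. t \<in> {0..T} \<Longrightarrow> sqrt (ip m (u t) (u t)) \<le> K'"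
    and f: "f differentiable_on UNIV" and C: "C > 0" "\<And>s. \<bar>deriv f s\<bar> \<le> C * \<bar>s\<bar> powr (r - 1)" and r: "r > 1" and f0: "f 0 = 0"
    and q: "1 \<le> q" and bn: "bochner_norm (q * ennreal (r - 1)) T (lnorm m \<infinity>) u < \<infinity>"
  shows "\<exists>B. AE t in lborel. t \<in> {0<..<T} \<longrightarrow> (\<lambda>x. f (u t x)) \<in> L2 m \<and> ip m (\<lambda>x. f (u t x)) (\<lambda>x. f (u t x)) \<le> B"
proof -
  define S where "S t = (if t \<in> {0<..<T} then lnorm m \<infinity> (u t) else 0)" for t
  have S_meas [measurable]: "S \<in> borel_measurable borel"
  proof (rule borel_measurableI_le)
    fix y :: ennreal
    show "{x \<in> space borel. S x \<le> y} \<in> sets borel"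
    proof (cases y)
      case (real c)
      have "{x. S x \<le> y} = ({t \<in> {0..T}. AE x in m. \<bar>u t x\<bar> \<le> c} \<inter> {0<..<T}) \<union> (- {0<..<T})"
        using lnorm_top_le_iff[OF L2_measurable[OF L2] real(1)] real by (auto simp: S_def)
      moreover have "closed {t \<in> {0..T}. AE x in m. \<bar>u t x\<bar> \<le> c}"
        by (rule sup_norm_semicontinuous[OF L2 lip])
      ultimately show ?thesis by (simp add: borel_closed)
    qed simp
  qed
  define g where "g t = enn2real (S t) powr (r - 1)" for t
  have [measurable]: "g \<in> borel_measurable borel" unfolding g_def by measurable
  have ae_on: "(AE t in lebesgue_on {0<..<T}. P t) \<longleftrightarrow> (AE t in lborel. t \<in> {0<..<T} \<longrightarrow> P t)" for P
    by (simp add: AE_restrict_space_iff AE_completion_iff)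
  have SG: "(AE t in lborel. S t < top) \<and> integrable lborel (\<lambda>t. indicator {0<..<T} t * g t)"
  proof (cases "q = top")
    case True
    then have "q * ennreal (r - 1) = top" using r by (simp add: ennreal_top_mult)
    then have "esssup (lebesgue_on {0<..<T}) (\<lambda>t. lnorm m \<infinity> (u t)) < top"
      using bn by (simp add: bochner_norm_def Lp_norm_def)
    then obtain c where c: "c \<ge> 0" "esssup (lebesgue_on {0<..<T}) (\<lambda>t. lnorm m \<infinity> (u t)) = ennreal c"
      by (metis ennreal_cases less_irrefl)
    have "AE t in lborel. t \<in> {0<..<T} \<longrightarrow> lnorm m \<infinity> (u t) \<le> ennreal c"
      using esssup_AE[of "\<lambda>t. lnorm m \<infinity> (u t)" "lebesgue_on {0<..<T}"] unfolding c(2) ae_on .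
    then have Sc: "AE t in lborel. S t \<le> ennreal c"
      by eventually_elim (auto simp: S_def)
    have bnd: "AE t in lborel. norm (indicator {0<..<T} t * g t) \<le> norm (c powr (r - 1) * indicator {0<..<T} t)"
      using Sc
    proof eventually_elim
      case (elim t)
      then have "enn2real (S t) \<le> c" using c(1) by (metis enn2real_ennreal enn2real_mono ennreal_less_top)
      then have "g t \<le> c powr (r - 1)" unfolding g_def using r by (intro powr_mono2) auto
      then show ?case by (auto simp: indicator_def g_def)
    qed
    have ic: "integrable lborel (\<lambda>t. c powr (r - 1) * indicator {0<..<T} t :: real)"
      using T by (intro integrable_mult_right integrable_real_indicator) auto
    have "integrable lborel (\<lambda>t. indicator {0<..<T} t * g t)"
      by (rule Bochner_Integration.integrable_bound[OF ic _ bnd]) auto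
    moreover have "AE t in lborel. S t < top"
      using Sc by eventually_elim (auto intro: le_less_trans)
    ultimately show ?thesis by blast
  next
    case False
    define q' where "q' = enn2real q"
    have q': "q = ennreal q'" "q' \<ge> 1" using False q by (auto simp: q'_def less_top enn2real_positive_iff intro: )
       (metis enn2real_1 enn2real_mono less_top)
    define c where "c = q' * (r - 1)"
    have c: "c > 0" "r - 1 \<le> c" using q' r by (auto simp: c_def)
    have qc: "q * ennreal (r - 1) = ennreal c" using q' r by (simp add: c_def ennreal_mult)
    have "(\<integral>\<^sup>+t. epow (lnorm m \<infinity> (u t)) c \<partial>lebesgue_on {0<..<T}) < top"
    proof (rule ccontr)
      assume "\<not> ?thesis"
      then have "(\<integral>\<^sup>+t. epow (lnorm m \<infinity> (u t)) c \<partial>lebesgue_on {0<..<T}) = top" using top.not_eq_extremum by blast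
      then show False using bn c by (simp add: bochner_norm_def qc Lp_norm_def epow_def)
    qed
    moreover have "(\<integral>\<^sup>+t. epow (lnorm m \<infinity> (u t)) c \<partial>lebesgue_on {0<..<T}) = (\<integral>\<^sup>+t. indicator {0<..<T} t * epow (S t) c \<partial>lborel)"
    proof -
      have "(\<integral>\<^sup>+t. epow (lnorm m \<infinity> (u t)) c \<partial>lebesgue_on {0<..<T}) = (\<integral>\<^sup>+t. epow (S t) c \<partial>lebesgue_on {0<..<T})"
        by (intro nn_integral_cong) (auto simp: S_def)
      also have "\<dots> = (\<integral>\<^sup>+t. epow (S t) c * indicator {0<..<T} t \<partial>lebesgue)"
        by (rule nn_integral_restrict_space) auto
      also have "\<dots> = (\<integral>\<^sup>+t. epow (S t) c * indicator {0<..<T} t \<partial>lborel)"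
        by (rule nn_integral_completion)
      finally show ?thesis by (simp add: mult.commute)
    qed
    ultimately have fin: "(\<integral>\<^sup>+t. indicator {0<..<T} t * epow (S t) c \<partial>lborel) < top" by simp
    have [measurable]: "(\<lambda>t. epow (S t) c) \<in> borel_measurable borel" unfolding epow_def by measurable
    have "AE t in lborel. indicator {0<..<T} t * epow (S t) c \<noteq> \<infinity>"
      by (rule nn_integral_PInf_AE) (use fin in auto)
    then have 1: "AE t in lborel. S t < top"
      by eventually_elim (auto simp: S_def epow_def less_top indicator_def split: if_splits)
    have "(\<integral>\<^sup>+t. ennreal (norm (indicator {0<..<T} t * g t)) \<partial>lborel) \<le> (\<integral>\<^sup>+t. indicator {0<..<T} t + indicator {0<..<T} t * epow (S t) c \<partial>lborel)"
    proof (rule nn_integral_mono_AE)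
      show "AE t in lborel. ennreal (norm (indicator {0<..<T} t * g t)) \<le> indicator {0<..<T} t + indicator {0<..<T} t * epow (S t) c"
        using 1
      proof eventually_elim
        case (elim t)
        have "g t \<le> 1 + enn2real (S t) powr c"
        proof (cases "enn2real (S t) \<le> 1")
          case True
          then have "g t \<le> 1 powr (r - 1)" unfolding g_def using r by (intro powr_mono2) auto
          then show ?thesis by (simp add: add_increasing2)
        next
          case False
          then have "g t \<le> enn2real (S t) powr c" unfolding g_def using c by (intro powr_mono) auto
          then show ?thesis by simp
        qed
        then have "ennreal (g t) \<le> 1 + epow (S t) c"
          using elim by (simp add: epow_def less_top flip: ennreal_plus ennreal_1)
        then show ?case by (auto simp: indicator_def g_def)
      qed
    qed
    also have "\<dots> = emeasure lborel {0<..<T} + (\<integral>\<^sup>+t. indicator {0<..<T} t * epow (S t) c \<partial>lborel)"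
      by (subst nn_integral_add) auto
    also have "\<dots> < \<infinity>" using fin T by (simp add: less_top)
    finally have "integrable lborel (\<lambda>t. indicator {0<..<T} t * g t)" by (intro integrableI_bounded) auto
    then show ?thesis using 1 by blast
  qed
  define G where "G = {t. S t < top}"
  define F where "F t x = f (u t x)" for t x
  have fm [measurable]: "f \<in> borel_measurable borel"
    using f by (intro borel_measurable_continuous_onI differentiable_imp_continuous_on)
  have bound: "AE x in m. \<bar>u t x\<bar> \<le> enn2real (S t)" if "t \<in> G" "t \<in> {0<..<T}" for t
  proof -
    have um: "u t \<in> borel_measurable m" using that by (intro L2_measurable L2) auto
    have "lnorm m \<infinity> (u t) \<le> ennreal (enn2real (S t))" using that by (simp add: G_def S_def)
    then show ?thesis by (subst (asm) lnorm_top_le_iff[OF um]) auto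
  qed
  have F_meas: "F t \<in> borel_measurable m" if "t \<in> {0<..<T}" for t
  proof -
    have [measurable]: "u t \<in> borel_measurable m" using that by (intro L2_measurable L2) auto
    show ?thesis unfolding F_def[abs_def] by measurable
  qed
  \<comment> \<open>The lattice property of \<open>L\<^sup>2\<close> with the constant made explicit; it serves for \<open>F(t)\<close> and for its increments.\<close>
  have dom: "h \<in> L2 m \<and> sqrt (ip m h h) \<le> c * sqrt (ip m k k)"
    if h: "h \<in> borel_measurable m" and k: "k \<in> L2 m" and le: "AE x in m. \<bar>h x\<bar> \<le> c * \<bar>k x\<bar>" and c: "c \<ge> 0" for h k c
  proof -
    have sq: "AE x in m. (h x)\<^sup>2 \<le> c\<^sup>2 * (k x)\<^sup>2"
      using le
    proof eventually_elim
      case (elim x)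
      then have "\<bar>h x\<bar>\<^sup>2 \<le> (c * \<bar>k x\<bar>)\<^sup>2" by (intro power_mono) auto
      then show ?case by (simp add: power_mult_distrib)
    qed
    have ik: "integrable m (\<lambda>x. c\<^sup>2 * (k x)\<^sup>2)" using k by (auto simp: L2_iff)
    have hh: "integrable m (\<lambda>x. (h x)\<^sup>2)"
      by (rule Bochner_Integration.integrable_bound[OF ik]) (use h sq in \<open>auto simp: elim: eventually_mono\<close>)
    have "ip m h h \<le> c\<^sup>2 * ip m k k"
      using integral_mono_AE[OF hh ik sq] by (simp add: ip_def power2_eq_square)
    then have "sqrt (ip m h h) \<le> sqrt (c\<^sup>2 * ip m k k)" by simp
    then show ?thesis using h hh c by (simp add: L2_iff real_sqrt_mult)
  qed
  have F_L2: "F t \<in> L2 m \<and> sqrt (ip m (F t) (F t)) \<le> C * g t * sqrt (ip m (u t) (u t))" if t: "t \<in> G" "t \<in> {0<..<T}" for t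
  proof (rule dom[OF F_meas[OF t(2)]])
    show "u t \<in> L2 m" using t by (intro L2) auto
    show "AE x in m. \<bar>F t x\<bar> \<le> C * g t * \<bar>u t x\<bar>"
      using bound[OF t]
    proof eventually_elim
      case (elim x)
      then show ?case using power_growth_lipschitz[OF f C r elim, of 0] f0 by (simp add: F_def g_def)
    qed
  qed (use C in \<open>simp add: g_def\<close>)
  have F_lip: "\<bar>sqrt (ip m (F t) (F t)) - sqrt (ip m (F s) (F s))\<bar> \<le> (C * K * g t + C * K * g s) * \<bar>t - s\<bar>"
    if s: "s \<in> G" "s \<in> {0<..<T}" and t: "t \<in> G" "t \<in> {0<..<T}" for s t
  proof -
    have ds: "s \<in> {0..T}" "t \<in> {0..T}" using s t by auto
    have "sqrt (ip m (\<lambda>x. F t x - F s x) (\<lambda>x. F t x - F s x)) \<le> C * (g t + g s) * sqrt (ip m (\<lambda>x. u t x - u s x) (\<lambda>x. u t x - u s x))"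
    proof (rule conjunct2[OF dom])
      show "(\<lambda>x. F t x - F s x) \<in> borel_measurable m" using F_meas s t by auto
      show "(\<lambda>x. u t x - u s x) \<in> L2 m" by (intro L2_diff L2 ds)
      show "AE x in m. \<bar>F t x - F s x\<bar> \<le> C * (g t + g s) * \<bar>u t x - u s x\<bar>"
        using bound[OF s] bound[OF t]
      proof eventually_elim
        case (elim x)
        define A where "A = max (enn2real (S t)) (enn2real (S s))"
        have "\<bar>F t x - F s x\<bar> \<le> C * A powr (r - 1) * \<bar>u t x - u s x\<bar>"
          unfolding F_def using elim by (intro power_growth_lipschitz[OF f C r]) (auto simp: A_def)
        also have "\<dots> \<le> C * (g t + g s) * \<bar>u t x - u s x\<bar>"
          using C(1) by (intro mult_right_mono mult_left_mono) (auto simp: A_def g_def max_def)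
        finally show ?case .
      qed
    qed (use C in \<open>simp add: g_def\<close>)
    also have "\<dots> \<le> C * (g t + g s) * (K * \<bar>t - s\<bar>)"
      using C(1) by (intro mult_left_mono lip ds) (auto simp: g_def)
    finally have d: "sqrt (ip m (\<lambda>x. F t x - F s x) (\<lambda>x. F t x - F s x)) \<le> (C * K * g t + C * K * g s) * \<bar>t - s\<bar>"
      by (simp add: algebra_simps)
    have sym: "ip m (\<lambda>x. F s x - F t x) (\<lambda>x. F s x - F t x) = ip m (\<lambda>x. F t x - F s x) (\<lambda>x. F t x - F s x)"
      by (simp add: ip_def algebra_simps)
    show ?thesis
      using L2_triangle[of "F t" m "F s"] L2_triangle[of "F s" m "F t"] F_L2[OF s] F_L2[OF t] d sym by auto
  qed
  have good: "AE t in lborel. t \<in> {0<..<T} \<longrightarrow> t \<in> G" using SG by (auto simp: G_def elim: eventually_mono)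
  have K'0: "K' \<ge> 0" using K'[of 0] T ip_nonneg[of m "u 0"] by (meson atLeastAtMost_iff less_imp_le order_refl order_trans real_sqrt_ge_zero)
  define gg where "gg t = C * (K + K') * g t" for t
  have gi: "integrable lborel (\<lambda>t. indicator {0<..<T} t * gg t)"
    using integrable_mult_right[of "C * (K + K')" lborel "\<lambda>t. indicator {0<..<T} t * g t"] SG by (simp add: gg_def mult_ac)
  have g_nn: "g t \<ge> 0" for t by (simp add: g_def)
  have le1: "C * K * g t \<le> gg t" "C * K' * g t \<le> gg t" for t
    using C(1) K K'0 g_nn by (auto simp: gg_def intro!: mult_right_mono mult_left_mono)
  define B where "B = (4 * 1 / T + 14) * (LBINT s. indicator {0<..<T} s * gg s)"
  have "sqrt (ip m (F t) (F t)) \<le> B" if t: "t \<in> G" "t \<in> {0<..<T}" for t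
    unfolding B_def
  proof (rule chain_bound[OF T gi _ _ good _ _ t, where N="\<lambda>t. sqrt (ip m (F t) (F t))"])
    show "0 \<le> gg s" for s using C(1) K K'0 by (simp add: gg_def g_def)
    show "\<bar>sqrt (ip m (F t) (F t)) - sqrt (ip m (F s) (F s))\<bar> \<le> (gg t + gg s) * \<bar>t - s\<bar>"
      if "s \<in> G" "t \<in> G" "s \<in> {0<..<T}" "t \<in> {0<..<T}" for s t
      by (rule order_trans[OF F_lip[OF that(1,3,2,4)]]) (intro mult_right_mono add_mono le1, simp)
    show "sqrt (ip m (F s) (F s)) \<le> 1 * gg s" if s: "s \<in> G" "s \<in> {0<..<T}" for s
    proof -
      have "sqrt (ip m (F s) (F s)) \<le> C * g s * sqrt (ip m (u s) (u s))" using F_L2[OF s] by blast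
      also have "\<dots> \<le> C * g s * K'" using C(1) s by (intro mult_left_mono K') (auto simp: g_def)
      also have "\<dots> \<le> gg s" using le1(2)[of s] by (simp add: mult_ac)
      finally show ?thesis by simp
    qed
  qed simp
  then have "ip m (F t) (F t) \<le> B\<^sup>2" if t: "t \<in> G" "t \<in> {0<..<T}" for t
    using that by (intro sqrt_le_D)
  then have "AE t in lborel. t \<in> {0<..<T} \<longrightarrow> F t \<in> L2 m \<and> ip m (F t) (F t) \<le> B\<^sup>2"
    using good by (auto elim!: eventually_mono dest: F_L2)
  then show ?thesis unfolding F_def[abs_def] by blast
qed

section \<open>Strong measurability\<close>

text \<open>Rounding to a multiple of \<open>1/d\<close>. The cut-off at \<open>k\<close> makes the range finite.\<close>

definition discretize :: "nat \<Rightarrow> real \<Rightarrow> real \<Rightarrow> real" where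
  "discretize k d x = (if \<bar>x\<bar> \<le> real k then of_int \<lfloor>x * d\<rfloor> / d else 0)"

lemma discretize_error: "d > 0 \<Longrightarrow> \<bar>x\<bar> \<le> real k \<Longrightarrow> \<bar>discretize k d x - x\<bar> \<le> 1 / d"
proof -
  assume d: "d > 0" and x: "\<bar>x\<bar> \<le> real k"
  have "\<bar>of_int \<lfloor>x * d\<rfloor> - x * d\<bar> \<le> 1" by linarith
  moreover have "discretize k d x - x = (of_int \<lfloor>x * d\<rfloor> - x * d) / d"
    using d x by (simp add: discretize_def field_simps)
  ultimately show ?thesis using d by (simp add: divide_right_mono)
qed

lemma finite_range_discretize: "finite (range (discretize k d))"
proof -
  have "range (discretize k d) \<subseteq> insert 0 ((\<lambda>j. of_int j / d) ` {\<lfloor>- (real k * \<bar>d\<bar>)\<rfloor>..\<lceil>real k * \<bar>d\<bar>\<rceil>})"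
  proof
    fix y assume "y \<in> range (discretize k d)"
    then obtain x where y: "y = discretize k d x" by blast
    show "y \<in> insert 0 ((\<lambda>j. of_int j / d) ` {\<lfloor>- (real k * \<bar>d\<bar>)\<rfloor>..\<lceil>real k * \<bar>d\<bar>\<rceil>})"
    proof (cases "\<bar>x\<bar> \<le> real k")
      case True
      have "\<bar>x * d\<bar> \<le> real k * \<bar>d\<bar>" unfolding abs_mult using True by (intro mult_right_mono) auto
      then have "- (real k * \<bar>d\<bar>) \<le> x * d" "x * d \<le> real k * \<bar>d\<bar>" by linarith+
      then have "\<lfloor>- (real k * \<bar>d\<bar>)\<rfloor> \<le> \<lfloor>x * d\<rfloor>" "\<lfloor>x * d\<rfloor> \<le> \<lceil>real k * \<bar>d\<bar>\<rceil>"
        by (simp_all only: floor_mono order_trans[OF floor_mono floor_le_ceiling])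
      then show ?thesis using True by (auto simp: y discretize_def)
    qed (simp add: y discretize_def)
  qed
  then show ?thesis by (rule finite_subset) simp
qed

lemma discretize_measurable [measurable]: "discretize k d \<in> borel_measurable borel"
  unfolding discretize_def by measurable

lemma simple_discretize:
  assumes "g \<in> borel_measurable M"
  shows "simple_function M (\<lambda>t. discretize k d (g t))"
  unfolding simple_function_iff_borel_measurable
proof
  have "(\<lambda>t. discretize k d (g t)) ` space M \<subseteq> range (discretize k d)" by auto
  then show "finite ((\<lambda>t. discretize k d (g t)) ` space M)" using finite_range_discretize finite_subset by blast
qed (use assms in measurable)

lemma simple_function_comb:
  fixes e :: "nat \<Rightarrow> 'a \<Rightarrow> real"
  assumes "\<And>n. simple_function M (c n)"
  shows "simple_function M (\<lambda>t x. \<Sum>n<k. c n t * e n x)"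
proof (induction k)
  case 0
  then show ?case by simp
next
  case (Suc k)
  have "simple_function M (\<lambda>t. (\<lambda>h a x. h x + a * e k x) ((\<lambda>t x. \<Sum>n<k. c n t * e n x) t) (c k t))"
    by (rule simple_function_compose2[OF Suc assms])
  then show ?case by simp
qed

context onb begin

text \<open>Pettis' theorem for the spectral scale: a function with measurable coefficients is strongly measurable. The
  approximating simple functions are finite combinations of basis elements with discretised
  coefficients. The mesh \<open>1 / d k\<close> is chosen so fine that the total rounding error in the first \<open>k\<close>
  coefficients, weighted by the eigenvalues, tends to zero.\<close>

lemma strongly_measurable_coefficients:
  fixes g :: "real \<Rightarrow> 'a \<Rightarrow> real"
  assumes S: "\<And>c k. (\<lambda>x. \<Sum>n<k. c n * e n x) \<in> S"
    and gS: "AE t in lebesgue_on {0<..<T}. g t \<in> S"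
    and gL2: "AE t in lebesgue_on {0<..<T}. g t \<in> L2 m \<and> Vnorm m e ev \<sigma> (g t) < \<infinity>"
    and meas: "\<And>n. (\<lambda>t. ip m (g t) (e n)) \<in> borel_measurable (lebesgue_on {0<..<T})"
    and N: "\<And>h. h \<in> L2 m \<Longrightarrow> N h = Vnorm m e ev \<sigma> h"
  shows "strongly_measurable T S N g"
proof -
  define d where "d k = (real k + 1) * (1 + (\<Sum>n<k. ev n powr (2 * \<sigma>)))" for k
  have s0: "0 \<le> (\<Sum>n<k. ev n powr (2 * \<sigma>))" for k by (intro sum_nonneg) simp
  have d1: "real k + 1 \<le> d k" "(\<Sum>n<k. ev n powr (2 * \<sigma>)) \<le> d k" "d k > 0" for k
  proof -
    have "(real k + 1) * 1 \<le> d k" unfolding d_def using s0[of k] by (intro mult_left_mono) auto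
    then show 1: "real k + 1 \<le> d k" by simp
    have "1 * (\<Sum>n<k. ev n powr (2 * \<sigma>)) \<le> d k" unfolding d_def using s0[of k] by (intro mult_mono) auto
    then show "(\<Sum>n<k. ev n powr (2 * \<sigma>)) \<le> d k" by simp
    show "d k > 0" using 1 by linarith
  qed
  define \<sigma>' where "\<sigma>' k t = (\<lambda>x. \<Sum>n<k. discretize k (d k) (ip m (g t) (e n)) * e n x)" for k t
  have conv: "(\<lambda>k. N (\<sigma>' k t - g t)) \<longlonglongrightarrow> 0" if g: "g t \<in> L2 m" "Vnorm m e ev \<sigma> (g t) < \<infinity>" for t
  proof -
    define a where "a n = (ip m (g t) (e n))\<^sup>2 * ev n powr (2 * \<sigma>)" for n
    have a0: "a n \<ge> 0" for n by (simp add: a_def)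
    have "(\<Sum>n. ennreal (a n)) < top"
      using g(2) by (simp add: Vnorm_def a_def epow_half_finite)
    then have sa: "summable a" using a0 by (intro summable_suminf_not_top) (auto simp: less_top)
    define tail where "tail k = (\<Sum>n. a (n + k))" for k
    have tail: "tail \<longlonglongrightarrow> 0" unfolding tail_def using suminf_exist_split2[OF sa] by simp
    obtain K where K: "sqrt (ip m (g t) (g t)) \<le> real K" using real_arch_simple by blast
    have coef: "\<bar>ip m (g t) (e n)\<bar> \<le> real k" if "k \<ge> K" for n k
      using ip_abs_le[OF g(1) e_L2[of n]] K that by (simp add: orth)
    have bound: "N (\<sigma>' k t - g t) \<le> ennreal (sqrt (1 / (real k + 1) + tail k))" if k: "k \<ge> K" for k
    proof -
      have L2: "(\<lambda>x. \<sigma>' k t x - g t x) \<in> L2 m" unfolding \<sigma>'_def by (intro L2_diff comb_L2 g)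
      define b where "b n = (if n < k then ev n powr (2 * \<sigma>) / (d k)\<^sup>2 else a n)" for n
      have b0: "b n \<ge> 0" for n using a0 by (simp add: b_def)
      have cf: "ip m (\<sigma>' k t - g t) (e n) = (if n < k then discretize k (d k) (ip m (g t) (e n)) - ip m (g t) (e n) else - ip m (g t) (e n))" for n
        using ip_diff[OF comb_L2[of "\<lambda>n. discretize k (d k) (ip m (g t) (e n))" k] g(1) e_L2[of n]]
        by (simp add: \<sigma>'_def fun_diff_def ip_comb)
      have le: "(ip m (\<sigma>' k t - g t) (e n))\<^sup>2 * ev n powr (2 * \<sigma>) \<le> b n" for n
      proof (cases "n < k")
        case True
        have "\<bar>discretize k (d k) (ip m (g t) (e n)) - ip m (g t) (e n)\<bar>\<^sup>2 \<le> (1 / d k)\<^sup>2"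
          by (intro power_mono discretize_error d1 coef k) simp
        then have "(ip m (\<sigma>' k t - g t) (e n))\<^sup>2 * ev n powr (2 * \<sigma>) \<le> (1 / d k)\<^sup>2 * ev n powr (2 * \<sigma>)"
          unfolding cf using True by (intro mult_right_mono) auto
        then show ?thesis using True by (simp add: b_def power_divide)
      next
        case False
        then show ?thesis by (simp add: cf b_def a_def)
      qed
      have sb: "summable b"
        using sa by (subst summable_iff_shift[of b k, symmetric]) (simp add: b_def summable_iff_shift)
      have "suminf b = tail k + (\<Sum>n<k. b n)"
        unfolding tail_def using suminf_split_initial_segment[OF sb, of k] by (simp add: b_def)
      also have "(\<Sum>n<k. b n) = (\<Sum>n<k. ev n powr (2 * \<sigma>)) / (d k)\<^sup>2"
        by (simp add: b_def sum_divide_distrib)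
      also have "\<dots> \<le> d k / (d k)\<^sup>2" using d1[of k] by (intro divide_right_mono) auto
      also have "\<dots> = 1 / d k" using d1[of k] by (simp add: power2_eq_square)
      also have "\<dots> \<le> 1 / (real k + 1)" using d1[of k] by (intro divide_left_mono) auto
      finally have sb_le: "suminf b \<le> 1 / (real k + 1) + tail k" by simp
      have nn: "0 \<le> 1 / (real k + 1) + tail k" using order_trans[OF suminf_nonneg[OF sb b0] sb_le] .
      have "(\<Sum>n. ennreal ((ip m (\<sigma>' k t - g t) (e n))\<^sup>2 * ev n powr (2 * \<sigma>))) \<le> (\<Sum>n. ennreal (b n))"
        by (intro suminf_le ennreal_leI le) auto
      also have "\<dots> = ennreal (suminf b)" by (rule suminf_ennreal2[OF b0 sb])
      also have "\<dots> \<le> ennreal ((sqrt (1 / (real k + 1) + tail k))\<^sup>2)" using sb_le nn by (intro ennreal_leI) simp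
      finally have "Vnorm m e ev \<sigma> (\<sigma>' k t - g t) \<le> ennreal (sqrt (1 / (real k + 1) + tail k))"
        unfolding Vnorm_def using nn by (subst epow_half_le_iff) auto
      moreover have "N (\<sigma>' k t - g t) = Vnorm m e ev \<sigma> (\<sigma>' k t - g t)"
        by (rule N) (use L2 in \<open>simp add: fun_diff_def\<close>)
      ultimately show ?thesis by simp
    qed
    have "(\<lambda>k. 1 / (real k + 1)) \<longlonglongrightarrow> 0" using LIMSEQ_inverse_real_of_nat by (simp add: inverse_eq_divide add.commute)
    then have "(\<lambda>k. ennreal (sqrt (1 / (real k + 1) + tail k))) \<longlonglongrightarrow> ennreal (sqrt (0 + 0))"
      by (intro tendsto_intros tail)
    then have lim: "(\<lambda>k. ennreal (sqrt (1 / (real k + 1) + tail k))) \<longlonglongrightarrow> 0" by simp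
    show ?thesis
    proof (rule tendsto_sandwich[OF _ _ tendsto_const lim])
      show "\<forall>\<^sub>F k in sequentially. N (\<sigma>' k t - g t) \<le> ennreal (sqrt (1 / (real k + 1) + tail k))"
        by (rule eventually_sequentiallyI[of K]) (rule bound)
    qed simp
  qed
  show ?thesis unfolding strongly_measurable_def
  proof (intro conjI exI[of _ \<sigma>'] allI)
    show "AE t in lebesgue_on {0<..<T}. g t \<in> S" by (rule gS)
    show "simple_function (lebesgue_on {0<..<T}) (\<sigma>' k)" for k
      unfolding \<sigma>'_def by (intro simple_function_comb simple_discretize meas)
    show "\<sigma>' k ` {0<..<T} \<subseteq> S" for k unfolding \<sigma>'_def by (intro image_subsetI S)
    show "AE t in lebesgue_on {0<..<T}. (\<lambda>k. N (\<sigma>' k t - g t)) \<longlonglongrightarrow> 0"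
      using gL2 by eventually_elim (use conv in blast)
  qed
qed

end

section \<open>Coefficients of the solution and of the operator\<close>

lemma AE_lebesgue_on_Ioo:
  "(AE t in lebesgue_on {a<..<b::real}. P t) \<longleftrightarrow> (AE t in lborel. t \<in> {a<..<b} \<longrightarrow> P t)"
  by (simp add: AE_restrict_space_iff AE_completion_iff)

lemma measurable_lebesgue_on_Ioo:
  fixes f :: "real \<Rightarrow> real"
  assumes "f \<in> borel_measurable borel" "\<And>t. t \<in> {a<..<b} \<Longrightarrow> g t = f t"
  shows "g \<in> borel_measurable (lebesgue_on {a<..<b})"
proof -
  have "f \<in> borel_measurable (lebesgue_on {a<..<b})"
    using assms(1) by (intro measurable_restrict_space1 measurable_completion) simp
  then show ?thesis by (rule measurable_cong[THEN iffD1, rotated]) (simp add: assms(2))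
qed

lemma nn_integral_lebesgue_on_Ioo:
  fixes f :: "real \<Rightarrow> ennreal"
  shows "(\<integral>\<^sup>+t. f t \<partial>lebesgue_on {a<..<b}) = (\<integral>\<^sup>+t. indicator {a<..<b} t * f t \<partial>lborel)"
proof -
  have "(\<integral>\<^sup>+t. f t \<partial>lebesgue_on {a<..<b}) = (\<integral>\<^sup>+t. f t * indicator {a<..<b} t \<partial>lebesgue)"
    by (rule nn_integral_restrict_space) auto
  also have "\<dots> = (\<integral>\<^sup>+t. f t * indicator {a<..<b} t \<partial>lborel)" by (rule nn_integral_completion)
  finally show ?thesis by (simp add: mult.commute)
qed

lemma Lp_norm_1: "Lp_norm 1 M g = (\<integral>\<^sup>+x. g x \<partial>M)"
proof -
  have "epow y 1 = y" for y by (cases y) (auto simp: epow_def)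
  then show ?thesis by (simp add: Lp_norm_def)
qed

lemma bochner_norm_1: "bochner_norm 1 T N g = (\<integral>\<^sup>+t. indicator {0<..<T} t * N (g t) \<partial>lborel)"
  by (simp add: bochner_norm_def Lp_norm_1 nn_integral_lebesgue_on_Ioo)

text \<open>Composition with this map extends a function on \<open>[0,T]\<close> to the line and keeps it continuous.\<close>

definition clamp :: "real \<Rightarrow> real \<Rightarrow> real" where "clamp T t = max 0 (min T t)"

lemma clamp_in: "T \<ge> 0 \<Longrightarrow> clamp T t \<in> {0..T}" by (auto simp: clamp_def)
lemma clamp_id: "t \<in> {0..T} \<Longrightarrow> clamp T t = t" by (auto simp: clamp_def)

lemma clamp_bdd_borel:
  assumes T: "T > 0" and f: "continuous_on {0..T} f"
  shows "bdd_borel T (\<lambda>t. f (clamp T t))" "continuous_on UNIV (\<lambda>t. f (clamp T t))"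
proof -
  show c: "continuous_on UNIV (\<lambda>t. f (clamp T t))"
    using T clamp_in[of T] by (intro continuous_on_compose2[OF f]) (auto simp: clamp_def intro!: continuous_intros)
  have "compact (f ` {0..T})" using f by (intro compact_continuous_image) auto
  then obtain M where M: "\<And>t. t \<in> {0..T} \<Longrightarrow> \<bar>f t\<bar> \<le> M"
    using compact_imp_bounded bounded_iff by (metis imageI real_norm_def)
  show "bdd_borel T (\<lambda>t. f (clamp T t))"
    using M T clamp_in by (intro bdd_borelI[where M=M] borel_measurable_continuous_onI c) auto
qed

locale curve = onb m e ev for m :: "'a measure" and e ev +
  fixes T :: real and u :: "real \<Rightarrow> 'a \<Rightarrow> real"
  assumes T: "T > 0" and C1: "C1_L2 m T u"
begin

definition y :: "nat \<Rightarrow> real \<Rightarrow> real" where "y n t = ip m (u (clamp T t)) (e n)"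
definition y' :: "nat \<Rightarrow> real \<Rightarrow> real" where "y' n t = ip m (dt m T u (clamp T t)) (e n)"

lemma u_L2: "t \<in> {0..T} \<Longrightarrow> u t \<in> L2 m" using C1 by (simp add: C1_L2_def cont_into_def)
lemma dt_L2: "t \<in> {0..T} \<Longrightarrow> dt m T u t \<in> L2 m" using C1 by (simp add: C1_L2_def cont_into_def)

lemma coefficient_continuous:
  assumes g: "cont_into T (L2 m) (lnorm m 2) g" and k: "k \<in> L2 m"
  shows "continuous_on {0..T} (\<lambda>t. ip m (g t) k)"
  unfolding continuous_on_def
proof
  fix t assume t: "t \<in> {0..T}"
  have L2: "\<And>s. s \<in> {0..T} \<Longrightarrow> g s \<in> L2 m" using g by (simp add: cont_into_def)
  have lim: "((\<lambda>s. lnorm m 2 (g s - g t)) \<longlongrightarrow> 0) (at t within {0..T})" using g t by (simp add: cont_into_def)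
  have ev: "\<forall>\<^sub>F s in at t within {0..T}. s \<in> {0..T}" by (simp add: eventually_at_filter)
  have "((\<lambda>s. ennreal (sqrt (ip m (\<lambda>x. g s x - g t x) (\<lambda>x. g s x - g t x)))) \<longlongrightarrow> ennreal 0) (at t within {0..T})"
  proof (rule Lim_transform_eventually)
    show "((\<lambda>s. lnorm m 2 (g s - g t)) \<longlongrightarrow> ennreal 0) (at t within {0..T})" using lim by simp
    show "\<forall>\<^sub>F s in at t within {0..T}. lnorm m 2 (g s - g t) = ennreal (sqrt (ip m (\<lambda>x. g s x - g t x) (\<lambda>x. g s x - g t x)))"
      using ev
    proof eventually_elim
      case (elim s)
      show ?case using L2_norm[OF L2_diff[OF L2[OF elim] L2[OF t]]] by (simp add: fun_diff_def)
    qed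
  qed
  then have "((\<lambda>s. sqrt (ip m (\<lambda>x. g s x - g t x) (\<lambda>x. g s x - g t x))) \<longlongrightarrow> 0) (at t within {0..T})"
    by (rule tendsto_ennrealD) (auto simp: ip_nonneg)
  then have z: "((\<lambda>s. sqrt (ip m (\<lambda>x. g s x - g t x) (\<lambda>x. g s x - g t x)) * sqrt (ip m k k)) \<longlongrightarrow> 0) (at t within {0..T})"
    by (rule tendsto_mult_left_zero)
  have "((\<lambda>s. ip m (g s) k - ip m (g t) k) \<longlongrightarrow> 0) (at t within {0..T})"
  proof (rule Lim_null_comparison[OF _ z])
    show "\<forall>\<^sub>F s in at t within {0..T}. norm (ip m (g s) k - ip m (g t) k) \<le> sqrt (ip m (\<lambda>x. g s x - g t x) (\<lambda>x. g s x - g t x)) * sqrt (ip m k k)"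
      using ev
    proof eventually_elim
      case (elim s)
      then show ?case using ip_abs_le[OF L2_diff[OF L2[OF elim] L2[OF t]] k] ip_diff[OF L2[OF elim] L2[OF t] k] by simp
    qed
  qed
  then show "((\<lambda>s. ip m (g s) k) \<longlongrightarrow> ip m (g t) k) (at t within {0..T})"
    by (rule LIM_zero_cancel)
qed

lemma u_cont: "continuous_on {0..T} (\<lambda>t. ip m (u t) (e n))"
  using C1 by (intro coefficient_continuous e_L2) (simp add: C1_L2_def)

lemma dt_cont: "continuous_on {0..T} (\<lambda>t. ip m (dt m T u t) (e n))"
  using C1 by (intro coefficient_continuous e_L2) (simp add: C1_L2_def)

lemma y_bdd: "bdd_borel T (y n)" unfolding y_def by (rule clamp_bdd_borel[OF T u_cont])
lemma y'_bdd: "bdd_borel T (y' n)" unfolding y'_def by (rule clamp_bdd_borel[OF T dt_cont])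

lemma coefficient_derivative:
  assumes t: "t \<in> {0..T}"
  shows "((\<lambda>s. ip m (u s) (e n)) has_real_derivative ip m (dt m T u t) (e n)) (at t within {0..T})"
proof -
  let ?v = "dt m T u t"
  let ?d = "\<lambda>s x. (u s x - u t x) / (s - t) - ?v x"
  have "has_dt m T u t ?v" using C1 t by (simp add: C1_L2_def)
  then have lim: "((\<lambda>s. lnorm m 2 (?d s)) \<longlongrightarrow> 0) (at t within {0..T})" by (simp add: has_dt_def)
  have ev: "\<forall>\<^sub>F s in at t within {0..T}. s \<in> {0..T}" by (simp add: eventually_at_filter)
  have quot: "(\<lambda>x. (u s x - u t x) / (s - t)) \<in> L2 m" if "s \<in> {0..T}" for s
    using L2_scale[OF L2_diff[OF u_L2[OF that] u_L2[OF t]], of "1 / (s - t)"] by simp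
  have dL2: "?d s \<in> L2 m" if "s \<in> {0..T}" for s
    by (intro L2_diff quot that dt_L2 t)
  have "((\<lambda>s. ennreal (sqrt (ip m (?d s) (?d s)))) \<longlongrightarrow> ennreal 0) (at t within {0..T})"
  proof (rule Lim_transform_eventually)
    show "((\<lambda>s. lnorm m 2 (?d s)) \<longlongrightarrow> ennreal 0) (at t within {0..T})" using lim by simp
    show "\<forall>\<^sub>F s in at t within {0..T}. lnorm m 2 (?d s) = ennreal (sqrt (ip m (?d s) (?d s)))"
      using ev by eventually_elim (rule L2_norm[OF dL2])
  qed
  then have z: "((\<lambda>s. sqrt (ip m (?d s) (?d s))) \<longlongrightarrow> 0) (at t within {0..T})"
    by (rule tendsto_ennrealD) (auto simp: ip_nonneg)
  have "((\<lambda>s. (ip m (u s) (e n) - ip m (u t) (e n)) / (s - t) - ip m ?v (e n)) \<longlongrightarrow> 0) (at t within {0..T})"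
  proof (rule Lim_null_comparison[OF _ z])
    show "\<forall>\<^sub>F s in at t within {0..T}. norm ((ip m (u s) (e n) - ip m (u t) (e n)) / (s - t) - ip m ?v (e n)) \<le> sqrt (ip m (?d s) (?d s))"
      using ev
    proof eventually_elim
      case (elim s)
      have "ip m (\<lambda>x. (u s x - u t x) / (s - t)) (e n) = (ip m (u s) (e n) - ip m (u t) (e n)) / (s - t)"
        using ip_scale[of m "1 / (s - t)" "\<lambda>x. u s x - u t x" "e n"] ip_diff[OF u_L2[OF elim] u_L2[OF t] e_L2[of n]] by simp
      then have "(ip m (u s) (e n) - ip m (u t) (e n)) / (s - t) - ip m ?v (e n) = ip m (?d s) (e n)"
        using ip_diff[OF quot[OF elim] dt_L2[OF t] e_L2[of n]] by simp
      then show ?case using ip_abs_le[OF dL2[OF elim] e_L2[of n]] by (simp add: orth)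
    qed
  qed
  then have "((\<lambda>s. (ip m (u s) (e n) - ip m (u t) (e n)) / (s - t)) \<longlongrightarrow> ip m ?v (e n)) (at t within {0..T})"
    by (rule LIM_zero_cancel)
  then show ?thesis by (simp add: has_field_derivative_iff)
qed

lemma y_J:
  assumes t: "t \<in> {0..T}"
  shows "y n t = y n 0 + RL 1 (y' n) t"
proof -
  let ?f = "\<lambda>t. ip m (u t) (e n)" and ?f' = "\<lambda>t. ip m (dt m T u t) (e n)"
  have "(LBINT s. indicator {0..t} s *\<^sub>R ?f' s) = ?f t - ?f 0"
  proof (rule integral_FTC_Icc)
    show "0 \<le> t" using t by simp
    show "(?f has_vector_derivative ?f' s) (at s within {0..t})" if "0 \<le> s" "s \<le> t" for s
      using coefficient_derivative[of s n] that t
      by (auto simp: has_real_derivative_iff_has_vector_derivative intro: has_vector_derivative_within_subset)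
    show "continuous_on {0..t} ?f'" by (rule continuous_on_subset[OF dt_cont]) (use t in auto)
  qed
  moreover have "(LBINT s. indicator {0..t} s *\<^sub>R ?f' s) = RL 1 (y' n) t"
    unfolding RL_1
  proof (rule integral_cong_AE)
    have "continuous_on {0..t} ?f'" by (rule continuous_on_subset[OF dt_cont]) (use t in auto)
    then show "(\<lambda>s. indicator {0..t} s *\<^sub>R ?f' s) \<in> borel_measurable lborel"
      using borel_measurable_continuous_on_indicator[of "{0..t}" ?f'] by simp
    show "(\<lambda>s. indicator {0<..<t} s * y' n s) \<in> borel_measurable lborel"
      using bdd_borel_measurable[OF y'_bdd] by simp
    show "AE s in lborel. indicator {0..t} s *\<^sub>R ?f' s = indicator {0<..<t} s * y' n s"
      using AE_lborel_singleton[of 0] AE_lborel_singleton[of t]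
      by eventually_elim (use t in \<open>auto simp: indicator_def y'_def clamp_id\<close>)
  qed
  ultimately show ?thesis using t T by (simp add: y_def clamp_id)
qed

lemma L2_curve_bound:
  assumes g: "cont_into T (L2 m) (lnorm m 2) g"
  shows "\<exists>M. \<forall>t\<in>{0..T}. \<forall>N. (\<Sum>n<N. (ip m (g t) (e n))\<^sup>2) \<le> M"
proof -
  have L2: "\<And>s. s \<in> {0..T} \<Longrightarrow> g s \<in> L2 m" using g by (simp add: cont_into_def)
  have "\<exists>M. \<forall>t\<in>{0..T}. \<forall>N. (\<Sum>n<N. ev n powr (2 * 0) * (ip m (g t) (e n))\<^sup>2) \<le> M"
  proof (rule coefficient_bound)
    fix t assume t: "t \<in> {0..T}"
    show "g t \<in> L2 m" by (rule L2[OF t])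
    show "Vnorm m e ev 0 (g t) < \<infinity>" using L2[OF t] by (simp add: Vnorm_zero L2_norm)
    have ev: "\<forall>\<^sub>F s in at t within {0..T}. s \<in> {0..T}" by (simp add: eventually_at_filter)
    show "((\<lambda>s. Vnorm m e ev 0 (g s - g t)) \<longlongrightarrow> 0) (at t within {0..T})"
    proof (rule Lim_transform_eventually)
      show "((\<lambda>s. lnorm m 2 (g s - g t)) \<longlongrightarrow> 0) (at t within {0..T})" using g t by (simp add: cont_into_def)
      show "\<forall>\<^sub>F s in at t within {0..T}. lnorm m 2 (g s - g t) = Vnorm m e ev 0 (g s - g t)"
        using ev
      proof eventually_elim
        case (elim s)
        have "g s - g t \<in> L2 m" using L2_diff[OF L2[OF elim] L2[OF t]] by (simp add: fun_diff_def)
        then show ?case by (simp add: Vnorm_zero)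
      qed
    qed
  qed
  then show ?thesis using ev_pos by (simp add: less_imp_neq[symmetric])
qed

lemma norm_le_of_partial_sums:
  assumes "h \<in> L2 m" "\<And>N. (\<Sum>n<N. (ip m h (e n))\<^sup>2) \<le> M"
  shows "ip m h h \<le> M"
  by (rule LIMSEQ_le_const2[OF Parseval[OF assms(1), unfolded sums_def]]) (use assms(2) in auto)

text \<open>The mean value inequality in \<open>L\<^sup>2\<close>. Let \<open>c\<close> be the vector of the first \<open>N\<close> coefficients of \<open>u(t) - u(s)\<close>. Its square norm is the
  increment of \<open>RL 1\<close> of the scalar function \<open>\<Sum> c\<^sub>n y'\<^sub>n\<close>, and this function is bounded by \<open>\<surd>M\<close> times the norm of
  \<open>c\<close>.\<close>

lemma lipschitz:
  assumes M: "\<And>t N. t \<in> {0..T} \<Longrightarrow> (\<Sum>n<N. (ip m (dt m T u t) (e n))\<^sup>2) \<le> M"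
    and s: "s \<in> {0..T}" and t: "t \<in> {0..T}"
  shows "sqrt (ip m (\<lambda>x. u t x - u s x) (\<lambda>x. u t x - u s x)) \<le> sqrt M * \<bar>t - s\<bar>"
proof -
  have M0: "M \<ge> 0" using M[OF s, of 0] by simp
  have part: "(\<Sum>n<N. (ip m (u t) (e n) - ip m (u s) (e n))\<^sup>2) \<le> M * (t - s)\<^sup>2" if st: "s \<le> t" "s \<in> {0..T}" "t \<in> {0..T}" for N s t
  proof -
    define c where "c n = ip m (u t) (e n) - ip m (u s) (e n)" for n
    define A where "A = (\<Sum>n<N. (c n)\<^sup>2)"
    have A0: "A \<ge> 0" unfolding A_def by (intro sum_nonneg) auto
    define h where "h x = (\<Sum>n<N. c n * y' n x)" for x
    have b: "bdd_borel T (\<lambda>x. c n * y' n x)" for n by (intro bdd_borel_intros y'_bdd)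
    have hb: "bdd_borel T h" and hJ: "\<And>x. x \<le> T \<Longrightarrow> RL 1 h x = (\<Sum>n<N. c n * RL 1 (y' n) x)"
      unfolding h_def using RL_sum[of "{..<N}" T "\<lambda>n x. c n * y' n x" 1] b by (auto simp: RL_cmult)
    have hle: "\<bar>h x\<bar> \<le> sqrt (A * M)" if "x \<in> {0..T}" for x
    proof -
      have "(h x)\<^sup>2 \<le> A * (\<Sum>n<N. (y' n x)\<^sup>2)" unfolding h_def A_def by (rule Cauchy_Schwarz_ineq_sum)
      also have "\<dots> \<le> A * M" using M[OF that, of N] A0 that by (intro mult_left_mono) (auto simp: y'_def clamp_id)
      finally show ?thesis by (metis real_sqrt_abs real_sqrt_le_mono)
    qed
    have "A = RL 1 h t - RL 1 h s"
    proof -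
      have cn: "c n = RL 1 (y' n) t - RL 1 (y' n) s" for n
        using y_J[OF st(2), of n] y_J[OF st(3), of n] st by (simp add: c_def y_def clamp_id)
      have "A = (\<Sum>n<N. c n * (RL 1 (y' n) t - RL 1 (y' n) s))"
        unfolding A_def power2_eq_square by (intro sum.cong refl arg_cong2[where f="(*)"] cn)
      then show ?thesis using hJ[of t] hJ[of s] st by (simp add: right_diff_distrib sum_subtractf)
    qed
    also have "\<dots> \<le> sqrt (A * M) * (t - s)"
      using RL_1_lipschitz[OF hb hle, of s t] st by (simp add: abs_le_iff)
    finally have "A\<^sup>2 \<le> (sqrt (A * M) * (t - s))\<^sup>2" using A0 by (intro power_mono) auto
    also have "\<dots> = A * (M * (t - s)\<^sup>2)" using A0 M0 by (simp add: power_mult_distrib)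
    finally have "A * A \<le> A * (M * (t - s)\<^sup>2)" by (simp add: power2_eq_square)
    then have "A \<le> M * (t - s)\<^sup>2" using A0 M0 by (cases "A = 0") (auto simp: mult_le_cancel_left)
    then show ?thesis by (simp add: A_def c_def)
  qed
  have "ip m (\<lambda>x. u t x - u s x) (\<lambda>x. u t x - u s x) \<le> M * (t - s)\<^sup>2"
  proof (rule norm_le_of_partial_sums)
    show "(\<lambda>x. u t x - u s x) \<in> L2 m" by (intro L2_diff u_L2 s t)
    have "ip m (\<lambda>x. u t x - u s x) (e n) = ip m (u t) (e n) - ip m (u s) (e n)" for n
      by (rule ip_diff[OF u_L2[OF t] u_L2[OF s] e_L2])
    then show "(\<Sum>n<N. (ip m (\<lambda>x. u t x - u s x) (e n))\<^sup>2) \<le> M * (t - s)\<^sup>2" for N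
      using part[of s t N] part[of t s N] s t by (cases "s \<le> t") (auto simp: power2_commute)
  qed
  then have "sqrt (ip m (\<lambda>x. u t x - u s x) (\<lambda>x. u t x - u s x)) \<le> sqrt (M * (t - s)\<^sup>2)" by simp
  then show ?thesis by (simp add: real_sqrt_mult)
qed

end

locale spectral = onb m e ev for m :: "'a measure" and e ev +
  fixes DA :: "('a \<Rightarrow> real) set" and A :: "('a \<Rightarrow> real) \<Rightarrow> 'a \<Rightarrow> real"
  assumes sa: "nonneg_selfadjoint m DA A" and eb: "eigenbasis m DA A e ev"
begin

lemma DA_L2: "h \<in> DA \<Longrightarrow> h \<in> L2 m" and A_L2: "h \<in> DA \<Longrightarrow> A h \<in> L2 m"
  using sa by (auto simp: nonneg_selfadjoint_def dense_subspace_def)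

lemma comb_DA: "(\<lambda>x. \<Sum>n<k. c n * e n x) \<in> DA"
proof (induction k)
  case 0
  then show ?case using sa by (simp add: nonneg_selfadjoint_def dense_subspace_def)
next
  case (Suc k)
  have "e k \<in> DA" using eb by (simp add: eigenbasis_def)
  moreover have "\<And>u v a b. u \<in> DA \<Longrightarrow> v \<in> DA \<Longrightarrow> (\<lambda>x. a * u x + b * v x) \<in> DA"
    using sa by (simp add: nonneg_selfadjoint_def dense_subspace_def)
  ultimately have "(\<lambda>x. 1 * (\<Sum>n<k. c n * e n x) + c k * e k x) \<in> DA" using Suc by blast
  then show ?case by simp
qed

lemma A_e: "h \<in> L2 m \<Longrightarrow> ip m (A (e n)) h = ev n * ip m (e n) h"
proof -
  assume h: "h \<in> L2 m"
  have en: "e n \<in> DA" "ae_eq m (A (e n)) (\<lambda>x. ev n * e n x)" using eb by (simp_all add: eigenbasis_def)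
  have "ip m (A (e n)) h = ip m (\<lambda>x. ev n * e n x) h"
    using en h A_L2 e_L2 L2_scale[OF e_L2, of "ev n" n] by (intro ip_cong_AE L2_measurable) auto
  then show ?thesis by (simp add: ip_scale)
qed

lemma A_coefficient:
  assumes h: "h \<in> DA"
  shows "ip m (A h) (e n) = ev n * ip m h (e n)"
proof -
  have en: "e n \<in> DA" using eb by (simp add: eigenbasis_def)
  have "ip m (A h) (e n) = ip m h (A (e n))" using sa h en by (simp add: nonneg_selfadjoint_def)
  also have "\<dots> = ev n * ip m h (e n)" using A_e[OF DA_L2[OF h], of n] by (simp add: ip_commute)
  finally show ?thesis .
qed

text \<open>By the Riesz-Fischer theorem there is \<open>g\<close> in \<open>L\<^sup>2\<close> with the coefficients that \<open>A h\<close> ought to have. Parseval's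
  identity gives \<open>(A v, h) = (v, g)\<close> for all \<open>v\<close> in the domain. So \<open>h\<close> is in the domain of the adjoint of \<open>A\<close>, which
  is \<open>A\<close>.\<close>

lemma domain_of_A:
  assumes h: "h \<in> L2 m" and fin: "(\<Sum>n. ennreal ((ip m h (e n))\<^sup>2 * ev n powr 2)) < top"
  shows "h \<in> DA"
proof -
  have "summable (\<lambda>n. (ip m h (e n))\<^sup>2 * ev n powr 2)"
    using fin by (intro summable_suminf_not_top) (auto simp: less_top)
  moreover have "(ip m h (e n))\<^sup>2 * ev n powr 2 = (ev n * ip m h (e n))\<^sup>2" for n
    using ev_pos[of n] by (simp add: power_mult_distrib)
  ultimately have "summable (\<lambda>n. (ev n * ip m h (e n))\<^sup>2)" by simp
  from Riesz_Fischer[OF this] obtain g where g: "g \<in> L2 m" "\<And>n. ip m g (e n) = ev n * ip m h (e n)" by blast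
  have "ip m (A v) h = ip m v g" if v: "v \<in> DA" for v
  proof -
    have "(\<lambda>n. ip m (A v) (e n) * ip m h (e n)) sums ip m (A v) h" by (rule Parseval2[OF A_L2[OF v] h])
    moreover have "(\<lambda>n. ip m v (e n) * ip m g (e n)) sums ip m v g" by (rule Parseval2[OF DA_L2[OF v] g(1)])
    moreover have "ip m (A v) (e n) * ip m h (e n) = ip m v (e n) * ip m g (e n)" for n
      using A_coefficient[OF v, of n] g(2)[of n] by simp
    ultimately show ?thesis using sums_unique2 by simp
  qed
  moreover have "\<forall>v\<in>L2 m. \<forall>g\<in>L2 m. (\<forall>k\<in>DA. ip m (A k) v = ip m k g) \<longrightarrow> v \<in> DA \<and> ae_eq m (A v) g"
    using sa unfolding nonneg_selfadjoint_def by blast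
  ultimately show ?thesis using h g(1) by blast
qed

lemma A_norm:
  assumes h: "h \<in> DA"
  shows "lnorm m 2 (A h) = Vnorm m e ev 1 h"
proof -
  have "(ip m (A h) (e n))\<^sup>2 * ev n powr (2 * 0) = (ip m h (e n))\<^sup>2 * ev n powr (2 * 1)" for n
    using ev_pos[of n] by (simp add: A_coefficient[OF h] power_mult_distrib)
  then show ?thesis using Vnorm_zero[OF A_L2[OF h]] unfolding Vnorm_def by simp
qed

lemma e_V: "e n \<in> V m e ev \<sigma>"
proof -
  have "(\<Sum>k. ennreal ((ip m (e n) (e k))\<^sup>2 * ev k powr (2 * \<sigma>))) = (\<Sum>k\<in>{n}. ennreal ((ip m (e n) (e k))\<^sup>2 * ev k powr (2 * \<sigma>)))"
    by (rule suminf_finite) (auto simp: orth)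
  then show ?thesis using e_L2[of n] by (simp add: V_def Vnorm_def epow_half_finite less_top)
qed

lemma V_antimono:
  assumes "\<tau> \<le> \<sigma>"
  shows "V m e ev \<sigma> \<subseteq> V m e ev \<tau>"
proof
  fix h assume h: "h \<in> V m e ev \<sigma>"
  define C where "C = ev 0 powr (2 * (\<tau> - \<sigma>))"
  have le: "ev n powr (2 * \<tau>) \<le> C * ev n powr (2 * \<sigma>)" for n
  proof -
    have "ev n powr (2 * \<tau>) = ev n powr (2 * (\<tau> - \<sigma>)) * ev n powr (2 * \<sigma>)" by (simp add: algebra_simps flip: powr_add)
    also have "\<dots> \<le> C * ev n powr (2 * \<sigma>)"
      unfolding C_def using assms ev_pos[of 0] ev_mono[of n] by (intro mult_right_mono powr_mono2') auto
    finally show ?thesis .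
  qed
  have "(\<Sum>n. ennreal ((ip m h (e n))\<^sup>2 * ev n powr (2 * \<tau>))) \<le> (\<Sum>n. ennreal C * ennreal ((ip m h (e n))\<^sup>2 * ev n powr (2 * \<sigma>)))"
  proof (intro suminf_le)
    fix n
    have "(ip m h (e n))\<^sup>2 * ev n powr (2 * \<tau>) \<le> C * ((ip m h (e n))\<^sup>2 * ev n powr (2 * \<sigma>))"
      using mult_left_mono[OF le[of n], of "(ip m h (e n))\<^sup>2"] by (simp add: mult_ac)
    then show "ennreal ((ip m h (e n))\<^sup>2 * ev n powr (2 * \<tau>)) \<le> ennreal C * ennreal ((ip m h (e n))\<^sup>2 * ev n powr (2 * \<sigma>))"
      by (simp add: C_def ennreal_leI flip: ennreal_mult)
  qed auto
  also have "\<dots> = ennreal C * (\<Sum>n. ennreal ((ip m h (e n))\<^sup>2 * ev n powr (2 * \<sigma>)))" by (rule ennreal_suminf_cmult)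
  also have "\<dots> < top" using h by (simp add: V_def Vnorm_def epow_half_finite ennreal_mult_less_top)
  finally show "h \<in> V m e ev \<tau>" using h by (simp add: V_def Vnorm_def epow_half_finite)
qed

end

section \<open>Weak solutions are strong\<close>

lemma conj_exponent_ge_1: "1 \<le> p \<Longrightarrow> 1 \<le> conj_exponent p"
  by (auto simp: conj_exponent_def field_simps)

text \<open>Integrals over time are taken with respect to the completed Lebesgue measure in the definition of solutions; all
  calculations use Borel representatives.\<close>

lemma set_lebesgue_integral_borel:
  fixes f g :: "real \<Rightarrow> real"
  assumes "g \<in> borel_measurable borel" "\<And>t. t \<in> {a<..<b} \<Longrightarrow> f t = g t"
  shows "(LINT t:{a<..<b}|lebesgue. f t) = (LBINT t. indicator {a<..<b} t * g t)"
proof -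
  have "(LINT t:{a<..<b}|lebesgue. f t) = (LINT t|lebesgue. indicator {a<..<b} t * g t)"
    unfolding set_lebesgue_integral_def
    by (intro Bochner_Integration.integral_cong refl) (auto simp: indicator_def assms(2))
  also have "\<dots> = (LBINT t. indicator {a<..<b} t * g t)"
    using assms(1) by (intro integral_completion) simp
  finally show ?thesis .
qed

text \<open>The locale \<open>modes\<close> is instantiated with the coefficients of \<open>u\<close>, of its time derivative and of \<open>f(u)\<close>. Its
  conclusion is the integrability of the norm of \<open>u\<close> in \<open>V\<^sub>1\<close>, and \<open>f(u) - A u\<close> serves as the Caputo derivative.\<close>

lemma weak_solution_imp_strong:
  fixes m :: "'a measure" and E :: "('a \<Rightarrow> real) \<Rightarrow> ('a \<Rightarrow> real) \<Rightarrow> real"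
    and u :: "real \<Rightarrow> 'a \<Rightarrow> real" and f :: "real \<Rightarrow> real"
  assumes fin: "finite_measure m" and df: "dirichlet_form m DE E"
    and sa: "nonneg_selfadjoint m DA A" and eb: "eigenbasis m DA A e ev"
    and ao: "associated_operator m DE E DA A e ev"
    and \<alpha>: "1 < \<alpha>" "\<alpha> < 2"
    and f: "f differentiable_on UNIV" and C: "C > 0" "\<And>s. \<bar>deriv f s\<bar> \<le> C * \<bar>s\<bar> powr (r - 1)" and r: "r > 1" and f0: "f 0 = 0"
    and q: "1 \<le> q" and T: "0 < T"
    and ws: "weak_solution m E e ev \<alpha> q f u0 u1 T u"
    and bn: "bochner_norm (q * ennreal (r - 1)) T (lnorm m \<infinity>) u < \<infinity>"
  shows "strong_solution m DA e ev \<alpha> T u"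
proof -
  let ?V = "V m e ev (1/\<alpha>)"
  have e_DA: "\<And>n. e n \<in> DA" and DA_sub: "DA \<subseteq> L2 m"
    using eb sa by (auto simp: eigenbasis_def nonneg_selfadjoint_def dense_subspace_def)
  have ev0: "0 < ev 0" and ev_inc: "incseq ev" using eb by (auto simp: eigenbasis_def)
  have ev_ge: "ev 0 \<le> ev n" for n using ev_inc by (simp add: incseq_def)
  interpret onb m e ev
  proof (rule onb.intro)
    show "finite_measure m" by (rule fin)
    show "e n \<in> L2 m" for n using e_DA DA_sub by blast
    show "ip m (e i) (e j) = (if i = j then 1 else 0)" for i j using eb by (simp add: eigenbasis_def)
    show "(\<lambda>n. lnorm m 2 (\<lambda>x. h x - (\<Sum>k<n. ip m h (e k) * e k x))) \<longlonglongrightarrow> 0" if "h \<in> L2 m" for h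
      using eb that by (simp add: eigenbasis_def)
    show "0 < ev n" for n using ev0 ev_ge[of n] by linarith
    show "ev 0 \<le> ev n" for n by (rule ev_ge)
  qed
  interpret spectral m e ev DA A by unfold_locales (rule sa, rule eb)
  note ws' = ws[unfolded weak_solution_def Let_def]
  have uV: "cont_into T ?V (Vnorm m e ev (1/\<alpha>)) u" and C1: "C1_L2 m T u" using ws' by blast+
  obtain w0 where w0: "has_caputo_derivative m ?V \<alpha> T u w0"
    and w0_eq: "\<And>\<phi>. \<phi> \<in> ?V \<Longrightarrow> AE t in lebesgue_on {0<..<T}. w0 t \<phi> + E (u t) \<phi> = ip m (\<lambda>x. f (u t x)) \<phi>"
    using ws' by blast
  interpret curve m e ev T u by unfold_locales (rule T, rule C1)
  have uV_t: "u t \<in> ?V" if "t \<in> {0..T}" for t using uV that by (simp add: cont_into_def)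
  have y_eq: "y n t = ip m (u t) (e n)" if "t \<in> {0..T}" for n t using that by (simp add: y_def clamp_id)
  have y'_eq: "y' n t = ip m (dt m T u t) (e n)" if "t \<in> {0..T}" for n t using that by (simp add: y'_def clamp_id)
  note [measurable] = bdd_borel_measurable[OF y_bdd] bdd_borel_measurable[OF y'_bdd]
  \<comment> \<open>Since \<open>1/\<alpha> > 1/2\<close>, the form can be evaluated on the solution; it is diagonal in the eigenbasis.\<close>
  have DE: "DE = V m e ev (1/2)" using ao by (simp add: associated_operator_def)
  have VDE: "?V \<subseteq> DE" unfolding DE using \<alpha> by (intro V_antimono) (simp add: field_simps)
  have DA_DE: "DA \<subseteq> DE" and EA: "\<And>h k. h \<in> DA \<Longrightarrow> k \<in> DE \<Longrightarrow> E h k = ip m (A h) k"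
    using ao by (auto simp: associated_operator_def)
  have E_sym: "E h k = E k h" if "h \<in> DE" "k \<in> DE" for h k
    using df that by (simp add: dirichlet_form_def symmetric_form_def)
  have E_e: "E h (e n) = ev n * ip m h (e n)" if h: "h \<in> ?V" for h n
  proof -
    have "h \<in> L2 m" using h by (simp add: V_def)
    have "E h (e n) = E (e n) h" using h VDE e_DA[of n] DA_DE by (intro E_sym) auto
    also have "\<dots> = ip m (A (e n)) h" using h VDE e_DA by (intro EA) auto
    also have "\<dots> = ev n * ip m h (e n)" using A_e[OF \<open>h \<in> L2 m\<close>] by (simp add: ip_commute)
    finally show ?thesis .
  qed
  have "\<exists>M. \<forall>t\<in>{0..T}. \<forall>N. (\<Sum>n<N. ev n powr (2 * (1/\<alpha>)) * (ip m (u t) (e n))\<^sup>2) \<le> M"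
    by (rule coefficient_bound) (use uV in \<open>auto simp: cont_into_def V_def\<close>)
  then obtain M1 where M1': "\<forall>t\<in>{0..T}. \<forall>N. (\<Sum>n<N. ev n powr (2 * (1/\<alpha>)) * (ip m (u t) (e n))\<^sup>2) \<le> M1" by blast
  have M1: "(\<Sum>n<N. ev n powr (2 / \<alpha>) * (y n t)\<^sup>2) \<le> M1" if "t \<in> {0..T}" for N t
    using M1'[rule_format, OF that, of N] by (simp add: y_eq[OF that])
  have ci: "cont_into T (L2 m) (lnorm m 2) (dt m T u)" "cont_into T (L2 m) (lnorm m 2) u"
    using C1 unfolding C1_L2_def by blast+
  obtain M2 M0 where M2': "\<forall>t\<in>{0..T}. \<forall>N. (\<Sum>n<N. (ip m (dt m T u t) (e n))\<^sup>2) \<le> M2"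
    and M0': "\<forall>t\<in>{0..T}. \<forall>N. (\<Sum>n<N. (ip m (u t) (e n))\<^sup>2) \<le> M0"
    using L2_curve_bound[OF ci(1)] L2_curve_bound[OF ci(2)] by blast
  have M2: "(\<Sum>n<N. (ip m (dt m T u t) (e n))\<^sup>2) \<le> M2" and M0: "(\<Sum>n<N. (ip m (u t) (e n))\<^sup>2) \<le> M0" if "t \<in> {0..T}" for t N
    using M2' M0' that by blast+
  define F where "F t x = f (u t x)" for t x
  have "\<exists>B. AE t in lborel. t \<in> {0<..<T} \<longrightarrow> (\<lambda>x. f (u t x)) \<in> L2 m \<and> ip m (\<lambda>x. f (u t x)) (\<lambda>x. f (u t x)) \<le> B"
  proof (rule nonlinearity_bounded[OF T u_L2 lipschitz[OF M2] _ _ f C r f0 q bn])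
    show "sqrt (ip m (u t) (u t)) \<le> sqrt M0" if "t \<in> {0..T}" for t
      using norm_le_of_partial_sums[OF u_L2[OF that] M0[OF that]] by simp
    show "0 \<le> sqrt M2" using M2[of 0 0] T by simp
  qed auto
  then obtain B where B: "AE t in lborel. t \<in> {0<..<T} \<longrightarrow> F t \<in> L2 m \<and> ip m (F t) (F t) \<le> B"
    unfolding F_def[abs_def] by blast
  \<comment> \<open>The coefficients of the Caputo derivative are only Lebesgue measurable. They are replaced by Borel
    representatives, and all exceptional times are collected in one null set \<open>N1\<close>, on which the coefficients \<open>Fn\<close> of the
    nonlinearity are set to zero.\<close>
  have int_w0: "set_integrable lebesgue {0<..<T} (\<lambda>t. w0 t \<phi>)" if "\<phi> \<in> ?V" for \<phi>
    using w0 that by (simp add: has_caputo_derivative_def)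
  have "\<exists>g\<in>borel_measurable lborel. AE t in lborel. indicator {0<..<T} t *\<^sub>R w0 t (e n) = g t" for n
    using int_w0[OF e_V] unfolding set_integrable_def
    by (intro completion_ex_borel_measurable_real borel_measurable_integrable)
  then have "\<forall>n. \<exists>g. g \<in> borel_measurable borel \<and> (AE t in lborel. indicator {0<..<T} t *\<^sub>R w0 t (e n) = g t)"
    by (simp add: Bex_def)
  from choice[OF this] obtain W1 where W1': "\<forall>n. W1 n \<in> borel_measurable borel \<and> (AE t in lborel. indicator {0<..<T} t *\<^sub>R w0 t (e n) = W1 n t)"
    by blast
  have W1 [measurable]: "W1 n \<in> borel_measurable borel"
    and W1_eq: "AE t in lborel. indicator {0<..<T} t *\<^sub>R w0 t (e n) = W1 n t" for n
    using W1' by blast+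
  define P where "P t \<longleftrightarrow> (\<forall>n. W1 n t + ev n * y n t = ip m (F t) (e n)) \<and> F t \<in> L2 m \<and> ip m (F t) (F t) \<le> B" for t
  have "AE t in lborel. \<forall>n. t \<in> {0<..<T} \<longrightarrow> W1 n t + ev n * y n t = ip m (F t) (e n)"
    unfolding AE_all_countable
  proof
    fix n
    have "AE t in lborel. t \<in> {0<..<T} \<longrightarrow> w0 t (e n) + E (u t) (e n) = ip m (\<lambda>x. f (u t x)) (e n)"
      using w0_eq[OF e_V] unfolding AE_lebesgue_on_Ioo .
    then show "AE t in lborel. t \<in> {0<..<T} \<longrightarrow> W1 n t + ev n * y n t = ip m (F t) (e n)"
      using W1_eq[of n]
    proof eventually_elim
      case (elim t)
      show ?case
      proof
        assume t: "t \<in> {0<..<T}"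
        then have "t \<in> {0..T}" by auto
        then show "W1 n t + ev n * y n t = ip m (F t) (e n)"
          using elim t E_e[OF uV_t, of t n] y_eq[of t n] by (simp add: F_def[abs_def])
      qed
    qed
  qed
  with B have "AE t in lborel. t \<in> {0<..<T} \<longrightarrow> P t" by eventually_elim (simp add: P_def)
  then obtain N1 where N1: "{t \<in> space lborel. \<not> (t \<in> {0<..<T} \<longrightarrow> P t)} \<subseteq> N1" "emeasure lborel N1 = 0" "N1 \<in> sets lborel"
    by (rule AE_E)
  have [measurable]: "N1 \<in> sets borel" using N1(3) by simp
  have P_good: "P t" if "t \<in> {0<..<T}" "t \<notin> N1" for t using N1(1) that by auto
  define Fn where "Fn n t = (if t \<in> {0<..<T} \<and> t \<notin> N1 then W1 n t + ev n * y n t else 0)" for n t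
  have Fn_eq: "Fn n t = ip m (F t) (e n)" if "t \<in> {0<..<T}" "t \<notin> N1" for n t
    using P_good[OF that] that by (simp add: Fn_def P_def)
  have [measurable]: "Fn n \<in> borel_measurable borel" for n unfolding Fn_def by measurable
  have B0: "0 \<le> B"
  proof (rule ccontr)
    assume "\<not> 0 \<le> B"
    have "AE t in lborel. t \<notin> {0<..<T}"
      using B
    proof eventually_elim
      case (elim t)
      then show ?case using \<open>\<not> 0 \<le> B\<close> ip_nonneg[of m "F t"] by force
    qed
    from AE_not_in_Ioo[OF this] show False using T by simp
  qed
  have M3: "(\<Sum>n<N. (Fn n t)\<^sup>2) \<le> B" for N t
  proof (cases "t \<in> {0<..<T} \<and> t \<notin> N1")
    case True
    then have "(\<Sum>n<N. (Fn n t)\<^sup>2) \<le> ip m (F t) (F t)"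
      using Bessel[of "F t" N] P_good[of t] by (simp add: Fn_eq P_def)
    then show ?thesis using P_good[of t] True by (simp add: P_def)
  next
    case False
    then show ?thesis using B0 by (auto simp: Fn_def)
  qed
  have Fn_bdd: "bdd_borel T (Fn n)" for n
  proof (rule bdd_borelI)
    fix t assume "t \<in> {0..T}"
    have "(Fn n t)\<^sup>2 \<le> (\<Sum>k<Suc n. (Fn k t)\<^sup>2)" by (rule member_le_sum) auto
    then have "(Fn n t)\<^sup>2 \<le> B" using M3[of t "Suc n"] by linarith
    then show "\<bar>Fn n t\<bar> \<le> sqrt B" by (metis real_sqrt_abs real_sqrt_le_mono)
  qed measurable
  have AE_N1: "AE t in lborel. t \<notin> N1" using N1 by (intro AE_not_in) (simp add: null_sets_def)
  \<comment> \<open>The equation tested with \<open>e n\<close>, in the form required by \<open>modes\<close>.\<close>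
  have scalar: "(LBINT t. indicator {0<..<T} t * (RL (2 - \<alpha>) (\<lambda>t. y n t - y n 0 - t * y' n 0) t * (deriv ^^ 2) \<psi> t))
       = (LBINT t. indicator {0<..<T} t * ((Fn n t - ev n * y n t) * \<psi> t))" if \<psi>: "test_function T \<psi>" for n \<psi>
  proof -
    have sm: "\<And>k t. ((deriv ^^ k) \<psi>) differentiable (at t)" using \<psi> by (simp add: test_function_def smooth_def)
    have psi_m: "(deriv ^^ k) \<psi> \<in> borel_measurable borel" for k
      using sm by (intro borel_measurable_continuous_onI continuous_at_imp_continuous_on ballI differentiable_imp_continuous_within)
    note [measurable] = psi_m[of 0, simplified] psi_m[of 2]
    let ?z = "\<lambda>t. y n t - y n 0 - t * y' n 0"
    have zm [measurable]: "?z \<in> borel_measurable borel" by measurable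
    note [measurable] = RL_measurable[OF zm]
    have prim: "caputo_primitive m \<alpha> T u t (e n) = RL (2 - \<alpha>) ?z t" if t: "t \<in> {0<..<T}" for t
    proof -
      have "ip m (\<lambda>x. u s x - u 0 x - s * dt m T u 0 x) (e n) = ?z s" if s: "s \<in> {0<..<t}" for s
      proof -
        have s': "s \<in> {0..T}" "0 \<in> {0..T}" using s t by auto
        have "ip m (\<lambda>x. u s x - u 0 x - s * dt m T u 0 x) (e n) = ip m (u s) (e n) - ip m (u 0) (e n) - s * ip m (dt m T u 0) (e n)"
          using ip_diff[OF L2_diff[OF u_L2[OF s'(1)] u_L2[OF s'(2)]] L2_scale[OF dt_L2[OF s'(2)], of s] e_L2[of n]]
            ip_diff[OF u_L2[OF s'(1)] u_L2[OF s'(2)] e_L2[of n]] by (simp add: ip_scale)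
        then show ?thesis using s' by (simp add: y_eq y'_eq)
      qed
      then have "(LINT s:{0<..<t}|lebesgue. (t - s) powr (1 - \<alpha>) * ip m (\<lambda>x. u s x - u 0 x - s * dt m T u 0 x) (e n))
         = (LBINT s. indicator {0<..<t} s * ((t - s) powr (1 - \<alpha>) * ?z s))"
        by (intro set_lebesgue_integral_borel) auto
      then show ?thesis by (simp add: caputo_primitive_def RL_def)
    qed
    have "(LBINT t. indicator {0<..<T} t * (RL (2 - \<alpha>) ?z t * (deriv ^^ 2) \<psi> t))
       = (LINT t:{0<..<T}|lebesgue. caputo_primitive m \<alpha> T u t (e n) * (deriv ^^ 2) \<psi> t)"
      by (rule set_lebesgue_integral_borel[symmetric]) (auto simp: prim)
    also have "\<dots> = (LINT t:{0<..<T}|lebesgue. w0 t (e n) * \<psi> t)"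
      using w0 e_V \<psi> unfolding has_caputo_derivative_def by blast
    also have "\<dots> = (LINT t|lebesgue. indicator {0<..<T} t * ((Fn n t - ev n * y n t) * \<psi> t))"
      unfolding set_lebesgue_integral_def
    proof (rule integral_cong_AE)
      have psi_l: "\<psi> \<in> borel_measurable lebesgue"
        by (rule measurable_completion) (use psi_m[of 0] in simp)
      have w0m: "(\<lambda>t. indicator {0<..<T} t *\<^sub>R w0 t (e n)) \<in> borel_measurable lebesgue"
        using int_w0[OF e_V] unfolding set_integrable_def by (rule borel_measurable_integrable)
      show "(\<lambda>t. indicator {0<..<T} t *\<^sub>R (w0 t (e n) * \<psi> t)) \<in> borel_measurable lebesgue"
        using borel_measurable_times[OF w0m psi_l] by (simp only: real_scaleR_def mult.assoc)
      show "(\<lambda>t. indicator {0<..<T} t * ((Fn n t - ev n * y n t) * \<psi> t)) \<in> borel_measurable lebesgue"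
        by (intro measurable_completion) measurable
      have "AE t in lborel. indicator {0<..<T} t *\<^sub>R (w0 t (e n) * \<psi> t) = indicator {0<..<T} t * ((Fn n t - ev n * y n t) * \<psi> t)"
        using AE_N1 W1_eq[of n]
      proof eventually_elim
        case (elim t)
        then show ?case by (auto simp: Fn_def indicator_def)
      qed
      then show "AE t in lebesgue. indicator {0<..<T} t *\<^sub>R (w0 t (e n) * \<psi> t) = indicator {0<..<T} t * ((Fn n t - ev n * y n t) * \<psi> t)"
        by (rule AE_completion)
    qed
    also have "\<dots> = (LBINT t. indicator {0<..<T} t * ((Fn n t - ev n * y n t) * \<psi> t))"
      by (intro integral_completion) measurable
    finally show ?thesis .
  qed
  interpret M: modes \<alpha> T ev y y' Fn M1 M2 B
  proof (rule modes.intro)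
    show "1 < \<alpha>" "\<alpha> < 2" "0 < T" by (rule \<alpha> T)+
    show "(\<Sum>n<N. (y' n t)\<^sup>2) \<le> M2" if "t \<in> {0..T}" for N t
      using M2[OF that, of N] by (simp only: y'_eq[OF that])
  qed (rule ev_pos y'_bdd Fn_bdd y_bdd M3 | erule y_J scalar M1)+
  have Vnorm_A2: "Vnorm m e ev 1 (u t) = epow (M.A2 t) (1/2)" if "t \<in> {0<..<T}" for t
    using that by (simp add: Vnorm_def M.A2_def y_eq)
  have Vint: "(\<integral>\<^sup>+t. indicator {0<..<T} t * Vnorm m e ev 1 (u t) \<partial>lborel) < \<infinity>"
  proof -
    have "(\<integral>\<^sup>+t. indicator {0<..<T} t * Vnorm m e ev 1 (u t) \<partial>lborel) = (\<integral>\<^sup>+t. indicator {0<..<T} t * epow (M.A2 t) (1/2) \<partial>lborel)"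
      by (intro nn_integral_cong) (auto simp: Vnorm_A2 indicator_def)
    then show ?thesis using M.A_integrable by simp
  qed
  have em [measurable]: "(\<lambda>t. epow (M.A2 t) (1/2)) \<in> borel_measurable borel" unfolding epow_def by measurable
  have "AE t in lborel. indicator {0<..<T} t * epow (M.A2 t) (1/2) \<noteq> \<infinity>"
    by (rule nn_integral_PInf_AE) (use M.A_integrable in auto)
  then have A2fin: "AE t in lborel. t \<in> {0<..<T} \<longrightarrow> M.A2 t < top"
    by eventually_elim (auto simp: epow_def less_top split: if_splits)
  define N where "N = N1 \<union> {t. M.A2 t = top}"
  have [measurable]: "N \<in> sets borel" unfolding N_def by measurable
  have AE_N: "AE t in lborel. t \<in> {0<..<T} \<longrightarrow> t \<notin> N"
    using AE_N1 A2fin by eventually_elim (auto simp: N_def)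
  have u_DA: "u t \<in> DA" if "t \<in> {0<..<T}" "t \<notin> N" for t
  proof (rule domain_of_A)
    show "u t \<in> L2 m" using that by (intro u_L2) auto
    show "(\<Sum>n. ennreal ((ip m (u t) (e n))\<^sup>2 * ev n powr 2)) < top"
      using that by (simp add: N_def M.A2_def y_eq less_top)
  qed
  have F_L2: "F t \<in> L2 m" "ip m (F t) (F t) \<le> B" if "t \<in> {0<..<T}" "t \<notin> N" for t
    using P_good[of t] that by (auto simp: P_def N_def)
  \<comment> \<open>The candidate for the Caputo derivative, with the value zero at the exceptional times.\<close>
  define w where "w t = (if t \<in> {0<..<T} \<and> t \<notin> N then (\<lambda>x. F t x - A (u t) x) else (\<lambda>x. 0))" for t
  have w_L2: "w t \<in> L2 m" for t
    unfolding w_def using F_L2[of t] A_L2[OF u_DA, of t] by (auto intro: L2_diff L2_zero)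
  define Wn where "Wn n t = (if t \<in> {0<..<T} \<and> t \<notin> N then Fn n t - ev n * y n t else 0)" for n t
  have [measurable]: "Wn n \<in> borel_measurable borel" for n unfolding Wn_def by measurable
  have w_coef: "ip m (w t) (e n) = Wn n t" for n t
  proof (cases "t \<in> {0<..<T} \<and> t \<notin> N")
    case True
    then have t: "t \<in> {0<..<T}" "t \<notin> N" "t \<notin> N1" "t \<in> {0..T}" by (auto simp: N_def)
    show ?thesis
      using ip_diff[OF F_L2(1)[OF t(1,2)] A_L2[OF u_DA[OF t(1,2)]] e_L2[of n]] t
      by (simp add: w_def Wn_def Fn_eq A_coefficient[OF u_DA[OF t(1,2)]] y_eq)
  next
    case False
    then show ?thesis by (auto simp: w_def Wn_def ip_def)
  qed
  have w_ip_meas: "(\<lambda>t. ip m (w t) \<phi>) \<in> borel_measurable borel" if "\<phi> \<in> L2 m" for \<phi>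
  proof -
    have "(\<lambda>t. ip m (w t) \<phi>) = (\<lambda>t. \<Sum>n. Wn n t * ip m \<phi> (e n))"
      using Parseval2[OF w_L2 that] by (auto simp: sums_iff w_coef)
    then show ?thesis by simp
  qed
  have w_w0: "AE t in lborel. t \<in> {0<..<T} \<longrightarrow> ip m (w t) \<phi> = w0 t \<phi>" if \<phi>: "\<phi> \<in> ?V" for \<phi>
  proof -
    have "\<phi> \<in> L2 m" using \<phi> by (simp add: V_def)
    have "AE t in lborel. t \<in> {0<..<T} \<longrightarrow> w0 t \<phi> + E (u t) \<phi> = ip m (F t) \<phi>"
      using w0_eq[OF \<phi>] unfolding AE_lebesgue_on_Ioo F_def[abs_def] .
    then show ?thesis using AE_N
    proof eventually_elim
      case (elim t)
      show ?case
      proof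
        assume t: "t \<in> {0<..<T}"
        then have n: "t \<notin> N" using elim by blast
        have "E (u t) \<phi> = ip m (A (u t)) \<phi>" using u_DA[OF t n] \<phi> VDE by (intro EA) auto
        moreover have "ip m (w t) \<phi> = ip m (F t) \<phi> - ip m (A (u t)) \<phi>"
          using ip_diff[OF F_L2(1)[OF t n] A_L2[OF u_DA[OF t n]] \<open>\<phi> \<in> L2 m\<close>] t n by (simp add: w_def)
        ultimately show "ip m (w t) \<phi> = w0 t \<phi>" using elim t by simp
      qed
    qed
  qed
  have caputo: "has_caputo_derivative m ?V \<alpha> T u (\<lambda>t \<phi>. ip m (w t) \<phi>)"
    unfolding has_caputo_derivative_def
  proof (intro ballI conjI allI impI)
    fix \<phi> assume \<phi>: "\<phi> \<in> ?V"
    then have \<phi>2: "\<phi> \<in> L2 m" by (simp add: V_def)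
    note [measurable] = w_ip_meas[OF \<phi>2]
    have ae: "AE t in lebesgue. indicator {0<..<T} t *\<^sub>R w0 t \<phi> = indicator {0<..<T} t *\<^sub>R ip m (w t) \<phi>"
      by (rule AE_completion, use w_w0[OF \<phi>] in eventually_elim) (auto simp: indicator_def)
    have wm: "(\<lambda>t. indicator {0<..<T} t *\<^sub>R ip m (w t) \<phi>) \<in> borel_measurable lebesgue"
      by (intro measurable_completion) measurable
    have w0m: "(\<lambda>t. indicator {0<..<T} t *\<^sub>R w0 t \<phi>) \<in> borel_measurable lebesgue"
      using borel_measurable_integrable[OF int_w0[OF \<phi>, unfolded set_integrable_def]] .
    show "set_integrable lebesgue {0<..<T} (\<lambda>t. ip m (w t) \<phi>)"
      using int_w0[OF \<phi>] unfolding set_integrable_def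
      by (subst integrable_cong_AE[OF wm w0m]) (use ae in \<open>auto elim: eventually_mono\<close>)
    fix \<psi> assume \<psi>: "test_function T \<psi>"
    have sm: "\<And>t. \<psi> differentiable (at t)" using \<psi> unfolding test_function_def smooth_def by (metis funpow_0)
    have psi_m [measurable]: "\<psi> \<in> borel_measurable borel"
      using sm by (intro borel_measurable_continuous_onI continuous_at_imp_continuous_on ballI differentiable_imp_continuous_within)
    have psi_l: "\<psi> \<in> borel_measurable lebesgue" by (intro measurable_completion) measurable
    have "(LINT t:{0<..<T}|lebesgue. caputo_primitive m \<alpha> T u t \<phi> * (deriv ^^ 2) \<psi> t) = (LINT t:{0<..<T}|lebesgue. w0 t \<phi> * \<psi> t)"
      using w0 \<phi> \<psi> unfolding has_caputo_derivative_def by blast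
    also have "\<dots> = (LINT t:{0<..<T}|lebesgue. ip m (w t) \<phi> * \<psi> t)"
      unfolding set_lebesgue_integral_def
    proof (rule integral_cong_AE)
      show "(\<lambda>t. indicator {0<..<T} t *\<^sub>R (w0 t \<phi> * \<psi> t)) \<in> borel_measurable lebesgue"
        using borel_measurable_times[OF w0m psi_l] by (simp only: real_scaleR_def mult.assoc)
      show "(\<lambda>t. indicator {0<..<T} t *\<^sub>R (ip m (w t) \<phi> * \<psi> t)) \<in> borel_measurable lebesgue"
        using borel_measurable_times[OF wm psi_l] by (simp only: real_scaleR_def mult.assoc)
      show "AE t in lebesgue. indicator {0<..<T} t *\<^sub>R (w0 t \<phi> * \<psi> t) = indicator {0<..<T} t *\<^sub>R (ip m (w t) \<phi> * \<psi> t)"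
        using ae by eventually_elim (auto simp: indicator_def)
    qed
    finally show "(LINT t:{0<..<T}|lebesgue. caputo_primitive m \<alpha> T u t \<phi> * (deriv ^^ 2) \<psi> t) = (LINT t:{0<..<T}|lebesgue. ip m (w t) \<phi> * \<psi> t)" .
  qed
  have u_B: "u \<in> bochner_Lp 1 T DA (Vnorm m e ev 1)"
    unfolding bochner_Lp_def
  proof (intro CollectI conjI)
    show "strongly_measurable T DA (Vnorm m e ev 1) u"
    proof (rule strongly_measurable_coefficients[where \<sigma> = 1])
      show "(\<lambda>x. \<Sum>n<k. c n * e n x) \<in> DA" for c k by (rule comb_DA)
      show "AE t in lebesgue_on {0<..<T}. u t \<in> DA"
        unfolding AE_lebesgue_on_Ioo using AE_N by eventually_elim (use u_DA in blast)
      show "AE t in lebesgue_on {0<..<T}. u t \<in> L2 m \<and> Vnorm m e ev 1 (u t) < \<infinity>"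
        unfolding AE_lebesgue_on_Ioo using A2fin
        by eventually_elim (auto simp: Vnorm_A2 epow_half_finite intro!: u_L2)
      show "(\<lambda>t. ip m (u t) (e n)) \<in> borel_measurable (lebesgue_on {0<..<T})" for n
        by (rule measurable_lebesgue_on_Ioo[of "y n"]) (auto simp: y_eq)
    qed simp
    show "bochner_norm 1 T (Vnorm m e ev 1) u < \<infinity>" unfolding bochner_norm_1 by (rule Vint)
  qed
  have w_B: "w \<in> bochner_Lp 1 T (L2 m) (lnorm m 2)"
    unfolding bochner_Lp_def
  proof (intro CollectI conjI)
    show "strongly_measurable T (L2 m) (lnorm m 2) w"
    proof (rule strongly_measurable_coefficients[where \<sigma> = 0])
      show "(\<lambda>x. \<Sum>n<k. c n * e n x) \<in> L2 m" for c k by (rule comb_L2)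
      show "AE t in lebesgue_on {0<..<T}. w t \<in> L2 m" using w_L2 by simp
      show "AE t in lebesgue_on {0<..<T}. w t \<in> L2 m \<and> Vnorm m e ev 0 (w t) < \<infinity>"
        using w_L2 by (simp add: Vnorm_zero L2_norm)
      show "(\<lambda>t. ip m (w t) (e n)) \<in> borel_measurable (lebesgue_on {0<..<T})" for n
        by (rule measurable_lebesgue_on_Ioo[of "Wn n"]) (auto simp: w_coef)
      show "lnorm m 2 h = Vnorm m e ev 0 h" if "h \<in> L2 m" for h using Vnorm_zero[OF that] by simp
    qed
    have "(\<integral>\<^sup>+t. indicator {0<..<T} t * lnorm m 2 (w t) \<partial>lborel)
      \<le> (\<integral>\<^sup>+t. ennreal (sqrt B) * indicator {0<..<T} t + indicator {0<..<T} t * epow (M.A2 t) (1/2) \<partial>lborel)"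
    proof (rule nn_integral_mono_AE, use AE_N in eventually_elim)
      fix t assume n: "t \<in> {0<..<T} \<longrightarrow> t \<notin> N"
      show "indicator {0<..<T} t * lnorm m 2 (w t) \<le> ennreal (sqrt B) * indicator {0<..<T} t + indicator {0<..<T} t * epow (M.A2 t) (1/2)"
      proof (cases "t \<in> {0<..<T}")
        case t: True
        then have n: "t \<notin> N" using n by blast
        have "sqrt (ip m (w t) (w t)) \<le> sqrt (ip m (F t) (F t)) + sqrt (ip m (\<lambda>x. w t x - F t x) (\<lambda>x. w t x - F t x))"
          by (rule L2_triangle[OF w_L2 F_L2(1)[OF t n]])
        also have "ip m (\<lambda>x. w t x - F t x) (\<lambda>x. w t x - F t x) = ip m (A (u t)) (A (u t))"
          using t n by (simp add: w_def ip_def)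
        also have "sqrt (ip m (F t) (F t)) \<le> sqrt B" using F_L2(2)[OF t n] by simp
        finally have "lnorm m 2 (w t) \<le> ennreal (sqrt B + sqrt (ip m (A (u t)) (A (u t))))"
          by (simp add: L2_norm[OF w_L2] ennreal_leI)
        also have "\<dots> = ennreal (sqrt B) + lnorm m 2 (A (u t))"
          using B0 by (simp add: L2_norm[OF A_L2[OF u_DA[OF t n]]] ip_nonneg)
        also have "lnorm m 2 (A (u t)) = epow (M.A2 t) (1/2)"
          using A_norm[OF u_DA[OF t n]] Vnorm_A2[OF t] by simp
        finally show ?thesis using t by simp
      qed simp
    qed
    also have "\<dots> = ennreal (sqrt B) * emeasure lborel {0<..<T} + (\<integral>\<^sup>+t. indicator {0<..<T} t * epow (M.A2 t) (1/2) \<partial>lborel)"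
      by (subst nn_integral_add) (auto simp: nn_integral_cmult)
    also have "\<dots> < \<infinity>" using M.A_integrable T by (simp add: ennreal_mult_less_top)
    finally show "bochner_norm 1 T (lnorm m 2) w < \<infinity>" unfolding bochner_norm_1 .
  qed
  show ?thesis unfolding strong_solution_def using w_B caputo u_B by blast
qed

theorem theorem4p8:
  fixes X :: "'a::metric_space set" and m :: "'a measure"
    and E :: "('a \<Rightarrow> real) \<Rightarrow> ('a \<Rightarrow> real) \<Rightarrow> real" and DE :: "('a \<Rightarrow> real) set"
    and A :: "('a \<Rightarrow> real) \<Rightarrow> ('a \<Rightarrow> real)" and DA :: "('a \<Rightarrow> real) set"
    and e :: "nat \<Rightarrow> 'a \<Rightarrow> real" and ev :: "nat \<Rightarrow> real"
    and qA \<alpha> r p T :: real and q :: ennreal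
    and f :: "real \<Rightarrow> real" and u0 u1 :: "'a \<Rightarrow> real" and u :: "real \<Rightarrow> 'a \<Rightarrow> real"
  assumes "radon_space X m"
    and "dirichlet_form m DE E"
    and "nonneg_selfadjoint m DA A"
    and "eigenbasis m DA A e ev"
    and "associated_operator m DE E DA A e ev"
    and "compactly_embedded m DE E"
    and "qA > 1" and "continuously_embedded m DE E (ennreal (2 * qA))"
    and "1 < \<alpha>" and "\<alpha> < 2"
    and "(case_i qA \<and> alpha0 qA \<le> \<alpha>) \<or> case_ii qA"
    and "Hf1 qA \<alpha> r f"
    and "1 \<le> p" and "p < 1 / (2 - \<alpha>)" and "q = conj_exponent p"
    and "u0 \<in> L2 m" and "u1 \<in> L2 m"
    and "0 < T" and "ereal T < T_max m E e ev \<alpha> q f u0 u1"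
    and "weak_solution m E e ev \<alpha> q f u0 u1 T u"
    and "bochner_norm (q * ennreal (r - 1)) T (lnorm m \<infinity>) u < \<infinity>"
  shows "strong_solution m DA e ev \<alpha> T u"
proof -
  have fin: "finite_measure m" using assms(1) by (simp add: radon_space_def)
  have f: "f differentiable_on UNIV" "f 0 = 0" "r > 1" using assms(12) by (auto simp: Hf1_def)
  obtain C where C: "C > 0" "\<And>s. \<bar>deriv f s\<bar> \<le> C * \<bar>s\<bar> powr (r - 1)"
    using assms(12) by (auto simp: Hf1_def)
  have q: "1 \<le> q" using conj_exponent_ge_1[OF assms(13)] assms(15) by simp
  show ?thesis
    by (rule weak_solution_imp_strong[OF fin assms(2-5) assms(9,10) f(1) C f(3,2) q assms(18,20,21)])
qed

end
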